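(* Let $\Omega\subset\mathbb{R}^n$, $n\in\{2,3\}$, be a bounded, simply connected domain with $C^\infty$ boundary, and $T>0$. Suppose $\mathbf U\in C^1(\bar\Omega\times[0,T])$ is a strong solution of the incompressible Euler equations in $\Omega$ with $\mathbf U\cdot\mathbf n=0$ on $\partial\Omega$ and $\mathbf U(\cdot,0)=\mathbf u_0$, and $\mathbf u\in L^\infty(0,T;H(\Omega))$ is an admissible weak solution of the Euler equations on $\Omega$ with initial data $\mathbf u_0$. Suppose there exists $\epsilon>0$ such that $$\mathbf u\in L^\infty(0,T;L^\infty(\Omega_\epsilon))\qquad\text{and}\qquad \lim_{\delta\to0}\|\mathbf n\cdot\mathbf u\|_{L^\infty(0,T;L^\infty(\Omega_\delta))}=0 .$$ Then $\mathbf u=\mathbf U$ for almost every $(\mathbf x,t)\in\Omega\times(0,T)$.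
   Context: $d(\mathbf x)=\inf_{\mathbf y\in\partial\Omega}|\mathbf x-\mathbf y|$ and $\Omega_\delta=\{\mathbf x\in\Omega:d(\mathbf x)<\delta\}$. For $\delta$ small enough, each $\mathbf x\in\Omega_\delta$ has a unique nearest point $\pi(\mathbf x)\in\partial\Omega$, $d$ is smooth on $\Omega_\delta$, and $\nabla d(\mathbf x)=\mathbf n(\pi(\mathbf x))=:\mathbf n(\mathbf x)$, where $\mathbf n$ on $\partial\Omega$ is the unit normal pointing into $\Omega$; this is the smooth extension of $\mathbf n$ used in the condition on $\mathbf n\cdot\mathbf u$. $H(\Omega)=\{\mathbf v\in L^2(\Omega;\mathbb{R}^n):\nabla\cdot\mathbf v=0\text{ in }\Omega,\ \mathbf v\cdot\mathbf n=0\text{ on }\partial\Omega\}$ (normal trace in the $H^{-1/2}$ sense). A weak solution of Euler with initial data $\mathbf u_0\in H(\Omega)$ is $\mathbf u\in L^\infty(0,T;H(\Omega))$ such that $\int_0^T\int_\Omega[\partial_t\boldsymbol\varphi\cdot\mathbf u+\nabla\boldsymbol\varphi:(\mathbf u\otimes\mathbf u)]\,dV\,dt+\int_\Omega\mathbf u_0\cdot\boldsymbol\varphi(\cdot,0)\,dV=0$ for all divergence-free $\boldsymbol\varphi\in C_c^\infty(\Omega\times[0,T);\mathbb{R}^n)$; it is admissible if in addition $\frac12\int_\Omega|\mathbf u(\mathbf x,t)|^2dV\le\frac12\int_\Omega|\mathbf u_0(\mathbf x)|^2dV$ for a.e. $t\in(0,T)$. *)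

theory Defs
  imports "HOL-Analysis.Analysis"
begin

fun Ck_on :: "nat \<Rightarrow> 'a::euclidean_space set \<Rightarrow> ('a \<Rightarrow> 'b::real_normed_vector) \<Rightarrow> bool" where
  "Ck_on 0 S f = continuous_on S f"
| "Ck_on (Suc k) S f =
     ((\<forall>x\<in>S. f differentiable (at x)) \<and> continuous_on S f \<and>
      (\<forall>e\<in>Basis. Ck_on k S (\<lambda>x. frechet_derivative f (at x) e)))"

definition smooth_on :: "'a::euclidean_space set \<Rightarrow> ('a \<Rightarrow> 'b::real_normed_vector) \<Rightarrow> bool" where
  "smooth_on S f \<longleftrightarrow> (\<forall>k. Ck_on k S f)"

definition grad :: "(real^'n \<Rightarrow> real) \<Rightarrow> real^'n \<Rightarrow> real^'n" where
  "grad f x = (\<chi> i. frechet_derivative f (at x) (axis i 1))"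

definition divg :: "(real^'n \<Rightarrow> real^'n) \<Rightarrow> real^'n \<Rightarrow> real" where
  "divg v x = (\<Sum>i\<in>UNIV. frechet_derivative v (at x) (axis i 1) $ i)"

definition local_defining_fn :: "(real^'n) set \<Rightarrow> real^'n \<Rightarrow> real \<Rightarrow> (real^'n \<Rightarrow> real) \<Rightarrow> bool" where
  "local_defining_fn \<Omega> p r \<phi> \<longleftrightarrow>
     r > 0 \<and> smooth_on (ball p r) \<phi> \<and> (\<forall>x\<in>ball p r. grad \<phi> x \<noteq> 0) \<and>
     \<Omega> \<inter> ball p r = {x\<in>ball p r. \<phi> x < 0}"

definition smooth_boundary :: "(real^'n) set \<Rightarrow> bool" where
  "smooth_boundary \<Omega> \<longleftrightarrow> (\<forall>p\<in>frontier \<Omega>. \<exists>r \<phi>. local_defining_fn \<Omega> p r \<phi>)"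

definition inward_normal :: "(real^'n) set \<Rightarrow> real^'n \<Rightarrow> real^'n" where
  "inward_normal \<Omega> p = (SOME \<nu>. \<exists>r \<phi>. local_defining_fn \<Omega> p r \<phi> \<and>
       \<nu> = - ((1 / norm (grad \<phi> p)) *\<^sub>R grad \<phi> p))"

definition bdist :: "(real^'n) set \<Rightarrow> real^'n \<Rightarrow> real" where
  "bdist \<Omega> x = infdist x (frontier \<Omega>)"

definition layer :: "(real^'n) set \<Rightarrow> real \<Rightarrow> (real^'n) set" where
  "layer \<Omega> \<delta> = {x\<in>\<Omega>. bdist \<Omega> x < \<delta>}"

definition nfield :: "(real^'n) set \<Rightarrow> real^'n \<Rightarrow> real^'n" where
  "nfield \<Omega> x = grad (bdist \<Omega>) x"

text \<open>C^1 on the closed cylinder: continuous on closure(Omega) x [0,T], differentiable in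
  the open cylinder, with all first partial derivatives uniformly continuous there
  (i.e. extending continuously to the closed cylinder).\<close>
definition C1_closed_cyl :: "(real^'n) set \<Rightarrow> real \<Rightarrow> (real^'n \<Rightarrow> real \<Rightarrow> real^'n) \<Rightarrow> bool" where
  "C1_closed_cyl \<Omega> T U \<longleftrightarrow>
     continuous_on (closure \<Omega> \<times> {0..T}) (\<lambda>z. U (fst z) (snd z)) \<and>
     (\<forall>z\<in>\<Omega> \<times> {0<..<T}. (\<lambda>z. U (fst z) (snd z)) differentiable (at z)) \<and>
     (\<forall>e\<in>Basis. uniformly_continuous_on (\<Omega> \<times> {0<..<T})
         (\<lambda>z. frechet_derivative (\<lambda>w. U (fst w) (snd w)) (at z) e))"

text \<open>Strong (classical) solution of incompressible Euler with pressure P, tangential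
  boundary condition and initial data u0 (a.e., u0 being an L^2 datum).\<close>
definition strong_euler ::
  "(real^'n) set \<Rightarrow> real \<Rightarrow> (real^'n \<Rightarrow> real \<Rightarrow> real^'n) \<Rightarrow> (real^'n \<Rightarrow> real^'n) \<Rightarrow> bool" where
  "strong_euler \<Omega> T U u0 \<longleftrightarrow>
     C1_closed_cyl \<Omega> T U \<and>
     (\<exists>P :: real^'n \<Rightarrow> real \<Rightarrow> real.
        \<forall>x\<in>\<Omega>. \<forall>t\<in>{0<..<T}.
          (\<lambda>y. P y t) differentiable (at x) \<and>
          vector_derivative (\<lambda>s. U x s) (at t)
            + frechet_derivative (\<lambda>y. U y t) (at x) (U x t)
            + grad (\<lambda>y. P y t) x = 0) \<and>
     (\<forall>x\<in>\<Omega>. \<forall>t\<in>{0<..<T}. divg (\<lambda>y. U y t) x = 0) \<and>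
     (\<forall>p\<in>frontier \<Omega>. \<forall>t\<in>{0..T}. U p t \<bullet> inward_normal \<Omega> p = 0) \<and>
     (AE x in lebesgue. x \<in> \<Omega> \<longrightarrow> U x 0 = u0 x)"

text \<open>H(Omega): L^2, divergence free with vanishing normal trace, the latter in the
  H^(-1/2) sense, i.e. via Green's formula against smooth compactly supported
  test functions on R^n.\<close>
definition H_space :: "(real^'n) set \<Rightarrow> (real^'n \<Rightarrow> real^'n) \<Rightarrow> bool" where
  "H_space \<Omega> v \<longleftrightarrow>
     set_borel_measurable lebesgue \<Omega> v \<and>
     (\<integral>\<^sup>+x. indicator \<Omega> x * ennreal ((norm (v x))\<^sup>2) \<partial>lebesgue) < \<infinity> \<and>
     (\<forall>\<psi>::real^'n \<Rightarrow> real. smooth_on UNIV \<psi> \<and> (\<exists>K. compact K \<and> (\<forall>x. x \<notin> K \<longrightarrow> \<psi> x = 0))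
        \<longrightarrow> (LINT x:\<Omega>|lebesgue. v x \<bullet> grad \<psi> x) = 0)"

definition Linf_H :: "(real^'n) set \<Rightarrow> real \<Rightarrow> (real^'n \<Rightarrow> real \<Rightarrow> real^'n) \<Rightarrow> bool" where
  "Linf_H \<Omega> T u \<longleftrightarrow>
     set_borel_measurable lebesgue (\<Omega> \<times> {0<..<T}) (\<lambda>z. u (fst z) (snd z)) \<and>
     (\<exists>M. AE t in lebesgue. t \<in> {0<..<T} \<longrightarrow>
          (\<integral>\<^sup>+x. indicator \<Omega> x * ennreal ((norm (u x t))\<^sup>2) \<partial>lebesgue) \<le> ennreal M) \<and>
     (AE t in lebesgue. t \<in> {0<..<T} \<longrightarrow> H_space \<Omega> (\<lambda>x. u x t))"

text \<open>Weak solution: tested against smooth, divergence-free fields with compact support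
  in Omega x (-infinity,T) (restrictions of which are exactly C_c^infinity(Omega x [0,T))).\<close>
definition weak_euler ::
  "(real^'n) set \<Rightarrow> real \<Rightarrow> (real^'n \<Rightarrow> real \<Rightarrow> real^'n) \<Rightarrow> (real^'n \<Rightarrow> real^'n) \<Rightarrow> bool" where
  "weak_euler \<Omega> T u u0 \<longleftrightarrow>
     Linf_H \<Omega> T u \<and>
     (\<forall>\<phi>::real^'n \<Rightarrow> real \<Rightarrow> real^'n.
        smooth_on UNIV (\<lambda>z. \<phi> (fst z) (snd z)) \<and>
        (\<exists>K. compact K \<and> K \<subseteq> \<Omega> \<times> {..<T} \<and> (\<forall>z. z \<notin> K \<longrightarrow> \<phi> (fst z) (snd z) = 0)) \<and>
        (\<forall>x t. divg (\<lambda>y. \<phi> y t) x = 0)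
      \<longrightarrow>
        (LINT z:\<Omega> \<times> {0<..<T}|lebesgue.
            vector_derivative (\<lambda>s. \<phi> (fst z) s) (at (snd z)) \<bullet> u (fst z) (snd z)
          + frechet_derivative (\<lambda>y. \<phi> y (snd z)) (at (fst z)) (u (fst z) (snd z)) \<bullet> u (fst z) (snd z))
        + (LINT x:\<Omega>|lebesgue. u0 x \<bullet> \<phi> x 0) = 0)"

definition admissible_weak_euler ::
  "(real^'n) set \<Rightarrow> real \<Rightarrow> (real^'n \<Rightarrow> real \<Rightarrow> real^'n) \<Rightarrow> (real^'n \<Rightarrow> real^'n) \<Rightarrow> bool" where
  "admissible_weak_euler \<Omega> T u u0 \<longleftrightarrow>
     weak_euler \<Omega> T u u0 \<and>
     (AE t in lebesgue. t \<in> {0<..<T} \<longrightarrow>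
        (1/2) * (LINT x:\<Omega>|lebesgue. (norm (u x t))\<^sup>2) \<le> (1/2) * (LINT x:\<Omega>|lebesgue. (norm (u0 x))\<^sup>2))"

end

theory Submission
  imports Defs
begin

text \<open>
  Testing the weak formulation with \<open>\<theta> U\<close>, where \<open>\<theta>\<close> depends on time only, and using admissibility gives a Gronwall
  inequality for the \<open>L\<^sup>2\<close> norm of \<open>u - U\<close>. Since \<open>\<theta> U\<close> does not have compact support, it is replaced by
  \<open>\<phi>\<^sub>\<epsilon>(y, t) = \<integral> K\<^sub>\<epsilon>((y, t) - (x + \<epsilon> w(x), s - \<epsilon>)) (I + \<epsilon> Dw(x)) \<theta>(s) U(x, s) d(x, s)\<close>, where \<open>w\<close> points into the
  domain near the boundary, so that \<open>\<phi>\<^sub>\<epsilon>\<close> is supported inside. The divergence of \<open>\<phi>\<^sub>\<epsilon>\<close> at \<open>(y, t)\<close> is the integral of \<open>\<theta> U\<close>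
  against the gradient of \<open>x \<mapsto> - K\<^sub>\<epsilon>((y, t) - (x + \<epsilon> w(x), s - \<epsilon>))\<close>, which is zero as \<open>U\<close> is solenoidal and tangential.

  Away from a boundary layer of width \<open>O(\<epsilon>)\<close> the derivatives of \<open>\<phi>\<^sub>\<epsilon>\<close> converge uniformly to those of \<open>\<theta> U\<close>. In the
  layer, whose volume is \<open>O(\<epsilon>)\<close>, the domain is close to a half-space, which is invariant under tangential translations;
  hence tangential and time derivatives of \<open>\<phi>\<^sub>\<epsilon>\<close> are \<open>o(1/\<epsilon>)\<close> there. The normal derivative is only \<open>O(1/\<epsilon>)\<close>, but it
  occurs multiplied by \<open>n \<bullet> u\<close>, which tends to zero.
\<close>

section \<open>Smooth functions with compact support\<close>

text \<open>A cutoff of \<open>U\<close> would no longer be solenoidal, and correcting its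
  divergence would be nonlocal. Moving the domain inwards along \<open>x + \<epsilon> w(x)\<close>
  and transporting \<open>U\<close> as a flux (the Piola transform, hence the factor
  \<open>I + \<epsilon> Dw\<close>) keeps it solenoidal. The price is the jump of \<open>U\<close>
  to zero at the displaced boundary, the source of the derivatives of size
  \<open>1/\<epsilon>\<close>. The curvature of the boundary enters through tangent balls of a fixed
  radius inside and outside the domain: at scale \<epsilon> the domain and its tangent half-space
  differ only in a slab of thickness \<open>O(\<epsilon>^2)\<close>, a fraction
  \<open>O(\<epsilon>)\<close> of the volume seen by the kernel, and this gains the missing factor
  \<epsilon> in tangential directions. The pressure is only known to be differentiable in space; its
  gradient is nevertheless uniformly continuous, because the Euler equation expresses it through
  \<open>U\<close> and its derivatives.\<close>

lemma smooth_on_UNIV_coinduct: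
  fixes f :: "'a::euclidean_space \<Rightarrow> 'b::real_normed_vector"
  assumes "f \<in> F"
    and diff: "\<And>f x. f \<in> F \<Longrightarrow> f differentiable (at x)"
    and deriv: "\<And>f e. f \<in> F \<Longrightarrow> e \<in> Basis \<Longrightarrow> (\<lambda>x. frechet_derivative f (at x) e) \<in> F"
  shows "smooth_on UNIV f"
proof -
  \<comment> \<open>The induction on \<open>k\<close> runs over all of \<open>F\<close> at once,
    because \<open>Ck_on (Suc k)\<close> passes from \<open>f\<close> to its partial derivatives,
    which are other members of \<open>F\<close>.\<close>
  have "\<forall>f\<in>F. Ck_on k UNIV f" for k
  proof (induction k)
    case 0
    then show ?case
      using diff by (auto simp: continuous_on_eq_continuous_at differentiable_imp_continuous_within)
  next
    case (Suc k)
    then show ?case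
      using diff deriv by (auto simp: continuous_on_eq_continuous_at differentiable_imp_continuous_within)
  qed
  then show ?thesis using assms(1) by (auto simp: smooth_on_def)
qed

lemma smooth_onD:
  assumes "smooth_on S f"
  shows "x \<in> S \<Longrightarrow> f differentiable (at x)" "continuous_on S f"
    "e \<in> Basis \<Longrightarrow> smooth_on S (\<lambda>x. frechet_derivative f (at x) e)"
proof -
  have *: "Ck_on (Suc k) S f" for k using assms by (simp add: smooth_on_def)
  then have **: "(\<forall>x\<in>S. f differentiable (at x))" "continuous_on S f" 
     "\<And>k e. e\<in>Basis \<Longrightarrow> Ck_on k S (\<lambda>x. frechet_derivative f (at x) e)" by auto
  show "x \<in> S \<Longrightarrow> f differentiable (at x)" "continuous_on S f"
    "e \<in> Basis \<Longrightarrow> smooth_on S (\<lambda>x. frechet_derivative f (at x) e)"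
    using ** by (auto simp: smooth_on_def)
qed

lemma smooth_on_has_derivative:
  "smooth_on S f \<Longrightarrow> x \<in> S \<Longrightarrow> (f has_derivative frechet_derivative f (at x)) (at x)"
  using smooth_onD(1) frechet_derivative_works by blast

text \<open>The span of these functions is closed under differentiation, whence smoothness by coinduction.\<close>

definition flat :: "nat \<Rightarrow> real \<Rightarrow> real" where
  "flat k x = (if x > 0 then exp (- 1 / x) / x ^ k else 0)"

lemma flat_nonneg: "flat k x \<ge> 0"
  by (simp add: flat_def)

text \<open>Keeping the single term of index \<open>k + 2\<close> in the series of
  \<open>exp (1 / x)\<close> beats the pole \<open>x ^ k\<close> by two powers of \<open>x\<close>.
  The square is what makes the difference quotient at 0 tend to 0 in
  \<open>flat_DERIV\<close>.\<close>

lemma flat_bound: "flat k x \<le> fact (k + 2) * x\<^sup>2"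
proof (cases "x > 0")
  case True
  have "(1/x) ^ (k+2) / fact (k+2) \<le> exp (1/x)"
  proof -
    have *: "(\<lambda>n. (1/x) ^ n / fact n) sums exp (1/x)"
      using exp_converges[of "1/x"] by (simp add: divide_inverse mult.commute)
    have "(\<Sum>n\<in>{k+2}. (1/x) ^ n / fact n) \<le> (\<Sum>n. (1/x) ^ n / fact n)"
      by (rule sum_le_suminf) (use * True in \<open>auto simp: sums_iff\<close>)
    then show ?thesis using * by (simp add: sums_iff)
  qed
  then have "1 \<le> exp (1/x) * fact (k+2) * x ^ (k+2)"
    using True by (simp only: power_one_over divide_divide_eq_left pos_divide_le_eq zero_less_power
        mult_pos_pos fact_gt_zero inverse_eq_divide mult.assoc mult.commute mult.left_commute)
  then have "exp (-1/x) \<le> exp (-1/x) * (exp (1/x) * fact (k+2) * x ^ (k+2))"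
    by simp
  also have "\<dots> = fact (k+2) * x ^ (k+2)"
    by (simp add: mult.assoc[symmetric] exp_add[symmetric])
  finally show ?thesis using True by (simp add: flat_def field_simps power_add power2_eq_square)
qed (simp add: flat_def)

lemma flat_DERIV: "(flat k has_real_derivative flat (k+2) x - real k * flat (k+1) x) (at x)"
proof -
  consider "x > 0" | "x < 0" | "x = 0" by linarith
  then show ?thesis
  proof cases
    case 1
    have "((\<lambda>x. exp (- 1 / x) / x ^ k) has_real_derivative flat (k+2) x - real k * flat (k+1) x) (at x)"
      using 1 apply (auto intro!: derivative_eq_intros simp: flat_def)
      apply (cases k)
       apply (auto simp: field_simps power2_eq_square power_add)
      done
    then show ?thesis
      by (rule has_field_derivative_transform_within_open[where S = "{0<..}"])
         (use 1 in \<open>auto simp: flat_def\<close>)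
  next
    case 2
    have "((\<lambda>x. 0) has_real_derivative flat (k+2) x - real k * flat (k+1) x) (at x)"
      using 2 by (simp add: flat_def)
    then show ?thesis
      by (rule has_field_derivative_transform_within_open[where S = "{..<0}"])
         (use 2 in \<open>auto simp: flat_def\<close>)
  next
    case 3
    have "((\<lambda>h. (flat k h - flat k 0) / h) \<longlongrightarrow> 0) (at 0)"
    proof (rule Lim_null_comparison)
      show "\<forall>\<^sub>F h in at 0. norm ((flat k h - flat k 0) / h) \<le> fact (k+2) * \<bar>h\<bar>"
      proof (rule eventuallyI)
        fix h :: real
        show "norm ((flat k h - flat k 0) / h) \<le> fact (k+2) * \<bar>h\<bar>"
        proof (cases "h = 0")
          case False
          have "flat k h \<le> fact (k+2) * \<bar>h\<bar> * \<bar>h\<bar>"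
            using flat_bound[of k h] by (simp add: power2_eq_square mult.assoc)
          then show ?thesis using False flat_nonneg[of k h]
            by (simp add: flat_def[of k 0] abs_divide pos_divide_le_eq)
        qed simp
      qed
      show "((\<lambda>h::real. fact (k+2) * \<bar>h\<bar>) \<longlongrightarrow> 0) (at 0)"
        by (auto intro!: tendsto_eq_intros)
    qed
    then show ?thesis using 3 by (simp add: DERIV_def flat_def)
  qed
qed

inductive_set bump_span :: "('a::euclidean_space \<Rightarrow> real) set" where
  base: "(\<lambda>z. flat k (1 - z \<bullet> z)) \<in> bump_span"
| scale: "f \<in> bump_span \<Longrightarrow> (\<lambda>z. c * f z) \<in> bump_span"
| mult: "f \<in> bump_span \<Longrightarrow> (\<lambda>z. (z \<bullet> a) * f z) \<in> bump_span"
| add: "f \<in> bump_span \<Longrightarrow> g \<in> bump_span \<Longrightarrow> (\<lambda>z. f z + g z) \<in> bump_span"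

lemma bump_span_derivative:
  assumes "f \<in> bump_span"
  shows "\<exists>f'. (\<forall>z. (f has_derivative f' z) (at z)) \<and> (\<forall>e. (\<lambda>z. f' z e) \<in> bump_span)"
  using assms
proof induction
  case (base k)
  let ?g = "\<lambda>z::'a. flat (k+2) (1 - z \<bullet> z) + (- real k) * flat (k+1) (1 - z \<bullet> z)"
  have "((\<lambda>z. flat k (1 - z \<bullet> z)) has_derivative (\<lambda>e. (-2) * ((z \<bullet> e) * ?g z))) (at z)" for z :: 'a
    by (rule has_derivative_eq_rhs, rule DERIV_compose_FDERIV[OF flat_DERIV])
       (auto intro!: derivative_eq_intros simp: inner_commute algebra_simps)
  moreover have "(\<lambda>z. (-2) * ((z \<bullet> e) * ?g z)) \<in> bump_span" for e
    by (intro bump_span.intros)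
  ultimately show ?case by (intro exI[of _ "\<lambda>z e. (-2) * ((z \<bullet> e) * ?g z)"]) auto
next
  case (scale f c)
  then obtain f' where "\<forall>z. (f has_derivative f' z) (at z)" "\<forall>e. (\<lambda>z. f' z e) \<in> bump_span" by blast
  then show ?case
    by (intro exI[of _ "\<lambda>z e. c * f' z e"]) (auto intro!: derivative_intros bump_span.intros)
next
  case (mult f a)
  then obtain f' where "\<forall>z. (f has_derivative f' z) (at z)" "\<forall>e. (\<lambda>z. f' z e) \<in> bump_span" by blast
  with mult show ?case
    by (intro exI[of _ "\<lambda>z e. (z \<bullet> a) * f' z e + (e \<bullet> a) * f z"])
       (auto intro!: derivative_eq_intros bump_span.intros)
next
  case (add f g)
  then obtain f' g' where "\<forall>z. (f has_derivative f' z) (at z)" "\<forall>e. (\<lambda>z. f' z e) \<in> bump_span"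
    "\<forall>z. (g has_derivative g' z) (at z)" "\<forall>e. (\<lambda>z. g' z e) \<in> bump_span" by blast
  then show ?case
    by (intro exI[of _ "\<lambda>z e. f' z e + g' z e"]) (auto intro!: derivative_intros bump_span.intros)
qed

lemma bump_span_smooth:
  assumes "f \<in> bump_span"
  shows "smooth_on UNIV f"
  using assms
proof (rule smooth_on_UNIV_coinduct)
  fix f :: "'a \<Rightarrow> real" and x e :: 'a
  assume "f \<in> bump_span"
  then obtain f' where f': "\<And>z. (f has_derivative f' z) (at z)" "\<And>e. (\<lambda>z. f' z e) \<in> bump_span"
    using bump_span_derivative by blast
  show "f differentiable (at x)" using f'(1) differentiableI by blast
  show "(\<lambda>x. frechet_derivative f (at x) e) \<in> bump_span"
    using f'(2)[of e] by (simp add: frechet_derivative_at[OF f'(1), symmetric])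
qed

text \<open>The classical \<open>exp (- 1 / (1 - |z|^2))\<close> on the unit ball, continued by
  zero.\<close>

definition bump :: "'a::euclidean_space \<Rightarrow> real" where
  "bump z = flat 0 (1 - z \<bullet> z)"

lemma bump_eq_0: "norm z \<ge> 1 \<Longrightarrow> bump z = 0"
  using power_mono[of 1 "norm z" 2] by (simp add: bump_def flat_def dot_square_norm not_less)

lemma bump_pos: "norm z < 1 \<Longrightarrow> bump z > 0"
  by (simp add: bump_def flat_def dot_square_norm power_less_one_iff abs_square_less_1)

lemma bump_nonneg: "bump z \<ge> 0"
  by (simp add: bump_def flat_nonneg)

lemma bump_smooth: "smooth_on UNIV (bump :: 'a::euclidean_space \<Rightarrow> real)"
  unfolding bump_def[abs_def] by (intro bump_span_smooth bump_span.intros)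

lemma frechet_derivative_eq_0:
  assumes "closed S" "\<And>x. x \<notin> S \<Longrightarrow> f x = 0" "x \<notin> S"
  shows "frechet_derivative f (at x) e = 0"
proof -
  have "(f has_derivative (\<lambda>_. 0)) (at x)"
    by (rule has_derivative_transform_within_open[where f="\<lambda>_. 0" and s="-S"]) (use assms in auto)
  then show ?thesis using frechet_derivative_at by metis
qed

section \<open>Uniform bounds for functions of compact support\<close>

lemma C1_compact_support_lipschitz:
  fixes f :: "'a::euclidean_space \<Rightarrow> 'b::euclidean_space"
  assumes f': "\<And>x. (f has_derivative f' x) (at x)"
    and cont: "\<And>e. e \<in> Basis \<Longrightarrow> continuous_on UNIV (\<lambda>x. f' x e)"
    and K: "compact K" "\<And>x. x \<notin> K \<Longrightarrow> f x = 0"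
  shows "\<exists>B\<ge>0. (\<forall>x e. norm (f' x e) \<le> B * norm e) \<and> (\<forall>x y. norm (f x - f y) \<le> B * norm (x - y))"
proof -
  have zero: "f' x e = 0" if "x \<notin> K" for x e
    using frechet_derivative_eq_0[where f=f and e=e, OF compact_imp_closed[OF K(1)] K(2) that]
    by (simp add: frechet_derivative_at[OF f', symmetric])
  have "\<exists>B\<ge>0. \<forall>x. norm (f' x e) \<le> B" if "e \<in> Basis" for e
  proof -
    have "compact ((\<lambda>x. f' x e) ` K)"
      using cont[OF that] K(1) by (intro compact_continuous_image) (auto intro: continuous_on_subset)
    then obtain B where "\<And>x. x \<in> K \<Longrightarrow> norm (f' x e) \<le> B"
      by (meson compact_imp_bounded bounded_iff imageI)
    then have "norm (f' x e) \<le> max B 0" for x using zero[of x e] by (cases "x \<in> K") (auto simp: le_max_iff_disj)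
    then show ?thesis by (intro exI[of _ "max B 0"]) auto
  qed
  then obtain b where b: "\<And>e. e \<in> Basis \<Longrightarrow> b e \<ge> 0" "\<And>e x. e \<in> Basis \<Longrightarrow> norm (f' x e) \<le> b e"
    by metis
  define B where "B = (\<Sum>e\<in>Basis. b e)"
  have B: "norm (f' x v) \<le> B * norm v" for x v
  proof -
    have "f' x v = f' x (\<Sum>e\<in>Basis. (v \<bullet> e) *\<^sub>R e)" by (simp add: euclidean_representation)
    also have "\<dots> = (\<Sum>e\<in>Basis. (v \<bullet> e) *\<^sub>R f' x e)"
      using has_derivative_linear[OF f'] by (simp add: linear_sum linear_scale)
    also have "norm \<dots> \<le> (\<Sum>e\<in>Basis. norm v * b e)"
      by (intro sum_norm_le) (auto intro!: mult_mono b Basis_le_norm)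
    finally show ?thesis by (simp add: B_def sum_distrib_left mult.commute)
  qed
  moreover have "norm (f x - f y) \<le> B * norm (x - y)" for x y
    by (rule differentiable_bound[where S=UNIV and f'=f']) (use f' B in \<open>auto intro!: onorm_le\<close>)
  moreover have "B \<ge> 0" unfolding B_def using b by (intro sum_nonneg) auto
  ultimately show ?thesis by blast
qed

text \<open>One constant serves all four bounds: the \<open>C^1\<close> estimate is applied to
  \<open>f\<close> and to each of its partial derivatives, which vanish outside the same
  \<open>K\<close>.\<close>

lemma smooth_compact_support_bounds:
  fixes f :: "'a::euclidean_space \<Rightarrow> real"
  assumes f: "smooth_on UNIV f" and K: "compact K" "\<And>x. x \<notin> K \<Longrightarrow> f x = 0"
  shows "\<exists>B\<ge>0. (\<forall>x. \<bar>f x\<bar> \<le> B) \<and> (\<forall>x e. \<bar>frechet_derivative f (at x) e\<bar> \<le> B * norm e) \<and>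
     (\<forall>x y. \<bar>f x - f y\<bar> \<le> B * norm (x - y)) \<and>
     (\<forall>x y e. \<bar>frechet_derivative f (at x) e - frechet_derivative f (at y) e\<bar> \<le> B * norm (x - y) * norm e)"
proof -
  let ?D = "\<lambda>x. frechet_derivative f (at x)"
  have D: "(f has_derivative ?D x) (at x)" for x using smooth_on_has_derivative[OF f] by auto
  have sm: "e \<in> Basis \<Longrightarrow> smooth_on UNIV (\<lambda>x. ?D x e)" for e using smooth_onD(3)[OF f] .
  obtain B1 where B1: "B1 \<ge> 0" "\<And>x e. norm (?D x e) \<le> B1 * norm e" "\<And>x y. norm (f x - f y) \<le> B1 * norm (x - y)"
    using C1_compact_support_lipschitz[OF D smooth_onD(2)[OF sm] K] by blast
  have "\<exists>B\<ge>0. \<forall>x y. norm (?D x e - ?D y e) \<le> B * norm (x - y)" if e: "e \<in> Basis" for e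
    using C1_compact_support_lipschitz[OF smooth_on_has_derivative[OF sm[OF e] UNIV_I]
        smooth_onD(2)[OF smooth_onD(3)[OF sm[OF e]]] K(1)
        frechet_derivative_eq_0[where f=f, OF compact_imp_closed[OF K(1)] K(2)]] by blast
  then obtain b where b: "\<And>e. e \<in> Basis \<Longrightarrow> b e \<ge> 0"
    "\<And>e x y. e \<in> Basis \<Longrightarrow> norm (?D x e - ?D y e) \<le> b e * norm (x - y)" by metis
  have "\<bar>?D x v - ?D y v\<bar> \<le> (\<Sum>e\<in>Basis. b e) * norm (x - y) * norm v" for x y v
  proof -
    have eq: "?D x v = (\<Sum>e\<in>Basis. (v \<bullet> e) *\<^sub>R ?D x e)" for x
      using has_derivative_linear[OF D[of x]]
      by (subst (1) euclidean_representation[of v, symmetric]) (simp add: linear_sum linear_scale)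
    have "?D x v - ?D y v = (\<Sum>e\<in>Basis. (v \<bullet> e) *\<^sub>R (?D x e - ?D y e))"
      by (simp add: eq[of x] eq[of y] sum_subtractf right_diff_distrib)
    also have "norm \<dots> \<le> (\<Sum>e\<in>Basis. norm v * (b e * norm (x - y)))"
      unfolding norm_scaleR
      by (intro sum_norm_le) (auto intro!: mult_mono Basis_le_norm b(2)[unfolded real_norm_def] simp: abs_mult)
    finally show ?thesis by (simp add: sum_distrib_left sum_distrib_right mult.commute mult.left_commute)
  qed note b2 = this
  have "bounded (f ` K)"
    by (intro compact_imp_bounded compact_continuous_image continuous_on_subset[OF smooth_onD(2)[OF f]] K) auto
  then obtain B0 where B0: "\<And>x. x \<in> K \<Longrightarrow> \<bar>f x\<bar> \<le> B0" by (auto simp: bounded_iff)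
  have B0': "\<bar>f x\<bar> \<le> \<bar>B0\<bar>" for x
    using B0[of x] K(2)[of x] by (cases "x \<in> K") auto
  define B where "B = \<bar>B0\<bar> + B1 + (\<Sum>e\<in>Basis. b e)"
  have s0: "(\<Sum>e\<in>Basis. b e) \<ge> 0" by (simp add: b sum_nonneg)
  have le: "\<bar>B0\<bar> \<le> B" "B1 \<le> B" "(\<Sum>e\<in>Basis. b e) \<le> B" "B \<ge> 0" using B1(1) s0 by (auto simp: B_def)
  show ?thesis
  proof (intro exI[of _ B] conjI allI)
    show "\<bar>f x\<bar> \<le> B" for x using B0' le by (meson order_trans)
    show "\<bar>?D x e\<bar> \<le> B * norm e" for x e
      using B1(2)[of x e] mult_right_mono[OF le(2), of "norm e"] by simp
    show "\<bar>f x - f y\<bar> \<le> B * norm (x - y)" for x y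
      using B1(3)[of x y] mult_right_mono[OF le(2), of "norm (x-y)"] by simp
    show "\<bar>?D x e - ?D y e\<bar> \<le> B * norm (x - y) * norm e" for x y e
      using b2[of x e y] mult_right_mono[OF le(3), of "norm (x-y)*norm e"] by (simp add: mult.assoc)
  qed (use le in auto)
qed

section \<open>Mollification\<close>

lemma integral_lborel_translate:
  fixes f :: "'a::euclidean_space \<Rightarrow> 'b::{banach, second_countable_topology}"
  assumes "f \<in> borel_measurable borel"
  shows "(LINT x|lborel. f (x + c)) = (LINT x|lborel. f x)"
proof -
  have "(LINT x|lborel. f x) = (LINT x|distr lborel borel ((+) c). f x)" by (simp add: lborel_distr_plus)
  also have "\<dots> = (LINT x|lborel. f (c + x))" by (rule integral_distr) (use assms in auto)
  finally show ?thesis by (simp add: add.commute)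
qed

lemma integral_lborel_reflect:
  fixes f :: "'a::euclidean_space \<Rightarrow> 'b::{banach, second_countable_topology}"
  assumes "f \<in> borel_measurable borel" "r > 0"
  shows "(LINT x|lborel. f ((c - x) /\<^sub>R r)) = r ^ DIM('a) *\<^sub>R (LINT x|lborel. f x)"
proof -
  have "(LINT x|lborel. f ((c - x) /\<^sub>R r)) =
     (LINT x|density (distr lborel borel (\<lambda>x. c + (- r) *\<^sub>R x)) (\<lambda>_. \<bar>- r\<bar>^DIM('a)). f ((c - x) /\<^sub>R r))"
    using assms(2) by (subst lborel_affine[of "- r" c]) auto
  also have "\<dots> = (LINT x|lborel. r^DIM('a) *\<^sub>R f ((c - (c + (- r) *\<^sub>R x)) /\<^sub>R r))"
    using assms by (simp add: integral_density integral_distr)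
  finally show ?thesis using assms(2) by simp
qed

lemma borel_measurable_compact_support_integrable:
  fixes f :: "'a::euclidean_space \<Rightarrow> 'b::euclidean_space"
  assumes "f \<in> borel_measurable borel" "\<And>x. norm (f x) \<le> B" "\<And>x. x \<notin> S \<Longrightarrow> f x = 0" "S \<in> sets borel" "bounded S"
  shows "integrable lborel f"
proof (rule Bochner_Integration.integrable_bound)
  show "integrable lborel (\<lambda>x. B * indicator S x)"
    using assms(4) emeasure_bounded_finite[OF assms(5)] by (intro integrable_mult_right integrable_real_indicator) auto
  show "AE x in lborel. norm (f x) \<le> norm (B * indicator S x)"
    using assms(2,3) by (intro always_eventually) (auto simp: indicator_def intro: order_trans[OF assms(2) abs_ge_self])
qed (use assms in auto)

text \<open>Applies to every \<open>f\<close> of this kind: a non-integrable function has integral 0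
  by convention, and \<open>B\<close> is nonnegative because it bounds a norm.\<close>

lemma integral_norm_bound_support:
  fixes f :: "'a::euclidean_space \<Rightarrow> 'b::euclidean_space"
  assumes "\<And>x. norm (f x) \<le> B" "\<And>x. x \<notin> S \<Longrightarrow> f x = 0" "S \<in> sets borel" "bounded S"
  shows "norm (LINT x|lborel. f x) \<le> B * measure lborel S"
proof (cases "integrable lborel f")
  case True
  have fin: "emeasure lborel S < \<infinity>" using emeasure_bounded_finite[OF assms(4)] by simp
  have "norm (LINT x|lborel. f x) \<le> (LINT x|lborel. norm (f x))" by (rule integral_norm_bound)
  also have "\<dots> \<le> (LINT x|lborel. B * indicator S x)"
    using assms fin by (intro integral_mono integrable_mult_right integrable_real_indicator integrable_norm True)
       (auto simp: indicator_def)
  also have "\<dots> = B * measure lborel S" using assms by simp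
  finally show ?thesis .
next
  case False
  have "B \<ge> 0" using assms(1) norm_ge_zero order_trans by blast
  then show ?thesis using False by (simp add: not_integrable_integral_eq)
qed

text \<open>With \<open>H = UNIV\<close> this is integration by parts.\<close>

lemma integral_directional_derivative_eq_0:
  fixes f :: "'a::euclidean_space \<Rightarrow> 'b::euclidean_space"
  assumes f': "\<And>x. (f has_derivative f' x) (at x)"
    and cont: "continuous_on UNIV (\<lambda>x. f' x e)"
    and S: "bounded S" "\<And>x. x \<notin> S \<Longrightarrow> f x = 0"
    and H: "H \<in> sets borel" "\<And>x s. x \<in> H \<Longrightarrow> x + s *\<^sub>R e \<in> H"
  shows "(LINT x|lborel. indicator H x *\<^sub>R f' x e) = 0"
proof -
  obtain R where R: "\<forall>x\<in>S. norm x \<le> R" using S(1) bounded_iff by blast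
  have f0: "f x = 0" if "x \<notin> cball 0 R" for x using S(2)[of x] R that by auto
  have f'0: "f' x e = 0" if "x \<notin> cball 0 R" for x
    using frechet_derivative_eq_0[of "cball 0 R" f x e] f0 that by (simp add: frechet_derivative_at[OF f', symmetric])
  have contf: "continuous_on UNIV f"
    using f' by (auto simp: continuous_on_eq_continuous_at intro: has_derivative_continuous)
  have [measurable]: "f \<in> borel_measurable borel" using contf by (rule borel_measurable_continuous_onI)
  have [measurable]: "(\<lambda>x. f' x e) \<in> borel_measurable borel" using cont by (rule borel_measurable_continuous_onI)
  note [measurable] = H(1)
  have "compact ((\<lambda>x. f' x e) ` cball 0 R)"
    using cont by (intro compact_continuous_image) (auto intro: continuous_on_subset)
  then obtain B where "\<And>x. x \<in> cball 0 R \<Longrightarrow> norm (f' x e) \<le> B"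
    by (meson compact_imp_bounded bounded_iff imageI)
  then have B: "norm (f' x e) \<le> max B 0" for x
    using f'0[of x] by (cases "x \<in> cball 0 R") (auto simp: le_max_iff_disj)
  have "compact (f ` cball 0 R)"
    using contf by (intro compact_continuous_image) (auto intro: continuous_on_subset)
  then obtain B1 where "\<And>x. x \<in> cball 0 R \<Longrightarrow> norm (f x) \<le> B1"
    by (meson compact_imp_bounded bounded_iff imageI)
  then have B1: "norm (f x) \<le> max B1 0" for x
    using f0[of x] by (cases "x \<in> cball 0 R") (auto simp: le_max_iff_disj)
  have line: "((\<lambda>t. f (x + t *\<^sub>R e)) has_vector_derivative f' (x + t *\<^sub>R e) e) (at t)" for x t
  proof -
    have "((\<lambda>t. f (x + t *\<^sub>R e)) has_derivative (\<lambda>h. f' (x + t *\<^sub>R e) (h *\<^sub>R e))) (at t)"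
      by (rule has_derivative_compose[OF _ f']) (auto intro!: derivative_eq_intros)
    then show ?thesis
      using has_derivative_linear[OF f'] by (simp add: has_vector_derivative_def linear_scale)
  qed
  have lip: "norm (f (x + t *\<^sub>R e) - f x) \<le> max B 0 * \<bar>t\<bar>" for x t
  proof -
    have "onorm (\<lambda>h. h *\<^sub>R f' (x + s *\<^sub>R e) e) \<le> max B 0" for s
      by (rule onorm_le) (use B in \<open>simp add: mult.commute mult_left_mono\<close>)
    then show ?thesis
      using differentiable_bound[of UNIV "\<lambda>t. f (x + t *\<^sub>R e)" "\<lambda>t h. h *\<^sub>R f' (x + t *\<^sub>R e) e" "max B 0" t 0]
        line[of x] by (simp add: has_vector_derivative_def)
  qed
  \<comment> \<open>Difference quotients along \<open>e\<close> with step
    \<open>1 / (n + 1)\<close>. Translation by multiples of \<open>e\<close> preserves both Lebesgue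
    measure and \<open>H\<close>, so each quotient has integral 0, and dominated convergence carries
    this over to the derivative.\<close>
  define q where "q n x = indicator H x *\<^sub>R (real (Suc n) *\<^sub>R (f (x + (1 / real (Suc n)) *\<^sub>R e) - f x))" for n x
  have [measurable]: "q n \<in> borel_measurable borel" for n
    unfolding q_def by measurable
  have indH: "indicator H (x + s *\<^sub>R e) = (indicator H x :: real)" for x s
    using H(2)[of x s] H(2)[of "x + s *\<^sub>R e" "- s"] by (auto simp: indicator_def)
  have intf: "integrable lborel (\<lambda>x. indicator H x *\<^sub>R f x)"
    by (rule borel_measurable_compact_support_integrable[of _ "max B1 0" "cball 0 R"])
      (use B1 f0 in \<open>auto simp: indicator_def\<close>)
  have q0: "integral\<^sup>L lborel (q n) = 0" for n
  proof -
    let ?s = "1 / real (Suc n)"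
    have int1: "integrable lborel (\<lambda>x. indicator H (x + ?s *\<^sub>R e) *\<^sub>R f (x + ?s *\<^sub>R e))"
    proof -
      have "integrable (distr lborel borel ((+) (?s *\<^sub>R e))) (\<lambda>x. indicator H x *\<^sub>R f x)"
        using intf by (simp only: lborel_distr_plus)
      then show ?thesis by (subst (asm) integrable_distr_eq) (auto simp: add.commute)
    qed
    have int2: "(LINT x|lborel. indicator H (x + ?s *\<^sub>R e) *\<^sub>R f (x + ?s *\<^sub>R e)) = (LINT x|lborel. indicator H x *\<^sub>R f x)"
      by (rule integral_lborel_translate[of "\<lambda>x. indicator H x *\<^sub>R f x"]) measurable
    have "q n = (\<lambda>x. real (Suc n) *\<^sub>R (indicator H x *\<^sub>R f (x + ?s *\<^sub>R e) - indicator H x *\<^sub>R f x))"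
      by (simp add: q_def fun_eq_iff scaleR_diff_right mult.commute)
    then have "integral\<^sup>L lborel (q n) = real (Suc n) *\<^sub>R ((LINT x|lborel. indicator H x *\<^sub>R f (x + ?s *\<^sub>R e)) - (LINT x|lborel. indicator H x *\<^sub>R f x))"
      using int1[unfolded indH] intf by (simp only: integral_scaleR_right Bochner_Integration.integral_diff)
    then show ?thesis using int2[unfolded indH] by (simp only:) simp
  qed
  have "(\<lambda>n. integral\<^sup>L lborel (q n)) \<longlonglongrightarrow> (LINT x|lborel. indicator H x *\<^sub>R f' x e)"
  proof (rule integral_dominated_convergence)
    \<comment> \<open>The mean value estimate \<open>lip\<close> bounds the quotients by
      \<open>max B 0\<close>; since the steps are at most 1, they vanish outside the support
      enlarged by \<open>norm e\<close>.\<close>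
    show "integrable lborel (\<lambda>x. max B 0 * indicator (cball 0 (R + norm e)) x)"
      using emeasure_bounded_finite[OF bounded_cball] by (intro integrable_mult_right integrable_real_indicator) auto
    show "AE x in lborel. (\<lambda>n. q n x) \<longlonglongrightarrow> indicator H x *\<^sub>R f' x e"
    proof (intro always_eventually allI)
      fix x
      have "((\<lambda>h. (f (x + h *\<^sub>R e) - f x) /\<^sub>R h) \<longlongrightarrow> f' x e) (at 0)"
      proof (subst LIM_zero_iff[symmetric], subst tendsto_norm_zero_iff[symmetric], rule Lim_transform_eventually)
        show "((\<lambda>h. norm (f (x + h *\<^sub>R e) - f x - h *\<^sub>R f' x e) / norm h) \<longlongrightarrow> 0) (at 0)"
          using line[of x 0] by (simp add: has_vector_derivative_def has_derivative_at)
        show "\<forall>\<^sub>F h in at 0. norm (f (x + h *\<^sub>R e) - f x - h *\<^sub>R f' x e) / norm h =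
            norm ((f (x + h *\<^sub>R e) - f x) /\<^sub>R h - f' x e)"
        proof (rule eventually_at_topological[THEN iffD2], intro exI[of _ UNIV] conjI ballI impI)
          fix h :: real assume "h \<noteq> 0"
          then have "(f (x + h *\<^sub>R e) - f x) /\<^sub>R h - f' x e = (f (x + h *\<^sub>R e) - f x - h *\<^sub>R f' x e) /\<^sub>R h"
            by (simp add: scaleR_diff_right)
          then show "norm (f (x + h *\<^sub>R e) - f x - h *\<^sub>R f' x e) / norm h =
            norm ((f (x + h *\<^sub>R e) - f x) /\<^sub>R h - f' x e)"
            by (simp add: divide_inverse mult.commute)
        qed auto
      qed
      moreover have "filterlim (\<lambda>n. 1 / real (Suc n)) (at 0) sequentially"
        using LIMSEQ_Suc[OF lim_const_over_n[of 1]] by (auto simp: filterlim_at)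
      ultimately have "(\<lambda>n. (f (x + (1 / real (Suc n)) *\<^sub>R e) - f x) /\<^sub>R (1 / real (Suc n))) \<longlonglongrightarrow> f' x e"
        by (rule filterlim_compose)
      then show "(\<lambda>n. q n x) \<longlonglongrightarrow> indicator H x *\<^sub>R f' x e"
        unfolding q_def by (intro tendsto_scaleR tendsto_const) (simp add: inverse_eq_divide)
    qed
    show "AE x in lborel. norm (q n x) \<le> max B 0 * indicator (cball 0 (R + norm e)) x" for n
    proof (intro always_eventually allI)
      fix x
      let ?s = "1 / real (Suc n)"
      have 1: "norm (real (Suc n) *\<^sub>R (f (x + ?s *\<^sub>R e) - f x)) \<le> max B 0"
        using mult_left_mono[OF lip[of x ?s], of "real (Suc n)"] by (simp del: of_nat_Suc)
      show "norm (q n x) \<le> max B 0 * indicator (cball 0 (R + norm e)) x"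
      proof (cases "norm x \<le> R + norm e")
        case False
        have "norm x \<le> norm (x + ?s *\<^sub>R e) + norm (?s *\<^sub>R e)"
          using norm_triangle_ineq4[of "x + ?s *\<^sub>R e" "?s *\<^sub>R e"] by simp
        moreover have "norm (?s *\<^sub>R e) \<le> norm e"
          by (simp add: divide_le_eq mult_le_cancel_left1)
        ultimately have "norm x > R" "norm (x + ?s *\<^sub>R e) > R"
          using False norm_ge_zero[of e] by linarith+
        then have "f x = 0" "f (x + ?s *\<^sub>R e) = 0" by (auto intro!: f0)
        then show ?thesis by (simp add: q_def)
      next
        case True
        then show ?thesis using 1 unfolding q_def by (auto simp: indicator_def)
      qed
    qed
  qed auto
  then show ?thesis by (simp add: q0 LIMSEQ_const_iff)
qed

section \<open>The mollifying kernel and its scaling\<close>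

definition moll :: "'a::euclidean_space \<Rightarrow> real" where
  "moll z = bump z / (LINT x|lborel. bump (x::'a))"

definition kern :: "real \<Rightarrow> 'a::euclidean_space \<Rightarrow> real" where
  "kern \<epsilon> z = moll (z /\<^sub>R \<epsilon>) / \<epsilon> ^ DIM('a)"

abbreviation dkern :: "real \<Rightarrow> 'a::euclidean_space \<Rightarrow> 'a \<Rightarrow> real" where
  "dkern \<epsilon> z e \<equiv> frechet_derivative (kern \<epsilon>) (at z) e"

lemma bump_borel [measurable]: "bump \<in> borel_measurable borel"
  using smooth_onD(2)[OF bump_smooth] by (rule borel_measurable_continuous_onI)

lemma bump_le_1: "bump z \<le> 1"
  by (simp add: bump_def flat_def)

lemma bump_integrable: "integrable lborel (bump :: 'a::euclidean_space \<Rightarrow> real)"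
  by (rule borel_measurable_compact_support_integrable[of _ 1 "cball 0 1"])
     (auto simp: bump_nonneg bump_le_1 intro!: bump_eq_0)

lemma integral_bump_pos: "(LINT x|lborel. bump (x::'a::euclidean_space)) > 0"
proof -
  have "(LINT x|lborel. bump (x::'a)) \<noteq> 0"
  proof
    assume "(LINT x|lborel. bump (x::'a)) = 0"
    then have "AE x in lborel. bump (x::'a) = 0"
      using integral_nonneg_eq_0_iff_AE[OF bump_integrable[where 'a='a]] by (simp add: bump_nonneg)
    then have "AE x in lborel. (x::'a) \<notin> ball 0 1"
      by eventually_elim (use bump_pos in force)
    then have "emeasure lborel (ball (0::'a) 1) = 0"
      by (subst (asm) AE_iff_measurable[of "ball 0 1"]) auto
    then show False using emeasure_lborel_ball_finite content_ball_pos[of 1 "0::'a"]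
      by (simp add: measure_def)
  qed
  moreover have "(LINT x|lborel. bump (x::'a)) \<ge> 0" by (simp add: bump_nonneg)
  ultimately show ?thesis by linarith
qed

lemma moll_smooth: "smooth_on UNIV (moll :: 'a::euclidean_space \<Rightarrow> real)"
proof -
  have "(\<lambda>z::'a. (1 / (LINT x|lborel. bump (x::'a))) * flat 0 (1 - z \<bullet> z)) \<in> bump_span"
    by (intro bump_span.intros)
  then have "smooth_on UNIV (\<lambda>z::'a. (1 / (LINT x|lborel. bump (x::'a))) * flat 0 (1 - z \<bullet> z))"
    by (rule bump_span_smooth)
  moreover have "(\<lambda>z::'a. (1 / (LINT x|lborel. bump (x::'a))) * flat 0 (1 - z \<bullet> z)) = moll"
    by (simp only: moll_def bump_def[symmetric] fun_eq_iff times_divide_eq_left mult_1_left) simp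
  ultimately show ?thesis by simp
qed

text \<open>In the coinduction \<open>a\<close> and \<open>b\<close> stay fixed while
  \<open>f\<close> and \<open>c\<close> vary: differentiation replaces \<open>f\<close> by a partial
  derivative and \<open>c\<close> by \<open>c * a\<close>.\<close>

lemma smooth_on_scaled:
  fixes f :: "'a::euclidean_space \<Rightarrow> real"
  assumes "smooth_on UNIV f"
  shows "smooth_on UNIV (\<lambda>z. c * f (a *\<^sub>R z + b))"
proof (rule smooth_on_UNIV_coinduct[where F = "{g. \<exists>f c. smooth_on UNIV f \<and> g = (\<lambda>z. c * f (a *\<^sub>R z + b))}"])
  have *: "((\<lambda>z. c * f (a *\<^sub>R z + b)) has_derivative (\<lambda>e. c * (a * frechet_derivative f (at (a *\<^sub>R x + b)) e))) (at x)"
    if f: "smooth_on UNIV f" for f :: "'a \<Rightarrow> real" and c x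
  proof -
    have "((\<lambda>z. f (a *\<^sub>R z + b)) has_derivative (\<lambda>e. frechet_derivative f (at (a *\<^sub>R x + b)) (a *\<^sub>R e))) (at x)"
      by (rule has_derivative_compose[OF _ smooth_on_has_derivative[OF f]]) (auto intro!: derivative_eq_intros)
    moreover have "linear (frechet_derivative f (at (a *\<^sub>R x + b)))"
      by (rule has_derivative_linear[OF smooth_on_has_derivative[OF f]]) simp
    ultimately show ?thesis by (auto intro!: derivative_eq_intros simp: linear_scale)
  qed
  show "g differentiable (at x)" if g: "g \<in> {g. \<exists>f c. smooth_on UNIV f \<and> g = (\<lambda>z. c * f (a *\<^sub>R z + b))}" for g :: "'a \<Rightarrow> real" and x
  proof -
    obtain f c where "smooth_on UNIV f" "g = (\<lambda>z. c * f (a *\<^sub>R z + b))" using g by blast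
    then show ?thesis using * by (metis differentiableI)
  qed
  show "(\<lambda>x. frechet_derivative g (at x) e) \<in> {g. \<exists>f c. smooth_on UNIV f \<and> g = (\<lambda>z. c * f (a *\<^sub>R z + b))}"
    if "g \<in> {g. \<exists>f c. smooth_on UNIV f \<and> g = (\<lambda>z. c * f (a *\<^sub>R z + b))}" and "e \<in> Basis" for g :: "'a \<Rightarrow> real" and e
  proof -
    obtain f c where f: "smooth_on UNIV f" "g = (\<lambda>z. c * f (a *\<^sub>R z + b))" using \<open>g \<in> _\<close> by blast
    have "(\<lambda>x. frechet_derivative g (at x) e) = (\<lambda>x. (c * a) * frechet_derivative f (at (a *\<^sub>R x + b)) e)"
      unfolding f(2) by (simp add: frechet_derivative_at[OF *[OF f(1)], symmetric] mult.assoc)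
    then show ?thesis using smooth_onD(3)[OF f(1) \<open>e \<in> Basis\<close>] by blast
  qed
qed (use assms in auto)

lemma kern_smooth: "smooth_on UNIV (kern \<epsilon> :: 'a::euclidean_space \<Rightarrow> real)"
  using smooth_on_scaled[OF moll_smooth, of "1 / \<epsilon> ^ DIM('a)" "inverse \<epsilon>" 0]
  by (simp add: kern_def[abs_def])

lemma kern_eq_0: "\<epsilon> > 0 \<Longrightarrow> norm z \<ge> \<epsilon> \<Longrightarrow> kern \<epsilon> z = 0"
  by (auto simp: kern_def moll_def field_simps intro!: bump_eq_0)

lemma kern_nonneg: "\<epsilon> > 0 \<Longrightarrow> kern \<epsilon> z \<ge> 0"
  using integral_bump_pos[where 'a='a] by (auto simp: kern_def moll_def bump_nonneg less_imp_le)

lemma kern_has_derivative: "(kern \<epsilon> has_derivative dkern \<epsilon> z) (at z)"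
  by (rule smooth_on_has_derivative[OF kern_smooth]) simp

lemma kern_continuous: "continuous_on UNIV (kern \<epsilon>)"
  by (rule smooth_onD(2)[OF kern_smooth])

lemma kern_borel [measurable]: "kern \<epsilon> \<in> borel_measurable borel"
  by (rule borel_measurable_continuous_onI[OF kern_continuous])

lemma dkern_linear: "linear (dkern \<epsilon> z)"
  using kern_has_derivative has_derivative_linear by blast

lemma dkern_eq: 
  fixes z :: "'a::euclidean_space"
  assumes "\<epsilon> > 0"
  shows "dkern \<epsilon> z e = frechet_derivative moll (at (z /\<^sub>R \<epsilon>)) e / \<epsilon> ^ (DIM('a) + 1)"
proof -
  have "((\<lambda>z. moll (z /\<^sub>R \<epsilon>)) has_derivative (\<lambda>e. frechet_derivative moll (at (z /\<^sub>R \<epsilon>)) (e /\<^sub>R \<epsilon>))) (at z)"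
    by (rule has_derivative_compose[OF _ smooth_on_has_derivative[OF moll_smooth]]) (auto intro!: derivative_eq_intros)
  then have "(kern \<epsilon> has_derivative (\<lambda>e. frechet_derivative moll (at (z /\<^sub>R \<epsilon>)) (e /\<^sub>R \<epsilon>) / \<epsilon> ^ DIM('a))) (at z)"
    unfolding kern_def[abs_def] divide_inverse by (auto intro!: derivative_eq_intros)
  moreover have "linear (frechet_derivative moll (at (z /\<^sub>R \<epsilon>)))"
    by (rule has_derivative_linear[OF smooth_on_has_derivative[OF moll_smooth]]) simp
  ultimately show ?thesis
    by (simp add: frechet_derivative_at[symmetric] linear_scale field_simps)
qed

text \<open>On the sphere \<open>norm z = \<epsilon>\<close> the kernel is zero without being zero
  nearby. As it is nonnegative, each of its zeros is a minimum, and the derivative vanishes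
  there.\<close>

lemma dkern_eq_0: "\<epsilon> > 0 \<Longrightarrow> norm z \<ge> \<epsilon> \<Longrightarrow> dkern \<epsilon> z e = 0"
proof -
  assume e: "\<epsilon> > 0" "norm z \<ge> \<epsilon>"
  have "kern \<epsilon> z = 0" using kern_eq_0 e by blast
  moreover have "kern \<epsilon> y \<ge> 0" for y :: 'a using kern_nonneg e by blast
  ultimately have "dkern \<epsilon> z = (\<lambda>_. 0)"
    by (intro differential_zero_maxmin[of z UNIV "kern \<epsilon>"] kern_has_derivative disjI2) auto
  then show ?thesis by simp
qed

lemma dkern_continuous: "continuous_on UNIV (\<lambda>z. dkern \<epsilon> z e)"
proof -
  have "(\<lambda>z. dkern \<epsilon> z e) = (\<lambda>z. \<Sum>b\<in>Basis. (e \<bullet> b) * dkern \<epsilon> z b)"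
    by (subst (1) euclidean_representation[of e, symmetric])
       (simp add: linear_sum[OF dkern_linear] linear_scale[OF dkern_linear] del: euclidean_representation)
  then show ?thesis
    by (simp only:) (intro continuous_intros smooth_onD(2)[OF smooth_onD(3)[OF kern_smooth]])
qed

lemma dkern_borel [measurable]: "(\<lambda>z. dkern \<epsilon> z e) \<in> borel_measurable borel"
  by (rule borel_measurable_continuous_onI[OF dkern_continuous])

text \<open>The bounds for \<open>moll\<close>, rescaled: the normalisation contributes
  \<open>\<epsilon> ^ DIM('a)\<close> to the denominator, and every derivative or Lipschitz estimate
  one more power of \<epsilon>.\<close>

lemma kern_bounds:
  "\<exists>B\<ge>0. \<forall>\<epsilon>>0. (\<forall>z::'a::euclidean_space. \<bar>kern \<epsilon> z\<bar> \<le> B / \<epsilon> ^ DIM('a)) \<and>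
     (\<forall>(z::'a) e. \<bar>dkern \<epsilon> z e\<bar> \<le> B / \<epsilon> ^ (DIM('a) + 1) * norm e) \<and>
     (\<forall>(z::'a) y. \<bar>kern \<epsilon> z - kern \<epsilon> y\<bar> \<le> B / \<epsilon> ^ (DIM('a) + 1) * norm (z - y)) \<and>
     (\<forall>(z::'a) y e. \<bar>dkern \<epsilon> z e - dkern \<epsilon> y e\<bar> \<le> B / \<epsilon> ^ (DIM('a) + 2) * norm (z - y) * norm e)"
proof -
  have m0: "moll z = 0" if "z \<notin> cball 0 1" for z :: 'a
    using that by (simp add: moll_def bump_eq_0)
  obtain B where B: "B \<ge> 0" "\<And>x::'a. \<bar>moll x\<bar> \<le> B" "\<And>(x::'a) e. \<bar>frechet_derivative moll (at x) e\<bar> \<le> B * norm e"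
    "\<And>(x::'a) y. \<bar>moll x - moll y\<bar> \<le> B * norm (x - y)"
    "\<And>(x::'a) y e. \<bar>frechet_derivative moll (at x) e - frechet_derivative moll (at y) e\<bar> \<le> B * norm (x - y) * norm e"
    using smooth_compact_support_bounds[OF moll_smooth compact_cball m0] by blast
  show ?thesis
  proof (intro exI[of _ B] conjI allI impI B(1))
    fix \<epsilon> :: real and z assume e: "\<epsilon> > 0"
    have n: "norm (z /\<^sub>R \<epsilon> - y /\<^sub>R \<epsilon>) = norm (z - y) / \<epsilon>" for y :: 'a
      using e by (simp add: scaleR_diff_right[symmetric] divide_inverse mult.commute)
    show "\<bar>kern \<epsilon> z\<bar> \<le> B / \<epsilon> ^ DIM('a)"
      using B(2) e by (auto simp: kern_def abs_divide intro!: divide_right_mono)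
    show "\<bar>dkern \<epsilon> z e\<bar> \<le> B / \<epsilon> ^ (DIM('a) + 1) * norm e" for e
      using divide_right_mono[OF B(3), of "\<epsilon> ^ (DIM('a) + 1)"] e by (auto simp: dkern_eq abs_divide)
    show "\<bar>kern \<epsilon> z - kern \<epsilon> y\<bar> \<le> B / \<epsilon> ^ (DIM('a) + 1) * norm (z - y)" for y
      using divide_right_mono[OF B(4)[of "z /\<^sub>R \<epsilon>" "y /\<^sub>R \<epsilon>"], of "\<epsilon> ^ DIM('a)"] e
      by (auto simp: kern_def abs_divide diff_divide_distrib[symmetric] n mult.commute)
    show "\<bar>dkern \<epsilon> z e - dkern \<epsilon> y e\<bar> \<le> B / \<epsilon> ^ (DIM('a) + 2) * norm (z - y) * norm e" for y e
      using divide_right_mono[OF B(5)[of "z /\<^sub>R \<epsilon>" e "y /\<^sub>R \<epsilon>"], of "\<epsilon> ^ (DIM('a)+1)"] e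
      by (auto simp: dkern_eq abs_divide diff_divide_distrib[symmetric] n mult.commute mult.left_commute)
  qed
qed

lemma integral_kern: "\<epsilon> > 0 \<Longrightarrow> (LINT x|lborel. kern \<epsilon> (c - x :: 'a::euclidean_space)) = 1"
proof -
  assume e: "\<epsilon> > 0"
  have [measurable]: "moll \<in> borel_measurable (borel :: 'a measure)"
    unfolding moll_def[abs_def] by measurable
  have "(LINT x|lborel. moll (x::'a)) = 1"
    using integral_bump_pos[where 'a='a] by (simp add: moll_def)
  then show ?thesis
    using integral_lborel_reflect[of "moll :: 'a \<Rightarrow> real" \<epsilon> c] e by (simp add: kern_def)
qed

section \<open>Differentiation under a convolution integral\<close>

lemma integrable_bounded_scaleR:
  fixes G :: "'c \<Rightarrow> 'b::euclidean_space"
  assumes "integrable M G" "k \<in> borel_measurable M" "\<And>x. \<bar>k x\<bar> \<le> B"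
  shows "integrable M (\<lambda>x. k x *\<^sub>R G x)"
proof (rule Bochner_Integration.integrable_bound)
  show "integrable M (\<lambda>x. B * norm (G x))" using assms by auto
  have "B \<ge> 0" using assms(3) abs_ge_zero order_trans by blast
  then show "AE x in M. norm (k x *\<^sub>R G x) \<le> norm (B * norm (G x))"
    using assms(3) by (intro always_eventually) (auto simp: abs_mult intro!: mult_right_mono)
qed (use assms in measurable)

text \<open>\<open>\<Psi>\<close> is merely measurable, so the kernel may be displaced in any way
  depending on the integration variable. Only \<open>K\<close> is differentiated: its derivative is
  Lipschitz, hence the Taylor remainder is quadratic uniformly in \<open>x\<close> and can be
  integrated against \<open>G\<close>.\<close>

lemma convolution_has_derivative:
  fixes K :: "'a::euclidean_space \<Rightarrow> real" and G :: "'c \<Rightarrow> 'b::euclidean_space"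
  assumes K: "smooth_on UNIV K" "compact S" "\<And>x. x \<notin> S \<Longrightarrow> K x = 0"
    and G: "integrable M G" and \<Psi>: "\<Psi> \<in> borel_measurable M"
  shows "((\<lambda>z. LINT x|M. K (z - \<Psi> x) *\<^sub>R G x) has_derivative
     (\<lambda>e. LINT x|M. frechet_derivative K (at (z - \<Psi> x)) e *\<^sub>R G x)) (at z)"
proof -
  let ?D = "\<lambda>x. frechet_derivative K (at x)"
  obtain B where B: "B \<ge> 0" "\<And>x. \<bar>K x\<bar> \<le> B" "\<And>x e. \<bar>?D x e\<bar> \<le> B * norm e"
    "\<And>x y. \<bar>K x - K y\<bar> \<le> B * norm (x - y)"
    "\<And>x y (e::'a). \<bar>?D x e - ?D y e\<bar> \<le> B * norm (x - y) * norm e"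
    using smooth_compact_support_bounds[OF K] by blast
  have D: "(K has_derivative ?D x) (at x)" for x using smooth_on_has_derivative[OF K(1)] by auto
  have lin: "linear (?D x)" for x using D has_derivative_linear by blast
  have [measurable]: "K \<in> borel_measurable borel"
    using smooth_onD(2)[OF K(1)] by (rule borel_measurable_continuous_onI)
  have contD: "continuous_on UNIV (\<lambda>x. ?D x e)" for e
    by (rule continuous_on_compose2[of UNIV "\<lambda>x. x"]) 
       (auto intro!: lipschitz_on_continuous_on[of "B * norm e"] lipschitz_onI
          simp: B(1) dist_norm mult.assoc mult.left_commute mult.commute B(5)[unfolded mult.assoc mult.commute[of "norm (_ - _)"]])
  have [measurable]: "(\<lambda>x. ?D x e) \<in> borel_measurable borel" for e
    by (rule borel_measurable_continuous_onI[OF contD])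
  note [measurable] = \<Psi>
  have i1: "integrable M (\<lambda>x. K (z - \<Psi> x) *\<^sub>R G x)" for z
    by (rule integrable_bounded_scaleR[OF G _ B(2)]) measurable
  have i2: "integrable M (\<lambda>x. ?D (z - \<Psi> x) e *\<^sub>R G x)" for z e
    by (rule integrable_bounded_scaleR[OF G _ B(3)]) measurable
  have taylor: "\<bar>K (x + h) - K x - ?D x h\<bar> \<le> B * (norm h)\<^sup>2" for x h
  proof -
    have "norm (K (x+h) - K x - ?D x ((x+h) - x)) \<le> norm ((x+h) - x) * (B * norm h)"
    proof (rule differentiable_bound_linearization[where S="cball x (norm h)"])
      fix y assume "y \<in> cball x (norm h)"
      then have *: "norm (y - x) \<le> norm h" by (simp add: dist_norm norm_minus_commute)
      show "onorm (?D y - ?D x) \<le> B * norm h"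
      proof (rule onorm_le)
        fix e :: 'a
        have "B * norm (y - x) * norm e \<le> B * norm h * norm e"
          using * B(1) by (intro mult_right_mono mult_left_mono) auto
        then show "norm ((?D y - ?D x) e) \<le> B * norm h * norm e"
          using B(5)[of y e x] by simp
      qed
      show "(K has_derivative ?D y) (at y within cball x (norm h))" using D has_derivative_at_withinI by blast
    qed (auto simp: dist_norm mult_le_cancel_right1 abs_mult intro: mult_left_le_one_le)
    then show ?thesis by (simp add: power2_eq_square mult.assoc mult.left_commute)
  qed
  show ?thesis
  proof (rule has_derivativeI_sandwich[of 1])
    have "norm (LINT x|M. ?D (z - \<Psi> x) e *\<^sub>R G x) \<le> norm e * (B * (LINT x|M. norm (G x)))" for e
    proof -
      have "norm (LINT x|M. ?D (z - \<Psi> x) e *\<^sub>R G x) \<le> (LINT x|M. norm (?D (z - \<Psi> x) e *\<^sub>R G x))"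
        by (rule integral_norm_bound)
      also have "\<dots> \<le> (LINT x|M. (B * norm e) * norm (G x))"
        using B(3) G i2 by (intro integral_mono integrable_norm) (auto intro!: mult_right_mono)
      finally show ?thesis by (simp add: mult.assoc mult.left_commute)
    qed
    then show "bounded_linear (\<lambda>e. LINT x|M. ?D (z - \<Psi> x) e *\<^sub>R G x)"
      using i2 by (intro bounded_linear_intro)
        (auto simp: linear_add[OF lin] linear_scale[OF lin] scaleR_add_left simp flip: scaleR_scaleR)
    let ?c = "B * (LINT x|M. norm (G x))"
    show "norm ((LINT x|M. K (y - \<Psi> x) *\<^sub>R G x) - (LINT x|M. K (z - \<Psi> x) *\<^sub>R G x) -
        (LINT x|M. ?D (z - \<Psi> x) (y - z) *\<^sub>R G x)) / norm (y - z) \<le> ?c * norm (y - z)"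
      if "y \<noteq> z" for y
    proof -
      have "(LINT x|M. K (y - \<Psi> x) *\<^sub>R G x) - (LINT x|M. K (z - \<Psi> x) *\<^sub>R G x) - (LINT x|M. ?D (z - \<Psi> x) (y - z) *\<^sub>R G x)
         = (LINT x|M. (K (y - \<Psi> x) - K (z - \<Psi> x) - ?D (z - \<Psi> x) (y - z)) *\<^sub>R G x)"
        using i1 i2 by (simp add: scaleR_diff_left)
      moreover have "norm (LINT x|M. (K (y - \<Psi> x) - K (z - \<Psi> x) - ?D (z - \<Psi> x) (y - z)) *\<^sub>R G x) 
          \<le> (LINT x|M. norm ((K (y - \<Psi> x) - K (z - \<Psi> x) - ?D (z - \<Psi> x) (y - z)) *\<^sub>R G x))"
        by (rule integral_norm_bound)
      moreover have "(LINT x|M. norm ((K (y - \<Psi> x) - K (z - \<Psi> x) - ?D (z - \<Psi> x) (y - z)) *\<^sub>R G x))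
           \<le> (LINT x|M. (B * (norm (y - z))\<^sup>2) * norm (G x))"
      proof (intro integral_mono integrable_norm)
        show "integrable M (\<lambda>x. (K (y - \<Psi> x) - K (z - \<Psi> x) - ?D (z - \<Psi> x) (y - z)) *\<^sub>R G x)"
          using i1 i2 by (auto simp: scaleR_diff_left)
        show "norm ((K (y - \<Psi> x) - K (z - \<Psi> x) - ?D (z - \<Psi> x) (y - z)) *\<^sub>R G x) \<le> (B * (norm (y - z))\<^sup>2) * norm (G x)" for x
          using mult_right_mono[OF taylor[of "z - \<Psi> x" "y - z"] norm_ge_zero[of "G x"]] by simp
      qed (use G in auto)
      ultimately have "norm ((LINT x|M. K (y - \<Psi> x) *\<^sub>R G x) - (LINT x|M. K (z - \<Psi> x) *\<^sub>R G x) -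
        (LINT x|M. ?D (z - \<Psi> x) (y - z) *\<^sub>R G x)) \<le> (LINT x|M. (B * (norm (y - z))\<^sup>2) * norm (G x))"
        by simp
      then show ?thesis using that by (simp add: pos_divide_le_eq power2_eq_square mult_ac)
    qed
    show "((\<lambda>y. ?c * norm (y - z)) \<longlongrightarrow> 0) (at z)"
      by (auto intro!: tendsto_eq_intros)
  qed simp
qed

text \<open>Coinduction over all kernels that are smooth and vanish outside the same
  \<open>S\<close>; differentiating the convolution means differentiating the kernel.\<close>

lemma convolution_smooth:
  fixes K :: "'a::euclidean_space \<Rightarrow> real" and G :: "'c \<Rightarrow> 'b::euclidean_space"
  assumes K: "smooth_on UNIV K" "compact S" "\<And>x. x \<notin> S \<Longrightarrow> K x = 0"
    and G: "integrable M G" and \<Psi>: "\<Psi> \<in> borel_measurable M"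
  shows "smooth_on UNIV (\<lambda>z. LINT x|M. K (z - \<Psi> x) *\<^sub>R G x)"
proof (rule smooth_on_UNIV_coinduct[where F = "{f. \<exists>K. smooth_on UNIV K \<and> (\<forall>x. x \<notin> S \<longrightarrow> K x = 0) \<and>
    f = (\<lambda>z. LINT x|M. K (z - \<Psi> x) *\<^sub>R G x)}"], goal_cases)
  case (2 f x)
  then obtain K where "smooth_on UNIV K" "\<forall>x. x \<notin> S \<longrightarrow> K x = 0" "f = (\<lambda>z. LINT x|M. K (z - \<Psi> x) *\<^sub>R G x)"
    by blast
  then show ?case
    using convolution_has_derivative[OF _ K(2) _ G \<Psi>, of K] differentiableI by blast
next
  case (3 f e)
  then obtain K where K': "smooth_on UNIV K" "\<And>x. x \<notin> S \<Longrightarrow> K x = 0" "f = (\<lambda>z. LINT x|M. K (z - \<Psi> x) *\<^sub>R G x)"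
    by blast
  have "(\<lambda>z. frechet_derivative f (at z) e) = (\<lambda>z. LINT x|M. frechet_derivative K (at (z - \<Psi> x)) e *\<^sub>R G x)"
    unfolding K'(3) by (simp add: frechet_derivative_at[OF convolution_has_derivative[OF K'(1) K(2) K'(2) G \<Psi>], symmetric])
  then show ?case
    using smooth_onD(3)[OF K'(1) 3(2)] frechet_derivative_eq_0[OF compact_imp_closed[OF K(2)] K'(2)]
    by (intro CollectI exI[of _ "\<lambda>x. frechet_derivative K (at x) e"]) auto
qed (use K in auto)

section \<open>Mollification with a displaced kernel\<close>

text \<open>The constant of \<open>kern_bounds\<close> is fixed once for each space, so that the
  constants of the locale \<open>shift_field\<close> can be written down as terms.\<close>

definition kern_const :: "'a::euclidean_space itself \<Rightarrow> real" where
  "kern_const _ = (SOME B. B \<ge> 0 \<and> (\<forall>\<epsilon>>0. (\<forall>z::'a. \<bar>kern \<epsilon> z\<bar> \<le> B / \<epsilon> ^ DIM('a)) \<and>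
     (\<forall>(z::'a) e. \<bar>dkern \<epsilon> z e\<bar> \<le> B / \<epsilon> ^ (DIM('a) + 1) * norm e) \<and>
     (\<forall>(z::'a) y. \<bar>kern \<epsilon> z - kern \<epsilon> y\<bar> \<le> B / \<epsilon> ^ (DIM('a) + 1) * norm (z - y)) \<and>
     (\<forall>(z::'a) y e. \<bar>dkern \<epsilon> z e - dkern \<epsilon> y e\<bar> \<le> B / \<epsilon> ^ (DIM('a) + 2) * norm (z - y) * norm e)))"

lemma kern_const:
  fixes z y :: "'a::euclidean_space"
  shows "kern_const TYPE('a) \<ge> 0"
    "\<epsilon> > 0 \<Longrightarrow> \<bar>kern \<epsilon> z\<bar> \<le> kern_const TYPE('a) / \<epsilon> ^ DIM('a)"
    "\<epsilon> > 0 \<Longrightarrow> \<bar>dkern \<epsilon> z e\<bar> \<le> kern_const TYPE('a) / \<epsilon> ^ (DIM('a) + 1) * norm e"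
    "\<epsilon> > 0 \<Longrightarrow> \<bar>kern \<epsilon> z - kern \<epsilon> y\<bar> \<le> kern_const TYPE('a) / \<epsilon> ^ (DIM('a) + 1) * norm (z - y)"
    "\<epsilon> > 0 \<Longrightarrow> \<bar>dkern \<epsilon> z e - dkern \<epsilon> y e\<bar> \<le> kern_const TYPE('a) / \<epsilon> ^ (DIM('a) + 2) * norm (z - y) * norm e"
proof -
  define P where "P = (\<lambda>B. B \<ge> 0 \<and> (\<forall>\<epsilon>>0. (\<forall>z::'a. \<bar>kern \<epsilon> z\<bar> \<le> B / \<epsilon> ^ DIM('a)) \<and>
     (\<forall>(z::'a) e. \<bar>dkern \<epsilon> z e\<bar> \<le> B / \<epsilon> ^ (DIM('a) + 1) * norm e) \<and>
     (\<forall>(z::'a) y. \<bar>kern \<epsilon> z - kern \<epsilon> y\<bar> \<le> B / \<epsilon> ^ (DIM('a) + 1) * norm (z - y)) \<and>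
     (\<forall>(z::'a) y e. \<bar>dkern \<epsilon> z e - dkern \<epsilon> y e\<bar> \<le> B / \<epsilon> ^ (DIM('a) + 2) * norm (z - y) * norm e)))"
  have "\<exists>B. P B" unfolding P_def using kern_bounds[where 'a='a] by simp
  then have "P (kern_const TYPE('a))"
    unfolding kern_const_def P_def[symmetric] by (rule someI_ex)
  note * = this[unfolded P_def]
  show "kern_const TYPE('a) \<ge> 0" by (rule conjunct1[OF *])
  assume "\<epsilon> > 0"
  note ** = conjunct2[OF *, rule_format, OF this]
  show "\<bar>kern \<epsilon> z\<bar> \<le> kern_const TYPE('a) / \<epsilon> ^ DIM('a)"
    "\<bar>dkern \<epsilon> z e\<bar> \<le> kern_const TYPE('a) / \<epsilon> ^ (DIM('a) + 1) * norm e"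
    "\<bar>kern \<epsilon> z - kern \<epsilon> y\<bar> \<le> kern_const TYPE('a) / \<epsilon> ^ (DIM('a) + 1) * norm (z - y)"
    "\<bar>dkern \<epsilon> z e - dkern \<epsilon> y e\<bar> \<le> kern_const TYPE('a) / \<epsilon> ^ (DIM('a) + 2) * norm (z - y) * norm e"
    using ** by simp_all
qed

lemma measure_lborel_ball_scale:
  fixes y :: "'a::euclidean_space"
  assumes "\<epsilon> \<ge> 0" "R \<ge> 0"
  shows "measure lborel (ball y (R * \<epsilon>)) = \<epsilon> ^ DIM('a) * measure lborel (ball (0::'a) R)"
  using content_ball_conv_unit_ball[of "R * \<epsilon>" y] content_ball_conv_unit_ball[of R "0::'a"] assms
  by (simp add: power_mult_distrib)

text \<open>The measure \<open>G dx\<close> is pushed forward by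
  \<open>x \<mapsto> x + \<epsilon> w x\<close> and then mollified at scale \<epsilon>. For
  \<open>w = 0\<close> this is the usual mollification.\<close>

definition pmoll :: "real \<Rightarrow> ('a::euclidean_space \<Rightarrow> 'a) \<Rightarrow> ('a \<Rightarrow> 'b::euclidean_space) \<Rightarrow> 'a \<Rightarrow> 'b" where
  "pmoll \<epsilon> w G y = (LINT x|lborel. kern \<epsilon> (y - (x + \<epsilon> *\<^sub>R w x)) *\<^sub>R G x)"

definition dpmoll :: "real \<Rightarrow> ('a::euclidean_space \<Rightarrow> 'a) \<Rightarrow> 'a \<Rightarrow> ('a \<Rightarrow> 'b::euclidean_space) \<Rightarrow> 'a \<Rightarrow> 'b" where
  "dpmoll \<epsilon> w e G y = (LINT x|lborel. dkern \<epsilon> (y - (x + \<epsilon> *\<^sub>R w x)) e *\<^sub>R G x)"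

locale shift_field =
  fixes w :: "'a::euclidean_space \<Rightarrow> 'a" and w' :: "'a \<Rightarrow> 'a \<Rightarrow> 'a" and W L :: real
  assumes bound: "norm (w x) \<le> W"
    and deriv: "(w has_derivative w' x) (at x)"
    and deriv_bound: "norm (w' x e) \<le> L * norm e"
    and deriv_lipschitz: "norm (w' x e - w' y e) \<le> L * norm (x - y) * norm e"
begin

lemma W_nonneg: "W \<ge> 0"
  using bound norm_ge_zero order_trans by blast

lemma L_nonneg: "L \<ge> 0"
proof -
  obtain e :: 'a where "e \<in> Basis" using nonempty_Basis by blast
  then show ?thesis using deriv_bound[of _ e] norm_ge_zero order_trans by (metis mult_1_right norm_Basis)
qed

lemma lipschitz: "norm (w x - w y) \<le> L * norm (x - y)"
  by (rule differentiable_bound[of UNIV w w']) (auto intro: deriv onorm_le deriv_bound)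

lemma continuous: "continuous_on UNIV w"
  using deriv by (auto simp: continuous_on_eq_continuous_at intro: has_derivative_continuous)

lemma borel [measurable]: "w \<in> borel_measurable borel"
  using continuous by (rule borel_measurable_continuous_onI)

lemma deriv_continuous: "continuous_on UNIV (\<lambda>x. w' x e)"
  by (rule lipschitz_on_continuous_on[of "L * norm e"])
     (use deriv_lipschitz L_nonneg in \<open>auto intro!: lipschitz_onI simp: dist_norm mult.assoc mult.commute[of "norm e"]\<close>)

lemma deriv_borel [measurable]: "(\<lambda>x. w' x e) \<in> borel_measurable borel"
  using deriv_continuous by (rule borel_measurable_continuous_onI)

text \<open>\<open>W + 1\<close> is the radius, in units of \<epsilon>, of the ball around
  \<open>y\<close> outside of which the displaced kernel vanishes, and \<open>L * (W + 1)\<close>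
  bounds the variation of \<open>w\<close> on it in the same units. The product of sums dominates
  each of the products that occur in the estimates.\<close>

definition C :: real where
  "C = kern_const TYPE('a) * (1 + measure lborel (ball (0::'a) (W + 1))) * (1 + L * (W + 1))"

lemma C_ge:
  "kern_const TYPE('a) * measure lborel (ball (0::'a) (W + 1)) \<le> C" (is ?a)
  "kern_const TYPE('a) * measure lborel (ball (0::'a) (W + 1)) * (L * (W + 1)) \<le> C" (is ?b)
  "kern_const TYPE('a) \<le> C" (is ?c) "C \<ge> 0" (is ?d)
proof -
  let ?k = "kern_const TYPE('a)" and ?v = "measure lborel (ball (0::'a) (W + 1))" and ?l = "L * (W + 1)"
  have "?k \<ge> 0" "?v \<ge> 0" "?l \<ge> 0" using kern_const(1) W_nonneg L_nonneg by auto
  then have "?k * ?v \<ge> 0" "?k * ?l \<ge> 0" "?k * ?v * ?l \<ge> 0" "?k \<ge> 0" by auto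
  moreover have "C = ?k + ?k * ?v + ?k * ?l + ?k * ?v * ?l" by (simp add: C_def algebra_simps)
  ultimately show ?a ?b ?c ?d by linarith+
qed

lemma pmoll_has_derivative:
  assumes "integrable lborel G" "\<epsilon> > 0"
  shows "(pmoll \<epsilon> w G has_derivative (\<lambda>e. dpmoll \<epsilon> w e G y)) (at y)"
  unfolding pmoll_def[abs_def] dpmoll_def[abs_def]
  by (rule convolution_has_derivative[OF kern_smooth compact_cball[of 0 \<epsilon>]])
     (use assms in \<open>auto simp: kern_eq_0\<close>)

lemma pmoll_smooth:
  assumes "integrable lborel G" "\<epsilon> > 0"
  shows "smooth_on UNIV (pmoll \<epsilon> w G)"
  unfolding pmoll_def[abs_def]
  by (rule convolution_smooth[OF kern_smooth compact_cball[of 0 \<epsilon>]])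
     (use assms in \<open>auto simp: kern_eq_0\<close>)

lemma near:
  assumes "\<epsilon> > 0" "norm (y - (x + \<epsilon> *\<^sub>R w z)) < \<epsilon>"
  shows "norm (x - y) < (W + 1) * \<epsilon>"
proof -
  have "norm (x - y) \<le> norm (y - (x + \<epsilon> *\<^sub>R w z)) + norm (\<epsilon> *\<^sub>R w z)"
    using norm_triangle_ineq[of "y - (x + \<epsilon> *\<^sub>R w z)" "\<epsilon> *\<^sub>R w z"] by (simp add: norm_minus_commute)
  moreover have "norm (\<epsilon> *\<^sub>R w z) \<le> \<epsilon> * W" using assms(1) bound by simp
  ultimately have "norm (x - y) < \<epsilon> + \<epsilon> * W" using assms(2) by linarith
  then show ?thesis by (simp add: algebra_simps)
qed

text \<open>Counterpart of \<open>near\<close> for the closed support of the kernel, which has to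
  lie in an open set in \<open>dpmoll_parts\<close>; \<open>W + 2\<close> keeps the inequality
  strict.\<close>

lemma near_le:
  assumes "\<epsilon> > 0" "norm (y - (x + \<epsilon> *\<^sub>R w z)) \<le> \<epsilon>"
  shows "norm (x - y) < (W + 2) * \<epsilon>"
proof -
  have "norm (x - y) \<le> norm (y - (x + \<epsilon> *\<^sub>R w z)) + norm (\<epsilon> *\<^sub>R w z)"
    using norm_triangle_ineq[of "y - (x + \<epsilon> *\<^sub>R w z)" "\<epsilon> *\<^sub>R w z"] by (simp add: norm_minus_commute)
  moreover have "norm (\<epsilon> *\<^sub>R w z) \<le> \<epsilon> * W" using assms(1) bound by simp
  ultimately have "norm (x - y) < 2 * \<epsilon> + \<epsilon> * W" using assms by linarith
  then show ?thesis by (simp add: algebra_simps)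
qed

lemma kern_near:
  assumes "\<epsilon> > 0" "x \<notin> ball y ((W + 1) * \<epsilon>)"
  shows "kern \<epsilon> (y - (x + \<epsilon> *\<^sub>R w z)) = 0" "dkern \<epsilon> (y - (x + \<epsilon> *\<^sub>R w z)) e = 0"
proof -
  have "\<epsilon> \<le> norm (y - (x + \<epsilon> *\<^sub>R w z))"
    using near[of \<epsilon> y x z] assms by (force simp: dist_norm norm_minus_commute not_less intro: ccontr)
  then show "kern \<epsilon> (y - (x + \<epsilon> *\<^sub>R w z)) = 0" "dkern \<epsilon> (y - (x + \<epsilon> *\<^sub>R w z)) e = 0"
    using kern_eq_0 dkern_eq_0 assms(1) by blast+
qed

lemma shift_diff:
  assumes "\<epsilon> > 0" "x \<in> ball y ((W + 1) * \<epsilon>)"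
  shows "norm ((y - (x + \<epsilon> *\<^sub>R w x)) - (y - (x + \<epsilon> *\<^sub>R w y))) \<le> \<epsilon> * (L * ((W + 1) * \<epsilon>))"
proof -
  have "norm ((y - (x + \<epsilon> *\<^sub>R w x)) - (y - (x + \<epsilon> *\<^sub>R w y))) = \<epsilon> * norm (w y - w x)"
    using assms(1) by (simp add: algebra_simps flip: scaleR_diff_right)
  also have "norm (w y - w x) \<le> L * norm (y - x)" by (rule lipschitz)
  also have "norm (y - x) \<le> (W + 1) * \<epsilon>" using assms(2) by (simp add: dist_norm)
  finally show ?thesis using assms(1) L_nonneg by (simp add: mult_left_mono)
qed

text \<open>Freezing the shift \<open>w\<close> at \<open>y\<close> and replacing \<open>G\<close> by a constant on a set \<open>H\<close> invariant
  in the direction \<open>e\<close> turns the derivative into an exact zero; the estimate collects the errors.\<close>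

lemma dpmoll_bound:
  fixes G :: "'a \<Rightarrow> 'b::euclidean_space"
  assumes eps: "\<epsilon> > 0" and G: "integrable lborel G"
    and D: "D \<in> sets borel" "\<And>x. x \<notin> D \<Longrightarrow> G x = 0"
    and osc: "\<And>x. x \<in> D \<Longrightarrow> norm (y - (x + \<epsilon> *\<^sub>R w x)) < \<epsilon> \<Longrightarrow> norm (G x - G0) \<le> \<omega>" "\<omega> \<ge> 0" "norm G0 \<le> g"
    and H: "H \<in> sets borel" "\<And>x s. x \<in> H \<Longrightarrow> x + s *\<^sub>R e \<in> H"
    and S: "S \<in> sets borel" "bounded S" "measure lborel S \<le> \<sigma> * \<epsilon> ^ DIM('a)"
      "\<And>x. norm (y - (x + \<epsilon> *\<^sub>R w y)) < \<epsilon> \<Longrightarrow> (x \<in> D) \<noteq> (x \<in> H) \<Longrightarrow> x \<in> S"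
  shows "norm (dpmoll \<epsilon> w e G y) \<le> C * (\<omega> + \<epsilon> * g + \<sigma> * g) / \<epsilon> * norm e"
proof -
  let ?k = "kern_const TYPE('a)" and ?v = "measure lborel (ball (0::'a) (W + 1))" and ?N = "DIM('a)"
  let ?B = "ball y ((W + 1) * \<epsilon>)"
  define a where "a x = dkern \<epsilon> (y - (x + \<epsilon> *\<^sub>R w x)) e" for x
  define b where "b x = dkern \<epsilon> (y - (x + \<epsilon> *\<^sub>R w y)) e" for x
  have g: "g \<ge> 0" using osc(3) norm_ge_zero order_trans by blast
  have k: "?k \<ge> 0" by (rule kern_const)
  note [measurable] = D(1) H(1) S(1)
  have Gm[measurable]: "G \<in> borel_measurable borel" using G by auto
  have am[measurable]: "a \<in> borel_measurable borel" unfolding a_def by measurable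
  have bm[measurable]: "b \<in> borel_measurable borel" unfolding b_def by measurable
  have ab: "\<bar>a x\<bar> \<le> ?k / \<epsilon> ^ (?N + 1) * norm e" "\<bar>b x\<bar> \<le> ?k / \<epsilon> ^ (?N + 1) * norm e" for x
    unfolding a_def b_def by (rule kern_const(3)[OF eps])+
  have a0: "a x = 0" "b x = 0" if "x \<notin> ?B" for x
    using kern_near[OF eps that] by (auto simp: a_def b_def)
  have mB: "measure lborel ?B = \<epsilon> ^ ?N * ?v" using measure_lborel_ball_scale[of \<epsilon> "W + 1"] eps W_nonneg by simp
  have kc: "?k / \<epsilon> ^ (?N + 1) * norm e \<ge> 0" using k eps by simp
  have i0: "integrable lborel (\<lambda>x. a x *\<^sub>R G x)"
    by (rule integrable_bounded_scaleR[OF G _ ab(1)]) measurable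
  have ia: "integrable lborel a" "integrable lborel b"
    by (rule borel_measurable_compact_support_integrable[of _ "?k / \<epsilon> ^ (?N + 1) * norm e" ?B]; use ab a0 in auto)+
  have i1: "integrable lborel (\<lambda>x. a x *\<^sub>R (indicator D x *\<^sub>R G0))"
    using integrable_bounded_scaleR[of lborel "\<lambda>x. a x *\<^sub>R G0" "indicator D" 1] ia(1)
    by (simp add: mult.commute)
  have i2: "integrable lborel (\<lambda>x. b x *\<^sub>R (indicator D x *\<^sub>R G0))"
    using integrable_bounded_scaleR[of lborel "\<lambda>x. b x *\<^sub>R G0" "indicator D" 1] ia(2)
    by (simp add: mult.commute)
  have i3: "integrable lborel (\<lambda>x. b x *\<^sub>R (indicator H x *\<^sub>R G0))"
    using integrable_bounded_scaleR[of lborel "\<lambda>x. b x *\<^sub>R G0" "indicator H" 1] ia(2)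
    by (simp add: mult.commute)
  have eqI: "dpmoll \<epsilon> w e G y = (LINT x|lborel. a x *\<^sub>R G x - a x *\<^sub>R (indicator D x *\<^sub>R G0))
     + (LINT x|lborel. a x *\<^sub>R (indicator D x *\<^sub>R G0) - b x *\<^sub>R (indicator D x *\<^sub>R G0))
     + (LINT x|lborel. b x *\<^sub>R (indicator D x *\<^sub>R G0) - b x *\<^sub>R (indicator H x *\<^sub>R G0))
     + (LINT x|lborel. b x *\<^sub>R (indicator H x *\<^sub>R G0))"
    using i0 i1 i2 i3 by (simp add: dpmoll_def a_def)
  have n1: "norm (LINT x|lborel. a x *\<^sub>R G x - a x *\<^sub>R (indicator D x *\<^sub>R G0)) \<le> (?k / \<epsilon> ^ (?N + 1) * norm e * \<omega>) * measure lborel ?B"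
  proof (rule integral_norm_bound_support)
    fix x
    show "norm (a x *\<^sub>R G x - a x *\<^sub>R (indicator D x *\<^sub>R G0)) \<le> ?k / \<epsilon> ^ (?N + 1) * norm e * \<omega>"
    proof (cases "x \<in> D \<and> norm (y - (x + \<epsilon> *\<^sub>R w x)) < \<epsilon>")
      case True
      then have "norm (a x *\<^sub>R G x - a x *\<^sub>R (indicator D x *\<^sub>R G0)) = \<bar>a x\<bar> * norm (G x - G0)"
        by (simp flip: scaleR_diff_right)
      also have "\<dots> \<le> ?k / \<epsilon> ^ (?N + 1) * norm e * \<omega>"
        using ab(1) osc(1) True kc by (intro mult_mono) auto
      finally show ?thesis .
    next
      case False
      then have "a x *\<^sub>R G x - a x *\<^sub>R (indicator D x *\<^sub>R G0) = 0"
        using D(2)[of x] dkern_eq_0[OF eps, of "y - (x + \<epsilon> *\<^sub>R w x)"] by (auto simp: a_def not_less)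
      then show ?thesis using mult_nonneg_nonneg[OF kc osc(2)] by simp
    qed
  qed (use a0 in auto)
  \<comment> \<open>Freezing the displacement moves the argument of the kernel by
    \<open>O(\<epsilon>^2)\<close>. This cancels the two powers of \<epsilon> that the Lipschitz
    constant of \<open>dkern\<close> costs beyond the volume, so the error is of order
    \<open>g\<close>, without a factor \<open>1/\<epsilon>\<close>.\<close>
  have n2: "norm (LINT x|lborel. a x *\<^sub>R (indicator D x *\<^sub>R G0) - b x *\<^sub>R (indicator D x *\<^sub>R G0)) \<le>
      (?k / \<epsilon> ^ (?N + 2) * (\<epsilon> * (L * ((W + 1) * \<epsilon>))) * norm e * g) * measure lborel ?B"
  proof (rule integral_norm_bound_support)
    fix x
    have nn: "?k / \<epsilon> ^ (?N + 2) * (\<epsilon> * (L * ((W + 1) * \<epsilon>))) * norm e \<ge> 0"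
      using k eps L_nonneg W_nonneg by simp
    show "norm (a x *\<^sub>R (indicator D x *\<^sub>R G0) - b x *\<^sub>R (indicator D x *\<^sub>R G0)) \<le> ?k / \<epsilon> ^ (?N + 2) * (\<epsilon> * (L * ((W + 1) * \<epsilon>))) * norm e * g"
    proof (cases "x \<in> ?B")
      case True
      have "\<bar>a x - b x\<bar> \<le> ?k / \<epsilon> ^ (?N + 2) * norm ((y - (x + \<epsilon> *\<^sub>R w x)) - (y - (x + \<epsilon> *\<^sub>R w y))) * norm e"
        unfolding a_def b_def by (rule kern_const(5)[OF eps])
      also have "\<dots> \<le> ?k / \<epsilon> ^ (?N + 2) * (\<epsilon> * (L * ((W + 1) * \<epsilon>))) * norm e"
        using k eps by (intro mult_right_mono mult_left_mono shift_diff True) auto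
      finally have "\<bar>a x - b x\<bar> * norm (indicator D x *\<^sub>R G0) \<le> ?k / \<epsilon> ^ (?N + 2) * (\<epsilon> * (L * ((W + 1) * \<epsilon>))) * norm e * g"
        using osc(3) g nn by (intro mult_mono) (auto simp: indicator_def)
      then show ?thesis by (simp only: scaleR_diff_left[symmetric] norm_scaleR)
    qed (use a0 nn g in simp)
  qed (use a0 in auto)
  have n3: "norm (LINT x|lborel. b x *\<^sub>R (indicator D x *\<^sub>R G0) - b x *\<^sub>R (indicator H x *\<^sub>R G0)) \<le>
      (?k / \<epsilon> ^ (?N + 1) * norm e * g) * measure lborel S"
  proof (rule integral_norm_bound_support)
    fix x
    have "norm (b x *\<^sub>R G0) \<le> ?k / \<epsilon> ^ (?N + 1) * norm e * g"
      unfolding norm_scaleR using ab(2) osc(3) kc g by (intro mult_mono) auto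
    then show "norm (b x *\<^sub>R (indicator D x *\<^sub>R G0) - b x *\<^sub>R (indicator H x *\<^sub>R G0)) \<le> ?k / \<epsilon> ^ (?N + 1) * norm e * g"
      using mult_nonneg_nonneg[OF kc g] by (auto simp: indicator_def)
  next
    fix x assume "x \<notin> S"
    then have "norm (y - (x + \<epsilon> *\<^sub>R w y)) \<ge> \<epsilon> \<or> (x \<in> D) = (x \<in> H)" using S(4)[of x] by force
    then show "b x *\<^sub>R (indicator D x *\<^sub>R G0) - b x *\<^sub>R (indicator H x *\<^sub>R G0) = 0"
      using dkern_eq_0[OF eps, of "y - (x + \<epsilon> *\<^sub>R w y)"] by (auto simp: b_def indicator_def)
  qed (use S in auto)
  have n4: "(LINT x|lborel. b x *\<^sub>R (indicator H x *\<^sub>R G0)) = 0"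
  proof -
    have "(LINT x|lborel. indicator H x *\<^sub>R b x) = 0"
      unfolding b_def
    proof (rule integral_directional_derivative_eq_0[where f = "\<lambda>x. - kern \<epsilon> (y - (x + \<epsilon> *\<^sub>R w y))" and S = ?B])
      show "((\<lambda>x. - kern \<epsilon> (y - (x + \<epsilon> *\<^sub>R w y))) has_derivative dkern \<epsilon> (y - (x + \<epsilon> *\<^sub>R w y))) (at x)" for x
      proof -
        have "((\<lambda>x. kern \<epsilon> (y - (x + \<epsilon> *\<^sub>R w y))) has_derivative (\<lambda>h. dkern \<epsilon> (y - (x + \<epsilon> *\<^sub>R w y)) (- h))) (at x)"
          by (rule has_derivative_compose[OF _ kern_has_derivative]) (auto intro!: derivative_eq_intros)
        then show ?thesis
          using has_derivative_minus by (fastforce simp: linear_neg[OF dkern_linear])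
      qed
      show "continuous_on UNIV (\<lambda>x. dkern \<epsilon> (y - (x + \<epsilon> *\<^sub>R w y)) e)"
        by (rule continuous_on_compose2[OF dkern_continuous]) (auto intro!: continuous_intros)
    qed (use H kern_near[OF eps] in auto)
    then have "(LINT x|lborel. (indicator H x *\<^sub>R b x) *\<^sub>R G0) = 0"
      using integrable_bounded_scaleR[of lborel b "indicator H" 1] ia(2) by simp
    then show ?thesis by (simp add: mult.commute)
  qed
  let ?Z = "\<epsilon> * norm e"
  have p: "\<epsilon> ^ ?N > 0" using eps by simp
  have "norm (dpmoll \<epsilon> w e G y) \<le> (?k / \<epsilon> ^ (?N + 1) * norm e * \<omega>) * measure lborel ?B +
      (?k / \<epsilon> ^ (?N + 2) * (\<epsilon> * (L * ((W + 1) * \<epsilon>))) * norm e * g) * measure lborel ?B +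
      (?k / \<epsilon> ^ (?N + 1) * norm e * g) * measure lborel S"
    unfolding eqI n4 add_0_right
    by (rule norm_triangle_le, rule add_mono[OF norm_triangle_le[OF add_mono[OF n1 n2]] n3])
  also have "(?k / \<epsilon> ^ (?N + 1) * norm e * \<omega>) * measure lborel ?B = ?k * ?v * (\<omega> / \<epsilon> * norm e)"
    unfolding mB using eps by simp
  also have "(?k / \<epsilon> ^ (?N + 2) * (\<epsilon> * (L * ((W + 1) * \<epsilon>))) * norm e * g) * measure lborel ?B = ?k * ?v * (L * (W + 1)) * (\<epsilon> * g / \<epsilon> * norm e)"
    unfolding mB using eps by (simp add: field_simps)
  also have "(?k / \<epsilon> ^ (?N + 1) * norm e * g) * measure lborel S \<le> ?k * (\<sigma> * g / \<epsilon> * norm e)"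
  proof -
    have "(?k / \<epsilon> ^ (?N + 1) * norm e * g) * measure lborel S \<le> (?k / \<epsilon> ^ (?N + 1) * norm e * g) * (\<sigma> * \<epsilon> ^ ?N)"
      using S(3) mult_nonneg_nonneg[OF kc g] by (intro mult_left_mono) auto
    then show ?thesis using eps by (simp add: field_simps)
  qed
  also have "?k * ?v * (\<omega> / \<epsilon> * norm e) + ?k * ?v * (L * (W + 1)) * (\<epsilon> * g / \<epsilon> * norm e) + ?k * (\<sigma> * g / \<epsilon> * norm e)
     \<le> C * (\<omega> / \<epsilon> * norm e) + C * (\<epsilon> * g / \<epsilon> * norm e) + C * (\<sigma> * g / \<epsilon> * norm e)"
  proof (intro add_mono mult_right_mono C_ge)
    have "\<sigma> \<ge> 0" using S(3) p measure_nonneg[of lborel S] by (metis order_trans zero_le_mult_iff not_less)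
    then show "0 \<le> \<sigma> * g / \<epsilon> * norm e" using g eps by simp
  qed (use eps g osc(2) in auto)
  also have "\<dots> = C * (\<omega> + \<epsilon> * g + \<sigma> * g) / \<epsilon> * norm e" using eps by (simp add: field_simps)
  finally show ?thesis by simp
qed

lemma dpmoll_bound_local:
  fixes G :: "'a \<Rightarrow> 'b::euclidean_space"
  assumes "\<epsilon> > 0" "integrable lborel G"
    "\<And>x. norm (y - (x + \<epsilon> *\<^sub>R w x)) < \<epsilon> \<Longrightarrow> norm (G x - G0) \<le> \<omega>" "\<omega> \<ge> 0" "norm G0 \<le> g"
  shows "norm (dpmoll \<epsilon> w e G y) \<le> C * (\<omega> + \<epsilon> * g) / \<epsilon> * norm e"
  using dpmoll_bound[of \<epsilon> G UNIV y G0 \<omega> g UNIV e "{}" 0] assms by simp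

lemma pmoll_bound:
  fixes G :: "'a \<Rightarrow> 'b::euclidean_space"
  assumes eps: "\<epsilon> > 0" and G: "integrable lborel G"
    and osc: "\<And>x. norm (y - (x + \<epsilon> *\<^sub>R w x)) < \<epsilon> \<Longrightarrow> norm (G x - G0) \<le> \<omega>" "\<omega> \<ge> 0" "norm G0 \<le> g"
  shows "norm (pmoll \<epsilon> w G y - G0) \<le> C * (\<omega> + \<epsilon> * g)"
proof -
  let ?k = "kern_const TYPE('a)" and ?v = "measure lborel (ball (0::'a) (W + 1))" and ?N = "DIM('a)"
  let ?B = "ball y ((W + 1) * \<epsilon>)"
  define a where "a x = kern \<epsilon> (y - (x + \<epsilon> *\<^sub>R w x))" for x
  define b where "b x = kern \<epsilon> (y - (x + \<epsilon> *\<^sub>R w y))" for x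
  have g: "g \<ge> 0" using osc(3) norm_ge_zero order_trans by blast
  have k: "?k \<ge> 0" by (rule kern_const)
  have Gm[measurable]: "G \<in> borel_measurable borel" using G by auto
  have am[measurable]: "a \<in> borel_measurable borel" unfolding a_def by measurable
  have bm[measurable]: "b \<in> borel_measurable borel" unfolding b_def by measurable
  have ab: "\<bar>a x\<bar> \<le> ?k / \<epsilon> ^ ?N" "\<bar>b x\<bar> \<le> ?k / \<epsilon> ^ ?N" for x
    unfolding a_def b_def by (rule kern_const(2)[OF eps])+
  have a0: "a x = 0" "b x = 0" if "x \<notin> ?B" for x
    using kern_near[OF eps that] by (auto simp: a_def b_def)
  have mB: "measure lborel ?B = \<epsilon> ^ ?N * ?v" using measure_lborel_ball_scale[of \<epsilon> "W + 1"] eps W_nonneg by simp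
  have kc: "?k / \<epsilon> ^ ?N \<ge> 0" using k eps by simp
  have i0: "integrable lborel (\<lambda>x. a x *\<^sub>R G x)"
    by (rule integrable_bounded_scaleR[OF G _ ab(1)]) measurable
  have ia: "integrable lborel a" and i2: "integrable lborel b"
    by (rule borel_measurable_compact_support_integrable[of _ "?k / \<epsilon> ^ ?N" ?B]; use ab a0 in auto)+
  have i1: "integrable lborel (\<lambda>x. a x *\<^sub>R G0)" using ia by simp
  have "(LINT x|lborel. b x) = 1"
    using integral_kern[OF eps, of "y - \<epsilon> *\<^sub>R w y"] by (simp add: b_def algebra_simps)
  then have i3: "(LINT x|lborel. b x *\<^sub>R G0) = G0" using i2 by simp
  have eqI: "pmoll \<epsilon> w G y - G0 = (LINT x|lborel. a x *\<^sub>R G x - a x *\<^sub>R G0) + (LINT x|lborel. a x *\<^sub>R G0 - b x *\<^sub>R G0)"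
    using i0 i1 i2 by (simp add: pmoll_def a_def i3)
  have n1: "norm (LINT x|lborel. a x *\<^sub>R G x - a x *\<^sub>R G0) \<le> (?k / \<epsilon> ^ ?N * \<omega>) * measure lborel ?B"
  proof (rule integral_norm_bound_support)
    fix x
    show "norm (a x *\<^sub>R G x - a x *\<^sub>R G0) \<le> ?k / \<epsilon> ^ ?N * \<omega>"
    proof (cases "norm (y - (x + \<epsilon> *\<^sub>R w x)) < \<epsilon>")
      case True
      then have "norm (a x *\<^sub>R G x - a x *\<^sub>R G0) = \<bar>a x\<bar> * norm (G x - G0)"
        by (simp flip: scaleR_diff_right)
      also have "\<dots> \<le> ?k / \<epsilon> ^ ?N * \<omega>"
        using ab(1) osc(1) True kc by (intro mult_mono) auto
      finally show ?thesis .
    qed (use kern_eq_0[OF eps, of "y - (x + \<epsilon> *\<^sub>R w x)"] mult_nonneg_nonneg[OF kc osc(2)] in \<open>auto simp: a_def not_less\<close>)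
  qed (use a0 in auto)
  have n2: "norm (LINT x|lborel. a x *\<^sub>R G0 - b x *\<^sub>R G0) \<le>
      (?k / \<epsilon> ^ (?N + 1) * (\<epsilon> * (L * ((W + 1) * \<epsilon>))) * g) * measure lborel ?B"
  proof (rule integral_norm_bound_support)
    fix x
    have nn: "?k / \<epsilon> ^ (?N + 1) * (\<epsilon> * (L * ((W + 1) * \<epsilon>))) \<ge> 0"
      using k eps L_nonneg W_nonneg by simp
    show "norm (a x *\<^sub>R G0 - b x *\<^sub>R G0) \<le> ?k / \<epsilon> ^ (?N + 1) * (\<epsilon> * (L * ((W + 1) * \<epsilon>))) * g"
    proof (cases "x \<in> ?B")
      case True
      have "\<bar>a x - b x\<bar> \<le> ?k / \<epsilon> ^ (?N + 1) * norm ((y - (x + \<epsilon> *\<^sub>R w x)) - (y - (x + \<epsilon> *\<^sub>R w y)))"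
        unfolding a_def b_def by (rule kern_const(4)[OF eps])
      also have "\<dots> \<le> ?k / \<epsilon> ^ (?N + 1) * (\<epsilon> * (L * ((W + 1) * \<epsilon>)))"
        using k eps by (intro mult_left_mono shift_diff True) auto
      finally have "\<bar>a x - b x\<bar> * norm G0 \<le> ?k / \<epsilon> ^ (?N + 1) * (\<epsilon> * (L * ((W + 1) * \<epsilon>))) * g"
        using osc(3) g nn by (intro mult_mono) auto
      then show ?thesis by (simp only: scaleR_diff_left[symmetric] norm_scaleR)
    qed (use a0 nn g in simp)
  qed (use a0 in auto)
  have "norm (pmoll \<epsilon> w G y - G0) \<le> (?k / \<epsilon> ^ ?N * \<omega>) * measure lborel ?B +
      (?k / \<epsilon> ^ (?N + 1) * (\<epsilon> * (L * ((W + 1) * \<epsilon>))) * g) * measure lborel ?B"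
    unfolding eqI by (rule norm_triangle_le[OF add_mono[OF n1 n2]])
  also have "(?k / \<epsilon> ^ ?N * \<omega>) * measure lborel ?B = ?k * ?v * \<omega>"
    unfolding mB using eps by simp
  also have "(?k / \<epsilon> ^ (?N + 1) * (\<epsilon> * (L * ((W + 1) * \<epsilon>))) * g) * measure lborel ?B = ?k * ?v * (L * (W + 1)) * (\<epsilon> * g)"
    unfolding mB using eps by (simp add: field_simps)
  also have "?k * ?v * \<omega> + ?k * ?v * (L * (W + 1)) * (\<epsilon> * g) \<le> C * \<omega> + C * (\<epsilon> * g)"
    using C_ge eps g osc(2) by (intro add_mono mult_right_mono) auto
  finally show ?thesis by (simp add: distrib_left)
qed

text \<open>Integration by parts. The derivative of \<open>x \<mapsto> kern \<epsilon> (y - (x +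
  \<epsilon> *\<^sub>R w x))\<close> in direction \<open>e\<close> is \<open>- dkern\<close> in the
  direction \<open>e + \<epsilon> *\<^sub>R w' x e\<close>, so moving the derivative from the kernel
  to \<open>G\<close> leaves a correction with \<open>w' x e\<close>; expanding it in the basis
  makes it a combination of terms \<open>dpmoll\<close>. Differentiability of \<open>G\<close> is
  asked for only on a neighbourhood \<open>N\<close> of the support of the kernel.\<close>

lemma dpmoll_parts:
  fixes G :: "'a \<Rightarrow> 'b::euclidean_space"
  assumes eps: "\<epsilon> > 0" and G: "integrable lborel G"
    and N: "open N" "\<And>x. norm (y - (x + \<epsilon> *\<^sub>R w x)) \<le> \<epsilon> \<Longrightarrow> x \<in> N"
    and G': "\<And>x. x \<in> N \<Longrightarrow> (G has_derivative G' x) (at x)"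
    and cont: "continuous_on N (\<lambda>x. G' x e)"
    and G1: "integrable lborel G1" "\<And>x. norm (y - (x + \<epsilon> *\<^sub>R w x)) < \<epsilon> \<Longrightarrow> G1 x = G' x e"
  shows "dpmoll \<epsilon> w e G y = pmoll \<epsilon> w G1 y -
    \<epsilon> *\<^sub>R (\<Sum>b\<in>Basis. dpmoll \<epsilon> w b (\<lambda>x. (w' x e \<bullet> b) *\<^sub>R G x) y)"
proof -
  define \<Phi> where "\<Phi> x = y - (x + \<epsilon> *\<^sub>R w x)" for x
  define A where "A = {x. norm (\<Phi> x) \<le> \<epsilon>}"
  have sub: "- N \<subseteq> - A" using N(2) by (auto simp: A_def \<Phi>_def)
  have k1: "kern \<epsilon> (\<Phi> x) = 0" "dkern \<epsilon> (\<Phi> x) h = 0" if "\<not> norm (\<Phi> x) < \<epsilon>" for x h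
    using kern_eq_0[OF eps, of "\<Phi> x"] dkern_eq_0[OF eps, of "\<Phi> x" h] that by auto
  then have k0: "kern \<epsilon> (\<Phi> x) = 0" "dkern \<epsilon> (\<Phi> x) h = 0" if "x \<notin> A" for x h
    using that by (auto simp: A_def)
  have \<Phi>': "(\<Phi> has_derivative (\<lambda>h. - (h + \<epsilon> *\<^sub>R w' x h))) (at x)" for x
    unfolding \<Phi>_def by (auto intro!: derivative_eq_intros deriv)
  have \<Phi>c: "continuous_on UNIV \<Phi>" unfolding \<Phi>_def by (intro continuous_intros continuous)
  have Ac: "closed A" unfolding A_def by (intro closed_Collect_le continuous_intros \<Phi>c)
  have [measurable]: "\<Phi> \<in> borel_measurable borel" using \<Phi>c by (rule borel_measurable_continuous_onI)
  \<comment> \<open>\<open>G\<close> is differentiable on \<open>N\<close> only. The product with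
    the kernel vanishes off the closed set \<open>A\<close>, and the open sets \<open>N\<close> and
    \<open>- A\<close> cover the space, so its derivative can be continued by 0.\<close>
  define f' where "f' x h = (if x \<in> N then kern \<epsilon> (\<Phi> x) *\<^sub>R G' x h - dkern \<epsilon> (\<Phi> x) (h + \<epsilon> *\<^sub>R w' x h) *\<^sub>R G x else 0)" for x h
  have der: "((\<lambda>x. kern \<epsilon> (\<Phi> x) *\<^sub>R G x) has_derivative f' x) (at x)" for x
  proof (cases "x \<in> N")
    case True
    have "((\<lambda>x. kern \<epsilon> (\<Phi> x)) has_derivative (\<lambda>h. dkern \<epsilon> (\<Phi> x) (- (h + \<epsilon> *\<^sub>R w' x h)))) (at x)"
      by (rule has_derivative_compose[OF \<Phi>' kern_has_derivative])
    from has_derivative_scaleR[OF this G'[OF True]] show ?thesis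
      using True by (simp add: f'_def[abs_def] linear_neg[OF dkern_linear] del: minus_add_distrib)
  next
    case False
    have "((\<lambda>x. kern \<epsilon> (\<Phi> x) *\<^sub>R G x) has_derivative (\<lambda>_. 0)) (at x)"
      by (rule has_derivative_transform_within_open[where f = "\<lambda>_. 0" and s = "- A"])
         (use False sub k0 Ac in auto)
    then show ?thesis using False by (simp add: f'_def[abs_def])
  qed
  have Gc: "continuous_on N G"
    using G' by (auto intro!: continuous_at_imp_continuous_on has_derivative_continuous)
  have dk: "dkern \<epsilon> (\<Phi> x) h = (\<Sum>b\<in>Basis. (h \<bullet> b) * dkern \<epsilon> (\<Phi> x) b)" for x h
    by (subst (1) euclidean_representation[of h, symmetric])
       (simp add: linear_sum[OF dkern_linear] linear_scale[OF dkern_linear] del: euclidean_representation)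
  have dkc: "continuous_on UNIV (\<lambda>x. dkern \<epsilon> (\<Phi> x) b)" for b
    by (rule continuous_on_compose2[OF dkern_continuous \<Phi>c]) auto
  have kc: "continuous_on UNIV (\<lambda>x. kern \<epsilon> (\<Phi> x))"
    by (rule continuous_on_compose2[OF kern_continuous \<Phi>c]) auto
  have "continuous_on (N \<union> - A) (\<lambda>x. f' x e)"
  proof (rule continuous_on_open_Un)
    have "continuous_on N (\<lambda>x. kern \<epsilon> (\<Phi> x) *\<^sub>R G' x e - (\<Sum>b\<in>Basis. ((e + \<epsilon> *\<^sub>R w' x e) \<bullet> b) * dkern \<epsilon> (\<Phi> x) b) *\<^sub>R G x)"
      by (intro continuous_intros cont Gc continuous_on_subset[OF dkc] continuous_on_subset[OF kc]
          continuous_on_subset[OF deriv_continuous]) auto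
    then show "continuous_on N (\<lambda>x. f' x e)"
      by (rule continuous_on_eq) (simp add: f'_def dk[of _ "e + _"])
    show "continuous_on (- A) (\<lambda>x. f' x e)"
      by (rule continuous_on_eq[where f = "\<lambda>_. 0"]) (auto simp: f'_def k0)
  qed (use N(1) Ac in auto)
  moreover have "N \<union> - A = UNIV" using sub by blast
  ultimately have cont': "continuous_on UNIV (\<lambda>x. f' x e)" by simp
  have int0: "(LINT x|lborel. indicator UNIV x *\<^sub>R f' x e) = 0"
    by (rule integral_directional_derivative_eq_0[OF der cont', where S = "ball y ((W + 1) * \<epsilon>)"]) (use kern_near[OF eps] in \<open>auto simp: \<Phi>_def\<close>)
  have feq: "f' x e = kern \<epsilon> (\<Phi> x) *\<^sub>R G1 x - dkern \<epsilon> (\<Phi> x) e *\<^sub>R G x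
     - \<epsilon> *\<^sub>R (\<Sum>b\<in>Basis. dkern \<epsilon> (\<Phi> x) b *\<^sub>R ((w' x e \<bullet> b) *\<^sub>R G x))" for x
  proof (cases "norm (\<Phi> x) < \<epsilon>")
    case True
    then have xN: "x \<in> N" using N(2) by (simp add: \<Phi>_def)
    have "dkern \<epsilon> (\<Phi> x) (e + \<epsilon> *\<^sub>R w' x e) = dkern \<epsilon> (\<Phi> x) e + \<epsilon> * (\<Sum>b\<in>Basis. dkern \<epsilon> (\<Phi> x) b * (w' x e \<bullet> b))"
      by (simp add: linear_add[OF dkern_linear] linear_scale[OF dkern_linear] dk[of x "w' x e"] mult.commute)
    then show ?thesis using xN G1(2)[OF True[unfolded \<Phi>_def]]
      by (simp add: f'_def scaleR_add_left scaleR_sum_left sum_distrib_left scaleR_right.sum algebra_simps)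
  next
    case False
    then show ?thesis by (simp add: f'_def k1)
  qed
  note k1 = kern_const(2)[OF eps] and k2 = kern_const(3)[OF eps]
  have i1: "integrable lborel (\<lambda>x. kern \<epsilon> (\<Phi> x) *\<^sub>R G1 x)"
    by (rule integrable_bounded_scaleR[OF G1(1) _ k1]) measurable
  have i2: "integrable lborel (\<lambda>x. dkern \<epsilon> (\<Phi> x) b *\<^sub>R G x)" for b
    by (rule integrable_bounded_scaleR[OF G _ k2]) measurable
  have i3: "integrable lborel (\<lambda>x. dkern \<epsilon> (\<Phi> x) b *\<^sub>R ((w' x e \<bullet> b) *\<^sub>R G x))" if "b \<in> Basis" for b
  proof -
    have "\<bar>w' x e \<bullet> b\<bar> \<le> L * norm e" for x
      using Basis_le_norm[OF that, of "w' x e"] deriv_bound[of x e] by linarith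
    then have "integrable lborel (\<lambda>x. (w' x e \<bullet> b) *\<^sub>R G x)"
      by (intro integrable_bounded_scaleR[OF G]) auto
    then show ?thesis by (rule integrable_bounded_scaleR[OF _ _ k2]) measurable
  qed
  have i4: "integrable lborel (\<lambda>x. \<Sum>b\<in>Basis. dkern \<epsilon> (\<Phi> x) b *\<^sub>R ((w' x e \<bullet> b) *\<^sub>R G x))"
    using i3 by (rule Bochner_Integration.integrable_sum)
  have i5: "integrable lborel (\<lambda>x. \<epsilon> *\<^sub>R (\<Sum>b\<in>Basis. dkern \<epsilon> (\<Phi> x) b *\<^sub>R ((w' x e \<bullet> b) *\<^sub>R G x)))"
    using i4 by (intro integrable_scaleR_right)
  have "0 = (LINT x|lborel. kern \<epsilon> (\<Phi> x) *\<^sub>R G1 x - dkern \<epsilon> (\<Phi> x) e *\<^sub>R G x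
     - \<epsilon> *\<^sub>R (\<Sum>b\<in>Basis. dkern \<epsilon> (\<Phi> x) b *\<^sub>R ((w' x e \<bullet> b) *\<^sub>R G x)))"
    using int0 unfolding feq by simp
  also have "\<dots> = (LINT x|lborel. kern \<epsilon> (\<Phi> x) *\<^sub>R G1 x) - (LINT x|lborel. dkern \<epsilon> (\<Phi> x) e *\<^sub>R G x)
     - \<epsilon> *\<^sub>R (LINT x|lborel. (\<Sum>b\<in>Basis. dkern \<epsilon> (\<Phi> x) b *\<^sub>R ((w' x e \<bullet> b) *\<^sub>R G x)))"
    by (subst Bochner_Integration.integral_diff[OF Bochner_Integration.integrable_diff[OF i1 i2] i5],
        subst Bochner_Integration.integral_diff[OF i1 i2], subst integral_scaleR_right, rule refl)
  also have "(LINT x|lborel. (\<Sum>b\<in>Basis. dkern \<epsilon> (\<Phi> x) b *\<^sub>R ((w' x e \<bullet> b) *\<^sub>R G x))) =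
     (\<Sum>b\<in>Basis. (LINT x|lborel. dkern \<epsilon> (\<Phi> x) b *\<^sub>R ((w' x e \<bullet> b) *\<^sub>R G x)))"
    using i3 by (rule Bochner_Integration.integral_sum)
  finally have fin: "0 = (LINT x|lborel. kern \<epsilon> (\<Phi> x) *\<^sub>R G1 x) - (LINT x|lborel. dkern \<epsilon> (\<Phi> x) e *\<^sub>R G x)
     - \<epsilon> *\<^sub>R (\<Sum>b\<in>Basis. (LINT x|lborel. dkern \<epsilon> (\<Phi> x) b *\<^sub>R ((w' x e \<bullet> b) *\<^sub>R G x)))" .
  have alg: "0 = a - b - c \<Longrightarrow> b = a - c" for a b c :: 'b by (simp add: algebra_simps)
  show ?thesis
    unfolding pmoll_def dpmoll_def \<Phi>_def[symmetric] by (rule alg[OF fin])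
qed

text \<open>The second summand pays for the correction term of \<open>dpmoll_parts\<close>, with one
  contribution for each basis vector.\<close>

definition C' :: real where
  "C' = C * (1 + real DIM('a) * (L * (W + 2) + 2 * L))"

lemma C'_nonneg: "C' \<ge> 0" unfolding C'_def using C_ge(4) W_nonneg L_nonneg by simp

text \<open>By \<open>dpmoll_parts\<close> the derivative is a mollification of \<open>G'\<close>,
  close to \<open>G' y e\<close>, plus \<epsilon> times derivatives of mollifications of
  \<open>(w' x e \<bullet> b) *\<^sub>R G x\<close>. These are bounded by a multiple of
  \<open>(\<omega> + \<epsilon> * g) / \<epsilon>\<close>, because the mollified functions oscillate
  little, and the factor \<epsilon> removes the denominator.\<close>

lemma dpmoll_converges:
  fixes G :: "'a \<Rightarrow> 'b::euclidean_space"
  assumes eps: "\<epsilon> > 0" and G: "integrable lborel G"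
    and N: "open N" "\<And>x. norm (y - (x + \<epsilon> *\<^sub>R w x)) \<le> \<epsilon> \<Longrightarrow> x \<in> N"
    and G': "\<And>x. x \<in> N \<Longrightarrow> (G has_derivative G' x) (at x)"
    and cont: "continuous_on N (\<lambda>x. G' x e)"
    and e: "norm e \<le> 1"
    and osc: "\<And>x. norm (y - (x + \<epsilon> *\<^sub>R w x)) < \<epsilon> \<Longrightarrow> norm (G x - G y) \<le> \<omega>" "norm (G y) \<le> g"
    and om: "\<omega> \<ge> 0"
    and osc': "\<And>x. norm (y - (x + \<epsilon> *\<^sub>R w x)) < \<epsilon> \<Longrightarrow> norm (G' x e - G' y e) \<le> \<omega>" "norm (G' y e) \<le> g"
  shows "norm (dpmoll \<epsilon> w e G y - G' y e) \<le> C' * (\<omega> + \<epsilon> * g)"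
proof -
  define B where "B = {x. norm (y - (x + \<epsilon> *\<^sub>R w x)) < \<epsilon>}"
  define G1 where "G1 x = indicator B x *\<^sub>R G' x e" for x
  have g: "g \<ge> 0" using osc(2) norm_ge_zero order_trans by blast
  have nearB: "x \<in> ball y ((W + 2) * \<epsilon>)" if "norm (y - (x + \<epsilon> *\<^sub>R w x)) < \<epsilon>" for x
  proof -
    have "norm (x - y) < (W + 1) * \<epsilon>" by (rule near[OF eps that])
    also have "\<dots> \<le> (W + 2) * \<epsilon>" using eps by simp
    finally show ?thesis by (simp add: dist_norm norm_minus_commute)
  qed
  have Bo: "open B" unfolding B_def by (intro open_Collect_less continuous_intros continuous)
  have BN: "B \<subseteq> N" using N(2) by (auto simp: B_def)
  have G1i: "integrable lborel G1"
  proof (rule borel_measurable_compact_support_integrable)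
    show "G1 \<in> borel_measurable borel"
      unfolding G1_def[abs_def] by (rule borel_measurable_continuous_on_indicator) (use Bo continuous_on_subset[OF cont BN] in auto)
    show "norm (G1 x) \<le> \<omega> + g" for x
      using osc'(1)[of x] osc'(2) norm_triangle_sub[of "G' x e" "G' y e"] om g by (auto simp: G1_def B_def indicator_def)
    show "G1 x = 0" if "x \<notin> ball y ((W + 2) * \<epsilon>)" for x using that nearB[of x] by (auto simp: G1_def B_def indicator_def)
  qed auto
  have eq: "dpmoll \<epsilon> w e G y - G' y e = (pmoll \<epsilon> w G1 y - G' y e) -
    \<epsilon> *\<^sub>R (\<Sum>b\<in>Basis. dpmoll \<epsilon> w b (\<lambda>x. (w' x e \<bullet> b) *\<^sub>R G x) y)"
    using dpmoll_parts[OF eps G N G' cont G1i] by (simp add: G1_def B_def)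
  have "norm (pmoll \<epsilon> w G1 y - G' y e) \<le> C * (\<omega> + \<epsilon> * g)"
    by (rule pmoll_bound[OF eps G1i]) (use osc' om in \<open>auto simp: G1_def B_def\<close>)
  moreover have "norm (\<epsilon> *\<^sub>R (\<Sum>b\<in>Basis. dpmoll \<epsilon> w b (\<lambda>x. (w' x e \<bullet> b) *\<^sub>R G x) y)) \<le>
     C * (real DIM('a) * (L * (W + 2) + 2 * L)) * (\<omega> + \<epsilon> * g)"
  proof -
    have "norm (dpmoll \<epsilon> w b (\<lambda>x. (w' x e \<bullet> b) *\<^sub>R G x) y) \<le>
       C * ((L * \<omega> + L * ((W + 2) * \<epsilon>) * g) + \<epsilon> * (L * g)) / \<epsilon>" if b: "b \<in> Basis" for b
    proof -
      have wb: "\<bar>w' x e \<bullet> b\<bar> \<le> L" for x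
        using Basis_le_norm[OF b, of "w' x e"] deriv_bound[of x e] mult_left_mono[OF e L_nonneg] by simp
      have i: "integrable lborel (\<lambda>x. (w' x e \<bullet> b) *\<^sub>R G x)"
        by (rule integrable_bounded_scaleR[OF G _ wb]) auto
      have "norm (dpmoll \<epsilon> w b (\<lambda>x. (w' x e \<bullet> b) *\<^sub>R G x) y) \<le>
         C * ((L * \<omega> + L * ((W + 2) * \<epsilon>) * g) + \<epsilon> * (L * g)) / \<epsilon> * norm b"
      proof (rule dpmoll_bound_local[OF eps i])
        fix x assume x: "norm (y - (x + \<epsilon> *\<^sub>R w x)) < \<epsilon>"
        have "norm ((w' x e \<bullet> b) *\<^sub>R G x - (w' y e \<bullet> b) *\<^sub>R G y) =
           norm ((w' x e \<bullet> b) *\<^sub>R (G x - G y) + ((w' x e - w' y e) \<bullet> b) *\<^sub>R G y)"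
          by (simp add: algebra_simps inner_diff_left)
        also have "\<dots> \<le> \<bar>w' x e \<bullet> b\<bar> * norm (G x - G y) + \<bar>(w' x e - w' y e) \<bullet> b\<bar> * norm (G y)"
          by (rule norm_triangle_le) simp
        also have "\<dots> \<le> L * \<omega> + (L * ((W + 2) * \<epsilon>)) * g"
        proof (intro add_mono mult_mono wb osc x)
          have "\<bar>(w' x e - w' y e) \<bullet> b\<bar> \<le> norm (w' x e - w' y e)" by (rule Basis_le_norm[OF b])
          also have "\<dots> \<le> L * norm (x - y) * norm e" by (rule deriv_lipschitz)
          also have "\<dots> \<le> L * norm (x - y)" using e L_nonneg by (simp add: mult_left_le)
          also have "\<dots> \<le> L * ((W + 2) * \<epsilon>)"
            using nearB[OF x] L_nonneg by (intro mult_left_mono) (auto simp: dist_norm norm_minus_commute)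
          finally show "\<bar>(w' x e - w' y e) \<bullet> b\<bar> \<le> L * ((W + 2) * \<epsilon>)" .
        qed (use om g L_nonneg W_nonneg eps in auto)
        finally show "norm ((w' x e \<bullet> b) *\<^sub>R G x - (w' y e \<bullet> b) *\<^sub>R G y) \<le> L * \<omega> + L * ((W + 2) * \<epsilon>) * g" .
      next
        show "norm ((w' y e \<bullet> b) *\<^sub>R G y) \<le> L * g"
          unfolding norm_scaleR real_norm_def by (intro mult_mono wb osc) (use L_nonneg in auto)
      qed (use om g L_nonneg W_nonneg eps in auto)
      then show ?thesis using b by simp
    qed
    then have "norm (\<Sum>b\<in>Basis. dpmoll \<epsilon> w b (\<lambda>x. (w' x e \<bullet> b) *\<^sub>R G x) y) \<le>
        (\<Sum>b\<in>(Basis::'a set). C * ((L * \<omega> + L * ((W + 2) * \<epsilon>) * g) + \<epsilon> * (L * g)) / \<epsilon>)"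
      by (rule sum_norm_le)
    then have "\<epsilon> * norm (\<Sum>b\<in>Basis. dpmoll \<epsilon> w b (\<lambda>x. (w' x e \<bullet> b) *\<^sub>R G x) y) \<le>
        \<epsilon> * (real DIM('a) * (C * ((L * \<omega> + L * ((W + 2) * \<epsilon>) * g) + \<epsilon> * (L * g)) / \<epsilon>))"
      using eps by (intro mult_left_mono) auto
    also have "\<dots> = C * real DIM('a) * (L * \<omega> + (L * (W + 2) + L) * (\<epsilon> * g))"
      using eps by (simp add: field_simps)
    also have "\<dots> \<le> C * real DIM('a) * ((L * (W + 2) + 2 * L) * \<omega> + (L * (W + 2) + 2 * L) * (\<epsilon> * g))"
      using C_ge(4) L_nonneg W_nonneg om eps g by (intro mult_left_mono add_mono mult_right_mono) auto
    finally show ?thesis using eps by (simp add: algebra_simps)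
  qed
  ultimately have "norm ((pmoll \<epsilon> w G1 y - G' y e) -
    \<epsilon> *\<^sub>R (\<Sum>b\<in>Basis. dpmoll \<epsilon> w b (\<lambda>x. (w' x e \<bullet> b) *\<^sub>R G x) y)) \<le> C * (\<omega> + \<epsilon> * g) +
     C * (real DIM('a) * (L * (W + 2) + 2 * L)) * (\<omega> + \<epsilon> * g)"
    using norm_triangle_ineq4[of "pmoll \<epsilon> w G1 y - G' y e" "\<epsilon> *\<^sub>R (\<Sum>b\<in>Basis. dpmoll \<epsilon> w b (\<lambda>x. (w' x e \<bullet> b) *\<^sub>R G x) y)"]
    by linarith
  also have "\<dots> = C' * (\<omega> + \<epsilon> * g)" by (simp add: C'_def algebra_simps)
  finally show ?thesis unfolding eq .
qed


end

section \<open>Domains with interior and exterior balls\<close>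

text \<open>Otherwise the point dividing the segment from \<open>x\<close> to \<open>y\<close> in
  the ratio \<open>r : s\<close> would lie in both balls. The geometry of tangent balls below, in
  \<open>foot\<close>, \<open>nu_lipschitz\<close> and \<open>tangent_balls_unique\<close>, rests on
  this inequality for centres.\<close>

lemma disjoint_balls_dist:
  fixes x y :: "'a::real_normed_vector"
  assumes "0 < r" "0 < s" "ball x r \<inter> ball y s = {}"
  shows "r + s \<le> dist x y"
proof (rule ccontr)
  assume *: "\<not> ?thesis"
  define t where "t = r / (r + s)"
  define z where "z = x + t *\<^sub>R (y - x)"
  have t: "t > 0" "1 - t = s / (r + s)" "1 - t > 0" using assms by (auto simp: t_def field_simps)
  have "x - z = - (t *\<^sub>R (y - x))" "y - z = (1 - t) *\<^sub>R (y - x)" by (auto simp: z_def algebra_simps)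
  then have "dist x z = t * dist x y" "dist y z = (1 - t) * dist x y"
    unfolding dist_norm using t(1,3) by (simp_all only: norm_minus_cancel norm_scaleR abs_of_pos norm_minus_commute[of y x])
  moreover have "t * dist x y < t * (r + s)" "(1 - t) * dist x y < (1 - t) * (r + s)"
    using mult_strict_left_mono[of "dist x y" "r + s"] * t(1,3) by (simp_all only: not_le)
  moreover have "t * (r + s) = r" "(1 - t) * (r + s) = s" using assms t(2) by (auto simp: t_def)
  ultimately have "z \<in> ball x r \<inter> ball y s" by auto
  then show False using assms(3) by blast
qed

lemma norm_add_scaleR_square:
  fixes a b :: "'a::real_inner"
  shows "(norm (a + c *\<^sub>R b))\<^sup>2 = (norm a)\<^sup>2 + c\<^sup>2 * (norm b)\<^sup>2 + 2 * c * (a \<bullet> b)"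
  unfolding dot_square_norm[symmetric]
  by (simp add: inner_add_left inner_add_right inner_commute power2_eq_square)

text \<open>Translates of \<open>S\<close> by multiples of \<open>h\<close> in direction
  \<open>u\<close> are pairwise disjoint. About \<open>R / h\<close> of them fit into the ball of
  twice the radius, which bounds their common measure; the factor 2 pays for rounding
  \<open>R / h\<close> down.\<close>

lemma thin_measure:
  fixes S :: "'a::euclidean_space set"
  assumes S: "S \<in> sets borel" "S \<subseteq> ball p R" and u: "norm u = 1" and h: "0 < h" "h \<le> R"
    and thin: "\<And>x s. x \<in> S \<Longrightarrow> s \<ge> 0 \<Longrightarrow> x + s *\<^sub>R u \<in> S \<Longrightarrow> s < h"
  shows "measure lborel S \<le> 2 * h / R * measure lborel (ball p (2 * R))"
proof -
  define K where "K = nat \<lfloor>R / h\<rfloor>"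
  have Rh: "R / h \<ge> 1" using h by simp
  have K1: "real K \<le> R / h" unfolding K_def using Rh by linarith
  have "real K = of_int \<lfloor>R / h\<rfloor>" unfolding K_def using Rh by simp
  moreover have "of_int \<lfloor>R / h\<rfloor> > R / h - 1" "of_int \<lfloor>R / h\<rfloor> \<ge> (1::real)"
    using Rh by linarith (use Rh one_le_floor[of "R / h"] in linarith)
  ultimately have K2: "real K \<ge> (R / h) / 2" by (simp only: mult.commute[of 2] pos_divide_le_eq zero_less_numeral)
  have bS: "bounded S" using S(2) bounded_ball bounded_subset by blast
  have SL: "S \<in> sets lebesgue" using S(1) by simp
  let ?S = "\<lambda>k::nat. (+) ((real k * h) *\<^sub>R u) ` S"
  have fm: "?S k \<in> lmeasurable" for k
    using bounded_set_imp_lmeasurable[OF bS SL] by (rule measurable_translation)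
  have disj: "pairwise (\<lambda>k l. disjnt (?S k) (?S l)) {..<K}"
  proof (rule pairwiseI)
    have aux: "False" if "x \<in> S" "y \<in> S" "(real k * h) *\<^sub>R u + x = (real l * h) *\<^sub>R u + y" "l < k" for x y k l
    proof -
      have "y = x + ((real k - real l) * h) *\<^sub>R u" using that(3) by (simp add: algebra_simps)
      then have "(real k - real l) * h < h" using thin[OF that(1), of "(real k - real l) * h"] that h by simp
      then show False using that(4) h by simp
    qed
    show "disjnt (?S k) (?S l)" if "k \<noteq> l" for k l
      using aux[of _ _ k l] aux[of _ _ l k] that
      by (auto simp: disjnt_def) (metis nat_neq_iff)
  qed
  have "measure lebesgue (\<Union>k<K. ?S k) = (\<Sum>k<K. measure lebesgue (?S k))"
    by (rule measure_UNION'[OF _ fm disj]) simp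
  also have "\<dots> = real K * measure lebesgue S" by (simp add: measure_translation)
  finally have eq: "real K * measure lebesgue S = measure lebesgue (\<Union>k<K. ?S k)" by simp
  have "measure lebesgue (\<Union>k<K. ?S k) \<le> measure lebesgue (ball p (2 * R))"
  proof (rule measure_mono_fmeasurable)
    show "(\<Union>k<K. ?S k) \<subseteq> ball p (2 * R)"
    proof clarify
      fix k x assume k: "k < K" and x: "x \<in> S"
      have "real k * h \<le> R" proof -
        have "real k * h \<le> real K * h" using k h by (intro mult_right_mono) auto
        also have "\<dots> \<le> R / h * h" using K1 h by (intro mult_right_mono) auto
        finally show ?thesis using h by simp
      qed
      moreover have "norm ((real k * h) *\<^sub>R u) = real k * h" using u h by simp
      moreover have "norm (x - p) < R" using x S(2) by (auto simp: dist_norm norm_minus_commute)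
      ultimately have "norm ((real k * h) *\<^sub>R u + (x - p)) < 2 * R"
        using norm_triangle_ineq[of "(real k * h) *\<^sub>R u" "x - p"] by linarith
      then show "(real k * h) *\<^sub>R u + x \<in> ball p (2 * R)"
        by (simp add: dist_norm norm_minus_commute algebra_simps)
    qed
    show "(\<Union>k<K. ?S k) \<in> sets lebesgue" using fm by (intro sets.finite_UN) (auto simp: fmeasurable_def)
  qed auto
  then have "real K * measure lebesgue S \<le> measure lebesgue (ball p (2 * R))" using eq by simp
  moreover have "(R / h) / 2 * measure lebesgue S \<le> real K * measure lebesgue S"
    using K2 by (rule mult_right_mono) simp
  ultimately have "(R / h) / 2 * measure lebesgue S \<le> measure lebesgue (ball p (2 * R))" by linarith
  then have "measure lebesgue S \<le> 2 * h / R * measure lebesgue (ball p (2 * R))"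
    using h by (simp add: field_simps)
  then show ?thesis using S(1) by (simp add: measure_completion)
qed

text \<open>Two points of the slab on a common line in direction \<open>u\<close> are at most
  \<open>2 * h\<close> apart; \<open>3 * h\<close> gives the strict inequality demanded by
  \<open>thin_measure\<close>.\<close>

lemma slab_measure:
  fixes p u :: "'a::euclidean_space"
  assumes "norm u = 1" "0 < h" "3 * h \<le> R"
  shows "measure lborel {x \<in> ball p R. \<bar>(x - p) \<bullet> u\<bar> \<le> h} \<le> 6 * h / R * measure lborel (ball p (2 * R))"
proof -
  have uu: "u \<bullet> u = 1" using assms(1) by (simp add: dot_square_norm)
  have "measure lborel {x \<in> ball p R. \<bar>(x - p) \<bullet> u\<bar> \<le> h} \<le> 2 * (3 * h) / R * measure lborel (ball p (2 * R))"
  proof (rule thin_measure[OF _ _ assms(1)])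
    have "{x \<in> ball p R. \<bar>(x - p) \<bullet> u\<bar> \<le> h} = ball p R \<inter> {x. \<bar>(x - p) \<bullet> u\<bar> \<le> h}" by auto
    moreover have "closed {x. \<bar>(x - p) \<bullet> u\<bar> \<le> h}" by (intro closed_Collect_le continuous_intros)
    ultimately show "{x \<in> ball p R. \<bar>(x - p) \<bullet> u\<bar> \<le> h} \<in> sets borel" by auto
    fix x s assume "x \<in> {x \<in> ball p R. \<bar>(x - p) \<bullet> u\<bar> \<le> h}" "x + s *\<^sub>R u \<in> {x \<in> ball p R. \<bar>(x - p) \<bullet> u\<bar> \<le> h}" "0 \<le> s"
    then show "s < 3 * h" using assms(2) uu by (auto simp: inner_add_left inner_diff_left)
  qed (use assms in auto)
  then show ?thesis by simp
qed

text \<open>Uniform interior and exterior ball condition: the quantitative form in which the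
  smoothness of the boundary enters the estimates.\<close>

locale two_ball_domain =
  fixes \<Omega> :: "'a::euclidean_space set" and r :: real and \<nu> :: "'a \<Rightarrow> 'a"
  assumes open_dom: "open \<Omega>" and bounded_dom: "bounded \<Omega>" and nonempty: "\<Omega> \<noteq> {}"
    and r_pos: "r > 0"
    and norm_nu: "p \<in> frontier \<Omega> \<Longrightarrow> norm (\<nu> p) = 1"
    and interior_ball: "p \<in> frontier \<Omega> \<Longrightarrow> ball (p + r *\<^sub>R \<nu> p) r \<subseteq> \<Omega>"
    and exterior_ball: "p \<in> frontier \<Omega> \<Longrightarrow> ball (p - r *\<^sub>R \<nu> p) r \<inter> \<Omega> = {}"
begin

abbreviation d :: "'a \<Rightarrow> real" where "d x \<equiv> infdist x (frontier \<Omega>)"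

lemma nu_nu: "p \<in> frontier \<Omega> \<Longrightarrow> \<nu> p \<bullet> \<nu> p = 1"
  using norm_nu by (simp add: dot_square_norm)

lemma frontier_compact: "compact (frontier \<Omega>)"
  using bounded_dom by (rule compact_frontier_bounded)

lemma frontier_nonempty: "frontier \<Omega> \<noteq> {}"
  using nonempty bounded_dom not_bounded_UNIV frontier_eq_empty[of \<Omega>] by auto

lemma frontier_not_dom: "p \<in> frontier \<Omega> \<Longrightarrow> p \<notin> \<Omega>"
  using frontier_disjoint_eq open_dom by blast

lemma d_pos: "x \<in> \<Omega> \<Longrightarrow> d x > 0"
  using frontier_not_dom[of x] infdist_pos_not_in_closed[OF frontier_closed frontier_nonempty, of x] by blast

lemma ball_d_subset:
  assumes "x \<in> \<Omega>" shows "ball x (d x) \<subseteq> \<Omega>"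
proof (rule ccontr)
  assume "\<not> ball x (d x) \<subseteq> \<Omega>"
  moreover have "x \<in> ball x (d x) \<inter> \<Omega>" using d_pos assms by simp
  then have "ball x (d x) \<inter> \<Omega> \<noteq> {}" by blast
  ultimately have "ball x (d x) \<inter> frontier \<Omega> \<noteq> {}"
    by (intro connected_Int_frontier[OF connected_ball]) auto
  then obtain q where "q \<in> frontier \<Omega>" "dist x q < d x" by auto
  then show False using infdist_le[of q "frontier \<Omega>" x] by simp
qed

text \<open>Membership of \<open>p + v\<close> in the interior tangent ball, with the square
  expanded; \<open>exterior_pointD\<close> reads the exterior ball in the same way.\<close>

lemma interior_pointI:
  assumes "p \<in> frontier \<Omega>" "(norm v)\<^sup>2 < 2 * r * (v \<bullet> \<nu> p)"
  shows "p + v \<in> \<Omega>"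
proof -
  have "(norm (r *\<^sub>R \<nu> p - v))\<^sup>2 = r\<^sup>2 + (norm v)\<^sup>2 - 2 * r * (v \<bullet> \<nu> p)"
    using nu_nu[OF assms(1)] unfolding dot_square_norm[symmetric]
    by (simp add: inner_diff_left inner_diff_right inner_commute power2_eq_square)
  then have "(norm (r *\<^sub>R \<nu> p - v))\<^sup>2 < r\<^sup>2" using assms(2) by simp
  then have "norm (r *\<^sub>R \<nu> p - v) < r" using r_pos power2_less_imp_less by force
  then have "p + v \<in> ball (p + r *\<^sub>R \<nu> p) r" by (simp add: dist_norm)
  then show ?thesis using interior_ball assms(1) by blast
qed

lemma exterior_pointD:
  assumes "p \<in> frontier \<Omega>" "x \<in> \<Omega>"
  shows "(norm (x - p))\<^sup>2 \<ge> - 2 * r * ((x - p) \<bullet> \<nu> p)"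
proof (rule ccontr)
  assume *: "\<not> ?thesis"
  have "(norm (- r *\<^sub>R \<nu> p - (x - p)))\<^sup>2 = r\<^sup>2 + (norm (x - p))\<^sup>2 + 2 * r * ((x - p) \<bullet> \<nu> p)"
    using nu_nu[OF assms(1)] unfolding dot_square_norm[symmetric]
    by (simp add: inner_diff_left inner_diff_right inner_commute power2_eq_square algebra_simps)
  then have "(norm (- r *\<^sub>R \<nu> p - (x - p)))\<^sup>2 < r\<^sup>2" using * by simp
  then have "norm (- r *\<^sub>R \<nu> p - (x - p)) < r" using r_pos power2_less_imp_less by force
  then have "x \<in> ball (p - r *\<^sub>R \<nu> p) r" by (simp add: dist_norm algebra_simps)
  then show False using exterior_ball assms by blast
qed

text \<open>The ball of radius \<open>d x\<close> around \<open>x\<close> and the exterior ball at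
  \<open>p\<close> are disjoint, so their centres are at distance at least \<open>d x + r\<close>,
  while the path from one to the other through \<open>p\<close> has just this length. Equality in
  the triangle inequality forces \<open>x - p\<close> to be a multiple of
  \<open>\<nu> p\<close>.\<close>

lemma foot:
  assumes "x \<in> \<Omega>" "p \<in> frontier \<Omega>" "dist x p = d x"
  shows "x = p + d x *\<^sub>R \<nu> p"
proof -
  let ?d = "d x"
  have "ball x ?d \<inter> ball (p - r *\<^sub>R \<nu> p) r = {}"
    using ball_d_subset[OF assms(1)] exterior_ball[OF assms(2)] by blast
  then have 1: "?d + r \<le> norm ((x - p) + r *\<^sub>R \<nu> p)"
    using disjoint_balls_dist[OF d_pos[OF assms(1)] r_pos, of x "p - r *\<^sub>R \<nu> p"] by (simp add: dist_norm algebra_simps)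
  have n: "(norm (x - p))\<^sup>2 = ?d\<^sup>2" using assms(3) by (simp add: dist_norm)
  have "(?d + r)\<^sup>2 \<le> (norm ((x - p) + r *\<^sub>R \<nu> p))\<^sup>2"
    using 1 d_pos[OF assms(1)] r_pos by (intro power_mono) auto
  also have "\<dots> = (norm (x - p))\<^sup>2 + r\<^sup>2 + 2 * r * ((x - p) \<bullet> \<nu> p)"
    using norm_nu[OF assms(2)] by (simp add: norm_add_scaleR_square)
  finally have "2 * r * ?d \<le> 2 * r * ((x - p) \<bullet> \<nu> p)" unfolding n by (simp add: power2_eq_square algebra_simps)
  then have 2: "?d \<le> (x - p) \<bullet> \<nu> p" using r_pos by simp
  have "(norm (x - p - ?d *\<^sub>R \<nu> p))\<^sup>2 = (norm (x - p))\<^sup>2 + ?d\<^sup>2 - 2 * ?d * ((x - p) \<bullet> \<nu> p)"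
    using norm_nu[OF assms(2)] norm_add_scaleR_square[of "x - p" "- ?d" "\<nu> p"] by simp
  also have "\<dots> \<le> ?d\<^sup>2 + ?d\<^sup>2 - 2 * ?d * ?d"
    unfolding n using 2 d_pos[OF assms(1)] by (intro diff_left_mono mult_left_mono) auto
  also have "\<dots> = 0" by (simp add: power2_eq_square)
  finally have "x - p - ?d *\<^sub>R \<nu> p = 0" by simp
  then show ?thesis by (simp add: algebra_simps)
qed

lemma ex_foot:
  assumes "x \<in> \<Omega>"
  obtains p where "p \<in> frontier \<Omega>" "dist x p = d x" "x = p + d x *\<^sub>R \<nu> p"
  using infdist_attains_inf[OF frontier_closed frontier_nonempty, of x] foot[OF assms] by metis

text \<open>The interior ball at each of the two points is disjoint from the exterior ball at the
  other. The squares of the two resulting lower bounds for distances of centres are added by the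
  parallelogram law.\<close>

lemma nu_lipschitz:
  assumes "p \<in> frontier \<Omega>" "q \<in> frontier \<Omega>"
  shows "norm (\<nu> p - \<nu> q) \<le> norm (p - q) / r"
proof -
  have "ball (p + r *\<^sub>R \<nu> p) r \<inter> ball (q - r *\<^sub>R \<nu> q) r = {}" "ball (q + r *\<^sub>R \<nu> q) r \<inter> ball (p - r *\<^sub>R \<nu> p) r = {}"
    using interior_ball exterior_ball assms by blast+
  then have "r + r \<le> norm ((p - q) + r *\<^sub>R (\<nu> p + \<nu> q))" "r + r \<le> norm (r *\<^sub>R (\<nu> p + \<nu> q) - (p - q))"
    using disjoint_balls_dist[OF r_pos r_pos] by (fastforce simp: dist_norm algebra_simps)+
  then have "(r + r)\<^sup>2 \<le> (norm ((p - q) + r *\<^sub>R (\<nu> p + \<nu> q)))\<^sup>2" "(r + r)\<^sup>2 \<le> (norm (r *\<^sub>R (\<nu> p + \<nu> q) - (p - q)))\<^sup>2"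
    using r_pos by (intro power_mono; simp)+
  then have "(r + r)\<^sup>2 + (r + r)\<^sup>2 \<le> 2 * (norm (p - q))\<^sup>2 + 2 * (norm (r *\<^sub>R (\<nu> p + \<nu> q)))\<^sup>2"
    unfolding dot_square_norm[symmetric] by (simp add: inner_add_left inner_add_right inner_diff_left inner_diff_right inner_commute)
  moreover have "(norm (r *\<^sub>R (\<nu> p + \<nu> q)))\<^sup>2 = r\<^sup>2 * (4 - (norm (\<nu> p - \<nu> q))\<^sup>2)"
    using nu_nu[OF assms(1)] nu_nu[OF assms(2)]
    unfolding norm_scaleR power_mult_distrib dot_square_norm[symmetric]
    by (simp add: inner_add_left inner_add_right inner_diff_left inner_diff_right inner_commute)
  ultimately have "r\<^sup>2 * (norm (\<nu> p - \<nu> q))\<^sup>2 \<le> (norm (p - q))\<^sup>2" by (simp add: algebra_simps power2_eq_square)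
  then have "(r * norm (\<nu> p - \<nu> q))\<^sup>2 \<le> (norm (p - q))\<^sup>2" by (simp add: power_mult_distrib)
  then have "r * norm (\<nu> p - \<nu> q) \<le> norm (p - q)" by (rule power2_le_imp_le) simp
  then show ?thesis using r_pos by (simp add: field_simps)
qed

lemma nu_inner_ge:
  assumes "p \<in> frontier \<Omega>" "q \<in> frontier \<Omega>" "norm (p - q) \<le> r / 2"
  shows "\<nu> p \<bullet> \<nu> q \<ge> 1 / 2"
proof -
  have "norm (\<nu> p - \<nu> q) \<le> 1 / 2"
  proof -
    have "norm (\<nu> p - \<nu> q) \<le> norm (p - q) / r" by (rule nu_lipschitz[OF assms(1,2)])
    also have "\<dots> \<le> (r / 2) / r" using assms(3) r_pos by (intro divide_right_mono) auto
    finally show ?thesis using r_pos by simp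
  qed
  then have "(norm (\<nu> p - \<nu> q))\<^sup>2 \<le> (1 / 2)\<^sup>2" by (rule power_mono) simp
  then show ?thesis
    using nu_nu[OF assms(1)] nu_nu[OF assms(2)] unfolding dot_square_norm[symmetric]
    by (simp add: inner_diff_left inner_diff_right inner_commute power2_eq_square)
qed

lemma d_ge_interior:
  assumes "p \<in> frontier \<Omega>"
  shows "d y \<ge> r - dist y (p + r *\<^sub>R \<nu> p)"
proof -
  obtain q where q: "q \<in> frontier \<Omega>" "d y = dist y q"
    using infdist_attains_inf[OF frontier_closed frontier_nonempty, of y] by auto
  have "q \<notin> ball (p + r *\<^sub>R \<nu> p) r" using interior_ball[OF assms] frontier_not_dom[OF q(1)] by blast
  then have "r \<le> dist (p + r *\<^sub>R \<nu> p) q" by simp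
  also have "\<dots> \<le> dist y (p + r *\<^sub>R \<nu> p) + dist y q" by (rule dist_triangle3)
  finally show ?thesis using q(2) by linarith
qed

text \<open>The distance lies between \<open>r - norm (y - c)\<close>, with \<open>c\<close> the
  centre of the interior ball at \<open>p\<close>, and \<open>norm (y - p)\<close>. Both functions
  agree with \<open>d\<close> at \<open>x\<close> and have the gradient \<open>\<nu> p\<close>
  there, so \<open>d\<close> is squeezed between them.\<close>

lemma d_has_derivative:
  assumes x: "x \<in> \<Omega>" "d x < r" and p: "p \<in> frontier \<Omega>" "x = p + d x *\<^sub>R \<nu> p"
  shows "(d has_derivative (\<lambda>h. \<nu> p \<bullet> h)) (at x)"
proof -
  let ?c = "p + r *\<^sub>R \<nu> p"
  have dx: "d x > 0" by (rule d_pos[OF x(1)])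
  have xp: "x - p = d x *\<^sub>R \<nu> p" using p(2) by (metis add_diff_cancel_left')
  have xc: "x - ?c = - ((r - d x) *\<^sub>R \<nu> p)" using xp by (simp add: algebra_simps)
  have np: "norm (x - p) = d x" "norm (x - ?c) = r - d x"
    unfolding xp xc using norm_nu[OF p(1)] dx x(2) by auto
  have up: "((\<lambda>y. norm (y - p)) has_derivative (\<lambda>h. \<nu> p \<bullet> h)) (at x)"
  proof -
    have "((\<lambda>y. norm (y - p)) has_derivative (\<lambda>h. h \<bullet> sgn (x - p))) (at x)"
      by (rule has_derivative_compose[of "\<lambda>y. y - p" "\<lambda>h. h"])
        (use np dx in \<open>auto intro!: derivative_eq_intros has_derivative_norm\<close>)
    then show ?thesis unfolding sgn_div_norm np unfolding xp using dx by (simp add: inner_commute)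
  qed
  have lo: "((\<lambda>y. r - norm (y - ?c)) has_derivative (\<lambda>h. \<nu> p \<bullet> h)) (at x)"
  proof -
    have "((\<lambda>y. norm (y - ?c)) has_derivative (\<lambda>h. h \<bullet> sgn (x - ?c))) (at x)"
      by (rule has_derivative_compose[of "\<lambda>y. y - ?c" "\<lambda>h. h"])
        (use np x(2) in \<open>auto intro!: derivative_eq_intros has_derivative_norm\<close>)
    from has_derivative_diff[OF has_derivative_const this]
    have "((\<lambda>y. r - norm (y - ?c)) has_derivative (\<lambda>h. 0 - h \<bullet> sgn (x - ?c))) (at x)" .
    then show ?thesis unfolding sgn_div_norm np unfolding xc using x(2) by (simp add: inner_commute)
  qed
  show ?thesis
  proof (rule has_derivativeI_sandwich[of 1])
    show "bounded_linear (\<lambda>h. \<nu> p \<bullet> h)" by (rule bounded_linear_inner_right)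
    let ?u = "\<lambda>y. norm (norm (y - p) - norm (x - p) - \<nu> p \<bullet> (y - x)) / norm (y - x)"
    let ?l = "\<lambda>y. norm ((r - norm (y - ?c)) - (r - norm (x - ?c)) - \<nu> p \<bullet> (y - x)) / norm (y - x)"
    show "((\<lambda>y. ?u y + ?l y) \<longlongrightarrow> 0) (at x)"
      using up lo by (auto simp: has_derivative_iff_norm intro!: tendsto_add_zero)
    fix y assume "y \<noteq> x"
    have "d y \<le> norm (y - p)" using infdist_le[OF p(1), of y] by (simp add: dist_norm)
    moreover have "d y \<ge> r - norm (y - ?c)" using d_ge_interior[OF p(1), of y] by (simp add: dist_norm)
    ultimately have "norm (d y - d x - \<nu> p \<bullet> (y - x)) \<le>
       norm (norm (y - p) - norm (x - p) - \<nu> p \<bullet> (y - x)) +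
       norm ((r - norm (y - ?c)) - (r - norm (x - ?c)) - \<nu> p \<bullet> (y - x))"
      unfolding np by (simp add: abs_if)
    then show "norm (d y - d x - \<nu> p \<bullet> (y - x)) / norm (y - x) \<le> ?u y + ?l y"
      unfolding add_divide_distrib[symmetric] by (rule divide_right_mono) simp
  qed simp
qed

text \<open>A point where the domain and the tangent half-space disagree lies outside both tangent
  balls at \<open>p\<close>, hence in the gap between the two spheres, whose height within a ball of
  radius \<open>R\<close> is at most \<open>R\<^sup>2 / (2 * r)\<close>.\<close>

lemma half_space_approx:
  assumes "p \<in> frontier \<Omega>" "x \<in> ball p R" "(x \<in> \<Omega>) \<noteq> ((x - p) \<bullet> \<nu> p > 0)"
  shows "\<bar>(x - p) \<bullet> \<nu> p\<bar> \<le> R\<^sup>2 / (2 * r)"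
proof -
  have R: "(norm (x - p))\<^sup>2 \<le> R\<^sup>2" using assms(2) by (intro power_mono) (auto simp: dist_norm norm_minus_commute)
  show ?thesis
  proof (cases "x \<in> \<Omega>")
    case True
    then show ?thesis using assms exterior_pointD[OF assms(1) True] R r_pos by (simp add: field_simps)
  next
    case False
    then have "\<not> (norm (x - p))\<^sup>2 < 2 * r * ((x - p) \<bullet> \<nu> p)" using interior_pointI[OF assms(1), of "x - p"] by auto
    then show ?thesis using assms False R r_pos by (simp add: field_simps)
  qed
qed

lemma layer_open: "open {x \<in> \<Omega>. d x < \<delta>}"
proof -
  have "open {x. d x < \<delta>}" by (intro open_Collect_less continuous_intros)
  moreover have "{x \<in> \<Omega>. d x < \<delta>} = \<Omega> \<inter> {x. d x < \<delta>}" by auto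
  ultimately show ?thesis using open_dom by auto
qed

text \<open>The boundary is covered by finitely many small balls. Within one of them the layer is
  thin in the direction of the normal at the centre, since moving by \<open>s\<close> in that
  direction increases \<open>d\<close> by at least \<open>3 / 8 * s\<close>; so
  \<open>thin_measure\<close> applies with height \<open>4 * \<delta>\<close>.\<close>

lemma layer_measure:
  "\<exists>C\<ge>0. \<exists>\<delta>0>0. \<forall>\<delta>. 0 < \<delta> \<and> \<delta> < \<delta>0 \<longrightarrow> measure lborel {x \<in> \<Omega>. d x < \<delta>} \<le> C * \<delta>"
proof -
  \<comment> \<open>Small enough that the displacement \<open>s\<close> stays below
    \<open>r / 8\<close> and the foot of \<open>x\<close> within \<open>r / 2\<close> of
    \<open>p\<close>, where \<open>nu_inner_ge\<close> bounds the cosine between the two normals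
    from below by \<open>1 / 2\<close>.\<close>
  define r1 where "r1 = r / 16"
  have r1: "r1 > 0" using r_pos by (simp add: r1_def)
  obtain I where I: "finite I" "I \<subseteq> frontier \<Omega>" "frontier \<Omega> \<subseteq> (\<Union>p\<in>I. ball p (r1 / 2))"
    using seq_compact_imp_totally_bounded[OF compact_imp_seq_compact[OF frontier_compact]] r1
    by (meson half_gt_zero)
  let ?L = "\<lambda>\<delta>. {x \<in> \<Omega>. d x < \<delta>}"
  define C where "C = (\<Sum>p\<in>I. 8 / r1 * measure lborel (ball p (2 * r1)))"
  have "measure lborel (?L \<delta>) \<le> C * \<delta>" if \<delta>: "0 < \<delta>" "\<delta> < r1 / 4" for \<delta>
  proof -
    have sub: "?L \<delta> \<subseteq> (\<Union>p\<in>I. ?L \<delta> \<inter> ball p r1)"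
    proof
      fix x assume x: "x \<in> ?L \<delta>"
      then obtain q where q: "q \<in> frontier \<Omega>" "dist x q = d x" using ex_foot by blast
      then obtain p where p: "p \<in> I" "dist p q < r1 / 2" using I(3) by auto
      have "dist p x \<le> dist p q + dist x q" by (rule dist_triangle2)
      then have "x \<in> ball p r1" using p(2) q(2) x \<delta>(2) r1 by auto
      then show "x \<in> (\<Union>p\<in>I. ?L \<delta> \<inter> ball p r1)" using x p(1) by blast
    qed
    have Lm: "?L \<delta> \<inter> ball p r1 \<in> sets borel" for p using layer_open[of \<delta>] by auto
    have part: "measure lborel (?L \<delta> \<inter> ball p r1) \<le> 2 * (4 * \<delta>) / r1 * measure lborel (ball p (2 * r1))" if p: "p \<in> I" for p
    proof (rule thin_measure[OF Lm, where u = "\<nu> p"])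
      have pf: "p \<in> frontier \<Omega>" using p I(2) by blast
      show "norm (\<nu> p) = 1" by (rule norm_nu[OF pf])
      fix x s assume x: "x \<in> ?L \<delta> \<inter> ball p r1" and s: "0 \<le> s" and xs: "x + s *\<^sub>R \<nu> p \<in> ?L \<delta> \<inter> ball p r1"
      obtain q where q: "q \<in> frontier \<Omega>" "dist x q = d x" "x = q + d x *\<^sub>R \<nu> q" using ex_foot x by blast
      have "s = norm (s *\<^sub>R \<nu> p)" using s norm_nu[OF pf] by simp
      also have "\<dots> = dist (x + s *\<^sub>R \<nu> p) x" by (simp add: dist_norm)
      also have "\<dots> \<le> dist p (x + s *\<^sub>R \<nu> p) + dist p x" by (rule dist_triangle3)
      also have "\<dots> < r / 8" using x xs by (simp add: r1_def)
      finally have s8: "s < r / 8" .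
      have dx: "d x > 0" "d x < \<delta>" using x d_pos by auto
      have d8: "d x < r / 64" using dx \<delta>(2) by (simp add: r1_def)
      have "norm (q - p) \<le> dist x q + dist p x" by (metis dist_norm dist_triangle3 dist_commute add.commute)
      then have "norm (q - p) \<le> r / 2" using q(2) d8 x r_pos by (simp add: r1_def)
      then have nn: "\<nu> q \<bullet> \<nu> p \<ge> 1 / 2" by (rule nu_inner_ge[OF q(1) pf])
      have "x - q = d x *\<^sub>R \<nu> q" using q(3) by (metis add_diff_cancel_left')
      then have "x + s *\<^sub>R \<nu> p - (q + r *\<^sub>R \<nu> q) = s *\<^sub>R \<nu> p - (r - d x) *\<^sub>R \<nu> q"
        by (simp only: scaleR_diff_left diff_conv_add_uminus minus_add_distrib minus_minus ac_simps) (simp add: algebra_simps)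
      then have "(dist (x + s *\<^sub>R \<nu> p) (q + r *\<^sub>R \<nu> q))\<^sup>2 = (norm (s *\<^sub>R \<nu> p - (r - d x) *\<^sub>R \<nu> q))\<^sup>2"
        by (simp only: dist_norm)
      also have "\<dots> = s\<^sup>2 + (r - d x)\<^sup>2 - 2 * s * (r - d x) * (\<nu> q \<bullet> \<nu> p)"
        using norm_nu[OF q(1)] norm_nu[OF pf] norm_add_scaleR_square[of "s *\<^sub>R \<nu> p" "- (r - d x)" "\<nu> q"]
        by (simp add: inner_commute power2_commute algebra_simps)
      also have "\<dots> \<le> s\<^sup>2 + (r - d x)\<^sup>2 - 2 * s * (r - d x) * (1 / 2)"
        using nn s d8 r_pos by (intro diff_left_mono mult_left_mono) auto
      \<comment> \<open>The cosine \<open>1 / 2\<close> alone would give the rate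
        \<open>1 / 2\<close>; lowering it to \<open>3 / 8\<close> absorbs the quadratic term, since
        \<open>s\<close> is at most a quarter of \<open>r - d x\<close>.\<close>
      also have "\<dots> \<le> (r - d x - 3 / 8 * s)\<^sup>2"
      proof -
        have "s * (3 / 4 * (r - d x) + s) \<le> s * (r - d x)"
        proof (rule mult_left_mono[OF _ s])
          show "3 / 4 * (r - d x) + s \<le> r - d x" using s8 d8 r_pos by (simp add: field_simps)
        qed
        then have "s * d x + 4 * (s * s) \<le> r * s" by (simp add: field_simps)
        moreover have "(r - d x - 3 / 8 * s)\<^sup>2 = (r - d x)\<^sup>2 - 3 / 4 * (r * s) + 3 / 4 * (s * d x) + 9 / 64 * (s * s)"
          by (simp add: power2_eq_square field_simps)
        moreover have "2 * s * (r - d x) * (1 / 2) = r * s - s * d x" "s\<^sup>2 = s * s"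
          by (simp_all add: algebra_simps power2_eq_square)
        ultimately show ?thesis using zero_le_square[of s] by linarith
      qed
      finally have "dist (x + s *\<^sub>R \<nu> p) (q + r *\<^sub>R \<nu> q) \<le> r - d x - 3 / 8 * s"
        by (rule power2_le_imp_le) (use s8 d8 r_pos in simp)
      then have "d (x + s *\<^sub>R \<nu> p) \<ge> d x + 3 / 8 * s"
        using d_ge_interior[OF q(1), of "x + s *\<^sub>R \<nu> p"] by linarith
      then show "s < 4 * \<delta>" using xs dx s by simp
    qed (use \<delta> in auto)
    have fin: "?L \<delta> \<inter> ball p r1 \<in> fmeasurable lborel" for p
    proof (rule fmeasurableI)
      have "bounded (?L \<delta> \<inter> ball p r1)" using bounded_ball by (rule bounded_subset) blast
      then show "emeasure lborel (?L \<delta> \<inter> ball p r1) < \<infinity>" using emeasure_bounded_finite by simp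
    qed (use Lm in simp)
    have "measure lborel (?L \<delta>) \<le> measure lborel (\<Union>p\<in>I. ?L \<delta> \<inter> ball p r1)"
    proof (rule measure_mono_fmeasurable[OF sub])
      show "(\<Union>p\<in>I. ?L \<delta> \<inter> ball p r1) \<in> fmeasurable lborel"
        using fin I(1) by (rule fmeasurable.finite_UN[rotated])
    qed (use layer_open in auto)
    also have "\<dots> \<le> (\<Sum>p\<in>I. measure lborel (?L \<delta> \<inter> ball p r1))"
      using fin I(1) by (intro measure_UNION_le) (auto simp: fmeasurable_def)
    also have "\<dots> \<le> (\<Sum>p\<in>I. 2 * (4 * \<delta>) / r1 * measure lborel (ball p (2 * r1)))"
      by (rule sum_mono) (rule part)
    also have "\<dots> = C * \<delta>" unfolding C_def sum_distrib_right by (rule sum.cong) auto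
    finally show ?thesis .
  qed
  moreover have "C \<ge> 0" unfolding C_def using r1 by (intro sum_nonneg) auto
  ultimately show ?thesis using r1 by (intro exI[of _ C] conjI exI[of _ "r1 / 4"]) auto
qed

end

section \<open>Smooth boundaries\<close>

lemma bump_ge: "norm z \<le> 1 / 2 \<Longrightarrow> bump z \<ge> exp (- 4 / 3)"
proof -
  assume "norm z \<le> 1 / 2"
  then have "(norm z)\<^sup>2 \<le> (1 / 2)\<^sup>2" by (intro power_mono) auto
  then have *: "1 - z \<bullet> z \<ge> 3 / 4" by (simp add: dot_square_norm power2_eq_square)
  then have "1 / (1 - z \<bullet> z) \<le> 1 / (3 / 4)" by (intro divide_left_mono) auto
  then have "exp (- 4 / 3) \<le> exp (- (1 / (1 - z \<bullet> z)))" by simp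
  also have "\<dots> = bump z" using * by (simp add: bump_def flat_def)
  finally show ?thesis .
qed

context two_ball_domain
begin

text \<open>A finite sum of bump functions times the normals at their centres. A bump of radius
  \<open>r / 2\<close> is nonzero only at boundary points whose normal has inner product at least
  \<open>1 / 2\<close> with the normal at the centre, so no contribution to
  \<open>w q \<bullet> \<nu> q\<close> is negative.\<close>

lemma ex_shift_field:
  "\<exists>w w' W L. shift_field w w' W L \<and> (\<forall>p\<in>frontier \<Omega>. w p \<bullet> \<nu> p \<ge> 8)"
proof -
  define \<rho> where "\<rho> = r / 2"
  have \<rho>: "\<rho> > 0" using r_pos by (simp add: \<rho>_def)
  obtain I where I: "finite I" "I \<subseteq> frontier \<Omega>" "frontier \<Omega> \<subseteq> (\<Union>p\<in>I. ball p (\<rho> / 2))"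
    using seq_compact_imp_totally_bounded[OF compact_imp_seq_compact[OF frontier_compact]] \<rho>
    by (meson half_gt_zero)
  define f where "f p x = 1 * bump ((1 / \<rho>) *\<^sub>R x + (- (1 / \<rho>) *\<^sub>R p))" for p x :: 'a
  have arg: "(1 / \<rho>) *\<^sub>R x + (- (1 / \<rho>) *\<^sub>R p) = (1 / \<rho>) *\<^sub>R (x - p)" for x p :: 'a
    by (simp add: algebra_simps)
  have fs: "smooth_on UNIV (f p)" for p
    unfolding f_def[abs_def] by (rule smooth_on_scaled[OF bump_smooth])
  have f0: "f p x = 0" if "x \<notin> ball p \<rho>" for p x
    unfolding f_def arg mult_1
    by (rule bump_eq_0) (use that \<rho> in \<open>simp add: dist_norm norm_minus_commute[of p] pos_le_divide_eq\<close>)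
  have fnn: "f p x \<ge> 0" for p x unfolding f_def by (simp add: bump_nonneg)
  have f1: "f p x \<ge> exp (- 4 / 3)" if "x \<in> ball p (\<rho> / 2)" for p x
    unfolding f_def arg mult_1
    by (rule bump_ge) (use that \<rho> in \<open>simp add: dist_norm norm_minus_commute[of p] pos_divide_le_eq\<close>)
  have "\<exists>B\<ge>0. (\<forall>x. \<bar>f p x\<bar> \<le> B) \<and> (\<forall>x e. \<bar>frechet_derivative (f p) (at x) e\<bar> \<le> B * norm e) \<and>
     (\<forall>x y. \<bar>f p x - f p y\<bar> \<le> B * norm (x - y)) \<and>
     (\<forall>x y e. \<bar>frechet_derivative (f p) (at x) e - frechet_derivative (f p) (at y) e\<bar> \<le> B * norm (x - y) * norm e)" for p
    by (rule smooth_compact_support_bounds[OF fs compact_cball[of p \<rho>]]) (auto intro!: f0)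
  then obtain B where B: "\<And>p. B p \<ge> 0" "\<And>p x. \<bar>f p x\<bar> \<le> B p"
     "\<And>p x e. \<bar>frechet_derivative (f p) (at x) e\<bar> \<le> B p * norm e"
     "\<And>p x y e. \<bar>frechet_derivative (f p) (at x) e - frechet_derivative (f p) (at y) e\<bar> \<le> B p * norm (x - y) * norm e"
    by metis
  \<comment> \<open>A bump whose centre is within half its radius of \<open>q\<close> is at least
    \<open>exp (- 4 / 3)\<close> there; with the inner product \<open>1 / 2\<close> a single such
    bump already contributes 8.\<close>
  define c where "c = 16 / exp (- 4 / 3 :: real)"
  have c: "c > 0" by (simp add: c_def)
  define w where "w x = (\<Sum>p\<in>I. (c * f p x) *\<^sub>R \<nu> p)" for x
  define w' where "w' x e = (\<Sum>p\<in>I. (c * frechet_derivative (f p) (at x) e) *\<^sub>R \<nu> p)" for x e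
  define W where "W = (\<Sum>p\<in>I. c * B p)"
  have np: "norm (\<nu> p) = 1" if "p \<in> I" for p using that I(2) norm_nu by blast
  have "shift_field w w' W W"
  proof
    fix x y e :: 'a
    show "norm (w x) \<le> W" unfolding w_def W_def
      by (rule sum_norm_le) (use B c np in \<open>simp add: abs_mult mult_left_mono\<close>)
    show "(w has_derivative w' x) (at x)"
      unfolding w_def[abs_def] w'_def[abs_def]
      by (auto intro!: derivative_eq_intros smooth_on_has_derivative[OF fs])
    have "norm (w' x e) \<le> (\<Sum>p\<in>I. c * (B p * norm e))" unfolding w'_def
      by (rule sum_norm_le) (use B c np in \<open>simp add: abs_mult mult_left_mono\<close>)
    then show "norm (w' x e) \<le> W * norm e" by (simp add: W_def sum_distrib_right mult.assoc)
    have "w' x e - w' y e = (\<Sum>p\<in>I. (c * (frechet_derivative (f p) (at x) e - frechet_derivative (f p) (at y) e)) *\<^sub>R \<nu> p)"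
      unfolding w'_def by (simp add: sum_subtractf algebra_simps)
    also have "norm \<dots> \<le> (\<Sum>p\<in>I. c * (B p * norm (x - y) * norm e))"
      by (rule sum_norm_le) (use B(4) c np in \<open>simp add: abs_mult mult_left_mono\<close>)
    finally show "norm (w' x e - w' y e) \<le> W * norm (x - y) * norm e"
      by (simp add: W_def sum_distrib_right mult.assoc)
  qed
  moreover have "w q \<bullet> \<nu> q \<ge> 8" if q: "q \<in> frontier \<Omega>" for q
  proof -
    obtain p where p: "p \<in> I" "q \<in> ball p (\<rho> / 2)" using I(3) q by blast
    have trm: "(c * f p q) * (\<nu> p \<bullet> \<nu> q) \<ge> (c * f p q) * (1 / 2)" if p: "p \<in> I" for p
    proof (cases "q \<in> ball p \<rho>")
      case True
      then have "\<nu> p \<bullet> \<nu> q \<ge> 1 / 2"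
        using p I(2) q by (intro nu_inner_ge) (auto simp: dist_norm \<rho>_def)
      then show ?thesis using c fnn by (intro mult_left_mono) auto
    qed (simp add: f0)
    have "8 \<le> c * exp (- 4 / 3) * (1 / 2)" by (simp add: c_def)
    also have "\<dots> \<le> (c * f p q) * (1 / 2)" using f1[OF p(2)] c by simp
    also have "\<dots> \<le> (\<Sum>p\<in>I. (c * f p q) * (1 / 2))"
      using p(1) I(1) fnn c by (intro member_le_sum) auto
    also have "\<dots> \<le> (\<Sum>p\<in>I. (c * f p q) * (\<nu> p \<bullet> \<nu> q))" by (intro sum_mono trm)
    also have "\<dots> = w q \<bullet> \<nu> q" by (simp add: w_def inner_sum_left)
    finally show ?thesis .
  qed
  ultimately show ?thesis by blast
qed

end

locale shifted_domain = two_ball_domain \<Omega> r \<nu> + shift_field w w' W L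
  for \<Omega> :: "'a::euclidean_space set" and r \<nu> w w' W L +
  assumes w_inward: "p \<in> frontier \<Omega> \<Longrightarrow> w p \<bullet> \<nu> p \<ge> 8"
begin

text \<open>Far from the boundary the displacement is too short to leave the domain. Otherwise the
  inward push of at least \<open>8 * \<epsilon>\<close> at the foot loses at most \<epsilon> through
  the variation of \<open>w\<close> and \<open>3 * \<epsilon>\<close> through the radius of the
  ball; the remaining \<open>4 * \<epsilon>\<close> in the normal direction outweigh the square of a
  displacement of order \<epsilon> in \<open>interior_pointI\<close>. The radius
  \<open>3 * \<epsilon>\<close> instead of \<epsilon> leaves room for passing to closures and
  neighbourhoods later.\<close>

lemma shift_into_domain:
  "\<exists>\<epsilon>0>0. \<forall>\<epsilon>. 0 < \<epsilon> \<and> \<epsilon> < \<epsilon>0 \<longrightarrow> (\<forall>x\<in>\<Omega>. ball (x + \<epsilon> *\<^sub>R w x) (3 * \<epsilon>) \<subseteq> \<Omega>)"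
proof -
  have A: "W + 4 > 0" "2 * W + 8 > 0" using W_nonneg by auto
  \<comment> \<open>The first bound keeps the variation of \<open>w\<close> between \<open>x\<close>
    and its foot below 1, the second makes \<open>(norm v)\<^sup>2\<close> smaller than
    \<open>8 * r * \<epsilon>\<close>.\<close>
  define \<epsilon>0 where "\<epsilon>0 = min (1 / (L * (W + 4) + 1)) (8 * r / (2 * W + 8)\<^sup>2)"
  have L1: "L * (W + 4) + 1 > 0" using L_nonneg A by (simp add: add_nonneg_pos)
  have "\<epsilon>0 > 0" unfolding \<epsilon>0_def using L1 A r_pos by simp
  moreover have "ball (x + \<epsilon> *\<^sub>R w x) (3 * \<epsilon>) \<subseteq> \<Omega>" if eps: "0 < \<epsilon>" "\<epsilon> < \<epsilon>0" and x: "x \<in> \<Omega>" for \<epsilon> x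
  proof
    fix z assume "z \<in> ball (x + \<epsilon> *\<^sub>R w x) (3 * \<epsilon>)"
    define \<zeta> where "\<zeta> = z - (x + \<epsilon> *\<^sub>R w x)"
    have \<zeta>: "norm \<zeta> < 3 * \<epsilon>" "z = x + \<epsilon> *\<^sub>R w x + \<zeta>"
      using \<open>z \<in> _\<close> by (auto simp: \<zeta>_def dist_norm norm_minus_commute)
    have ew: "norm (\<epsilon> *\<^sub>R w x) \<le> \<epsilon> * W" using eps bound by simp
    show "z \<in> \<Omega>"
    proof (cases "d x \<ge> (W + 4) * \<epsilon>")
      case True
      have "norm (z - x) \<le> norm (\<epsilon> *\<^sub>R w x) + norm \<zeta>" unfolding \<zeta>(2) using norm_triangle_ineq[of "\<epsilon> *\<^sub>R w x" \<zeta>] by (simp add: algebra_simps)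
      then have "norm (z - x) < \<epsilon> * W + 4 * \<epsilon>" using ew \<zeta>(1) eps(1) by linarith
      then have "norm (z - x) < (W + 4) * \<epsilon>" by (simp add: algebra_simps)
      then have "z \<in> ball x (d x)" using True by (simp add: dist_norm norm_minus_commute)
      then show ?thesis using ball_d_subset x by blast
    next
      case False
      obtain p where p: "p \<in> frontier \<Omega>" "dist x p = d x" "x = p + d x *\<^sub>R \<nu> p" using ex_foot x by blast
      have dx: "d x > 0" using d_pos x by blast
      define v where "v = d x *\<^sub>R \<nu> p + \<epsilon> *\<^sub>R w x + \<zeta>"
      have z: "z = p + v" unfolding \<zeta>(2) v_def using p(3) by (metis add.assoc)
      have "\<bar>(w x - w p) \<bullet> \<nu> p\<bar> \<le> norm (w x - w p) * norm (\<nu> p)" by (rule Cauchy_Schwarz_ineq2)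
      also have "\<dots> \<le> L * d x" using lipschitz[of x p] p(2) norm_nu[OF p(1)] by (simp add: dist_norm)
      also have "\<dots> \<le> L * ((W + 4) * \<epsilon>)" using False L_nonneg by (intro mult_left_mono) auto
      also have "\<dots> \<le> 1"
      proof -
        have "\<epsilon> < 1 / (L * (W + 4) + 1)" using eps by (simp add: \<epsilon>0_def)
        then show ?thesis using L1 eps by (simp add: field_simps)
      qed
      finally have "w x \<bullet> \<nu> p \<ge> 7" using w_inward[OF p(1)] by (simp add: inner_diff_left)
      then have "\<epsilon> * (w x \<bullet> \<nu> p) \<ge> \<epsilon> * 7" using eps by (intro mult_left_mono) auto
      moreover have "\<bar>\<zeta> \<bullet> \<nu> p\<bar> \<le> norm \<zeta>" using Cauchy_Schwarz_ineq2[of \<zeta> "\<nu> p"] norm_nu[OF p(1)] by simp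
      moreover have "v \<bullet> \<nu> p = d x + \<epsilon> * (w x \<bullet> \<nu> p) + \<zeta> \<bullet> \<nu> p"
        unfolding v_def using nu_nu[OF p(1)] by (simp add: inner_add_left)
      ultimately have vn: "v \<bullet> \<nu> p \<ge> 4 * \<epsilon>" using dx \<zeta>(1) by linarith
      have "norm v \<le> d x + norm (\<epsilon> *\<^sub>R w x) + norm \<zeta>"
        unfolding v_def using norm_nu[OF p(1)] dx
          norm_triangle_ineq[of "d x *\<^sub>R \<nu> p + \<epsilon> *\<^sub>R w x" \<zeta>] norm_triangle_ineq[of "d x *\<^sub>R \<nu> p" "\<epsilon> *\<^sub>R w x"] by simp
      moreover have "d x < W * \<epsilon> + 4 * \<epsilon>" using False by (simp add: algebra_simps)
      moreover have "W * \<epsilon> = \<epsilon> * W" by simp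
      ultimately have "norm v \<le> 2 * (W * \<epsilon>) + 8 * \<epsilon>" using ew \<zeta>(1) eps(1) by linarith
      then have "norm v \<le> (2 * W + 8) * \<epsilon>" by (simp add: algebra_simps)
      then have "(norm v)\<^sup>2 \<le> ((2 * W + 8) * \<epsilon>)\<^sup>2" by (intro power_mono) auto
      also have "\<dots> = ((2 * W + 8)\<^sup>2 * \<epsilon>) * \<epsilon>" by (simp add: power2_eq_square)
      also have "\<dots> < (8 * r) * \<epsilon>"
      proof -
        have "\<epsilon> < 8 * r / (2 * W + 8)\<^sup>2" using eps by (simp add: \<epsilon>0_def)
        then have "(2 * W + 8)\<^sup>2 * \<epsilon> < 8 * r" using A by (simp add: field_simps)
        then show ?thesis using eps by simp
      qed
      also have "\<dots> \<le> 2 * r * (v \<bullet> \<nu> p)" using vn r_pos by simp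
      finally show ?thesis unfolding z by (rule interior_pointI[OF p(1)])
    qed
  qed
  ultimately show ?thesis by blast
qed

end

section \<open>From defining functions to tangent balls\<close>

lemma Ck_on_subset: "Ck_on k S f \<Longrightarrow> T \<subseteq> S \<Longrightarrow> Ck_on k T f"
  by (induction k arbitrary: f) (auto intro: continuous_on_subset)

lemma frechet_euclidean_sum:
  assumes "(f has_derivative f') F"
  shows "f' v = (\<Sum>e\<in>Basis. (v \<bullet> e) *\<^sub>R f' e)"
  using has_derivative_linear[OF assms]
  by (subst (1) euclidean_representation[of v, symmetric]) (simp add: linear_sum linear_scale del: euclidean_representation)

lemma continuous_derivatives_lipschitz:
  fixes f :: "'a::euclidean_space \<Rightarrow> 'b::real_normed_vector"
  assumes K: "compact K" "convex K"
    and f': "\<And>x. x \<in> K \<Longrightarrow> (f has_derivative f' x) (at x)"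
    and cont: "\<And>e. e \<in> Basis \<Longrightarrow> continuous_on K (\<lambda>x. f' x e)"
  shows "\<exists>B\<ge>0. (\<forall>x\<in>K. \<forall>v. norm (f' x v) \<le> B * norm v) \<and> (\<forall>x\<in>K. \<forall>y\<in>K. norm (f x - f y) \<le> B * norm (x - y))"
proof -
  have "\<exists>b\<ge>0. \<forall>x\<in>K. norm (f' x e) \<le> b" if "e \<in> Basis" for e
  proof -
    have "bounded ((\<lambda>x. f' x e) ` K)"
      using cont[OF that] K(1) by (intro compact_imp_bounded compact_continuous_image)
    then obtain b where "\<forall>x\<in>K. norm (f' x e) \<le> b" unfolding bounded_iff by auto
    then have "\<forall>x\<in>K. norm (f' x e) \<le> max b 0" by (simp add: le_max_iff_disj)
    then show ?thesis by (intro exI[of _ "max b 0"]) auto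
  qed
  then obtain b where b: "\<And>e. e \<in> Basis \<Longrightarrow> b e \<ge> 0" "\<And>e x. e \<in> Basis \<Longrightarrow> x \<in> K \<Longrightarrow> norm (f' x e) \<le> b e"
    by metis
  define B where "B = (\<Sum>e\<in>Basis. b e)"
  have B: "norm (f' x v) \<le> B * norm v" if x: "x \<in> K" for x v
  proof -
    have "norm (f' x v) \<le> (\<Sum>e\<in>Basis. norm v * b e)"
      unfolding frechet_euclidean_sum[OF f'[OF x], of v]
      by (intro sum_norm_le) (auto intro!: mult_mono b x Basis_le_norm)
    then show ?thesis by (simp add: B_def sum_distrib_left mult.commute)
  qed
  moreover have "norm (f x - f y) \<le> B * norm (x - y)" if "x \<in> K" "y \<in> K" for x y
    by (rule differentiable_bound[where S=K and f'=f'])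
       (use K(2) f' B that in \<open>auto intro!: onorm_le intro: has_derivative_at_withinI\<close>)
  moreover have "B \<ge> 0" unfolding B_def using b by (intro sum_nonneg) auto
  ultimately show ?thesis by blast
qed

lemma grad_inner:
  fixes f :: "real^'n \<Rightarrow> real"
  assumes "(f has_derivative f') (at x)"
  shows "f' v = grad f x \<bullet> v"
proof -
  have "f' v = (\<Sum>e\<in>Basis. (v \<bullet> e) *\<^sub>R f' e)" by (rule frechet_euclidean_sum[OF assms])
  also have "\<dots> = (\<Sum>i\<in>UNIV. (v \<bullet> axis i 1) *\<^sub>R f' (axis i 1))"
    unfolding Basis_vec_def by (subst sum.UNION_disjoint) (auto simp: axis_eq_axis)
  finally show ?thesis
    by (simp add: grad_def inner_vec_def[of "vec_lambda _"] frechet_derivative_at[OF assms, symmetric] inner_axis mult.commute)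
qed

text \<open>On the boundary \<open>\<phi>\<close> vanishes, so up to a quadratic error
  \<open>\<phi> (q + v)\<close> is the linear function
  \<open>- norm (grad \<phi> q) * (\<nu> \<bullet> v)\<close>. In the interior tangent ball of
  radius \<open>s\<close> one has \<open>(norm v)\<^sup>2 < 2 * s * (\<nu> \<bullet> v)\<close>, in
  the exterior one the same with \<open>- \<nu>\<close>, and for small \<open>s\<close> the linear
  term decides the sign.\<close>

lemma local_two_ball:
  fixes \<Omega> :: "(real^'n) set"
  assumes \<phi>: "local_defining_fn \<Omega> p R \<phi>"
  shows "\<exists>s>0. \<forall>q\<in>ball p s. q \<in> frontier \<Omega> \<longrightarrow>
     (let \<nu> = - ((1 / norm (grad \<phi> q)) *\<^sub>R grad \<phi> q) in norm \<nu> = 1 \<and>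
       ball (q + s *\<^sub>R \<nu>) s \<subseteq> \<Omega> \<and> ball (q - s *\<^sub>R \<nu>) s \<inter> \<Omega> = {})"
proof -
  have R: "R > 0" and sm: "smooth_on (ball p R) \<phi>" and g0: "\<And>x. x \<in> ball p R \<Longrightarrow> grad \<phi> x \<noteq> 0"
    and dom: "\<Omega> \<inter> ball p R = {x\<in>ball p R. \<phi> x < 0}"
    using \<phi> by (auto simp: local_defining_fn_def)
  let ?K = "cball p (R / 2)"
  have KR: "?K \<subseteq> ball p R" using R by auto
  let ?D = "\<lambda>x. frechet_derivative \<phi> (at x)"
  have D: "(\<phi> has_derivative ?D x) (at x)" if "x \<in> ball p R" for x
    using smooth_on_has_derivative[OF sm that] .
  have "\<exists>B\<ge>0. \<forall>x\<in>?K. \<forall>y\<in>?K. norm (?D x e - ?D y e) \<le> B * norm (x - y)" if e: "e \<in> Basis" for e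
  proof -
    note se = smooth_onD(3)[OF sm e]
    have "\<exists>B\<ge>0. (\<forall>x\<in>?K. \<forall>v. norm (frechet_derivative (\<lambda>x. ?D x e) (at x) v) \<le> B * norm v) \<and>
       (\<forall>x\<in>?K. \<forall>y\<in>?K. norm (?D x e - ?D y e) \<le> B * norm (x - y))"
      by (rule continuous_derivatives_lipschitz)
         (use KR smooth_on_has_derivative[OF se] smooth_onD(2)[OF smooth_onD(3)[OF se]] in \<open>auto intro: continuous_on_subset\<close>)
    then show ?thesis by blast
  qed
  then obtain b where b: "\<And>e. e \<in> Basis \<Longrightarrow> b e \<ge> 0"
    "\<And>e x y. e \<in> Basis \<Longrightarrow> x \<in> ?K \<Longrightarrow> y \<in> ?K \<Longrightarrow> norm (?D x e - ?D y e) \<le> b e * norm (x - y)"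
    by metis
  define B where "B = (\<Sum>e\<in>(Basis::(real^'n) set). b e)"
  have B0: "B \<ge> 0" unfolding B_def using b by (intro sum_nonneg) auto
  have DB: "norm (?D x v - ?D y v) \<le> B * norm (x - y) * norm v" if x: "x \<in> ?K" and y: "y \<in> ?K" for x y v
  proof -
    have "x \<in> ball p R" "y \<in> ball p R" using x y KR by auto
    then have "?D x v - ?D y v = (\<Sum>e\<in>Basis. (v \<bullet> e) *\<^sub>R (?D x e - ?D y e))"
      using frechet_euclidean_sum[OF D[of x], of v] frechet_euclidean_sum[OF D[of y], of v]
      by (simp add: sum_subtractf right_diff_distrib)
    also have "norm \<dots> \<le> (\<Sum>e\<in>Basis. norm v * (b e * norm (x - y)))"
      unfolding norm_scaleR by (intro sum_norm_le) (auto intro!: mult_mono b(2)[unfolded real_norm_def] x y Basis_le_norm simp: abs_mult)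
    finally show ?thesis by (simp add: B_def sum_distrib_left sum_distrib_right mult_ac)
  qed
  have taylor: "\<bar>\<phi> (q + v) - \<phi> q - ?D q v\<bar> \<le> B * (norm v)\<^sup>2" if q: "q \<in> cball p (R / 4)" and v: "norm v \<le> R / 4" for q v
  proof -
    have sub: "cball q (norm v) \<subseteq> ?K"
    proof
      fix x assume "x \<in> cball q (norm v)"
      then show "x \<in> ?K" using q v dist_triangle[of p x q] by (auto simp: dist_commute)
    qed
    have "norm (\<phi> (q + v) - \<phi> q - ?D q ((q + v) - q)) \<le> norm ((q + v) - q) * (B * norm v)"
    proof (rule differentiable_bound_linearization[where S = "cball q (norm v)"])
      show "(\<phi> has_derivative ?D x) (at x within cball q (norm v))" if "x \<in> cball q (norm v)" for x
        by (rule has_derivative_at_withinI[OF D[OF subsetD[OF KR subsetD[OF sub that]]]])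
      show "onorm (?D x - ?D q) \<le> B * norm v" if x: "x \<in> cball q (norm v)" for x
      proof (rule onorm_le)
        fix h
        have "q \<in> cball q (norm v)" by simp
        then have "norm (?D x h - ?D q h) \<le> B * norm (x - q) * norm h"
          by (rule DB[OF subsetD[OF sub x] subsetD[OF sub]])
        also have "\<dots> \<le> B * norm v * norm h"
          using x B0 by (intro mult_right_mono mult_left_mono) (auto simp: dist_norm norm_minus_commute)
        finally show "norm ((?D x - ?D q) h) \<le> B * norm v * norm h" by simp
      qed
    qed (auto simp: dist_norm mult_left_le_one_le)
    then show ?thesis by (simp add: power2_eq_square mult_ac)
  qed
  have contg: "continuous_on ?K (\<lambda>x. norm (grad \<phi> x))"
  proof -
    have "continuous_on ?K (\<lambda>x. ?D x (axis i 1))" for i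
      using smooth_onD(2)[OF smooth_onD(3)[OF sm, of "axis i 1"]] KR by (auto simp: axis_in_Basis_iff intro: continuous_on_subset)
    then show ?thesis unfolding grad_def[abs_def] by (intro continuous_intros)
  qed
  have "?K \<noteq> {}" using R by simp
  then obtain x0 where x0: "x0 \<in> ?K" "\<And>x. x \<in> ?K \<Longrightarrow> norm (grad \<phi> x0) \<le> norm (grad \<phi> x)"
    using continuous_attains_inf[OF compact_cball _ contg] by blast
  define m where "m = norm (grad \<phi> x0)"
  have m: "m > 0" unfolding m_def using g0 x0(1) KR by auto
  \<comment> \<open>The first bound keeps both tangent balls within reach of the Taylor estimate;
    the second gives \<open>2 * s * B < m\<close>, with \<open>m\<close> the least norm of the
    gradient on \<open>?K\<close>.\<close>
  define s where "s = min (R / 8) (m / (2 * (B + 1)))"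
  have s: "s > 0" "s \<le> R / 8" "2 * s * B < m"
  proof -
    show "s > 0" unfolding s_def using R m B0 by auto
    show "s \<le> R / 8" unfolding s_def by (rule min.cobounded1)
    have "s \<le> m / (2 * (B + 1))" unfolding s_def by simp
    then have "s * (2 * (B + 1)) \<le> m" using B0 by (simp add: pos_le_divide_eq)
    then show "2 * s * B < m" using \<open>s > 0\<close> by (simp add: algebra_simps)
  qed
  show ?thesis
  proof (intro exI[of _ s] conjI ballI impI s(1))
    fix q assume q: "q \<in> ball p s" "q \<in> frontier \<Omega>"
    define g where "g = grad \<phi> q"
    define \<nu> where "\<nu> = - ((1 / norm g) *\<^sub>R g)"
    have qK: "q \<in> ?K" "q \<in> cball p (R / 4)" "q \<in> ball p R" using q s(2) R by auto
    have gm: "norm g \<ge> m" "g \<noteq> 0" using x0(2)[OF qK(1)] g0[OF qK(3)] by (auto simp: g_def m_def)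
    have Dg: "?D q v = - (norm g * (\<nu> \<bullet> v))" for v
      using grad_inner[OF D[OF qK(3)], of v] gm(2) by (simp add: g_def[symmetric] \<nu>_def)
    have nn: "norm \<nu> = 1" using gm(2) by (simp add: \<nu>_def)
    \<comment> \<open>By continuity a positive value would make \<open>q\<close> exterior to the
      domain, a negative one interior.\<close>
    have ph0: "\<phi> q = 0"
    proof -
      have cq: "isCont \<phi> q" using D[OF qK(3)] has_derivative_continuous by blast
      have "\<phi> q \<le> 0"
      proof (rule ccontr)
        assume "\<not> \<phi> q \<le> 0"
        then have "eventually (\<lambda>x. \<phi> x > 0) (nhds q)"
          using cq by (intro order_tendstoD(1)[of \<phi> "\<phi> q"]) (auto simp: isCont_def tendsto_at_iff_tendsto_nhds)
        moreover have "eventually (\<lambda>x. x \<in> ball p R) (nhds q)" using qK(3) by (intro eventually_nhds_in_open) auto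
        ultimately have "eventually (\<lambda>x. x \<notin> \<Omega>) (nhds q)"
          by eventually_elim (use dom in force)
        then obtain S where "open S" "q \<in> S" "\<forall>x\<in>S. x \<notin> \<Omega>" by (auto simp: eventually_nhds)
        then show False using q(2) open_Int_closure_eq_empty[of S \<Omega>] by (auto simp: frontier_def)
      qed
      moreover have "\<not> \<phi> q < 0"
      proof
        assume "\<phi> q < 0"
        then have "eventually (\<lambda>x. \<phi> x < 0) (nhds q)"
          using cq by (intro order_tendstoD(2)[of \<phi> "\<phi> q"]) (auto simp: isCont_def tendsto_at_iff_tendsto_nhds)
        moreover have "eventually (\<lambda>x. x \<in> ball p R) (nhds q)" using qK(3) by (intro eventually_nhds_in_open) auto
        ultimately have "eventually (\<lambda>x. x \<in> \<Omega>) (nhds q)"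
          by eventually_elim (use dom in force)
        then obtain S where "open S" "q \<in> S" "S \<subseteq> \<Omega>" by (auto simp: eventually_nhds)
        then have "q \<in> interior \<Omega>" by (auto simp: interior_def)
        then show False using q(2) by (simp add: frontier_def)
      qed
      ultimately show ?thesis by simp
    qed
    have est: "\<bar>\<phi> (q + v) + norm g * (\<nu> \<bullet> v)\<bar> \<le> B * (norm v)\<^sup>2" if "norm v \<le> R / 4" for v
      using taylor[OF qK(2) that] ph0 Dg[of v] by simp
    have sq: "(norm v)\<^sup>2 < 2 * s * (\<nu> \<bullet> v) \<and> norm v < 2 * s"
      if v: "norm (v - s *\<^sub>R \<nu>) < s" and n: "norm \<nu> = 1" for v and \<nu> :: "real^'n"
    proof
      have "(norm (v - s *\<^sub>R \<nu>))\<^sup>2 < s\<^sup>2" using v by (intro power_strict_mono) auto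
      then show "(norm v)\<^sup>2 < 2 * s * (\<nu> \<bullet> v)"
        using norm_add_scaleR_square[of v "- s" \<nu>] n by (simp add: inner_commute)
      show "norm v < 2 * s" using norm_triangle_sub[of v "s *\<^sub>R \<nu>"] v n s(1) by simp
    qed
    have inball: "q + v \<in> ball p R" if "norm v < 2 * s" for v
      using q that s(2) R norm_triangle_ineq[of "q - p" v] by (simp add: dist_norm norm_minus_commute algebra_simps)
    show "let \<nu> = - ((1 / norm (grad \<phi> q)) *\<^sub>R grad \<phi> q) in norm \<nu> = 1 \<and>
       ball (q + s *\<^sub>R \<nu>) s \<subseteq> \<Omega> \<and> ball (q - s *\<^sub>R \<nu>) s \<inter> \<Omega> = {}"
      unfolding Let_def g_def[symmetric] \<nu>_def[symmetric]
    proof (intro conjI nn)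
      have neg: "B * (norm v)\<^sup>2 < norm g * c" if "(norm v)\<^sup>2 < 2 * s * c" for v :: "real^'n" and c
      proof -
        have "2 * s * c > 0" using that by (metis le_less_trans zero_le_power2)
        then have c: "c > 0" using s(1) by (simp add: zero_less_mult_iff)
        have "B * (norm v)\<^sup>2 \<le> B * (2 * s * c)" using that B0 by (intro mult_left_mono) auto
        also have "\<dots> = (2 * s * B) * c" by simp
        also have "\<dots> < m * c" using s(3) c by (rule mult_strict_right_mono)
        also have "\<dots> \<le> norm g * c" using gm(1) c by simp
        finally show ?thesis .
      qed
      show "ball (q + s *\<^sub>R \<nu>) s \<subseteq> \<Omega>"
      proof
        fix z assume z: "z \<in> ball (q + s *\<^sub>R \<nu>) s"
        have v: "(norm (z - q))\<^sup>2 < 2 * s * (\<nu> \<bullet> (z - q))" "norm (z - q) < 2 * s"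
          using sq[of "z - q" \<nu>] z nn by (auto simp: dist_norm norm_minus_commute algebra_simps)
        have "\<phi> z < 0" using est[of "z - q"] neg[OF v(1)] v(2) s(2) R by simp
        then show "z \<in> \<Omega>" using inball[OF v(2)] dom by auto
      qed
      show "ball (q - s *\<^sub>R \<nu>) s \<inter> \<Omega> = {}"
      proof (intro equalityI subsetI; clarsimp)
        fix z assume z: "dist (q - s *\<^sub>R \<nu>) z < s" "z \<in> \<Omega>"
        have "norm ((z - q) - s *\<^sub>R (- \<nu>)) = dist (q - s *\<^sub>R \<nu>) z"
          unfolding dist_norm by (subst norm_minus_commute) (simp add: algebra_simps)
        then have v: "(norm (z - q))\<^sup>2 < 2 * s * ((- \<nu>) \<bullet> (z - q))" "norm (z - q) < 2 * s"
          using sq[of "z - q" "- \<nu>"] z(1) nn by auto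
        have "\<phi> z > 0" using est[of "z - q"] neg[OF v(1)] v(2) s(2) R by simp
        then have "z \<in> \<Omega> \<inter> ball p R" using inball[OF v(2)] z(2) by simp
        then show False using \<open>\<phi> z > 0\<close> unfolding dom by simp
      qed
    qed
  qed
qed

text \<open>The two balls are disjoint, so their centres \<open>q + s *\<^sub>R \<nu>\<close> and
  \<open>q - t *\<^sub>R \<mu>\<close> are at distance at least \<open>s + t\<close>; for unit
  vectors this is possible only if they coincide.\<close>

lemma tangent_balls_unique:
  fixes \<nu> \<mu> :: "'a::real_inner"
  assumes "norm \<nu> = 1" "norm \<mu> = 1" "s > 0" "t > 0"
    and "ball (q + s *\<^sub>R \<nu>) s \<subseteq> \<Omega>" "ball (q - t *\<^sub>R \<mu>) t \<inter> \<Omega> = {}"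
  shows "\<nu> = \<mu>"
proof -
  have "ball (q + s *\<^sub>R \<nu>) s \<inter> ball (q - t *\<^sub>R \<mu>) t = {}" using assms(5,6) by blast
  then have "s + t \<le> norm (s *\<^sub>R \<nu> + t *\<^sub>R \<mu>)"
    using disjoint_balls_dist[OF assms(3,4)] by (fastforce simp: dist_norm)
  then have "(s + t)\<^sup>2 \<le> (norm (s *\<^sub>R \<nu> + t *\<^sub>R \<mu>))\<^sup>2" using assms(3,4) by (intro power_mono) auto
  also have "\<dots> = s\<^sup>2 + t\<^sup>2 + 2 * t * (s * (\<nu> \<bullet> \<mu>))" using assms(1,2) by (simp add: norm_add_scaleR_square)
  finally have "s * t * 1 \<le> s * t * (\<nu> \<bullet> \<mu>)" by (simp add: power2_eq_square algebra_simps)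
  then have "\<nu> \<bullet> \<mu> \<ge> 1" using assms(3,4) by (simp add: mult_le_cancel_left_pos)
  moreover have "(norm (\<nu> - \<mu>))\<^sup>2 = 2 - 2 * (\<nu> \<bullet> \<mu>)"
    using norm_add_scaleR_square[of \<nu> "- 1" \<mu>] assms(1,2) by simp
  ultimately have "(norm (\<nu> - \<mu>))\<^sup>2 \<le> 0" by linarith
  then show ?thesis by simp
qed

lemma smooth_on_subset: "smooth_on S f \<Longrightarrow> T \<subseteq> S \<Longrightarrow> smooth_on T f"
  unfolding smooth_on_def using Ck_on_subset by blast

lemma local_defining_fn_recentre:
  assumes "local_defining_fn \<Omega> p R \<phi>" "q \<in> ball p R"
  shows "local_defining_fn \<Omega> q (R - dist p q) \<phi>"
proof -
  have sub: "ball q (R - dist p q) \<subseteq> ball p R"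
  proof
    fix x assume "x \<in> ball q (R - dist p q)"
    then show "x \<in> ball p R" using dist_triangle[of p x q] by simp
  qed
  have "\<Omega> \<inter> ball q (R - dist p q) = \<Omega> \<inter> ball p R \<inter> ball q (R - dist p q)" using sub by blast
  also have "\<dots> = {x \<in> ball q (R - dist p q). \<phi> x < 0}"
    using assms(1) sub unfolding local_defining_fn_def by blast
  finally show ?thesis
    using assms sub smooth_on_subset unfolding local_defining_fn_def by auto
qed

text \<open>\<open>inward_normal\<close> chooses some defining function. The choice does not matter:
  the interior ball obtained from one and the exterior ball obtained from the other force the same
  vector.\<close>

lemma inward_normal_eq:
  assumes "local_defining_fn \<Omega> q R \<phi>" "q \<in> frontier \<Omega>"
  shows "inward_normal \<Omega> q = - ((1 / norm (grad \<phi> q)) *\<^sub>R grad \<phi> q)"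
proof -
  have "\<exists>R \<phi>. local_defining_fn \<Omega> q R \<phi> \<and> inward_normal \<Omega> q = - ((1 / norm (grad \<phi> q)) *\<^sub>R grad \<phi> q)"
    unfolding inward_normal_def by (rule someI_ex) (use assms(1) in blast)
  then obtain R' \<psi> where psi: "local_defining_fn \<Omega> q R' \<psi>" "inward_normal \<Omega> q = - ((1 / norm (grad \<psi> q)) *\<^sub>R grad \<psi> q)"
    by blast
  obtain s where s: "s > 0" "norm (inward_normal \<Omega> q) = 1" "ball (q + s *\<^sub>R inward_normal \<Omega> q) s \<subseteq> \<Omega>"
    using local_two_ball[OF psi(1)] assms(2) unfolding psi(2) Let_def by (meson centre_in_ball)
  obtain t where "t > 0" "norm (- ((1 / norm (grad \<phi> q)) *\<^sub>R grad \<phi> q)) = 1"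
    "ball (q - t *\<^sub>R (- ((1 / norm (grad \<phi> q)) *\<^sub>R grad \<phi> q))) t \<inter> \<Omega> = {}"
    using local_two_ball[OF assms(1)] assms(2) unfolding Let_def by (meson centre_in_ball)
  then show ?thesis using s by (intro tangent_balls_unique[of _ _ s t q \<Omega>])
qed

lemma ball_tangent_mono:
  fixes q \<nu> :: "'a::real_normed_vector"
  assumes "norm \<nu> = 1" "r \<le> s"
  shows "ball (q + r *\<^sub>R \<nu>) r \<subseteq> ball (q + s *\<^sub>R \<nu>) s"
proof
  fix x assume x: "x \<in> ball (q + r *\<^sub>R \<nu>) r"
  have "dist (q + s *\<^sub>R \<nu>) (q + r *\<^sub>R \<nu>) = s - r"
    using assms by (simp add: dist_norm flip: scaleR_diff_left)
  then show "x \<in> ball (q + s *\<^sub>R \<nu>) s"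
    using x dist_triangle[of "q + s *\<^sub>R \<nu>" x "q + r *\<^sub>R \<nu>"] by simp
qed

text \<open>The local radii are made uniform by a finite subcover of the compact boundary; shrinking
  a tangent ball at its point of tangency keeps it inside the larger one.\<close>

lemma smooth_boundary_two_ball:
  fixes \<Omega> :: "(real^'n) set"
  assumes "open \<Omega>" "bounded \<Omega>" "\<Omega> \<noteq> {}" "smooth_boundary \<Omega>"
  shows "\<exists>r. two_ball_domain \<Omega> r (inward_normal \<Omega>)"
proof -
  let ?\<nu> = "inward_normal \<Omega>"
  have "\<exists>s>0. \<forall>q\<in>ball p s. q \<in> frontier \<Omega> \<longrightarrow> norm (?\<nu> q) = 1 \<and>
       ball (q + s *\<^sub>R ?\<nu> q) s \<subseteq> \<Omega> \<and> ball (q - s *\<^sub>R ?\<nu> q) s \<inter> \<Omega> = {}" if p: "p \<in> frontier \<Omega>" for p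
  proof -
    obtain R \<phi> where \<phi>: "local_defining_fn \<Omega> p R \<phi>" using assms(4) p by (auto simp: smooth_boundary_def)
    obtain s where s: "s > 0" and st: "\<And>q. q \<in> ball p s \<Longrightarrow> q \<in> frontier \<Omega> \<Longrightarrow>
       (let \<nu> = - ((1 / norm (grad \<phi> q)) *\<^sub>R grad \<phi> q) in norm \<nu> = 1 \<and>
       ball (q + s *\<^sub>R \<nu>) s \<subseteq> \<Omega> \<and> ball (q - s *\<^sub>R \<nu>) s \<inter> \<Omega> = {})"
      using local_two_ball[OF \<phi>] by blast
    have R: "R > 0" using \<phi> by (simp add: local_defining_fn_def)
    show ?thesis
    proof (intro exI[of _ "min s R"] conjI ballI impI)
      fix q assume q: "q \<in> ball p (min s R)" "q \<in> frontier \<Omega>"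
      then have "q \<in> ball p s" "q \<in> ball p R" by auto
      then have eq: "?\<nu> q = - ((1 / norm (grad \<phi> q)) *\<^sub>R grad \<phi> q)"
        using inward_normal_eq[OF local_defining_fn_recentre[OF \<phi>] q(2)] by blast
      have *: "norm (?\<nu> q) = 1" "ball (q + s *\<^sub>R ?\<nu> q) s \<subseteq> \<Omega>" "ball (q - s *\<^sub>R ?\<nu> q) s \<inter> \<Omega> = {}"
        using st[OF \<open>q \<in> ball p s\<close> q(2)] unfolding Let_def eq[symmetric] by auto
      then show "norm (?\<nu> q) = 1" by simp
      show "ball (q + min s R *\<^sub>R ?\<nu> q) (min s R) \<subseteq> \<Omega>"
        using ball_tangent_mono[OF *(1), of "min s R" s q] *(2) by auto
      show "ball (q - min s R *\<^sub>R ?\<nu> q) (min s R) \<inter> \<Omega> = {}"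
        using ball_tangent_mono[of "- ?\<nu> q" "min s R" s q] *(1,3) by auto
    qed (use s R in simp)
  qed
  then obtain s where s: "\<And>p. p \<in> frontier \<Omega> \<Longrightarrow> s p > 0"
    "\<And>p q. p \<in> frontier \<Omega> \<Longrightarrow> q \<in> ball p (s p) \<Longrightarrow> q \<in> frontier \<Omega> \<Longrightarrow> norm (?\<nu> q) = 1 \<and>
       ball (q + s p *\<^sub>R ?\<nu> q) (s p) \<subseteq> \<Omega> \<and> ball (q - s p *\<^sub>R ?\<nu> q) (s p) \<inter> \<Omega> = {}"
    by metis
  have "\<exists>I\<subseteq>frontier \<Omega>. finite I \<and> frontier \<Omega> \<subseteq> (\<Union>p\<in>I. ball p (s p))"
  proof (rule compactE_image[of "frontier \<Omega>" "frontier \<Omega>" "\<lambda>p. ball p (s p)"])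
    show "compact (frontier \<Omega>)" using assms(2) by (rule compact_frontier_bounded)
    show "frontier \<Omega> \<subseteq> (\<Union>p\<in>frontier \<Omega>. ball p (s p))" using s(1) by force
  qed auto
  then obtain I where I: "I \<subseteq> frontier \<Omega>" "finite I" "frontier \<Omega> \<subseteq> (\<Union>p\<in>I. ball p (s p))" by blast
  define r where "r = Min (insert 1 (s ` I))"
  have r: "r > 0" "\<And>p. p \<in> I \<Longrightarrow> r \<le> s p"
    unfolding r_def using I(1,2) s(1) by (auto simp: subset_iff)
  have "two_ball_domain \<Omega> r ?\<nu>"
  proof
    fix q assume q: "q \<in> frontier \<Omega>"
    then obtain p where p: "p \<in> I" "q \<in> ball p (s p)" using I(3) by blast
    then have *: "norm (?\<nu> q) = 1" "ball (q + s p *\<^sub>R ?\<nu> q) (s p) \<subseteq> \<Omega>" "ball (q - s p *\<^sub>R ?\<nu> q) (s p) \<inter> \<Omega> = {}"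
      using s(2)[of p q] q I(1) by auto
    show "norm (?\<nu> q) = 1" by (rule *(1))
    show "ball (q + r *\<^sub>R ?\<nu> q) r \<subseteq> \<Omega>"
      using ball_tangent_mono[OF *(1) r(2)[OF p(1)], of q] *(2) by auto
    show "ball (q - r *\<^sub>R ?\<nu> q) r \<inter> \<Omega> = {}"
      using ball_tangent_mono[of "- ?\<nu> q" r "s p" q] *(1,3) r(2)[OF p(1)] by auto
  qed (use assms r in auto)
  then show ?thesis by blast
qed

text \<open>Connects the normal component in the hypothesis of the theorem, defined by the gradient
  of the distance, with the normal at a foot point.\<close>

lemma nfield_eq:
  fixes \<Omega> :: "(real^'n) set"
  assumes "two_ball_domain \<Omega> r \<nu>" "x \<in> \<Omega>" "infdist x (frontier \<Omega>) < r"
    "p \<in> frontier \<Omega>" "x = p + infdist x (frontier \<Omega>) *\<^sub>R \<nu> p"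
  shows "nfield \<Omega> x = \<nu> p"
proof -
  have "(bdist \<Omega> has_derivative (\<lambda>h. \<nu> p \<bullet> h)) (at x)"
    unfolding bdist_def[abs_def] by (rule two_ball_domain.d_has_derivative[OF assms])
  from grad_inner[OF this] have "\<nu> p \<bullet> v = nfield \<Omega> x \<bullet> v" for v by (simp add: nfield_def)
  then show ?thesis by (metis vector_eq_ldot inner_commute)
qed

section \<open>Solenoidal fields\<close>

lemma ex_pos_less_finite:
  fixes S :: "real set"
  assumes "finite S" "\<forall>x\<in>S. 0 < x"
  shows "\<exists>\<epsilon>>0. \<forall>x\<in>S. \<epsilon> < x"
proof -
  define m where "m = Min (insert 1 S)"
  have "m > 0" unfolding m_def using assms by (subst Min_gr_iff) auto
  moreover have "m \<le> x" if "x \<in> S" for x unfolding m_def using that assms(1) by (intro Min_le) auto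
  ultimately show ?thesis by (intro exI[of _ "m / 2"]) force
qed

lemma linear_bound_unit:
  fixes f :: "'a::real_normed_vector \<Rightarrow> 'b::real_normed_vector"
  assumes "linear f" "\<And>e. norm e \<le> 1 \<Longrightarrow> norm (f e) \<le> c"
  shows "norm (f v) \<le> c * norm v"
proof (cases "v = 0")
  case False
  have "f v = f (norm v *\<^sub>R (v /\<^sub>R norm v))" using False by simp
  also have "\<dots> = norm v *\<^sub>R f (v /\<^sub>R norm v)" by (rule linear_scale[OF assms(1)])
  finally have "norm (f v) = norm v * norm (f (v /\<^sub>R norm v))" by simp
  also have "\<dots> \<le> norm v * c" using assms(2)[of "v /\<^sub>R norm v"] False by (intro mult_left_mono) auto
  finally show ?thesis by (simp add: mult.commute)
qed (simp add: linear_0[OF assms(1)])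

lemma linear_bound_Basis:
  fixes f :: "'a::euclidean_space \<Rightarrow> 'b::real_normed_vector"
  assumes "linear f" "\<And>e. e \<in> Basis \<Longrightarrow> norm (f e) \<le> c"
  shows "norm (f v) \<le> real DIM('a) * c * norm v"
proof -
  have "f v = (\<Sum>e\<in>Basis. (v \<bullet> e) *\<^sub>R f e)"
    by (subst (1) euclidean_representation[of v, symmetric])
       (simp add: linear_sum[OF assms(1)] linear_scale[OF assms(1)] del: euclidean_representation)
  also have "norm \<dots> \<le> (\<Sum>e\<in>(Basis::'a set). norm v * c)"
    unfolding norm_scaleR by (intro sum_norm_le) (auto intro!: mult_mono assms(2) Basis_le_norm)
  finally show ?thesis by (simp add: mult_ac)
qed

lemma integral_split_bound:
  fixes F :: "'a::euclidean_space \<Rightarrow> 'b::euclidean_space"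
  assumes "\<And>x. norm (F x) \<le> a * indicator A x + b * indicator B x"
    and "A \<in> sets borel" "B \<in> sets borel" "bounded A" "bounded B" "a \<ge> 0" "b \<ge> 0"
  shows "norm (LINT x|lborel. F x) \<le> a * measure lborel A + b * measure lborel B"
proof (cases "integrable lborel F")
  case True
  have fin: "emeasure lborel A < \<infinity>" "emeasure lborel B < \<infinity>" using emeasure_bounded_finite assms by auto
  have "norm (LINT x|lborel. F x) \<le> (LINT x|lborel. norm (F x))" by (rule integral_norm_bound)
  also have "\<dots> \<le> (LINT x|lborel. a * indicator A x + b * indicator B x)"
    using assms fin True
    by (intro integral_mono Bochner_Integration.integrable_add integrable_mult_right integrable_real_indicator integrable_norm) auto
  also have "\<dots> = a * measure lborel A + b * measure lborel B"
    using assms fin by (subst Bochner_Integration.integral_add) (auto intro!: integrable_mult_right integrable_real_indicator)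
  finally show ?thesis .
next
  case False
  then show ?thesis using assms by (simp add: not_integrable_integral_eq)
qed

lemma eq_0_if_arbitrarily_small:
  fixes I :: "'a::real_normed_vector"
  assumes "\<And>\<eta>. 0 < \<eta> \<Longrightarrow> norm I \<le> K * \<eta>"
  shows "I = 0"
proof (rule ccontr)
  assume "I \<noteq> 0"
  define \<eta> where "\<eta> = norm I / (2 * (\<bar>K\<bar> + 1))"
  have "\<eta> > 0" unfolding \<eta>_def using \<open>I \<noteq> 0\<close> by (simp add: add_nonneg_pos)
  then have "norm I \<le> K * \<eta>" by (rule assms)
  also have "\<dots> \<le> (\<bar>K\<bar> + 1) * \<eta>" using \<open>\<eta> > 0\<close> by (intro mult_right_mono) auto
  also have "\<dots> = norm I / 2" unfolding \<eta>_def by (simp add: field_simps)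
  finally show False using \<open>I \<noteq> 0\<close> by simp
qed

context two_ball_domain
begin

text \<open>By \<open>half_space_approx\<close> this contains the part of the ball where the domain
  and its tangent half-space at \<open>p\<close> differ.\<close>

definition slab :: "'a \<Rightarrow> real \<Rightarrow> 'a set" where
  "slab p R = {x \<in> ball p R. \<bar>(x - p) \<bullet> \<nu> p\<bar> \<le> R\<^sup>2 / (2 * r)}"

lemma dom_borel: "\<Omega> \<in> sets borel" using open_dom by simp

end

context shifted_domain
begin

text \<open>Width of the boundary layer in units of \<epsilon>: at distance at least
  \<open>A * \<epsilon>\<close> from the boundary the kernels see only interior points. The same
  number bounds the reach of the kernels in space-time.\<close>

definition A :: real where "A = W + 4"

lemma A_pos: "A \<ge> 4" using W_nonneg by (simp add: A_def)

lemma indicator_integrable: "integrable lborel (\<lambda>x. indicator \<Omega> x :: real)"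
  using dom_borel emeasure_bounded_finite[OF bounded_dom] by (intro integrable_real_indicator) auto

lemma interior_ball_near:
  assumes "y \<in> \<Omega>" "d y \<ge> A * \<epsilon>" "\<epsilon> > 0"
  shows "ball y ((W + 2) * \<epsilon>) \<subseteq> \<Omega>"
proof -
  have "(W + 2) * \<epsilon> \<le> A * \<epsilon>" using assms(3) by (simp add: A_def)
  then show ?thesis using ball_d_subset[OF assms(1)] assms(2) by auto
qed

text \<open>The image of \<open>closure \<Omega> \<times> cball 0 \<epsilon>\<close> is compact. A
  point of the closure is replaced by a nearby point of the domain at a cost below \<epsilon>, which
  the balls of radius \<open>3 * \<epsilon>\<close> in \<open>shift_into_domain\<close> can
  afford.\<close>

lemma support_compact:
  "\<exists>\<epsilon>0>0. \<forall>\<epsilon>. 0 < \<epsilon> \<and> \<epsilon> < \<epsilon>0 \<longrightarrow> (\<exists>K. compact K \<and> K \<subseteq> \<Omega> \<and>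
     (\<forall>x\<in>\<Omega>. \<forall>y. norm (y - (x + \<epsilon> *\<^sub>R w x)) < \<epsilon> \<longrightarrow> y \<in> K))"
proof -
  obtain \<epsilon>0 where e0: "\<epsilon>0 > 0" "\<And>\<epsilon> x. 0 < \<epsilon> \<Longrightarrow> \<epsilon> < \<epsilon>0 \<Longrightarrow> x \<in> \<Omega> \<Longrightarrow> ball (x + \<epsilon> *\<^sub>R w x) (3 * \<epsilon>) \<subseteq> \<Omega>"
    using shift_into_domain by blast
  have "\<exists>K. compact K \<and> K \<subseteq> \<Omega> \<and> (\<forall>x\<in>\<Omega>. \<forall>y. norm (y - (x + \<epsilon> *\<^sub>R w x)) < \<epsilon> \<longrightarrow> y \<in> K)"
    if eps: "0 < \<epsilon>" "\<epsilon> < \<epsilon>0" for \<epsilon>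
  proof (intro exI[of _ "(\<lambda>z. fst z + \<epsilon> *\<^sub>R w (fst z) + snd z) ` (closure \<Omega> \<times> cball 0 \<epsilon>)"] conjI ballI allI impI)
    have "continuous_on (closure \<Omega> \<times> cball 0 \<epsilon>) (\<lambda>z. w (fst z))"
      by (rule continuous_on_compose2[OF continuous]) (auto intro!: continuous_intros)
    then show "compact ((\<lambda>z. fst z + \<epsilon> *\<^sub>R w (fst z) + snd z) ` (closure \<Omega> \<times> cball 0 \<epsilon>))"
      using bounded_dom by (intro compact_continuous_image compact_Times) (auto intro!: continuous_intros)
    show "(\<lambda>z. fst z + \<epsilon> *\<^sub>R w (fst z) + snd z) ` (closure \<Omega> \<times> cball 0 \<epsilon>) \<subseteq> \<Omega>"
    proof clarsimp
      fix x \<zeta> :: 'a assume x: "x \<in> closure \<Omega>" and \<zeta>: "norm \<zeta> \<le> \<epsilon>"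
      have "\<epsilon> / (1 + \<epsilon> * L) > 0" using eps L_nonneg by (simp add: add_pos_nonneg)
      then obtain x' where x': "x' \<in> \<Omega>" "dist x' x < \<epsilon> / (1 + \<epsilon> * L)"
        using x by (auto simp: closure_approachable)
      have "norm (\<epsilon> *\<^sub>R w x - \<epsilon> *\<^sub>R w x') \<le> \<epsilon> * (L * norm (x - x'))"
        using lipschitz[of x x'] eps by (simp flip: scaleR_diff_right)
      moreover have "norm (x - x') * (1 + \<epsilon> * L) < \<epsilon>"
        using x'(2) eps L_nonneg by (simp add: dist_norm norm_minus_commute pos_less_divide_eq add_pos_nonneg)
      moreover have "norm ((x + \<epsilon> *\<^sub>R w x + \<zeta>) - (x' + \<epsilon> *\<^sub>R w x')) \<le> norm (x - x') + norm (\<epsilon> *\<^sub>R w x - \<epsilon> *\<^sub>R w x') + norm \<zeta>"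
        using norm_triangle_ineq[of "(x - x') + (\<epsilon> *\<^sub>R w x - \<epsilon> *\<^sub>R w x')" \<zeta>] norm_triangle_ineq[of "x - x'" "\<epsilon> *\<^sub>R w x - \<epsilon> *\<^sub>R w x'"]
        by (simp add: algebra_simps)
      ultimately have "norm ((x + \<epsilon> *\<^sub>R w x + \<zeta>) - (x' + \<epsilon> *\<^sub>R w x')) < 3 * \<epsilon>"
        using \<zeta> eps by (simp add: algebra_simps)
      then have "x + \<epsilon> *\<^sub>R w x + \<zeta> \<in> ball (x' + \<epsilon> *\<^sub>R w x') (3 * \<epsilon>)"
        by (simp add: dist_norm norm_minus_commute)
      then show "x + \<epsilon> *\<^sub>R w x + \<zeta> \<in> \<Omega>" using e0(2)[OF eps x'(1)] by blast
    qed
    fix x y assume "x \<in> \<Omega>" "norm (y - (x + \<epsilon> *\<^sub>R w x)) < \<epsilon>"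
    then show "y \<in> (\<lambda>z. fst z + \<epsilon> *\<^sub>R w (fst z) + snd z) ` (closure \<Omega> \<times> cball 0 \<epsilon>)"
      using closure_subset by (intro image_eqI[of _ _ "(x, y - (x + \<epsilon> *\<^sub>R w x))"]) auto
  qed
  then show ?thesis using e0(1) by blast
qed

text \<open>In general the derivative of the mollified indicator is of order
  \<open>1/\<epsilon>\<close>. For a tangential direction the half-space at \<open>p\<close> is an
  invariant set, and \<open>dpmoll_bound\<close> leaves only the slab, whose measure is
  \<open>O(\<epsilon>)\<close> relative to the support of the kernel; this cancels the
  denominator.\<close>

lemma cutoff_tangential:
  "\<exists>K\<ge>0. \<exists>\<epsilon>0>0. \<forall>\<epsilon> y p e. 0 < \<epsilon> \<longrightarrow> \<epsilon> < \<epsilon>0 \<longrightarrow> p \<in> frontier \<Omega> \<longrightarrow> dist y p < A * \<epsilon> \<longrightarrow> e \<bullet> \<nu> p = 0 \<longrightarrow>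
     \<bar>dpmoll \<epsilon> w e (\<lambda>x. indicator \<Omega> x :: real) y\<bar> \<le> K * norm e"
proof -
  define K where "K = C * (1 + 3 * (2 * A) / r * measure lborel (ball (0::'a) (4 * A)))"
  have K: "K \<ge> 0" unfolding K_def using C_ge(4) A_pos r_pos by simp
  have "\<bar>dpmoll \<epsilon> w e (\<lambda>x. indicator \<Omega> x :: real) y\<bar> \<le> K * norm e"
    if eps: "0 < \<epsilon>" "\<epsilon> < r / (3 * A)" and p: "p \<in> frontier \<Omega>" "dist y p < A * \<epsilon>" "e \<bullet> \<nu> p = 0" for \<epsilon> y p e
  proof -
    define R where "R = 2 * A * \<epsilon>"
    have R: "R > 0" "3 * (R\<^sup>2 / (2 * r)) \<le> R"
    proof -
      show "R > 0" using A_pos eps by (simp add: R_def)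
      have "3 * R \<le> 2 * r" using eps A_pos by (simp add: R_def pos_less_divide_eq mult_ac)
      then have "3 * R * R \<le> 2 * r * R" using \<open>R > 0\<close> by (intro mult_right_mono) auto
      then show "3 * (R\<^sup>2 / (2 * r)) \<le> R" using r_pos by (simp add: power2_eq_square field_simps)
    qed
    let ?\<sigma> = "3 * (2 * A) / r * measure lborel (ball (0::'a) (4 * A)) * \<epsilon>"
    have "norm (dpmoll \<epsilon> w e (\<lambda>x. indicator \<Omega> x :: real) y) \<le> C * (0 + \<epsilon> * 1 + ?\<sigma> * 1) / \<epsilon> * norm e"
    proof (rule dpmoll_bound[OF eps(1) indicator_integrable, where D = \<Omega> and H = "{x. (x - p) \<bullet> \<nu> p > 0}" and S = "slab p R" and ?G0.0 = 1])
      show "{x. 0 < (x - p) \<bullet> \<nu> p} \<in> sets borel"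
        by (intro borel_open open_Collect_less continuous_intros)
      show "x + s *\<^sub>R e \<in> {x. 0 < (x - p) \<bullet> \<nu> p}" if "x \<in> {x. 0 < (x - p) \<bullet> \<nu> p}" for x s
        using that p(3) by (simp add: inner_diff_left inner_add_left)
      have "slab p R = ball p R \<inter> {x. \<bar>(x - p) \<bullet> \<nu> p\<bar> \<le> R\<^sup>2 / (2 * r)}" by (auto simp: slab_def)
      moreover have "closed {x. \<bar>(x - p) \<bullet> \<nu> p\<bar> \<le> R\<^sup>2 / (2 * r)}" by (intro closed_Collect_le continuous_intros)
      ultimately show "slab p R \<in> sets borel" by auto
      show "bounded (slab p R)" using bounded_ball by (rule bounded_subset) (auto simp: slab_def)
      have "measure lborel (slab p R) \<le> 6 * (R\<^sup>2 / (2 * r)) / R * measure lborel (ball p (2 * R))"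
        unfolding slab_def by (rule slab_measure[OF norm_nu[OF p(1)] _ R(2)]) (use R(1) r_pos in simp)
      also have "measure lborel (ball p (2 * R)) = \<epsilon> ^ DIM('a) * measure lborel (ball (0::'a) (4 * A))"
        using measure_lborel_ball_scale[of \<epsilon> "4 * A" p] eps A_pos by (simp add: R_def mult_ac)
      also have "6 * (R\<^sup>2 / (2 * r)) / R = 3 * (2 * A) / r * \<epsilon>"
        using R(1) r_pos by (simp add: R_def power2_eq_square field_simps)
      finally show "measure lborel (slab p R) \<le> ?\<sigma> * \<epsilon> ^ DIM('a)" by (simp add: mult_ac)
      fix x assume x: "norm (y - (x + \<epsilon> *\<^sub>R w y)) < \<epsilon>" "(x \<in> \<Omega>) \<noteq> (x \<in> {x. 0 < (x - p) \<bullet> \<nu> p})"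
      have "norm (x - p) \<le> norm (x - y) + dist y p" unfolding dist_norm using norm_triangle_ineq[of "x - y" "y - p"] by simp
      also have "\<dots> < (W + 1) * \<epsilon> + A * \<epsilon>" using near[OF eps(1) x(1)] p(2) by simp
      also have "\<dots> \<le> R" unfolding R_def A_def using eps by (simp add: algebra_simps)
      finally have "x \<in> ball p R" by (simp add: dist_norm norm_minus_commute)
      then show "x \<in> slab p R" using half_space_approx[OF p(1), of x R] x(2) by (simp add: slab_def)
    qed (use dom_borel in auto)
    also have "C * (0 + \<epsilon> * 1 + ?\<sigma> * 1) / \<epsilon> = K" using eps by (simp add: K_def field_simps)
    finally show ?thesis by simp
  qed
  then show ?thesis using K r_pos A_pos by (intro exI[of _ K] conjI exI[of _ "r / (3 * A)"]) auto
qed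

text \<open>Divergence-free fields tangent to the boundary: no surface integrals are needed, since
  the gradient of the cutoff \<open>pmoll \<epsilon> w 1\<close> is of size \<open>1/\<epsilon>\<close> only in the normal direction.\<close>

lemma tangential_weakly:
  fixes V :: "'a \<Rightarrow> 'a" and g :: "'a \<Rightarrow> real"
  assumes Vc: "continuous_on (closure \<Omega>) V"
    and V': "\<And>x. x \<in> \<Omega> \<Longrightarrow> (V has_derivative V' x) (at x)"
    and V'c: "\<And>e. e \<in> Basis \<Longrightarrow> continuous_on \<Omega> (\<lambda>x. V' x e)"
    and divV: "\<And>x. x \<in> \<Omega> \<Longrightarrow> (\<Sum>b\<in>Basis. V' x b \<bullet> b) = 0"
    and Vn: "\<And>p. p \<in> frontier \<Omega> \<Longrightarrow> V p \<bullet> \<nu> p = 0"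
    and g': "\<And>x. (g has_derivative g' x) (at x)"
    and g'c: "\<And>e. e \<in> Basis \<Longrightarrow> continuous_on UNIV (\<lambda>x. g' x e)"
  shows "(LINT x|lborel. indicator \<Omega> x *\<^sub>R g' x (V x)) = 0"
proof -
  have ccl: "compact (closure \<Omega>)" using bounded_dom by simp
  have gc: "continuous_on UNIV g"
    using g' by (auto simp: continuous_on_eq_continuous_at intro: has_derivative_continuous)
  obtain MV where MV: "\<And>x. x \<in> closure \<Omega> \<Longrightarrow> norm (V x) \<le> MV"
    using compact_imp_bounded[OF compact_continuous_image[OF Vc ccl]] unfolding bounded_iff by auto
  obtain Mg where Mg: "\<And>x. x \<in> closure \<Omega> \<Longrightarrow> \<bar>g x\<bar> \<le> Mg"
    using compact_imp_bounded[OF compact_continuous_image[OF continuous_on_subset[OF gc] ccl]] unfolding bounded_iff by auto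
  have g'V: "g' x (V x) = (\<Sum>e\<in>Basis. (V x \<bullet> e) * g' x e)" for x
    by (subst frechet_euclidean_sum[OF g']) simp
  have g'Vc: "continuous_on (closure \<Omega>) (\<lambda>x. g' x (V x))"
    unfolding g'V by (intro continuous_intros Vc continuous_on_subset[OF g'c]) auto
  obtain M1 where M1: "\<And>x. x \<in> closure \<Omega> \<Longrightarrow> \<bar>g' x (V x)\<bar> \<le> M1"
    using compact_imp_bounded[OF compact_continuous_image[OF g'Vc ccl]] unfolding bounded_iff by auto
  obtain x0 where x0: "x0 \<in> \<Omega>" using nonempty by blast
  then have cx0: "x0 \<in> closure \<Omega>" using closure_subset by blast
  have M0: "MV \<ge> 0" "Mg \<ge> 0" "M1 \<ge> 0"
    using order_trans[OF norm_ge_zero MV[OF cx0]] order_trans[OF abs_ge_zero Mg[OF cx0]]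
      order_trans[OF abs_ge_zero M1[OF cx0]] by simp_all
  obtain Ct \<epsilon>1 where Ct: "Ct \<ge> 0" "\<epsilon>1 > 0" and tang: "\<And>\<epsilon> y p e. 0 < \<epsilon> \<Longrightarrow> \<epsilon> < \<epsilon>1 \<Longrightarrow> p \<in> frontier \<Omega> \<Longrightarrow>
      dist y p < A * \<epsilon> \<Longrightarrow> e \<bullet> \<nu> p = 0 \<Longrightarrow> \<bar>dpmoll \<epsilon> w e (\<lambda>x. indicator \<Omega> x :: real) y\<bar> \<le> Ct * norm e"
    using cutoff_tangential by blast
  obtain \<epsilon>2 where e2: "\<epsilon>2 > 0" "\<And>\<epsilon>. 0 < \<epsilon> \<Longrightarrow> \<epsilon> < \<epsilon>2 \<Longrightarrow> (\<exists>K. compact K \<and> K \<subseteq> \<Omega> \<and>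
     (\<forall>x\<in>\<Omega>. \<forall>y. norm (y - (x + \<epsilon> *\<^sub>R w x)) < \<epsilon> \<longrightarrow> y \<in> K))"
    using support_compact by blast
  obtain Cl \<delta>0 where Cl: "Cl \<ge> 0" "\<delta>0 > 0" "\<And>\<delta>. 0 < \<delta> \<Longrightarrow> \<delta> < \<delta>0 \<Longrightarrow> measure lborel {x \<in> \<Omega>. d x < \<delta>} \<le> Cl * \<delta>"
    using layer_measure by blast
  let ?c = "\<lambda>x. indicator \<Omega> x :: real"
  let ?I = "LINT x|lborel. indicator \<Omega> x *\<^sub>R g' x (V x)"
  have key: "norm ?I \<le> (C * M1 + Mg * (C' * MV)) * \<epsilon> * measure lborel \<Omega> + ((1 + C) * M1 + Mg * (C * \<omega> / \<epsilon> + Ct * MV)) * (Cl * (A * \<epsilon>))"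
    if eps: "0 < \<epsilon>" "\<epsilon> < \<epsilon>1" "\<epsilon> < \<epsilon>2" "A * \<epsilon> < \<delta>0"
      and \<omega>: "\<omega> \<ge> 0" "\<And>x y. x \<in> closure \<Omega> \<Longrightarrow> y \<in> closure \<Omega> \<Longrightarrow> dist x y < A * \<epsilon> \<Longrightarrow> norm (V x - V y) \<le> \<omega>" for \<epsilon> \<omega>
  proof -
    define \<xi> where "\<xi> = pmoll \<epsilon> w ?c"
    define \<xi>' where "\<xi>' y e = dpmoll \<epsilon> w e ?c y" for y e
    have chi': "(\<xi> has_derivative \<xi>' y) (at y)" for y
      unfolding \<xi>_def \<xi>'_def by (rule pmoll_has_derivative[OF indicator_integrable eps(1)])
    have chis: "smooth_on UNIV \<xi>" unfolding \<xi>_def by (rule pmoll_smooth[OF indicator_integrable eps(1)])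
    have chi'c: "continuous_on UNIV (\<lambda>y. \<xi>' y e)" if "e \<in> Basis" for e
      using smooth_onD(2)[OF smooth_onD(3)[OF chis that]] by (simp add: frechet_derivative_at[OF chi', symmetric])
    have lin: "linear (\<xi>' y)" for y using chi' has_derivative_linear by blast
    obtain K where K: "compact K" "K \<subseteq> \<Omega>" "\<And>x y. x \<in> \<Omega> \<Longrightarrow> norm (y - (x + \<epsilon> *\<^sub>R w x)) < \<epsilon> \<Longrightarrow> y \<in> K"
      using e2(2)[OF eps(1,3)] by blast
    have chi0: "\<xi> y = 0" if "y \<notin> K" for y
    proof -
      have "kern \<epsilon> (y - (x + \<epsilon> *\<^sub>R w x)) *\<^sub>R ?c x = 0" for x
        using K(3)[of x y] that kern_eq_0[OF eps(1), of "y - (x + \<epsilon> *\<^sub>R w x)"] by (cases "x \<in> \<Omega>") (auto simp: not_less[symmetric])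
      then show ?thesis unfolding \<xi>_def pmoll_def by (simp only:) simp
    qed
    have chi'0: "\<xi>' y e = 0" if "y \<notin> K" for y e
      using frechet_derivative_eq_0[where f=\<xi>, OF compact_imp_closed[OF K(1)] chi0 that]
      by (simp add: frechet_derivative_at[OF chi', symmetric])
    have chi_le: "\<bar>\<xi> y\<bar> \<le> C" for y
    proof -
      have "norm (pmoll \<epsilon> w ?c y - 0) \<le> C * (1 + \<epsilon> * 0)"
        by (rule pmoll_bound[OF eps(1) indicator_integrable]) (auto simp: indicator_def)
      then show ?thesis by (simp add: \<xi>_def)
    qed
    have chi'_le: "\<bar>\<xi>' y e\<bar> \<le> C / \<epsilon> * norm e" for y e
    proof -
      have "norm (dpmoll \<epsilon> w e ?c y) \<le> C * (1 + \<epsilon> * 0) / \<epsilon> * norm e"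
        by (rule dpmoll_bound_local[OF eps(1) indicator_integrable, where ?G0.0 = 0]) (auto simp: indicator_def)
      then show ?thesis by (simp add: \<xi>'_def)
    qed
    have chi_int: "\<bar>\<xi> y - 1\<bar> \<le> C * \<epsilon>" "\<bar>\<xi>' y e\<bar> \<le> C' * \<epsilon> * norm e" if y: "y \<in> \<Omega>" "d y \<ge> A * \<epsilon>" for y e
    proof -
      note sub = interior_ball_near[OF y eps(1)]
      have nearO: "x \<in> \<Omega>" if "norm (y - (x + \<epsilon> *\<^sub>R w x)) < \<epsilon>" for x
      proof -
        have "norm (x - y) < (W + 1) * \<epsilon>" by (rule near[OF eps(1) that])
        then have "x \<in> ball y ((W + 2) * \<epsilon>)" using eps(1) by (simp add: dist_norm norm_minus_commute algebra_simps)
        then show ?thesis using sub by blast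
      qed
      show "\<bar>\<xi> y - 1\<bar> \<le> C * \<epsilon>"
        using pmoll_bound[OF eps(1) indicator_integrable, of y 1 0 1] nearO unfolding \<xi>_def by auto
      have nearO': "x \<in> \<Omega>" if "norm (y - (x + \<epsilon> *\<^sub>R w x)) \<le> \<epsilon>" for x
        using near_le[OF eps(1) that] sub eps(1) by (auto simp: dist_norm norm_minus_commute algebra_simps)
      have "norm (\<xi>' y e) \<le> C' * \<epsilon>" if e: "norm e \<le> 1" for e
      proof -
        have "norm (dpmoll \<epsilon> w e ?c y - (\<lambda>_ _. 0) y e) \<le> C' * (0 + \<epsilon> * 1)"
        proof (rule dpmoll_converges[OF eps(1) indicator_integrable open_dom nearO' _ _ e])
          fix x assume x: "x \<in> \<Omega>"
          show "(?c has_derivative (\<lambda>_. 0)) (at x)"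
            by (rule has_derivative_transform_within_open[where f="\<lambda>_. 1" and s=\<Omega>]) (use x open_dom in auto)
        qed (use nearO y(1) in auto)
        then show ?thesis by (simp add: \<xi>'_def)
      qed
      then show "\<bar>\<xi>' y e\<bar> \<le> C' * \<epsilon> * norm e"
        using linear_bound_unit[OF lin[of y], of "C' * \<epsilon>" e] by simp
    qed
    \<comment> \<open>The normal component of \<open>V\<close> is at most \<open>\<omega>\<close>,
      since it vanishes at the foot, and meets a derivative of order \<open>1/\<epsilon>\<close>;
      the tangential component meets the bounded derivative of
      \<open>cutoff_tangential\<close>.\<close>
    have chi_lay: "\<bar>\<xi>' y (V y)\<bar> \<le> C * \<omega> / \<epsilon> + Ct * MV" if y: "y \<in> \<Omega>" "d y < A * \<epsilon>" for y
    proof -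
      obtain p where p: "p \<in> frontier \<Omega>" "dist y p = d y" using ex_foot y(1) by blast
      define a where "a = V y \<bullet> \<nu> p"
      have cl: "y \<in> closure \<Omega>" "p \<in> closure \<Omega>" using y(1) closure_subset p(1) by (auto simp: frontier_def)
      have "a = (V y - V p) \<bullet> \<nu> p" using Vn[OF p(1)] by (simp add: a_def inner_diff_left)
      also have "\<bar>\<dots>\<bar> \<le> norm (V y - V p) * norm (\<nu> p)" by (rule Cauchy_Schwarz_ineq2)
      also have "\<dots> \<le> \<omega>" using \<omega>(2)[OF cl] p(2) y(2) norm_nu[OF p(1)] by simp
      finally have a: "\<bar>a\<bar> \<le> \<omega>" .
      have orth: "(V y - a *\<^sub>R \<nu> p) \<bullet> \<nu> p = 0" using nu_nu[OF p(1)] by (simp add: a_def inner_diff_left)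
      have "(norm (V y - a *\<^sub>R \<nu> p))\<^sup>2 = (norm (V y))\<^sup>2 - a\<^sup>2"
        using norm_add_scaleR_square[of "V y" "- a" "\<nu> p"] norm_nu[OF p(1)] by (simp add: a_def[symmetric] power2_eq_square)
      then have "(norm (V y - a *\<^sub>R \<nu> p))\<^sup>2 \<le> (norm (V y))\<^sup>2" by simp
      then have "norm (V y - a *\<^sub>R \<nu> p) \<le> norm (V y)" by (rule power2_le_imp_le) simp
      then have nt: "norm (V y - a *\<^sub>R \<nu> p) \<le> MV" using MV[OF cl(1)] by linarith
      have "\<xi>' y (V y) = a * \<xi>' y (\<nu> p) + \<xi>' y (V y - a *\<^sub>R \<nu> p)"
        by (simp add: linear_diff[OF lin] linear_scale[OF lin])
      moreover have "\<bar>a * \<xi>' y (\<nu> p)\<bar> \<le> \<omega> * (C / \<epsilon>)"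
        unfolding abs_mult using chi'_le[of y "\<nu> p"] norm_nu[OF p(1)] a \<omega>(1) by (intro mult_mono) auto
      moreover have "\<bar>\<xi>' y (V y - a *\<^sub>R \<nu> p)\<bar> \<le> Ct * MV"
      proof -
        have "\<bar>\<xi>' y (V y - a *\<^sub>R \<nu> p)\<bar> \<le> Ct * norm (V y - a *\<^sub>R \<nu> p)"
          unfolding \<xi>'_def using tang[OF eps(1,2) p(1) _ orth] p(2) y(2) by simp
        also have "\<dots> \<le> Ct * MV" using nt Ct(1) by (rule mult_left_mono)
        finally show ?thesis .
      qed
      ultimately show ?thesis by (simp add: mult.commute)
    qed
    \<comment> \<open>Components of the field \<open>\<xi> g V\<close>, which has compact support in
      the domain, so its divergence integrates to 0. As \<open>V\<close> is solenoidal, this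
      divergence is \<open>\<xi> x * g' x (V x) + g x * \<xi>' x (V x)\<close>.\<close>
    define f where "f b x = \<xi> x * g x * (V x \<bullet> b)" for b x
    define f' where "f' b x h = (if x \<in> \<Omega> then \<xi> x * g x * (V' x h \<bullet> b) + (\<xi> x * g' x h + \<xi>' x h * g x) * (V x \<bullet> b) else 0)" for b x h
    have df: "(f b has_derivative f' b x) (at x)" for b x
    proof (cases "x \<in> \<Omega>")
      case True
      then show ?thesis unfolding f_def[abs_def] f'_def[abs_def]
        by (auto intro!: derivative_eq_intros chi' g' V' simp: algebra_simps)
    next
      case False
      have "(f b has_derivative (\<lambda>_. 0)) (at x)"
        by (rule has_derivative_transform_within_open[where f="\<lambda>_. 0" and s="- K"])
           (use False K chi0 in \<open>auto simp: f_def compact_imp_closed open_Compl\<close>)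
      then show ?thesis using False by (simp add: f'_def[abs_def])
    qed
    have VO: "continuous_on \<Omega> V" using continuous_on_subset[OF Vc closure_subset] .
    have contf: "continuous_on UNIV (\<lambda>x. f' b x b)" if b: "b \<in> Basis" for b
    proof -
      have "continuous_on (\<Omega> \<union> - K) (\<lambda>x. f' b x b)"
      proof (rule continuous_on_open_Un)
        have "continuous_on \<Omega> (\<lambda>x. \<xi> x * g x * (V' x b \<bullet> b) + (\<xi> x * g' x b + \<xi>' x b * g x) * (V x \<bullet> b))"
          by (intro continuous_intros VO V'c[OF b] continuous_on_subset[OF g'c[OF b]] continuous_on_subset[OF gc]
              continuous_on_subset[OF chi'c[OF b]] continuous_on_subset[OF smooth_onD(2)[OF chis]]) auto
        then show "continuous_on \<Omega> (\<lambda>x. f' b x b)" by (rule continuous_on_eq) (simp add: f'_def)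
        show "continuous_on (- K) (\<lambda>x. f' b x b)"
          by (rule continuous_on_eq[where f="\<lambda>_. 0"]) (auto simp: f'_def chi0 chi'0)
      qed (use open_dom K(1) compact_imp_closed in auto)
      moreover have "\<Omega> \<union> - K = UNIV" using K(2) by blast
      ultimately show ?thesis by simp
    qed
    have int_f: "(LINT x|lborel. f' b x b) = 0" if b: "b \<in> Basis" for b
    proof -
      have "(LINT x|lborel. indicator UNIV x *\<^sub>R f' b x b) = 0"
        by (rule integral_directional_derivative_eq_0[OF df contf[OF b] compact_imp_bounded[OF K(1)]]) (auto simp: f_def chi0)
      then show ?thesis by simp
    qed
    have fi: "integrable lborel (\<lambda>x. f' b x b)" if b: "b \<in> Basis" for b
    proof -
      obtain M where M: "\<And>x. x \<in> K \<Longrightarrow> norm (f' b x b) \<le> M"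
        using compact_imp_bounded[OF compact_continuous_image[OF continuous_on_subset[OF contf[OF b]] K(1)]]
        unfolding bounded_iff by auto
      have f'0: "f' b x b = 0" if "x \<notin> K" for x using that by (simp add: f'_def chi0 chi'0)
      show ?thesis
      proof (rule borel_measurable_compact_support_integrable[OF _ _ f'0])
        show "(\<lambda>x. f' b x b) \<in> borel_measurable borel" using contf[OF b] by (rule borel_measurable_continuous_onI)
        show "norm (f' b x b) \<le> max M 0" for x
          using M[of x] f'0[of x] by (cases "x \<in> K") (auto simp: le_max_iff_disj)
      qed (use K(1) compact_imp_bounded in \<open>auto intro: borel_compact\<close>)
    qed
    have sum_f: "(\<Sum>b\<in>Basis. f' b x b) = indicator \<Omega> x * (\<xi> x * g' x (V x) + g x * \<xi>' x (V x))" for x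
    proof (cases "x \<in> \<Omega>")
      case True
      have "(\<Sum>b\<in>Basis. f' b x b) = \<xi> x * g x * (\<Sum>b\<in>Basis. V' x b \<bullet> b) + \<xi> x * (\<Sum>b\<in>Basis. (V x \<bullet> b) * g' x b) + g x * (\<Sum>b\<in>Basis. (V x \<bullet> b) * \<xi>' x b)"
        using True by (simp add: f'_def sum.distrib sum_distrib_left algebra_simps)
      also have "(\<Sum>b\<in>Basis. (V x \<bullet> b) * \<xi>' x b) = \<xi>' x (V x)" using frechet_euclidean_sum[OF chi'[of x], of "V x"] by simp
      finally show ?thesis using True divV[OF True] by (simp add: g'V)
    qed (simp add: f'_def)
    have "(LINT x|lborel. indicator \<Omega> x * (\<xi> x * g' x (V x) + g x * \<xi>' x (V x))) = (\<Sum>b\<in>Basis. (LINT x|lborel. f' b x b))"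
      unfolding sum_f[symmetric] using fi by (rule Bochner_Integration.integral_sum)
    also have "\<dots> = 0" using int_f by simp
    finally have zero: "(LINT x|lborel. indicator \<Omega> x * (\<xi> x * g' x (V x) + g x * \<xi>' x (V x))) = 0" .
    have i1: "integrable lborel (\<lambda>x. indicator \<Omega> x * (\<xi> x * g' x (V x) + g x * \<xi>' x (V x)))"
      unfolding sum_f[symmetric] using fi by (rule Bochner_Integration.integrable_sum)
    have i2: "integrable lborel (\<lambda>x. indicator \<Omega> x *\<^sub>R g' x (V x))"
    proof (rule borel_measurable_compact_support_integrable)
      show "(\<lambda>x. indicator \<Omega> x *\<^sub>R g' x (V x)) \<in> borel_measurable borel"
        by (rule borel_measurable_continuous_on_indicator[OF dom_borel continuous_on_subset[OF g'Vc closure_subset]])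
      show "norm (indicator \<Omega> x *\<^sub>R g' x (V x)) \<le> M1" for x
        using M1[of x] M0 closure_subset[of \<Omega>] by (auto simp: indicator_def)
    qed (use dom_borel bounded_dom in auto)
    have "?I = ?I - (LINT x|lborel. indicator \<Omega> x * (\<xi> x * g' x (V x) + g x * \<xi>' x (V x)))" using zero by simp
    also have "\<dots> = (LINT x|lborel. indicator \<Omega> x *\<^sub>R g' x (V x) - indicator \<Omega> x * (\<xi> x * g' x (V x) + g x * \<xi>' x (V x)))"
      using i1 i2 by simp
    finally have eqI: "?I = (LINT x|lborel. indicator \<Omega> x *\<^sub>R g' x (V x) - indicator \<Omega> x * (\<xi> x * g' x (V x) + g x * \<xi>' x (V x)))" .
    have bd: "norm (indicator \<Omega> x *\<^sub>R g' x (V x) - indicator \<Omega> x * (\<xi> x * g' x (V x) + g x * \<xi>' x (V x))) \<le>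
        ((C * M1 + Mg * (C' * MV)) * \<epsilon>) * indicator \<Omega> x + ((1 + C) * M1 + Mg * (C * \<omega> / \<epsilon> + Ct * MV)) * indicator {x \<in> \<Omega>. d x < A * \<epsilon>} x" for x
    proof (cases "x \<in> \<Omega>")
      case True
      then have cl: "x \<in> closure \<Omega>" using closure_subset by blast
      have "indicator \<Omega> x *\<^sub>R g' x (V x) - indicator \<Omega> x * (\<xi> x * g' x (V x) + g x * \<xi>' x (V x)) = - ((\<xi> x - 1) * g' x (V x) + g x * \<xi>' x (V x))"
        using True by (simp add: algebra_simps)
      then have n: "norm (indicator \<Omega> x *\<^sub>R g' x (V x) - indicator \<Omega> x * (\<xi> x * g' x (V x) + g x * \<xi>' x (V x))) \<le> \<bar>\<xi> x - 1\<bar> * M1 + Mg * \<bar>\<xi>' x (V x)\<bar>"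
        using mult_left_mono[OF M1[OF cl], of "\<bar>\<xi> x - 1\<bar>"] mult_right_mono[OF Mg[OF cl], of "\<bar>\<xi>' x (V x)\<bar>"]
        by (simp add: abs_mult[symmetric] del: abs_mult)
      show ?thesis
      proof (cases "d x < A * \<epsilon>")
        case lay: True
        have "\<bar>\<xi> x - 1\<bar> * M1 + Mg * \<bar>\<xi>' x (V x)\<bar> \<le> (1 + C) * M1 + Mg * (C * \<omega> / \<epsilon> + Ct * MV)"
          using chi_le[of x] chi_lay[OF True lay] M0 by (intro add_mono mult_right_mono mult_left_mono) auto
        moreover have "0 \<le> (C * M1 + Mg * (C' * MV)) * \<epsilon>" using M0 C_ge(4) C'_nonneg eps(1) by simp
        ultimately show ?thesis using n True lay by simp
      next
        case False
        then have nl: "d x \<ge> A * \<epsilon>" by simp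
        have "\<bar>\<xi>' x (V x)\<bar> \<le> C' * \<epsilon> * MV"
          using chi_int(2)[OF True nl, of "V x"] mult_left_mono[OF MV[OF cl], of "C' * \<epsilon>"] C'_nonneg eps(1) by simp
        then have "\<bar>\<xi> x - 1\<bar> * M1 + Mg * \<bar>\<xi>' x (V x)\<bar> \<le> C * \<epsilon> * M1 + Mg * (C' * \<epsilon> * MV)"
          using chi_int(1)[OF True nl] M0 by (intro add_mono mult_right_mono mult_left_mono) auto
        then show ?thesis using n True False by (simp add: algebra_simps)
      qed
    qed simp
    have "norm ?I \<le> ((C * M1 + Mg * (C' * MV)) * \<epsilon>) * measure lborel \<Omega> + ((1 + C) * M1 + Mg * (C * \<omega> / \<epsilon> + Ct * MV)) * measure lborel {x \<in> \<Omega>. d x < A * \<epsilon>}"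
      unfolding eqI
      by (rule integral_split_bound[OF bd dom_borel _ bounded_dom bounded_subset[OF bounded_dom]])
         (use layer_open M0 C_ge(4) C'_nonneg eps(1) \<omega>(1) Ct(1) in auto)
    also have "\<dots> \<le> ((C * M1 + Mg * (C' * MV)) * \<epsilon>) * measure lborel \<Omega> + ((1 + C) * M1 + Mg * (C * \<omega> / \<epsilon> + Ct * MV)) * (Cl * (A * \<epsilon>))"
      using Cl(3)[of "A * \<epsilon>"] eps A_pos M0 C_ge(4) \<omega>(1) Ct(1) by (intro add_left_mono mult_left_mono) auto
    finally show ?thesis .
  qed
  \<comment> \<open>The only term with denominator \<epsilon> carries \<open>\<omega>\<close> and is
    integrated over a layer of volume \<open>O(\<epsilon>)\<close>, so with \<open>\<eta>\<close>
    for \<open>\<omega>\<close> and \<open>\<epsilon> < \<eta>\<close> everything is at most a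
    multiple of \<open>\<eta>\<close>.\<close>
  define Kc where "Kc = (C * M1 + Mg * (C' * MV)) * measure lborel \<Omega> + ((1 + C) * M1 + Mg * (C + Ct * MV)) * (Cl * A)"
  have small: "norm ?I \<le> Kc * \<eta>" if \<eta>: "0 < \<eta>" for \<eta>
  proof -
    have "uniformly_continuous_on (closure \<Omega>) V" using Vc ccl by (rule compact_uniformly_continuous)
    then obtain \<delta> where \<delta>: "\<delta> > 0" "\<And>x y. x \<in> closure \<Omega> \<Longrightarrow> y \<in> closure \<Omega> \<Longrightarrow> dist x y < \<delta> \<Longrightarrow> dist (V x) (V y) < \<eta>"
      using \<eta> unfolding uniformly_continuous_on_def by (metis dist_commute)
    obtain \<epsilon> where "\<epsilon> > 0" and lt: "\<epsilon> < \<eta>" "\<epsilon> < \<epsilon>1" "\<epsilon> < \<epsilon>2" "\<epsilon> < \<delta> / A" "\<epsilon> < \<delta>0 / A"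
      using ex_pos_less_finite[of "{\<eta>, \<epsilon>1, \<epsilon>2, \<delta> / A, \<delta>0 / A}"] \<eta> Ct(2) e2(1) \<delta>(1) Cl(2) A_pos by auto
    have "\<epsilon> \<le> \<eta>" "\<epsilon> < \<epsilon>1" "\<epsilon> < \<epsilon>2" using lt by auto
    moreover have "A * \<epsilon> < \<delta>" "A * \<epsilon> < \<delta>0"
      using lt(4,5) A_pos by (auto simp: pos_less_divide_eq mult_ac)
    ultimately have "norm ?I \<le> (C * M1 + Mg * (C' * MV)) * \<epsilon> * measure lborel \<Omega> + ((1 + C) * M1 + Mg * (C * \<eta> / \<epsilon> + Ct * MV)) * (Cl * (A * \<epsilon>))"
      using \<open>\<epsilon> > 0\<close> \<eta> \<delta>(2) by (intro key) (auto simp: dist_norm less_imp_le)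
    also have "\<dots> = (C * M1 + Mg * (C' * MV)) * measure lborel \<Omega> * \<epsilon> + ((1 + C) * M1 + Mg * (Ct * MV)) * (Cl * A) * \<epsilon> + Mg * C * (Cl * A) * \<eta>"
      using \<open>\<epsilon> > 0\<close> by (simp add: field_simps)
    also have "\<dots> \<le> (C * M1 + Mg * (C' * MV)) * measure lborel \<Omega> * \<eta> + ((1 + C) * M1 + Mg * (Ct * MV)) * (Cl * A) * \<eta> + Mg * C * (Cl * A) * \<eta>"
      using \<open>\<epsilon> \<le> \<eta>\<close> M0 C_ge(4) C'_nonneg Ct(1) Cl(1) A_pos by (intro add_mono mult_left_mono) auto
    also have "\<dots> = Kc * \<eta>" by (simp add: Kc_def algebra_simps)
    finally show ?thesis .
  qed
  show ?thesis by (rule eq_0_if_arbitrarily_small[OF small])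
qed

text \<open>The hypothesis \<open>sol\<close> admits only test functions that are smooth on the
  whole space, whereas \<open>g\<close> is controlled on the open domain only, with no extension at
  hand. The map \<open>\<Phi> z = z + \<epsilon> w z\<close> sends a neighbourhood of the domain
  into the domain, so \<open>g\<close> composed with \<open>\<Phi>\<close> can be mollified, and the
  gradients converge to that of \<open>g\<close> uniformly on the domain. This is what makes the
  pressure a legitimate test function.\<close>

lemma solenoidal_gradient:
  fixes v :: "'a \<Rightarrow> 'a" and g :: "'a \<Rightarrow> real"
  assumes vi: "integrable lborel (\<lambda>x. indicator \<Omega> x *\<^sub>R v x)"
    and sol: "\<And>\<psi>::'a \<Rightarrow> real. smooth_on UNIV \<psi> \<Longrightarrow> \<exists>K. compact K \<and> (\<forall>x. x \<notin> K \<longrightarrow> \<psi> x = 0) \<Longrightarrow>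
        (LINT x|lborel. indicator \<Omega> x *\<^sub>R frechet_derivative \<psi> (at x) (v x)) = 0"
    and g': "\<And>x. x \<in> \<Omega> \<Longrightarrow> (g has_derivative g' x) (at x)"
    and g'u: "\<And>e. e \<in> Basis \<Longrightarrow> uniformly_continuous_on \<Omega> (\<lambda>x. g' x e)"
  shows "(LINT x|lborel. indicator \<Omega> x *\<^sub>R g' x (v x)) = 0"
proof -
  \<comment> \<open>Zero displacement: the estimates for \<open>pmoll\<close> specialise to ordinary
    mollification.\<close>
  interpret z: shift_field "\<lambda>_::'a. 0::'a" "\<lambda>_ _. 0" 0 0 by standard auto
  have g'c: "continuous_on \<Omega> (\<lambda>x. g' x e)" if "e \<in> Basis" for e
    using g'u[OF that] by (rule uniformly_continuous_imp_continuous)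
  have gc: "continuous_on \<Omega> g"
    using g' by (auto intro!: continuous_at_imp_continuous_on has_derivative_continuous)
  have lin: "linear (g' x)" if "x \<in> \<Omega>" for x using g'[OF that] has_derivative_linear by blast
  have "\<exists>b. \<forall>x\<in>\<Omega>. norm (g' x e) \<le> b" if "e \<in> Basis" for e
    using bounded_uniformly_continuous_image[OF g'u[OF that] bounded_dom] unfolding bounded_iff by auto
  then obtain b where b: "\<And>e x. e \<in> Basis \<Longrightarrow> x \<in> \<Omega> \<Longrightarrow> norm (g' x e) \<le> b e" by metis
  define B where "B = real DIM('a) * (\<Sum>e\<in>Basis. \<bar>b e\<bar>)"
  have B0: "B \<ge> 0" unfolding B_def by (intro mult_nonneg_nonneg sum_nonneg) auto
  have B: "\<bar>g' x h\<bar> \<le> B * norm h" if x: "x \<in> \<Omega>" for x h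
  proof -
    have "norm (g' x e) \<le> (\<Sum>e\<in>Basis. \<bar>b e\<bar>)" if e: "e \<in> Basis" for e
    proof -
      have "norm (g' x e) \<le> \<bar>b e\<bar>" using b[OF e x] by linarith
      also have "\<dots> \<le> (\<Sum>e\<in>Basis. \<bar>b e\<bar>)" using e by (intro member_le_sum) auto
      finally show ?thesis .
    qed
    from linear_bound_Basis[OF lin[OF x] this, of h] show ?thesis by (simp add: B_def)
  qed
  note [measurable] = dom_borel
  have g'm[measurable]: "(\<lambda>x. indicator \<Omega> x *\<^sub>R g' x e) \<in> borel_measurable borel" if "e \<in> Basis" for e
    by (rule borel_measurable_continuous_on_indicator[OF dom_borel g'c[OF that]])
  have vm: "(\<lambda>x. indicator \<Omega> x *\<^sub>R v x) \<in> borel_measurable borel" using vi by auto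
  have int_lin: "integrable lborel (\<lambda>x. indicator \<Omega> x *\<^sub>R f x (v x))"
    if lf: "\<And>x. x \<in> \<Omega> \<Longrightarrow> linear (f x)" and fm: "\<And>e. e \<in> Basis \<Longrightarrow> (\<lambda>x. indicator \<Omega> x *\<^sub>R f x e) \<in> borel_measurable borel"
      and fb: "\<And>x h. x \<in> \<Omega> \<Longrightarrow> \<bar>f x h\<bar> \<le> M * norm h" for f :: "'a \<Rightarrow> 'a \<Rightarrow> real" and M
  proof (rule Bochner_Integration.integrable_bound)
    show "integrable lborel (\<lambda>x. M * norm (indicator \<Omega> x *\<^sub>R v x))"
      using vi by (intro integrable_mult_right integrable_norm)
    have "indicator \<Omega> x *\<^sub>R f x (v x) = (\<Sum>e\<in>Basis. ((indicator \<Omega> x *\<^sub>R v x) \<bullet> e) * (indicator \<Omega> x *\<^sub>R f x e))" for x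
    proof (cases "x \<in> \<Omega>")
      case True
      have "f x (v x) = (\<Sum>e\<in>Basis. (v x \<bullet> e) *\<^sub>R f x e)"
        by (subst (1) euclidean_representation[of "v x", symmetric])
           (simp add: linear_sum[OF lf[OF True]] linear_scale[OF lf[OF True]] del: euclidean_representation)
      then show ?thesis using True by simp
    qed simp
    moreover have "(\<lambda>x. \<Sum>e\<in>Basis. ((indicator \<Omega> x *\<^sub>R v x) \<bullet> e) * (indicator \<Omega> x *\<^sub>R f x e)) \<in> borel_measurable borel"
      using fm vm by (intro borel_measurable_sum borel_measurable_times borel_measurable_inner) auto
    ultimately show "(\<lambda>x. indicator \<Omega> x *\<^sub>R f x (v x)) \<in> borel_measurable lborel" by simp
    show "AE x in lborel. norm (indicator \<Omega> x *\<^sub>R f x (v x)) \<le> norm (M * norm (indicator \<Omega> x *\<^sub>R v x))"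
    proof (intro always_eventually allI)
      fix x show "norm (indicator \<Omega> x *\<^sub>R f x (v x)) \<le> norm (M * norm (indicator \<Omega> x *\<^sub>R v x))"
        using fb[of x "v x"] by (cases "x \<in> \<Omega>") (auto simp: abs_mult intro: order_trans[OF _ mult_right_mono[OF abs_ge_self]])
    qed
  qed
  let ?I = "LINT x|lborel. indicator \<Omega> x *\<^sub>R g' x (v x)"
  obtain \<epsilon>0 where e0: "\<epsilon>0 > 0" "\<And>\<epsilon> x. 0 < \<epsilon> \<Longrightarrow> \<epsilon> < \<epsilon>0 \<Longrightarrow> x \<in> \<Omega> \<Longrightarrow> ball (x + \<epsilon> *\<^sub>R w x) (3 * \<epsilon>) \<subseteq> \<Omega>"
    using shift_into_domain by blast
  have key: "norm ?I \<le> real DIM('a) * (z.C * ((\<eta> + B * (\<epsilon> * L)) + \<epsilon> * B)) * (LINT x|lborel. norm (indicator \<Omega> x *\<^sub>R v x))"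
    if eps: "0 < \<epsilon>" "\<epsilon> < \<epsilon>0" "\<epsilon> * L < 1 / 5" and \<eta>: "\<eta> \<ge> 0"
      "\<And>e x y. e \<in> Basis \<Longrightarrow> x \<in> \<Omega> \<Longrightarrow> y \<in> \<Omega> \<Longrightarrow> dist x y < \<epsilon> * (W + 1) \<Longrightarrow> norm (g' x e - g' y e) \<le> \<eta>" for \<epsilon> \<eta>
  proof -
    define \<Phi> where "\<Phi> z = z + \<epsilon> *\<^sub>R w z" for z
    define N where "N = (\<Union>x\<in>\<Omega>. ball x (2 * \<epsilon>))"
    have No: "open N" unfolding N_def by auto
    have Nb: "bounded N"
    proof -
      obtain R where R: "\<And>x. x \<in> \<Omega> \<Longrightarrow> norm x \<le> R" using bounded_dom by (auto simp: bounded_iff)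
      have "norm z \<le> R + 2 * \<epsilon>" if z: "z \<in> N" for z
      proof -
        obtain x where "x \<in> \<Omega>" "dist x z < 2 * \<epsilon>" using z by (auto simp: N_def)
        then show ?thesis using R[of x] norm_triangle_sub[of z x] by (simp add: dist_norm norm_minus_commute)
      qed
      then show ?thesis by (auto simp: bounded_iff)
    qed
    have \<Phi>c: "continuous_on UNIV \<Phi>" unfolding \<Phi>_def by (intro continuous_intros continuous)
    \<comment> \<open>Points of the closure of \<open>N\<close> are within
      \<open>5 / 2 * \<epsilon>\<close> of the domain and \<open>\<Phi>\<close> has Lipschitz
      constant at most \<open>6 / 5\<close>; the product is the radius \<open>3 * \<epsilon>\<close>
      of \<open>shift_into_domain\<close>. The closure matters because it is compact, which bounds
      \<open>g\<close> composed with \<open>\<Phi>\<close>.\<close>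
    have \<Phi>N: "\<Phi> z \<in> \<Omega>" if z: "z \<in> closure N" for z
    proof -
      obtain z' where z': "z' \<in> N" "dist z' z < \<epsilon> / 2" using z eps(1) half_gt_zero unfolding closure_approachable by blast
      then obtain x where x: "x \<in> \<Omega>" "dist x z' < 2 * \<epsilon>" by (auto simp: N_def)
      have n: "norm (z - x) < 5 / 2 * \<epsilon>" using z'(2) x(2) dist_triangle[of x z z'] by (simp add: dist_norm norm_minus_commute)
      have "norm (\<Phi> z - (x + \<epsilon> *\<^sub>R w x)) \<le> norm (z - x) + norm (\<epsilon> *\<^sub>R (w z - w x))"
        unfolding \<Phi>_def using norm_triangle_ineq[of "z - x" "\<epsilon> *\<^sub>R (w z - w x)"] by (simp add: algebra_simps)
      also have "norm (\<epsilon> *\<^sub>R (w z - w x)) \<le> \<epsilon> * (L * norm (z - x))" using lipschitz[of z x] eps(1) by simp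
      also have "norm (z - x) + \<epsilon> * (L * norm (z - x)) = (1 + \<epsilon> * L) * norm (z - x)" by (simp add: algebra_simps)
      also have "\<dots> \<le> (6 / 5) * norm (z - x)" using eps(3) by (intro mult_right_mono) auto
      also have "\<dots> < 3 * \<epsilon>" using n by simp
      finally have "\<Phi> z \<in> ball (x + \<epsilon> *\<^sub>R w x) (3 * \<epsilon>)" by (simp add: dist_norm norm_minus_commute)
      then show ?thesis using e0(2)[OF eps(1,2) x(1)] by blast
    qed
    have NN: "N \<subseteq> closure N" by (rule closure_subset)
    have "continuous_on (closure N) (\<lambda>z. g (\<Phi> z))"
      by (rule continuous_on_compose2[OF gc continuous_on_subset[OF \<Phi>c]]) (use \<Phi>N in auto)
    then have "bounded ((\<lambda>z. g (\<Phi> z)) ` closure N)"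
      using Nb by (intro compact_imp_bounded compact_continuous_image) auto
    then obtain Mh where Mh: "\<And>z. z \<in> closure N \<Longrightarrow> \<bar>g (\<Phi> z)\<bar> \<le> Mh" by (auto simp: bounded_iff)
    define h where "h z = indicator N z *\<^sub>R g (\<Phi> z)" for z
    have hi: "integrable lborel h"
    proof (rule borel_measurable_compact_support_integrable)
      have "continuous_on N (\<lambda>z. g (\<Phi> z))"
        by (rule continuous_on_compose2[OF gc continuous_on_subset[OF \<Phi>c]]) (use \<Phi>N NN in auto)
      then show "h \<in> borel_measurable borel"
        unfolding h_def[abs_def] using No by (intro borel_measurable_continuous_on_indicator) auto
      show "norm (h x) \<le> \<bar>Mh\<bar>" for x using Mh[of x] NN by (auto simp: h_def indicator_def)
      show "h x = 0" if "x \<notin> N" for x using that by (simp add: h_def)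
    qed (use No Nb in auto)
    have hd: "(h has_derivative (\<lambda>k. g' (\<Phi> z) (k + \<epsilon> *\<^sub>R w' z k))) (at z)" if z: "z \<in> N" for z
    proof (rule has_derivative_transform_within_open[OF _ No z])
      have "(\<Phi> has_derivative (\<lambda>k. k + \<epsilon> *\<^sub>R w' z k)) (at z)"
        unfolding \<Phi>_def by (auto intro!: derivative_eq_intros deriv)
      then show "((\<lambda>z. g (\<Phi> z)) has_derivative (\<lambda>k. g' (\<Phi> z) (k + \<epsilon> *\<^sub>R w' z k))) (at z)"
        by (rule has_derivative_compose) (use \<Phi>N z NN g' in auto)
    qed (simp add: h_def)
    define \<psi> where "\<psi> = pmoll \<epsilon> (\<lambda>_. 0) h"
    define \<psi>' where "\<psi>' y e = dpmoll \<epsilon> (\<lambda>_. 0) e h y" for y e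
    have psi': "(\<psi> has_derivative \<psi>' y) (at y)" for y
      unfolding \<psi>_def \<psi>'_def by (rule z.pmoll_has_derivative[OF hi eps(1)])
    have psis: "smooth_on UNIV \<psi>" unfolding \<psi>_def by (rule z.pmoll_smooth[OF hi eps(1)])
    have supp: "\<exists>K. compact K \<and> (\<forall>y. y \<notin> K \<longrightarrow> \<psi> y = 0)"
    proof -
      obtain R where R: "\<And>z. z \<in> N \<Longrightarrow> norm z \<le> R" using Nb by (auto simp: bounded_iff)
      have "\<psi> y = 0" if y: "y \<notin> cball 0 (R + \<epsilon>)" for y
      proof -
        have "kern \<epsilon> (y - (x + \<epsilon> *\<^sub>R 0)) *\<^sub>R h x = 0" for x
        proof (cases "x \<in> N")
          case True
          then have "norm (y - x) \<ge> \<epsilon>" using y R[OF True] norm_triangle_sub[of y x] by simp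
          then show ?thesis using kern_eq_0[OF eps(1), of "y - x"] by simp
        qed (simp add: h_def)
        then show ?thesis unfolding \<psi>_def pmoll_def by (simp only:) simp
      qed
      then show ?thesis by (intro exI[of _ "cball 0 (R + \<epsilon>)"]) auto
    qed
    let ?err = "z.C * ((\<eta> + B * (\<epsilon> * L)) + \<epsilon> * B)"
    have err: "norm (\<psi>' y e - g' y e) \<le> ?err" if y: "y \<in> \<Omega>" and e: "e \<in> Basis" for y e
    proof -
      have bN: "ball y ((0 + 2) * \<epsilon>) \<subseteq> N" using y by (auto simp: N_def)
      define G1 where "G1 z = indicator N z *\<^sub>R g' (\<Phi> z) (e + \<epsilon> *\<^sub>R w' z e)" for z
      have cN: "continuous_on N (\<lambda>z. g' (\<Phi> z) (e + \<epsilon> *\<^sub>R w' z e))"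
      proof -
        have "continuous_on N (\<lambda>z. \<Sum>c\<in>Basis. ((e + \<epsilon> *\<^sub>R w' z e) \<bullet> c) *\<^sub>R g' (\<Phi> z) c)"
          by (intro continuous_intros continuous_on_subset[OF deriv_continuous]
              continuous_on_compose2[OF g'c continuous_on_subset[OF \<Phi>c]]) (use \<Phi>N NN in auto)
        then show ?thesis
          by (rule continuous_on_eq) (use \<Phi>N NN frechet_euclidean_sum[OF g', symmetric] in blast)
      qed
      have nw: "norm (e + \<epsilon> *\<^sub>R w' z e) \<le> 1 + \<epsilon> * L" for z
        using norm_triangle_ineq[of e "\<epsilon> *\<^sub>R w' z e"] deriv_bound[of z e] e eps(1) by simp (smt (verit) mult_left_mono)
      have G1i: "integrable lborel G1"
      proof (rule borel_measurable_compact_support_integrable)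
        show "G1 \<in> borel_measurable borel"
          unfolding G1_def[abs_def] using No cN by (intro borel_measurable_continuous_on_indicator) auto
        show "norm (G1 x) \<le> B * (1 + \<epsilon> * L)" for x
        proof (cases "x \<in> N")
          case True
          then have "norm (G1 x) \<le> B * norm (e + \<epsilon> *\<^sub>R w' x e)" using B \<Phi>N NN by (auto simp: G1_def)
          also have "\<dots> \<le> B * (1 + \<epsilon> * L)" using nw B0 by (rule mult_left_mono)
          finally show ?thesis .
        qed (use B0 L_nonneg eps(1) in \<open>simp add: G1_def\<close>)
        show "G1 x = 0" if "x \<notin> N" for x using that by (simp add: G1_def)
      qed (use No Nb in auto)
      have "dpmoll \<epsilon> (\<lambda>_. 0) e h y = pmoll \<epsilon> (\<lambda>_. 0) G1 y - \<epsilon> *\<^sub>R (\<Sum>c\<in>Basis. dpmoll \<epsilon> (\<lambda>_. 0) c (\<lambda>x. (0 \<bullet> c) *\<^sub>R h x) y)"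
        by (rule z.dpmoll_parts[OF eps(1) hi No _ hd cN G1i])
           (use bN eps(1) in \<open>auto simp: G1_def dist_norm indicator_def subset_iff\<close>)
      then have "\<psi>' y e = pmoll \<epsilon> (\<lambda>_. 0) G1 y" by (simp add: \<psi>'_def dpmoll_def)
      moreover have "norm (pmoll \<epsilon> (\<lambda>_. 0) G1 y - g' y e) \<le> ?err"
      proof (rule z.pmoll_bound[OF eps(1) G1i])
        fix x assume "norm (y - (x + \<epsilon> *\<^sub>R 0)) < \<epsilon>"
        then have xy: "norm (y - x) < \<epsilon>" by simp
        then have xN: "x \<in> N" using bN eps(1) by (auto simp: dist_norm)
        have \<Phi>x: "\<Phi> x \<in> \<Omega>" using xN \<Phi>N NN by blast
        have "norm (\<Phi> x - y) \<le> norm (x - y) + norm (\<epsilon> *\<^sub>R w x)"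
          unfolding \<Phi>_def using norm_triangle_ineq[of "x - y" "\<epsilon> *\<^sub>R w x"] by (simp add: algebra_simps)
        also have "norm (\<epsilon> *\<^sub>R w x) \<le> \<epsilon> * W" using bound eps(1) by simp
        finally have "dist (\<Phi> x) y < \<epsilon> * (W + 1)" using xy by (simp add: dist_norm norm_minus_commute algebra_simps)
        then have 1: "norm (g' (\<Phi> x) e - g' y e) \<le> \<eta>" by (rule \<eta>(2)[OF e \<Phi>x y])
        have "\<bar>g' (\<Phi> x) (\<epsilon> *\<^sub>R w' x e)\<bar> \<le> B * norm (\<epsilon> *\<^sub>R w' x e)" by (rule B[OF \<Phi>x])
        also have "\<dots> \<le> B * (\<epsilon> * L)" using deriv_bound[of x e] e eps(1) B0 by (intro mult_left_mono) auto
        finally have 2: "\<bar>g' (\<Phi> x) (\<epsilon> *\<^sub>R w' x e)\<bar> \<le> B * (\<epsilon> * L)" .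
        have "G1 x - g' y e = (g' (\<Phi> x) e - g' y e) + g' (\<Phi> x) (\<epsilon> *\<^sub>R w' x e)"
          using xN by (simp add: G1_def linear_add[OF lin[OF \<Phi>x]])
        then show "norm (G1 x - g' y e) \<le> \<eta> + B * (\<epsilon> * L)"
          using 1 2 abs_triangle_ineq[of "g' (\<Phi> x) e - g' y e" "g' (\<Phi> x) (\<epsilon> *\<^sub>R w' x e)"] by simp
      next
        show "norm (g' y e) \<le> B" using B[OF y, of e] e by simp
      qed (use \<eta>(1) B0 L_nonneg eps(1) in auto)
      ultimately show ?thesis by simp
    qed
    have linp: "linear (\<psi>' y)" for y using psi' has_derivative_linear by blast
    have err': "\<bar>\<psi>' y k - g' y k\<bar> \<le> real DIM('a) * ?err * norm k" if y: "y \<in> \<Omega>" for y k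
      using linear_bound_Basis[OF linear_compose_sub[OF linp[of y] lin[OF y]] err[OF y], of k] by simp
    obtain K where K: "compact K" "\<And>y. y \<notin> K \<Longrightarrow> \<psi> y = 0" using supp by blast
    obtain Bp where Bp: "\<And>y k. \<bar>frechet_derivative \<psi> (at y) k\<bar> \<le> Bp * norm k"
      using smooth_compact_support_bounds[OF psis K] by blast
    have Dpsi: "frechet_derivative \<psi> (at y) = \<psi>' y" for y by (rule frechet_derivative_at[OF psi', symmetric])
    have i1: "integrable lborel (\<lambda>x. indicator \<Omega> x *\<^sub>R g' x (v x))"
      by (rule int_lin[OF lin g'm B])
    have i2: "integrable lborel (\<lambda>x. indicator \<Omega> x *\<^sub>R \<psi>' x (v x))"
    proof (rule int_lin[OF linp _ Bp[unfolded Dpsi]])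
      fix e :: 'a assume "e \<in> Basis"
      then have "continuous_on UNIV (\<lambda>x. \<psi>' x e)" using smooth_onD(2)[OF smooth_onD(3)[OF psis]] by (simp add: Dpsi)
      then have "(\<lambda>x. \<psi>' x e) \<in> borel_measurable borel" by (rule borel_measurable_continuous_onI)
      then show "(\<lambda>x. indicator \<Omega> x *\<^sub>R \<psi>' x e) \<in> borel_measurable borel" by measurable
    qed
    have "(LINT x|lborel. indicator \<Omega> x *\<^sub>R \<psi>' x (v x)) = 0" using sol[OF psis supp] by (simp only: Dpsi)
    then have "?I = (LINT x|lborel. indicator \<Omega> x *\<^sub>R g' x (v x) - indicator \<Omega> x *\<^sub>R \<psi>' x (v x))"
      using i1 i2 by simp
    also have "norm \<dots> \<le> (LINT x|lborel. norm (indicator \<Omega> x *\<^sub>R g' x (v x) - indicator \<Omega> x *\<^sub>R \<psi>' x (v x)))"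
      by (rule integral_norm_bound)
    also have "\<dots> \<le> (LINT x|lborel. real DIM('a) * ?err * norm (indicator \<Omega> x *\<^sub>R v x))"
    proof (rule integral_mono)
      show "integrable lborel (\<lambda>x. norm (indicator \<Omega> x *\<^sub>R g' x (v x) - indicator \<Omega> x *\<^sub>R \<psi>' x (v x)))"
        using i1 i2 by (intro integrable_norm Bochner_Integration.integrable_diff)
      show "integrable lborel (\<lambda>x. real DIM('a) * ?err * norm (indicator \<Omega> x *\<^sub>R v x))"
        using vi by (intro integrable_mult_right integrable_norm)
      show "norm (indicator \<Omega> x *\<^sub>R g' x (v x) - indicator \<Omega> x *\<^sub>R \<psi>' x (v x)) \<le> real DIM('a) * ?err * norm (indicator \<Omega> x *\<^sub>R v x)" for x
        using err'[of x "v x"] by (cases "x \<in> \<Omega>") (auto simp: abs_minus_commute)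
    qed
    finally show ?thesis by simp
  qed
  define J where "J = (LINT x|lborel. norm (indicator \<Omega> x *\<^sub>R v x))"
  have J: "J \<ge> 0" unfolding J_def by simp
  have small: "norm ?I \<le> real DIM('a) * (z.C * (1 + B * L + B)) * J * \<eta>" if \<eta>: "0 < \<eta>" for \<eta>
  proof -
    have "\<exists>\<delta>>0. \<forall>x\<in>\<Omega>. \<forall>y\<in>\<Omega>. dist x y < \<delta> \<longrightarrow> norm (g' x e - g' y e) < \<eta>" if "e \<in> Basis" for e
      using g'u[OF that] \<eta> unfolding uniformly_continuous_on_def dist_norm by (metis norm_minus_commute)
    then obtain \<delta> where \<delta>: "\<And>e. e \<in> Basis \<Longrightarrow> \<delta> e > 0"
      "\<And>e x y. e \<in> Basis \<Longrightarrow> x \<in> \<Omega> \<Longrightarrow> y \<in> \<Omega> \<Longrightarrow> dist x y < \<delta> e \<Longrightarrow> norm (g' x e - g' y e) < \<eta>" by metis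
    define \<delta>m where "\<delta>m = Min (\<delta> ` Basis)"
    have \<delta>m: "\<delta>m > 0" "\<And>e. e \<in> Basis \<Longrightarrow> \<delta>m \<le> \<delta> e" unfolding \<delta>m_def using \<delta>(1) by auto
    obtain \<epsilon> where \<epsilon>: "\<epsilon> > 0" "\<epsilon> < \<eta>" "\<epsilon> < \<epsilon>0" "\<epsilon> < 1 / (5 * (L + 1))" "\<epsilon> < \<delta>m / (W + 1)"
      using ex_pos_less_finite[of "{\<eta>, \<epsilon>0, 1 / (5 * (L + 1)), \<delta>m / (W + 1)}"] \<eta> e0(1) \<delta>m(1) L_nonneg W_nonneg by auto
    have "\<epsilon> * L < 1 / 5" using \<epsilon>(1,4) L_nonneg by (simp add: pos_less_divide_eq algebra_simps)
    moreover have dm: "\<epsilon> * (W + 1) < \<delta>m" using \<epsilon>(5) W_nonneg by (simp add: pos_less_divide_eq)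
    have "norm (g' x e - g' y e) \<le> \<eta>" if "e \<in> Basis" "x \<in> \<Omega>" "y \<in> \<Omega>" "dist x y < \<epsilon> * (W + 1)" for e x y
      using \<delta>(2)[OF that(1-3)] \<delta>m(2)[OF that(1)] dm that(4) by simp
    ultimately have "norm ?I \<le> real DIM('a) * (z.C * ((\<eta> + B * (\<epsilon> * L)) + \<epsilon> * B)) * J"
      unfolding J_def using \<epsilon> \<eta> by (intro key) simp_all
    also have "\<dots> \<le> real DIM('a) * (z.C * ((\<eta> + B * (\<eta> * L)) + \<eta> * B)) * J"
      using \<epsilon>(2) J B0 L_nonneg z.C_ge(4) by (intro mult_right_mono mult_left_mono add_mono) auto
    also have "\<dots> = real DIM('a) * (z.C * (1 + B * L + B)) * J * \<eta>" by (simp add: algebra_simps)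
    finally show ?thesis .
  qed
  show ?thesis by (rule eq_0_if_arbitrarily_small[OF small])
qed

end

section \<open>Divergence-free test fields\<close>

context shifted_domain
begin

text \<open>Because of the time component \<open>- 1\<close> the kernel centred at time \<open>t\<close> only sees the times between \<open>t\<close> and
  \<open>t + 2 * \<epsilon>\<close>.\<close>

definition wt :: "'a \<times> real \<Rightarrow> 'a \<times> real" where "wt z = (w (fst z), - 1)"
definition wt' :: "'a \<times> real \<Rightarrow> 'a \<times> real \<Rightarrow> 'a \<times> real" where "wt' z h = (w' (fst z) (fst h), 0)"

lemma shift_field_wt: "shift_field wt wt' (W + 1) L"
proof
  fix x y e :: "'a \<times> real"
  show "norm (wt x) \<le> W + 1"
    using norm_Pair_le[of "w (fst x)" "- 1 :: real"] bound[of "fst x"] by (simp add: wt_def)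
  have "((\<lambda>z. w (fst z)) has_derivative (\<lambda>h. w' (fst x) (fst h))) (at x)"
    by (rule has_derivative_compose[OF _ deriv]) (auto intro!: derivative_eq_intros)
  then show "(wt has_derivative wt' x) (at x)"
    unfolding wt_def[abs_def] wt'_def[abs_def] by (auto intro!: derivative_eq_intros)
  have "norm (w' (fst x) (fst e)) \<le> L * norm (fst e)" by (rule deriv_bound)
  also have "\<dots> \<le> L * norm e" using L_nonneg norm_fst_le[of "fst e" "snd e"] by (intro mult_left_mono) auto
  finally show "norm (wt' x e) \<le> L * norm e" by (simp add: wt'_def)
  have xy: "norm (fst x - fst y) \<le> norm (x - y)" by (metis fst_diff norm_fst_le prod.collapse)
  have "norm (w' (fst x) (fst e) - w' (fst y) (fst e)) \<le> L * norm (fst x - fst y) * norm (fst e)" by (rule deriv_lipschitz)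
  also have "\<dots> \<le> L * norm (x - y) * norm e"
    using L_nonneg norm_fst_le[of "fst e" "snd e"] xy
    by (intro mult_mono mult_nonneg_nonneg) auto
  finally show "norm (wt' x e - wt' y e) \<le> L * norm (x - y) * norm e" by (simp add: wt'_def)
qed

interpretation st: shift_field wt wt' "W + 1" L by (rule shift_field_wt)

lemma wt_near:
  assumes "norm ((y, t) - (z + \<epsilon> *\<^sub>R wt z)) < \<epsilon>"
  shows "t < snd z" "snd z < t + 2 * \<epsilon>" "norm (y - (fst z + \<epsilon> *\<^sub>R w (fst z))) < \<epsilon>"
proof -
  have "(y, t) - (z + \<epsilon> *\<^sub>R wt z) = (y - (fst z + \<epsilon> *\<^sub>R w (fst z)), t - snd z + \<epsilon>)"
    by (simp add: wt_def prod_eq_iff)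
  then have *: "norm (y - (fst z + \<epsilon> *\<^sub>R w (fst z)), t - snd z + \<epsilon>) < \<epsilon>" using assms by simp
  show "norm (y - (fst z + \<epsilon> *\<^sub>R w (fst z))) < \<epsilon>" by (rule order.strict_trans1[OF norm_fst_le *])
  have "norm (t - snd z + \<epsilon>) < \<epsilon>" by (rule order.strict_trans1[OF norm_snd_le *])
  then have "\<bar>t - snd z + \<epsilon>\<bar> < \<epsilon>" by simp
  then show "t < snd z" "snd z < t + 2 * \<epsilon>" by linarith+
qed

lemma wt_near_le:
  assumes "norm ((y, t) - (z + \<epsilon> *\<^sub>R wt z)) \<le> \<epsilon>"
  shows "t \<le> snd z" "snd z \<le> t + 2 * \<epsilon>" "norm (y - (fst z + \<epsilon> *\<^sub>R w (fst z))) \<le> \<epsilon>"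
proof -
  have "(y, t) - (z + \<epsilon> *\<^sub>R wt z) = (y - (fst z + \<epsilon> *\<^sub>R w (fst z)), t - snd z + \<epsilon>)"
    by (simp add: wt_def prod_eq_iff)
  then have *: "norm (y - (fst z + \<epsilon> *\<^sub>R w (fst z)), t - snd z + \<epsilon>) \<le> \<epsilon>" using assms by simp
  show "norm (y - (fst z + \<epsilon> *\<^sub>R w (fst z))) \<le> \<epsilon>" by (rule order_trans[OF norm_fst_le *])
  have "norm (t - snd z + \<epsilon>) \<le> \<epsilon>" by (rule order_trans[OF norm_snd_le *])
  then have "\<bar>t - snd z + \<epsilon>\<bar> \<le> \<epsilon>" by simp
  then show "t \<le> snd z" "snd z \<le> t + 2 * \<epsilon>" by linarith+
qed

text \<open>The argument of \<open>cutoff_tangential\<close> for space-time fields that vary by at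
  most \<open>\<omega>\<close> within the domain. The half-space extends along the time axis, so
  time counts as a tangential direction and the pure time derivative is covered.\<close>

lemma spacetime_tangential:
  "\<exists>K\<ge>0. \<exists>\<epsilon>0>0. \<forall>\<epsilon> y p t e. \<forall>(G::'a \<times> real \<Rightarrow> 'b::euclidean_space) G0 \<omega> g.
    0 < \<epsilon> \<longrightarrow> \<epsilon> < \<epsilon>0 \<longrightarrow> p \<in> frontier \<Omega> \<longrightarrow> dist y p < A * \<epsilon> \<longrightarrow> fst e \<bullet> \<nu> p = 0 \<longrightarrow>
    integrable lborel G \<longrightarrow> (\<forall>z. fst z \<notin> \<Omega> \<longrightarrow> G z = 0) \<longrightarrow> 0 \<le> \<omega> \<longrightarrow> norm G0 \<le> g \<longrightarrow>
    (\<forall>z. fst z \<in> \<Omega> \<longrightarrow> norm ((y, t) - (z + \<epsilon> *\<^sub>R wt z)) < \<epsilon> \<longrightarrow> norm (G z - G0) \<le> \<omega>) \<longrightarrow>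
    norm (dpmoll \<epsilon> wt e G (y, t)) \<le> K * (\<omega> / \<epsilon> + g) * norm e"
proof -
  define v where "v = 3 * (2 * A) / r * measure lborel (ball (0::'a \<times> real) (4 * A))"
  have v: "v \<ge> 0" unfolding v_def using A_pos r_pos by simp
  define K where "K = st.C * (1 + v)"
  have K: "K \<ge> 0" unfolding K_def using st.C_ge(4) v by simp
  have "norm (dpmoll \<epsilon> wt e G (y, t)) \<le> K * (\<omega> / \<epsilon> + g) * norm e"
    if eps: "0 < \<epsilon>" "\<epsilon> < r / (3 * A)" and p: "p \<in> frontier \<Omega>" "dist y p < A * \<epsilon>" "fst e \<bullet> \<nu> p = 0"
      and G: "integrable lborel G" "\<And>z. fst z \<notin> \<Omega> \<Longrightarrow> G z = 0" and \<omega>: "0 \<le> \<omega>" and g: "norm G0 \<le> g"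
      and osc: "\<And>z. fst z \<in> \<Omega> \<Longrightarrow> norm ((y, t) - (z + \<epsilon> *\<^sub>R wt z)) < \<epsilon> \<Longrightarrow> norm (G z - G0) \<le> \<omega>"
    for \<epsilon> y p t e and G :: "'a \<times> real \<Rightarrow> 'b" and G0 \<omega> g
  proof -
    define R where "R = 2 * A * \<epsilon>"
    have R: "R > 0" "3 * (R\<^sup>2 / (2 * r)) \<le> R"
    proof -
      show "R > 0" using A_pos eps by (simp add: R_def)
      have "3 * R \<le> 2 * r" using eps A_pos by (simp add: R_def pos_less_divide_eq mult_ac)
      then have "3 * R * R \<le> 2 * r * R" using \<open>R > 0\<close> by (intro mult_right_mono) auto
      then show "3 * (R\<^sup>2 / (2 * r)) \<le> R" using r_pos by (simp add: power2_eq_square field_simps)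
    qed
    define S where "S = {z \<in> ball (p, t) R. \<bar>(z - (p, t)) \<bullet> (\<nu> p, 0)\<bar> \<le> R\<^sup>2 / (2 * r)}"
    have g0: "g \<ge> 0" using g norm_ge_zero order_trans by blast
    have "norm (dpmoll \<epsilon> wt e G (y, t)) \<le> st.C * (\<omega> + \<epsilon> * g + (v * \<epsilon>) * g) / \<epsilon> * norm e"
    proof (rule st.dpmoll_bound[OF eps(1) G(1), where D = "\<Omega> \<times> UNIV" and H = "{z. (fst z - p) \<bullet> \<nu> p > 0}" and S = S and ?G0.0 = G0])
      show "\<Omega> \<times> UNIV \<in> sets borel" using open_dom by (intro borel_open open_Times) auto
      show "{z. 0 < (fst z - p) \<bullet> \<nu> p} \<in> sets borel"
        by (intro borel_open open_Collect_less continuous_intros)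
      show "z + s *\<^sub>R e \<in> {z. 0 < (fst z - p) \<bullet> \<nu> p}" if "z \<in> {z. 0 < (fst z - p) \<bullet> \<nu> p}" for z s
        using that p(3) by (simp add: inner_diff_left inner_add_left)
      have "S = ball (p, t) R \<inter> {z. \<bar>(z - (p, t)) \<bullet> (\<nu> p, 0)\<bar> \<le> R\<^sup>2 / (2 * r)}" by (auto simp: S_def)
      moreover have "closed {z. \<bar>(z - (p, t)) \<bullet> (\<nu> p, 0)\<bar> \<le> R\<^sup>2 / (2 * r)}" by (intro closed_Collect_le continuous_intros)
      ultimately show "S \<in> sets borel" by auto
      show "bounded S" using bounded_ball by (rule bounded_subset) (auto simp: S_def)
      have "measure lborel S \<le> 6 * (R\<^sup>2 / (2 * r)) / R * measure lborel (ball (p, t) (2 * R))"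
        unfolding S_def by (rule slab_measure[OF _ _ R(2)]) (use R(1) r_pos norm_nu[OF p(1)] in \<open>auto simp: norm_Pair\<close>)
      also have "measure lborel (ball (p, t) (2 * R)) = \<epsilon> ^ DIM('a \<times> real) * measure lborel (ball (0::'a \<times> real) (4 * A))"
        using measure_lborel_ball_scale[of \<epsilon> "4 * A" "(p, t)"] eps A_pos by (simp add: R_def mult_ac)
      also have "6 * (R\<^sup>2 / (2 * r)) / R = 3 * (2 * A) / r * \<epsilon>"
        using R(1) r_pos by (simp add: R_def power2_eq_square field_simps)
      finally show "measure lborel S \<le> (v * \<epsilon>) * \<epsilon> ^ DIM('a \<times> real)" by (simp add: v_def mult_ac)
      fix z assume z: "norm ((y, t) - (z + \<epsilon> *\<^sub>R wt (y, t))) < \<epsilon>" "(z \<in> \<Omega> \<times> UNIV) \<noteq> (z \<in> {z. 0 < (fst z - p) \<bullet> \<nu> p})"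
      have "norm (z - (p, t)) \<le> norm (z - (y, t)) + norm ((y, t) - (p, t))" using dist_triangle[of z "(p, t)" "(y, t)"] by (simp only: dist_norm)
      also have "norm ((y, t) - (p, t)) = dist y p" by (simp add: norm_Pair dist_norm)
      also have "norm (z - (y, t)) + dist y p < ((W + 1) + 1) * \<epsilon> + A * \<epsilon>" using st.near[OF eps(1) z(1)] p(2) by simp
      also have "\<dots> \<le> R" unfolding R_def A_def using eps by (simp add: algebra_simps)
      finally have zR: "norm (z - (p, t)) < R" .
      have "norm (fst z - p) \<le> norm (z - (p, t))" by (metis fst_diff fst_conv norm_fst_le prod.collapse)
      then have "fst z \<in> ball p R" using zR by (simp add: dist_norm norm_minus_commute)
      then have "\<bar>(fst z - p) \<bullet> \<nu> p\<bar> \<le> R\<^sup>2 / (2 * r)" using half_space_approx[OF p(1)] z(2) by (auto simp: mem_Times_iff)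
      then show "z \<in> S" using zR by (simp add: S_def dist_norm norm_minus_commute inner_prod_def)
    qed (use G(2) osc \<omega> g in \<open>auto simp: mem_Times_iff\<close>)
    also have "\<dots> = (st.C * \<omega> / \<epsilon> + st.C * (1 + v) * g) * norm e" using eps by (simp add: field_simps)
    also have "\<dots> \<le> (K * (\<omega> / \<epsilon>) + K * g) * norm e"
    proof (intro mult_right_mono add_mono)
      have "st.C * (\<omega> / \<epsilon>) \<le> K * (\<omega> / \<epsilon>)"
        unfolding K_def using st.C_ge(4) v \<omega> eps by (intro mult_right_mono) (auto simp: algebra_simps)
      then show "st.C * \<omega> / \<epsilon> \<le> K * (\<omega> / \<epsilon>)" by simp
    qed (use g0 in \<open>auto simp: K_def\<close>)
    also have "\<dots> = K * (\<omega> / \<epsilon> + g) * norm e" by (simp add: algebra_simps)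
    finally show ?thesis .
  qed
  then show ?thesis using K r_pos A_pos by (intro exI[of _ K] conjI exI[of _ "r / (3 * A)"]) auto
qed

end

section \<open>Approximation of a solenoidal tangential field by test fields\<close>

text \<open>\<open>V\<close> will be \<open>\<theta> U\<close> with \<open>\<theta>\<close>
  vanishing from time \<open>T'\<close> on; the gap between \<open>T'\<close> and \<open>T\<close>
  lets the kernels look forward in time without leaving the cylinder. \<open>Vsol\<close> says in
  weak form that \<open>V\<close> is solenoidal and tangential at each time, as needed for
  \<open>\<phi>_divergence_free\<close>.\<close>

locale test_field = shifted_domain \<Omega> r \<nu> w w' W L
  for \<Omega> :: "'a::euclidean_space set" and r \<nu> w w' W L +
  fixes T T' g :: real and V :: "'a \<times> real \<Rightarrow> 'a" and V' :: "'a \<times> real \<Rightarrow> 'a \<times> real \<Rightarrow> 'a"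
  assumes T': "0 < T'" "T' < T"
    and Vd: "z \<in> \<Omega> \<times> {0<..<T} \<Longrightarrow> (V has_derivative V' z) (at z)"
    and V'c: "continuous_on (\<Omega> \<times> {0<..<T}) (\<lambda>z. V' z e)"
    and Vg: "z \<in> \<Omega> \<times> {0<..<T} \<Longrightarrow> norm (V z) \<le> g"
    and V'g: "z \<in> \<Omega> \<times> {0<..<T} \<Longrightarrow> norm (V' z e) \<le> g * norm e"
    and V0: "z \<in> \<Omega> \<times> {T'..<T} \<Longrightarrow> V z = 0"
    and V'0: "z \<in> \<Omega> \<times> {T'..<T} \<Longrightarrow> V' z e = 0"
    and Vsol: "0 < s \<Longrightarrow> s < T \<Longrightarrow> (\<And>x. (f has_derivative f' x) (at x)) \<Longrightarrow>
       (\<And>e. e \<in> Basis \<Longrightarrow> continuous_on UNIV (\<lambda>x. f' x e)) \<Longrightarrow>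
       (LINT x|lborel. indicator \<Omega> x *\<^sub>R (f' x (V (x, s)) :: real)) = 0"
begin

interpretation st: shift_field wt wt' "W + 1" L by (rule shift_field_wt)

abbreviation Q :: "('a \<times> real) set" where "Q \<equiv> \<Omega> \<times> {0<..<T}"

text \<open>Multiplying \<open>V\<close> by the derivative of
  \<open>x \<mapsto> x + \<epsilon> w x\<close> before pushing it forward is the Piola transform,
  which preserves solenoidal fields.\<close>

definition \<G> :: "real \<Rightarrow> 'a \<times> real \<Rightarrow> 'a" where
  "\<G> \<epsilon> z = indicator Q z *\<^sub>R (V z + \<epsilon> *\<^sub>R w' (fst z) (V z))"

definition \<phi> :: "real \<Rightarrow> 'a \<times> real \<Rightarrow> 'a" where "\<phi> \<epsilon> = pmoll \<epsilon> wt (\<G> \<epsilon>)"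
definition \<phi>' :: "real \<Rightarrow> 'a \<times> real \<Rightarrow> 'a \<times> real \<Rightarrow> 'a" where "\<phi>' \<epsilon> z e = dpmoll \<epsilon> wt e (\<G> \<epsilon>) z"

lemma g_nonneg: "g \<ge> 0"
proof -
  obtain x where "x \<in> \<Omega>" using nonempty by blast
  then have "(x, T') \<in> Q" using T' by simp
  then show ?thesis using Vg norm_ge_zero order_trans by blast
qed

lemma Q_open: "open Q" using open_dom by (intro open_Times) auto

lemma Q_bounded: "bounded Q" using bounded_dom by (intro bounded_Times) auto

lemma Q_borel [measurable]: "Q \<in> sets borel" using Q_open by simp

lemma V_continuous: "continuous_on Q V"
  using Vd by (auto intro!: continuous_at_imp_continuous_on has_derivative_continuous)

lemma w'_linear: "linear (w' x)"
  using deriv has_derivative_linear by blast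

lemma wV_continuous: "continuous_on Q (\<lambda>z. w' (fst z) (V z))"
proof -
  have "continuous_on Q (\<lambda>z. w' (fst z) b)" for b
    by (rule continuous_on_compose2[OF deriv_continuous]) (auto intro!: continuous_intros)
  then have "continuous_on Q (\<lambda>z. \<Sum>b\<in>Basis. (V z \<bullet> b) *\<^sub>R w' (fst z) b)"
    by (intro continuous_intros V_continuous)
  then show ?thesis
    by (rule continuous_on_eq) (simp add: frechet_euclidean_sum[OF deriv, of _ "V _"])
qed

lemma V_integrable: "integrable lborel (\<lambda>z. indicator Q z *\<^sub>R V z)"
proof (rule borel_measurable_compact_support_integrable)
  show "(\<lambda>z. indicator Q z *\<^sub>R V z) \<in> borel_measurable borel"
    by (rule borel_measurable_continuous_on_indicator[OF Q_borel V_continuous])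
  show "norm (indicator Q z *\<^sub>R V z) \<le> g" for z using Vg[of z] g_nonneg by (auto simp: indicator_def)
  show "indicator Q z *\<^sub>R V z = 0" if "z \<notin> Q" for z using that by simp
qed (use Q_bounded in auto)

lemma wV_bound: "z \<in> Q \<Longrightarrow> norm (w' (fst z) (V z)) \<le> L * g"
  using deriv_bound[of "fst z" "V z"] mult_left_mono[OF Vg L_nonneg] order_trans by blast

lemma wV_integrable: "integrable lborel (\<lambda>z. indicator Q z *\<^sub>R w' (fst z) (V z))"
proof (rule borel_measurable_compact_support_integrable)
  show "(\<lambda>z. indicator Q z *\<^sub>R w' (fst z) (V z)) \<in> borel_measurable borel"
    by (rule borel_measurable_continuous_on_indicator[OF Q_borel wV_continuous])
  show "norm (indicator Q z *\<^sub>R w' (fst z) (V z)) \<le> L * g" for z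
    using wV_bound[of z] g_nonneg L_nonneg by (auto simp: indicator_def)
  show "indicator Q z *\<^sub>R w' (fst z) (V z) = 0" if "z \<notin> Q" for z using that by simp
qed (use Q_bounded in auto)

lemma \<G>_eq: "\<G> \<epsilon> z = indicator Q z *\<^sub>R V z + \<epsilon> *\<^sub>R (indicator Q z *\<^sub>R w' (fst z) (V z))"
  by (simp add: \<G>_def algebra_simps)

lemma \<G>_integrable: "integrable lborel (\<G> \<epsilon>)"
  unfolding \<G>_eq[abs_def] by (intro Bochner_Integration.integrable_add integrable_scaleR_right V_integrable wV_integrable)

lemma \<phi>_has_derivative: "\<epsilon> > 0 \<Longrightarrow> (\<phi> \<epsilon> has_derivative \<phi>' \<epsilon> z) (at z)"
  unfolding \<phi>_def \<phi>'_def[abs_def] by (rule st.pmoll_has_derivative[OF \<G>_integrable])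

lemma \<phi>_smooth: "\<epsilon> > 0 \<Longrightarrow> smooth_on UNIV (\<phi> \<epsilon>)"
  unfolding \<phi>_def by (rule st.pmoll_smooth[OF \<G>_integrable])

text \<open>Separates off the contribution of \<open>Dw\<close>: it carries a factor \<epsilon>, so
  the crude bound of order \<open>1/\<epsilon>\<close> for its derivative is enough except for the
  convergence in the interior.\<close>

lemma \<phi>_split:
  assumes "\<epsilon> > 0"
  shows "\<phi> \<epsilon> z = pmoll \<epsilon> wt (\<lambda>z. indicator Q z *\<^sub>R V z) z + \<epsilon> *\<^sub>R pmoll \<epsilon> wt (\<lambda>z. indicator Q z *\<^sub>R w' (fst z) (V z)) z"
    and "\<phi>' \<epsilon> z e = dpmoll \<epsilon> wt e (\<lambda>z. indicator Q z *\<^sub>R V z) z + \<epsilon> *\<^sub>R dpmoll \<epsilon> wt e (\<lambda>z. indicator Q z *\<^sub>R w' (fst z) (V z)) z"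
proof -
  let ?a = "\<lambda>z. indicator Q z *\<^sub>R V z" and ?b = "\<lambda>z. indicator Q z *\<^sub>R w' (fst z) (V z)"
  have split: "(LINT x|lborel. k x *\<^sub>R \<G> \<epsilon> x) = (LINT x|lborel. k x *\<^sub>R ?a x) + \<epsilon> *\<^sub>R (LINT x|lborel. k x *\<^sub>R ?b x)"
    if "k \<in> borel_measurable borel" "\<And>x. \<bar>k x\<bar> \<le> B" for k B
  proof -
    have i: "integrable lborel (\<lambda>x. k x *\<^sub>R ?a x)" "integrable lborel (\<lambda>x. k x *\<^sub>R ?b x)"
      using integrable_bounded_scaleR[OF V_integrable _ that(2)] integrable_bounded_scaleR[OF wV_integrable _ that(2)] that(1) by auto
    have "(LINT x|lborel. k x *\<^sub>R \<G> \<epsilon> x) = (LINT x|lborel. k x *\<^sub>R ?a x + \<epsilon> *\<^sub>R (k x *\<^sub>R ?b x))"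
      unfolding \<G>_eq by (simp only: scaleR_add_right scaleR_left_commute)
    also have "\<dots> = (LINT x|lborel. k x *\<^sub>R ?a x) + (LINT x|lborel. \<epsilon> *\<^sub>R (k x *\<^sub>R ?b x))"
      by (intro Bochner_Integration.integral_add i(1) integrable_scaleR_right i(2))
    finally show ?thesis by (simp only: integral_scaleR_right)
  qed
  show "\<phi> \<epsilon> z = pmoll \<epsilon> wt ?a z + \<epsilon> *\<^sub>R pmoll \<epsilon> wt ?b z"
    unfolding \<phi>_def pmoll_def by (rule split[OF _ kern_const(2)[OF assms]]) measurable
  show "\<phi>' \<epsilon> z e = dpmoll \<epsilon> wt e ?a z + \<epsilon> *\<^sub>R dpmoll \<epsilon> wt e ?b z"
    unfolding \<phi>'_def dpmoll_def by (rule split[OF _ kern_const(3)[OF assms]]) measurable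
qed

text \<open>The kernel at time \<open>t\<close> sees times between \<open>t\<close> and
  \<open>t + 2 * \<epsilon>\<close>. So \<open>\<phi> \<epsilon>\<close> vanishes from
  \<open>T'\<close> on, but it may extend to negative times down to \<open>- 2 * \<epsilon>\<close>,
  as the class of test fields permits.\<close>

lemma \<phi>_support:
  "\<exists>\<epsilon>0>0. \<forall>\<epsilon>. 0 < \<epsilon> \<longrightarrow> \<epsilon> < \<epsilon>0 \<longrightarrow> (\<exists>K. compact K \<and> K \<subseteq> \<Omega> \<times> {..<T} \<and> (\<forall>z. z \<notin> K \<longrightarrow> \<phi> \<epsilon> z = 0))"
proof -
  obtain \<epsilon>0 where e0: "\<epsilon>0 > 0" "\<And>\<epsilon>. 0 < \<epsilon> \<Longrightarrow> \<epsilon> < \<epsilon>0 \<Longrightarrow> \<exists>K. compact K \<and> K \<subseteq> \<Omega> \<and>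
     (\<forall>x\<in>\<Omega>. \<forall>y. norm (y - (x + \<epsilon> *\<^sub>R w x)) < \<epsilon> \<longrightarrow> y \<in> K)" using support_compact by blast
  have "\<exists>K. compact K \<and> K \<subseteq> \<Omega> \<times> {..<T} \<and> (\<forall>z. z \<notin> K \<longrightarrow> \<phi> \<epsilon> z = 0)" if eps: "0 < \<epsilon>" "\<epsilon> < \<epsilon>0" for \<epsilon>
  proof -
    obtain K where K: "compact K" "K \<subseteq> \<Omega>" "\<And>x y. x \<in> \<Omega> \<Longrightarrow> norm (y - (x + \<epsilon> *\<^sub>R w x)) < \<epsilon> \<Longrightarrow> y \<in> K"
      using e0(2)[OF eps] by blast
    have "\<phi> \<epsilon> (y, t) = 0" if yt: "(y, t) \<notin> K \<times> {- 2 * \<epsilon>..T'}" for y t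
    proof -
      have "kern \<epsilon> ((y, t) - (z + \<epsilon> *\<^sub>R wt z)) *\<^sub>R \<G> \<epsilon> z = 0" for z
      proof (rule ccontr)
        assume *: "\<not> ?thesis"
        then have near: "norm ((y, t) - (z + \<epsilon> *\<^sub>R wt z)) < \<epsilon>"
          using kern_eq_0[OF eps(1), of "(y, t) - (z + \<epsilon> *\<^sub>R wt z)"] by (auto simp: not_less[symmetric])
        have zQ: "z \<in> Q" using * by (auto simp: \<G>_def indicator_def split: if_splits)
        have "snd z < T'"
        proof (rule ccontr)
          assume "\<not> snd z < T'"
          then have "z \<in> \<Omega> \<times> {T'..<T}" using zQ by (auto simp: mem_Times_iff)
          then show False using * V0 linear_0[OF w'_linear] by (auto simp: \<G>_def)
        qed
        moreover have "y \<in> K" using K(3)[of "fst z" y] wt_near(3)[OF near] zQ by (auto simp: mem_Times_iff)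
        moreover have "snd z > 0" using zQ by (auto simp: mem_Times_iff)
        ultimately show False using yt wt_near(1,2)[OF near] by auto
      qed
      then show ?thesis unfolding \<phi>_def pmoll_def by (simp only:) simp
    qed
    then have "\<forall>z. z \<notin> K \<times> {- 2 * \<epsilon>..T'} \<longrightarrow> \<phi> \<epsilon> z = 0" by auto
    moreover have "compact (K \<times> {- 2 * \<epsilon>..T'})" using K(1) by (intro compact_Times) auto
    moreover have "K \<times> {- 2 * \<epsilon>..T'} \<subseteq> \<Omega> \<times> {..<T}" using K(2) T' by auto
    ultimately show ?thesis by blast
  qed
  then show ?thesis using e0(1) by blast
qed

lemma \<phi>'_eq_0:
  assumes "\<epsilon> > 0" "t \<ge> T'"
  shows "\<phi>' \<epsilon> (y, t) e = 0"
proof -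
  have "dkern \<epsilon> ((y, t) - (z + \<epsilon> *\<^sub>R wt z)) e *\<^sub>R \<G> \<epsilon> z = 0" for z
  proof (rule ccontr)
    assume *: "\<not> ?thesis"
    then have near: "norm ((y, t) - (z + \<epsilon> *\<^sub>R wt z)) < \<epsilon>"
      using dkern_eq_0[OF assms(1), of "(y, t) - (z + \<epsilon> *\<^sub>R wt z)" e] by (auto simp: not_less[symmetric])
    have zQ: "z \<in> Q" using * by (auto simp: \<G>_def indicator_def split: if_splits)
    then have "z \<in> \<Omega> \<times> {T'..<T}" using wt_near(1)[OF near] assms(2) by (auto simp: mem_Times_iff)
    then show False using * V0 linear_0[OF w'_linear] by (auto simp: \<G>_def)
  qed
  then show ?thesis unfolding \<phi>'_def dpmoll_def by (simp only:) simp
qed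

text \<open>This is where the factor \<open>I + \<epsilon> Dw\<close> in \<open>\<G>\<close> is needed: it turns the divergence of the kernel into
  the spatial gradient of \<open>x \<mapsto> K (y - x - \<epsilon> w x)\<close>, against which \<open>V\<close> integrates to zero.\<close>

lemma \<phi>_divergence_free:
  assumes "\<epsilon> > 0"
  shows "(\<Sum>b\<in>Basis. \<phi>' \<epsilon> (y, t) (b, 0) \<bullet> b) = 0"
proof -
  define k where "k z = (y, t) - (z + \<epsilon> *\<^sub>R wt z)" for z
  have km: "k \<in> borel_measurable borel" unfolding k_def by measurable
  have i: "integrable lborel (\<lambda>z. dkern \<epsilon> (k z) e *\<^sub>R \<G> \<epsilon> z)" for e
    by (rule integrable_bounded_scaleR[OF \<G>_integrable _ kern_const(3)[OF assms]]) (use km in measurable)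
  define F where "F z = (\<Sum>b\<in>Basis. dkern \<epsilon> (k z) (b, 0) *\<^sub>R \<G> \<epsilon> z \<bullet> b)" for z
  have Fi: "integrable lborel F" unfolding F_def using i by (intro Bochner_Integration.integrable_sum integrable_inner_left)
  have "(\<Sum>b\<in>Basis. \<phi>' \<epsilon> (y, t) (b, 0) \<bullet> b) = (LINT z|lborel. F z)"
  proof -
    have "(LINT z|lborel. F z) = (\<Sum>b\<in>Basis. (LINT z|lborel. dkern \<epsilon> (k z) (b, 0) *\<^sub>R \<G> \<epsilon> z \<bullet> b))"
      unfolding F_def by (rule Bochner_Integration.integral_sum) (rule integrable_inner_left, rule i)
    also have "\<dots> = (\<Sum>b\<in>Basis. (LINT z|lborel. dkern \<epsilon> (k z) (b, 0) *\<^sub>R \<G> \<epsilon> z) \<bullet> b)"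
      by (rule sum.cong[OF refl], rule integral_inner_left, rule i)
    finally show ?thesis unfolding \<phi>'_def dpmoll_def k_def[symmetric] by simp
  qed
  also have "\<dots> = (LINT s|lborel. (LINT x|lborel. F (x, s)))"
    using lborel_pair.integral_snd[of "\<lambda>x s. F (x, s)"] Fi unfolding lborel_prod by (simp add: case_prod_beta')
  also have "\<dots> = 0"
  proof -
    have "(LINT x|lborel. F (x, s)) = 0" for s
    proof (cases "0 < s \<and> s < T")
      case True
      define f where "f x = - kern \<epsilon> (k (x, s))" for x
      define f' where "f' x h = dkern \<epsilon> (k (x, s)) (h + \<epsilon> *\<^sub>R w' x h, 0)" for x h
      have kd: "((\<lambda>x. k (x, s)) has_derivative (\<lambda>h. - (h + \<epsilon> *\<^sub>R w' x h, 0))) (at x)" for x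
        unfolding k_def wt_def by (auto intro!: derivative_eq_intros deriv)
      have fd: "(f has_derivative f' x) (at x)" for x
      proof -
        have "((\<lambda>x. kern \<epsilon> (k (x, s))) has_derivative (\<lambda>h. dkern \<epsilon> (k (x, s)) (- (h + \<epsilon> *\<^sub>R w' x h, 0)))) (at x)"
          by (rule has_derivative_compose[OF kd kern_has_derivative])
        from has_derivative_minus[OF this] show ?thesis
          unfolding f_def[abs_def] f'_def[abs_def] by (simp only: linear_neg[OF dkern_linear] minus_minus)
      qed
      have kc: "continuous_on UNIV (\<lambda>x. k (x, s))"
        using kd by (auto simp: continuous_on_eq_continuous_at intro: has_derivative_continuous)
      have f'c: "continuous_on UNIV (\<lambda>x. f' x e)" for e
      proof -
        have "f' x e = (\<Sum>b\<in>Basis. ((e + \<epsilon> *\<^sub>R w' x e, 0::real) \<bullet> b) * dkern \<epsilon> (k (x, s)) b)" for x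
          unfolding f'_def by (subst frechet_euclidean_sum[OF kern_has_derivative]) simp
        moreover have "continuous_on UNIV (\<lambda>x. \<Sum>b\<in>Basis. ((e + \<epsilon> *\<^sub>R w' x e, 0::real) \<bullet> b) * dkern \<epsilon> (k (x, s)) b)"
          by (intro continuous_intros deriv_continuous continuous_on_compose2[OF dkern_continuous kc]) auto
        ultimately show ?thesis by simp
      qed
      have "F (x, s) = indicator \<Omega> x *\<^sub>R f' x (V (x, s))" for x
      proof (cases "x \<in> \<Omega>")
        case xO: True
        let ?v = "V (x, s) + \<epsilon> *\<^sub>R w' x (V (x, s))"
        have "F (x, s) = (\<Sum>b\<in>Basis. (?v \<bullet> b) * dkern \<epsilon> (k (x, s)) (b, 0))"
          using True xO by (simp add: F_def \<G>_def mult.commute)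
        also have "\<dots> = dkern \<epsilon> (k (x, s)) (\<Sum>b\<in>Basis. (?v \<bullet> b) *\<^sub>R (b, 0))"
          by (simp add: linear_sum[OF dkern_linear] linear_scale[OF dkern_linear] del: scaleR_Pair)
        also have "(\<Sum>b\<in>Basis. (?v \<bullet> b) *\<^sub>R (b, 0::real)) = (?v, 0)"
          by (simp add: sum_prod euclidean_representation)
        finally show ?thesis using xO by (simp add: f'_def)
      qed (simp add: F_def \<G>_def)
      then show ?thesis using Vsol[OF _ _ fd f'c] True by simp
    qed (auto simp: F_def \<G>_def)
    then show ?thesis by simp
  qed
  finally show ?thesis .
qed

lemma near_Q:
  assumes eps: "0 < \<epsilon>" "2 * \<epsilon> < T - T'" and t: "0 \<le> t" "t < T'"
    and near: "norm ((y, t) - (z + \<epsilon> *\<^sub>R wt z)) < \<epsilon>" and z: "fst z \<in> \<Omega>"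
  shows "z \<in> Q" "dist z (y, t) < A * \<epsilon>"
proof -
  have "0 < snd z" "snd z < T" using wt_near(1,2)[OF near] eps(2) t by linarith+
  then show "z \<in> Q" using z by (auto simp: mem_Times_iff)
  have "norm (z - (y, t)) < ((W + 1) + 1) * \<epsilon>" by (rule st.near[OF eps(1) near])
  also have "\<dots> \<le> A * \<epsilon>" using eps(1) by (simp add: A_def)
  finally show "dist z (y, t) < A * \<epsilon>" by (simp add: dist_norm)
qed

lemma interior_near_Q:
  assumes eps: "0 < \<epsilon>" "2 * \<epsilon> < T - T'" and t: "0 < t" "t < T'" and y: "y \<in> \<Omega>" "A * \<epsilon> \<le> d y"
    and near: "norm ((y, t) - (z + \<epsilon> *\<^sub>R wt z)) \<le> \<epsilon>"
  shows "z \<in> Q"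
proof -
  have "norm (fst z - y) < (W + 2) * \<epsilon>" using near_le[OF eps(1) wt_near_le(3)[OF near]] .
  then have "fst z \<in> \<Omega>" using interior_ball_near[OF y eps(1)] by (auto simp: dist_norm norm_minus_commute)
  moreover have "0 < snd z" "snd z < T" using wt_near_le(1,2)[OF near] eps(2) t by linarith+
  ultimately show ?thesis by (auto simp: mem_Times_iff)
qed

lemma interior_near_\<Omega>:
  assumes eps: "0 < \<epsilon>" and y: "y \<in> \<Omega>" "A * \<epsilon> \<le> d y"
    and near: "norm ((y, t) - (z + \<epsilon> *\<^sub>R wt z)) \<le> \<epsilon>"
  shows "fst z \<in> \<Omega>"
  using near_le[OF eps(1) wt_near_le(3)[OF near]] interior_ball_near[OF y eps(1)]
  by (auto simp: dist_norm norm_minus_commute)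

lemma wV_oscillation:
  assumes z: "z \<in> Q" "z' \<in> Q" "dist z z' < A * \<epsilon>" and V: "norm (V z - V z') \<le> \<omega>"
  shows "norm (w' (fst z) (V z) - w' (fst z') (V z')) \<le> L * \<omega> + L * (A * \<epsilon>) * g"
proof -
  have zz: "norm (fst z - fst z') \<le> A * \<epsilon>"
    using z(3) norm_fst_le[of "fst z - fst z'" "snd z - snd z'"] unfolding dist_norm by (simp add: minus_prod_def)
  have "w' (fst z) (V z) - w' (fst z') (V z') = w' (fst z) (V z - V z') + (w' (fst z) (V z') - w' (fst z') (V z'))"
    by (simp add: linear_diff[OF w'_linear])
  also have "norm \<dots> \<le> L * norm (V z - V z') + L * norm (fst z - fst z') * norm (V z')"
    by (intro norm_triangle_le add_mono deriv_bound deriv_lipschitz)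
  also have "\<dots> \<le> L * \<omega> + L * (A * \<epsilon>) * g"
    by (intro add_mono mult_left_mono[OF V L_nonneg] mult_mono[OF mult_left_mono[OF zz L_nonneg] Vg[OF z(2)]]
        mult_nonneg_nonneg[OF L_nonneg order_trans[OF norm_ge_zero zz]] norm_ge_zero)
  finally show ?thesis .
qed

text \<open>Four regimes: derivatives of order \<open>1/\<epsilon>\<close> everywhere, convergence
  of derivatives away from the layer, the tangential gain in the layer, and the values at time 0.
  Here \<open>\<omega>\<close> is a modulus of continuity of \<open>V\<close> and \<open>V'\<close>
  at scale \<open>A * \<epsilon>\<close>. The initial value is represented by a free
  \<open>G0\<close>, since time 0 does not belong to the open cylinder on which \<open>V\<close> is
  controlled.\<close>

lemma estimates:
  "\<exists>K\<ge>0. \<exists>\<epsilon>0>0. \<forall>\<epsilon> \<omega>. 0 < \<epsilon> \<longrightarrow> \<epsilon> < \<epsilon>0 \<longrightarrow> 0 \<le> \<omega> \<longrightarrow>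
    (\<forall>z\<in>Q. \<forall>z'\<in>Q. dist z z' < A * \<epsilon> \<longrightarrow> norm (V z - V z') \<le> \<omega> \<and> (\<forall>e. norm e \<le> 1 \<longrightarrow> norm (V' z e - V' z' e) \<le> \<omega>)) \<longrightarrow>
    (\<forall>y\<in>\<Omega>. (\<forall>t e. 0 < t \<longrightarrow> t < T \<longrightarrow>
        norm (\<phi>' \<epsilon> (y, t) e) \<le> K / \<epsilon> * norm e \<and>
        (A * \<epsilon> \<le> d y \<longrightarrow> norm (\<phi>' \<epsilon> (y, t) e - V' (y, t) e) \<le> K * (\<omega> + \<epsilon>) * norm e) \<and>
        (\<forall>p\<in>frontier \<Omega>. dist y p < A * \<epsilon> \<longrightarrow> fst e \<bullet> \<nu> p = 0 \<longrightarrow> norm (\<phi>' \<epsilon> (y, t) e) \<le> K * (\<omega> / \<epsilon> + 1) * norm e)) \<and>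
      norm (\<phi> \<epsilon> (y, 0)) \<le> K \<and>
      (\<forall>G0. A * \<epsilon> \<le> d y \<longrightarrow> norm G0 \<le> g \<longrightarrow> (\<forall>z\<in>Q. dist z (y, 0) < A * \<epsilon> \<longrightarrow> norm (V z - G0) \<le> \<omega>) \<longrightarrow>
         norm (\<phi> \<epsilon> (y, 0) - G0) \<le> K * (\<omega> + \<epsilon>)))"
proof -
  obtain K1 \<epsilon>1 where K1: "K1 \<ge> 0" "\<epsilon>1 > 0" and tang: "\<And>\<epsilon> y p t e G (G0::'a) \<omega> g. 0 < \<epsilon> \<Longrightarrow> \<epsilon> < \<epsilon>1 \<Longrightarrow> p \<in> frontier \<Omega> \<Longrightarrow>
      dist y p < A * \<epsilon> \<Longrightarrow> fst e \<bullet> \<nu> p = 0 \<Longrightarrow> integrable lborel G \<Longrightarrow> (\<forall>z. fst z \<notin> \<Omega> \<longrightarrow> G z = 0) \<Longrightarrow> 0 \<le> \<omega> \<Longrightarrow> norm G0 \<le> g \<Longrightarrow>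
      (\<forall>z. fst z \<in> \<Omega> \<longrightarrow> norm ((y, t) - (z + \<epsilon> *\<^sub>R wt z)) < \<epsilon> \<longrightarrow> norm (G z - G0) \<le> \<omega>) \<Longrightarrow>
      norm (dpmoll \<epsilon> wt e G (y, t)) \<le> K1 * (\<omega> / \<epsilon> + g) * norm e"
    using spacetime_tangential[where 'b='a] by blast
  let ?a = "\<lambda>z. indicator Q z *\<^sub>R V z" and ?b = "\<lambda>z. indicator Q z *\<^sub>R w' (fst z) (V z)"
  define Ka where "Ka = st.C * (g + L * g)"
  define Kb where "Kb = st.C' * (1 + g) + st.C * (L + L * A * g + L * g)"
  define Kc where "Kc = K1 * (1 + g) + st.C * (L * g)"
  define Kd where "Kd = st.C * (1 + g) + st.C * (L * g)"
  define K where "K = Ka + Kb + Kc + Kd"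
  note nn = g_nonneg L_nonneg A_pos st.C_ge(4) st.C'_nonneg K1(1)
  have Kpos: "Ka \<ge> 0" "Kb \<ge> 0" "Kc \<ge> 0" "Kd \<ge> 0" unfolding Ka_def Kb_def Kc_def Kd_def using nn by auto
  then have K: "K \<ge> 0" "Ka \<le> K" "Kb \<le> K" "Kc \<le> K" "Kd \<le> K" by (auto simp: K_def)
  \<comment> \<open>The bound \<open>(T - T') / 2\<close> ensures that a kernel at a time before
    \<open>T'\<close> sees no time beyond \<open>T\<close>.\<close>
  define \<epsilon>0 where "\<epsilon>0 = min (min 1 \<epsilon>1) ((T - T') / 2)"
  have e0: "\<epsilon>0 > 0" unfolding \<epsilon>0_def using K1(2) T' by auto
  have ab: "norm (?a z) \<le> g" "norm (?b z) \<le> L * g" for z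
    using Vg[of z] wV_bound[of z] nn by (auto simp: indicator_def)
  show ?thesis
  proof (rule exI[of _ K], rule conjI, rule K(1), rule exI[of _ \<epsilon>0], rule conjI, rule e0, intro allI impI ballI conjI)
    fix \<epsilon> \<omega> y assume eps: "0 < \<epsilon>" "\<epsilon> < \<epsilon>0" and \<omega>: "0 \<le> \<omega>"
      and osc: "\<forall>z\<in>Q. \<forall>z'\<in>Q. dist z z' < A * \<epsilon> \<longrightarrow> norm (V z - V z') \<le> \<omega> \<and> (\<forall>e. norm e \<le> 1 \<longrightarrow> norm (V' z e - V' z' e) \<le> \<omega>)"
      and y: "y \<in> \<Omega>"
    have e1: "\<epsilon> < 1" "\<epsilon> < \<epsilon>1" "2 * \<epsilon> < T - T'" using eps(2) by (auto simp: \<epsilon>0_def)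
    have split': "norm (\<phi>' \<epsilon> z e) \<le> norm (dpmoll \<epsilon> wt e ?a z) + \<epsilon> * norm (dpmoll \<epsilon> wt e ?b z)" for z e
      unfolding \<phi>_split(2)[OF eps(1)] by (rule norm_triangle_le) (use eps(1) in simp)
    have b_any: "\<epsilon> * norm (dpmoll \<epsilon> wt e ?b z) \<le> st.C * (L * g) * norm e" for z e
    proof -
      have "norm (dpmoll \<epsilon> wt e ?b z) \<le> st.C * (L * g + \<epsilon> * 0) / \<epsilon> * norm e"
        by (rule st.dpmoll_bound_local[OF eps(1) wV_integrable, where ?G0.0 = 0]) (use ab nn in auto)
      then have "\<epsilon> * norm (dpmoll \<epsilon> wt e ?b z) \<le> \<epsilon> * (st.C * (L * g + \<epsilon> * 0) / \<epsilon> * norm e)"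
        using eps(1) by (intro mult_left_mono) auto
      then show ?thesis using eps(1) by simp
    qed
    {
      fix t e assume t: "0 < t" "t < T"
      show "norm (\<phi>' \<epsilon> (y, t) e) \<le> K / \<epsilon> * norm e"
      proof -
        have "norm (dpmoll \<epsilon> wt e ?a (y, t)) \<le> st.C * (g + \<epsilon> * 0) / \<epsilon> * norm e"
          by (rule st.dpmoll_bound_local[OF eps(1) V_integrable, where ?G0.0 = 0]) (use ab nn in auto)
        moreover have "st.C * (L * g) * norm e \<le> st.C * (L * g) / \<epsilon> * norm e"
        proof (rule mult_right_mono)
          have "st.C * (L * g) * \<epsilon> \<le> st.C * (L * g)" using e1(1) eps(1) nn by (intro mult_right_le_one_le) auto
          then show "st.C * (L * g) \<le> st.C * (L * g) / \<epsilon>" using eps(1) by (simp only: pos_le_divide_eq)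
        qed simp
        ultimately have "norm (\<phi>' \<epsilon> (y, t) e) \<le> st.C * (g + \<epsilon> * 0) / \<epsilon> * norm e + st.C * (L * g) / \<epsilon> * norm e"
          using split'[of "(y, t)" e] b_any[of e "(y, t)"] by linarith
        also have "\<dots> = Ka / \<epsilon> * norm e" by (simp add: Ka_def add_divide_distrib algebra_simps)
        also have "\<dots> \<le> K / \<epsilon> * norm e" using K(2) eps(1) by (intro mult_right_mono divide_right_mono) auto
        finally show ?thesis .
      qed
      show "norm (\<phi>' \<epsilon> (y, t) e - V' (y, t) e) \<le> K * (\<omega> + \<epsilon>) * norm e" if dy: "A * \<epsilon> \<le> d y"
      proof (cases "t < T'")
        case True
        have yQ: "(y, t) \<in> Q" using y t by simp
        have near: "z \<in> Q" "dist z (y, t) < A * \<epsilon>" if "norm ((y, t) - (z + \<epsilon> *\<^sub>R wt z)) < \<epsilon>" for z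
          using near_Q[OF eps(1) e1(3) less_imp_le[OF t(1)] True that]
            interior_near_\<Omega>[OF eps(1) y dy less_imp_le[OF that]] by blast+
        have lin: "linear (\<lambda>e. \<phi>' \<epsilon> (y, t) e - V' (y, t) e)"
          using has_derivative_linear[OF \<phi>_has_derivative[OF eps(1)]] has_derivative_linear[OF Vd[OF yQ]]
          by (intro linear_compose_sub)
        have "norm (\<phi>' \<epsilon> (y, t) e - V' (y, t) e) \<le> Kb * (\<omega> + \<epsilon>)" if e: "norm e \<le> 1" for e
        proof -
          have n1: "norm (dpmoll \<epsilon> wt e ?a (y, t) - V' (y, t) e) \<le> st.C' * (\<omega> + \<epsilon> * g)"
          proof (rule st.dpmoll_converges[OF eps(1) V_integrable Q_open interior_near_Q[OF eps(1) e1(3) t(1) True y dy] _ V'c e])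
            fix z assume z: "z \<in> Q"
            show "(?a has_derivative V' z) (at z)"
              by (rule has_derivative_transform_within_open[OF Vd[OF z] Q_open z]) simp
          next
            fix z assume "norm ((y, t) - (z + \<epsilon> *\<^sub>R wt z)) < \<epsilon>"
            note nz = near[OF this]
            have "norm (V z - V (y, t)) \<le> \<omega>" using osc nz yQ by blast
            then show "norm (?a z - ?a (y, t)) \<le> \<omega>" using nz(1) yQ by simp
            show "norm (V' z e - V' (y, t) e) \<le> \<omega>" using osc nz yQ e by blast
          next
            show "norm (V' (y, t) e) \<le> g" using V'g[OF yQ, of e] e g_nonneg by (meson mult_left_le order_trans)
          qed (use ab \<omega> in auto)
          have n2: "\<epsilon> * norm (dpmoll \<epsilon> wt e ?b (y, t)) \<le> st.C * ((L * \<omega> + L * (A * \<epsilon>) * g) + \<epsilon> * (L * g))"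
          proof -
            have "norm (dpmoll \<epsilon> wt e ?b (y, t)) \<le> st.C * ((L * \<omega> + L * (A * \<epsilon>) * g) + \<epsilon> * (L * g)) / \<epsilon> * norm e"
            proof (rule st.dpmoll_bound_local[OF eps(1) wV_integrable])
              fix z assume "norm ((y, t) - (z + \<epsilon> *\<^sub>R wt z)) < \<epsilon>"
              note nz = near[OF this]
              have "norm (V z - V (y, t)) \<le> \<omega>" using osc nz yQ by blast
              from wV_oscillation[OF nz(1) yQ nz(2) this]
              show "norm (?b z - ?b (y, t)) \<le> L * \<omega> + L * (A * \<epsilon>) * g" using nz(1) yQ by simp
            qed (use ab nn \<omega> eps(1) in auto)
            also have "\<dots> \<le> st.C * ((L * \<omega> + L * (A * \<epsilon>) * g) + \<epsilon> * (L * g)) / \<epsilon>"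
              using e nn \<omega> eps(1) by (intro mult_left_le) auto
            finally show ?thesis using eps(1) by (simp add: pos_le_divide_eq mult.commute)
          qed
          have eqd: "\<phi>' \<epsilon> (y, t) e - V' (y, t) e = (dpmoll \<epsilon> wt e ?a (y, t) - V' (y, t) e) + \<epsilon> *\<^sub>R dpmoll \<epsilon> wt e ?b (y, t)"
            unfolding \<phi>_split(2)[OF eps(1)] by simp
          have "norm (\<phi>' \<epsilon> (y, t) e - V' (y, t) e) \<le> st.C' * (\<omega> + \<epsilon> * g) + st.C * ((L * \<omega> + L * (A * \<epsilon>) * g) + \<epsilon> * (L * g))"
            unfolding eqd by (rule norm_triangle_le[OF add_mono[OF n1]]) (use n2 eps(1) in simp)
          also have "\<dots> \<le> st.C' * ((1 + g) * (\<omega> + \<epsilon>)) + st.C * ((L + L * A * g + L * g) * (\<omega> + \<epsilon>))"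
          proof (intro add_mono mult_left_mono)
            have "0 \<le> g * \<omega>" "0 \<le> L * \<epsilon>" "0 \<le> L * A * g * \<omega>" "0 \<le> L * g * \<omega>" using nn \<omega> eps(1) by auto
            then show "\<omega> + \<epsilon> * g \<le> (1 + g) * (\<omega> + \<epsilon>)" "L * \<omega> + L * (A * \<epsilon>) * g + \<epsilon> * (L * g) \<le> (L + L * A * g + L * g) * (\<omega> + \<epsilon>)"
              using eps(1) by (simp_all add: algebra_simps)
          qed (use nn in auto)
          also have "\<dots> = Kb * (\<omega> + \<epsilon>)" by (simp add: Kb_def algebra_simps)
          finally show ?thesis .
        qed
        from linear_bound_unit[OF lin this, of e]
        have "norm (\<phi>' \<epsilon> (y, t) e - V' (y, t) e) \<le> Kb * (\<omega> + \<epsilon>) * norm e" .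
        also have "\<dots> \<le> K * (\<omega> + \<epsilon>) * norm e" using K(3) \<omega> eps(1) by (intro mult_right_mono) auto
        finally show ?thesis .
      next
        \<comment> \<open>From \<open>T'\<close> on both \<open>\<phi>' \<epsilon>\<close> and
          \<open>V'\<close> vanish.\<close>
        case False
        then have "V' (y, t) e = 0" using V'0[of "(y, t)" e] y t by auto
        then show ?thesis using \<phi>'_eq_0[OF eps(1), of t y e] False K(1) \<omega> eps(1) by auto
      qed
      show "norm (\<phi>' \<epsilon> (y, t) e) \<le> K * (\<omega> / \<epsilon> + 1) * norm e" if p: "p \<in> frontier \<Omega>" "dist y p < A * \<epsilon>" "fst e \<bullet> \<nu> p = 0" for p
      proof (cases "t < T'")
        case True
        have yQ: "(y, t) \<in> Q" using y t by simp
        have "norm (dpmoll \<epsilon> wt e ?a (y, t)) \<le> K1 * (\<omega> / \<epsilon> + g) * norm e"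
        proof (rule tang[OF eps(1) e1(2) p V_integrable _ \<omega> Vg[OF yQ]]; clarify)
          fix z assume z: "fst z \<in> \<Omega>" "norm ((y, t) - (z + \<epsilon> *\<^sub>R wt z)) < \<epsilon>"
          note nz = near_Q[OF eps(1) e1(3) less_imp_le[OF t(1)] True z(2,1)]
          have "norm (V z - V (y, t)) \<le> \<omega>" using osc nz yQ by blast
          then show "norm (?a z - V (y, t)) \<le> \<omega>" using nz(1) by simp
        qed (auto simp: indicator_def)
        then have "norm (\<phi>' \<epsilon> (y, t) e) \<le> K1 * (\<omega> / \<epsilon> + g) * norm e + st.C * (L * g) * norm e"
          using split'[of "(y, t)" e] b_any[of e "(y, t)"] by linarith
        also have "\<dots> = (K1 * (\<omega> / \<epsilon> + g) + st.C * (L * g)) * norm e" by (simp add: algebra_simps)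
        also have "\<dots> \<le> (Kc * (\<omega> / \<epsilon> + 1)) * norm e"
        proof (intro mult_right_mono)
          have "0 \<le> K1 * g * (\<omega> / \<epsilon>)" "0 \<le> st.C * (L * g) * (\<omega> / \<epsilon>)" "0 \<le> K1" using nn \<omega> eps(1) by auto
          then show "K1 * (\<omega> / \<epsilon> + g) + st.C * (L * g) \<le> Kc * (\<omega> / \<epsilon> + 1)" by (simp add: Kc_def algebra_simps)
        qed simp
        also have "\<dots> \<le> K * (\<omega> / \<epsilon> + 1) * norm e" using K(4) \<omega> eps(1) by (intro mult_right_mono) auto
        finally show ?thesis .
      next
        case False
        then show ?thesis using \<phi>'_eq_0[OF eps(1), of t y e] K(1) \<omega> eps(1) by auto
      qed
    }
    have pb: "norm (pmoll \<epsilon> wt ?b (y, 0)) \<le> st.C * (L * g)"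
    proof -
      have "norm (pmoll \<epsilon> wt ?b (y, 0) - 0) \<le> st.C * (L * g + \<epsilon> * 0)"
        by (rule st.pmoll_bound[OF eps(1) wV_integrable]) (use ab nn in auto)
      then show ?thesis by simp
    qed
    have eb: "\<epsilon> * norm (pmoll \<epsilon> wt ?b (y, 0)) \<le> \<epsilon> * (st.C * (L * g))" using pb eps(1) by (intro mult_left_mono) auto
    show "norm (\<phi> \<epsilon> (y, 0)) \<le> K"
    proof -
      have "norm (pmoll \<epsilon> wt ?a (y, 0) - 0) \<le> st.C * (g + \<epsilon> * 0)"
        by (rule st.pmoll_bound[OF eps(1) V_integrable]) (use ab nn in auto)
      then have n1: "norm (pmoll \<epsilon> wt ?a (y, 0)) \<le> st.C * g" by simp
      have "\<epsilon> * (st.C * (L * g)) \<le> st.C * (L * g)" using e1(1) eps(1) nn by (intro mult_left_le_one_le) auto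
      from order_trans[OF eb this] have n2: "norm (\<epsilon> *\<^sub>R pmoll \<epsilon> wt ?b (y, 0)) \<le> st.C * (L * g)" using eps(1) by simp
      have "norm (\<phi> \<epsilon> (y, 0)) \<le> Ka"
        unfolding \<phi>_split(1)[OF eps(1)] Ka_def distrib_left by (rule norm_triangle_le[OF add_mono[OF n1 n2]])
      then show ?thesis using K(2) by linarith
    qed
    fix G0 :: 'a assume dy: "A * \<epsilon> \<le> d y" and G0: "norm G0 \<le> g"
      and osc0: "\<forall>z\<in>Q. dist z (y, 0) < A * \<epsilon> \<longrightarrow> norm (V z - G0) \<le> \<omega>"
    have n1: "norm (pmoll \<epsilon> wt ?a (y, 0) - G0) \<le> st.C * (\<omega> + \<epsilon> * g)"
    proof (rule st.pmoll_bound[OF eps(1) V_integrable _ \<omega> G0])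
      fix z assume near: "norm ((y, 0) - (z + \<epsilon> *\<^sub>R wt z)) < \<epsilon>"
      note nz = near_Q[OF eps(1) e1(3) order_refl T'(1) near interior_near_\<Omega>[OF eps(1) y dy less_imp_le[OF near]]]
      have "norm (V z - G0) \<le> \<omega>" using osc0 nz by blast
      then show "norm (?a z - G0) \<le> \<omega>" using nz(1) by simp
    qed
    have eqd: "\<phi> \<epsilon> (y, 0) - G0 = (pmoll \<epsilon> wt ?a (y, 0) - G0) + \<epsilon> *\<^sub>R pmoll \<epsilon> wt ?b (y, 0)"
      unfolding \<phi>_split(1)[OF eps(1)] by simp
    have "norm (\<phi> \<epsilon> (y, 0) - G0) \<le> st.C * (\<omega> + \<epsilon> * g) + \<epsilon> * (st.C * (L * g))"
      unfolding eqd by (rule norm_triangle_le[OF add_mono[OF n1]]) (use eb eps(1) in simp)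
    also have "\<dots> \<le> Kd * (\<omega> + \<epsilon>)"
    proof -
      have "0 \<le> st.C * g * \<omega>" "0 \<le> st.C * \<epsilon>" "0 \<le> st.C * (L * g) * \<omega>" using nn \<omega> eps(1) by auto
      then show ?thesis by (simp add: Kd_def algebra_simps)
    qed
    also have "\<dots> \<le> K * (\<omega> + \<epsilon>)" using K(5) \<omega> eps(1) by (intro mult_right_mono) auto
    finally show "norm (\<phi> \<epsilon> (y, 0) - G0) \<le> K * (\<omega> + \<epsilon>)" .
  qed
qed

end

section \<open>Passage to the limit in the weak formulation\<close>

lemma integral_norm_bound_AE:
  fixes f :: "'a \<Rightarrow> 'b::euclidean_space"
  assumes "AE x in M. norm (f x) \<le> h x" "integrable M h" "integrable M f"
  shows "norm (LINT x|M. f x) \<le> (LINT x|M. h x)"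
proof -
  have "norm (LINT x|M. f x) \<le> (LINT x|M. norm (f x))" by (rule integral_norm_bound)
  also have "\<dots> \<le> (LINT x|M. h x)" using assms by (intro integral_mono_AE) auto
  finally show ?thesis .
qed

lemma norm_le_1_square: "norm (x::'b::real_normed_vector) \<le> 1 + (norm x)\<^sup>2"
proof -
  have "0 \<le> (norm x - 1)\<^sup>2 + norm x" by simp
  then show ?thesis by (simp add: power2_eq_square algebra_simps)
qed

context test_field
begin

text \<open>In the layer of width \<open>O(\<epsilon>)\<close> the
  derivative of \<open>\<phi> \<epsilon>\<close> is of order \<open>1/\<epsilon>\<close> only in the normal direction, where the factor \<open>\<nu> \<bullet> v\<close> is small.\<close>

lemma weak_limit:
  fixes v :: "'a \<times> real \<Rightarrow> 'a" and v0 V0 :: "'a \<Rightarrow> 'a"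
  assumes vm: "v \<in> borel_measurable borel"
    and v2: "integrable lborel (\<lambda>z. indicator Q z * (norm (v z))\<^sup>2)"
    and weak: "\<And>\<psi> \<psi>'. smooth_on UNIV \<psi> \<Longrightarrow> (\<And>z. (\<psi> has_derivative \<psi>' z) (at z)) \<Longrightarrow>
       \<exists>K. compact K \<and> K \<subseteq> \<Omega> \<times> {..<T} \<and> (\<forall>z. z \<notin> K \<longrightarrow> \<psi> z = 0) \<Longrightarrow>
       (\<And>y t. (\<Sum>b\<in>Basis. \<psi>' (y, t) (b, 0) \<bullet> b) = 0) \<Longrightarrow>
       (LINT z|lborel. indicator Q z *\<^sub>R (\<psi>' z (0, 1) \<bullet> v z + \<psi>' z (v z, 0) \<bullet> v z)) +
       (LINT x|lborel. indicator \<Omega> x *\<^sub>R (v0 x \<bullet> \<psi> (x, 0))) = 0"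
    and layer: "\<delta>1 > 0" "AE z in lborel. z \<in> Q \<longrightarrow> d (fst z) < \<delta>1 \<longrightarrow> norm (v z) \<le> M"
    and normal: "\<And>\<eta>. \<eta> > 0 \<Longrightarrow> \<exists>\<delta>>0. AE z in lborel. z \<in> Q \<longrightarrow> d (fst z) < \<delta> \<longrightarrow>
        (\<forall>p\<in>frontier \<Omega>. dist (fst z) p = d (fst z) \<longrightarrow> \<bar>\<nu> p \<bullet> v z\<bar> \<le> \<eta>)"
    and unif: "\<And>\<eta>. \<eta> > 0 \<Longrightarrow> \<exists>\<delta>>0. \<forall>z\<in>Q. \<forall>z'\<in>Q. dist z z' < \<delta> \<longrightarrow>
        norm (V z - V z') \<le> \<eta> \<and> (\<forall>e. norm e \<le> 1 \<longrightarrow> norm (V' z e - V' z' e) \<le> \<eta>)"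
    and init: "\<And>\<eta>. \<eta> > 0 \<Longrightarrow> \<exists>\<delta>>0. \<forall>x\<in>\<Omega>. \<forall>z\<in>Q. dist z (x, 0) < \<delta> \<longrightarrow> norm (V z - V0 x) \<le> \<eta>"
    and V0g: "\<And>x. x \<in> \<Omega> \<Longrightarrow> norm (V0 x) \<le> g"
    and V0m: "(\<lambda>x. indicator \<Omega> x *\<^sub>R V0 x) \<in> borel_measurable borel"
    and v0m: "(\<lambda>x. indicator \<Omega> x *\<^sub>R v0 x) \<in> borel_measurable borel"
    and v0b: "\<And>x. x \<in> \<Omega> \<Longrightarrow> norm (v0 x) \<le> M0"
  shows "(LINT z|lborel. indicator Q z *\<^sub>R (V' z (0, 1) \<bullet> v z + V' z (v z, 0) \<bullet> v z)) +
       (LINT x|lborel. indicator \<Omega> x *\<^sub>R (v0 x \<bullet> V0 x)) = 0"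
proof -
  note [measurable] = vm dom_borel
  obtain x0 where x0: "x0 \<in> \<Omega>" using nonempty by blast
  have M0: "M0 \<ge> 0" using v0b[OF x0] norm_ge_zero order_trans by blast
  define M1 where "M1 = max M 0"
  have M1: "M1 \<ge> 0" "AE z in lborel. z \<in> Q \<longrightarrow> d (fst z) < \<delta>1 \<longrightarrow> norm (v z) \<le> M1"
    using layer(2) by (auto simp: M1_def elim!: eventually_mono)
  have dir: "norm (h, 0::real) = norm h" for h :: 'a by (simp add: norm_Pair)
  have meas: "(\<lambda>z. indicator Q z *\<^sub>R (D z (0, 1) \<bullet> v z + D z (v z, 0) \<bullet> v z)) \<in> borel_measurable borel"
    if D: "\<And>e. e \<in> Basis \<Longrightarrow> (\<lambda>z. indicator Q z *\<^sub>R D z e) \<in> borel_measurable borel"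
      and lin: "\<And>z. z \<in> Q \<Longrightarrow> linear (D z)" for D :: "'a \<times> real \<Rightarrow> 'a \<times> real \<Rightarrow> 'a"
  proof -
    have "indicator Q z *\<^sub>R (D z (0, 1) \<bullet> v z + D z (v z, 0) \<bullet> v z) =
      (indicator Q z *\<^sub>R D z (0, 1)) \<bullet> v z + (\<Sum>b\<in>Basis. (v z \<bullet> b) *\<^sub>R (indicator Q z *\<^sub>R D z (b, 0))) \<bullet> v z" for z
    proof (cases "z \<in> Q")
      case True
      have "D z (v z, 0) = D z (\<Sum>b\<in>Basis. (v z \<bullet> b) *\<^sub>R (b, 0))"
        by (simp add: sum_prod euclidean_representation)
      also have "\<dots> = (\<Sum>b\<in>Basis. (v z \<bullet> b) *\<^sub>R D z (b, 0))"
        using lin[OF True] by (simp add: linear_sum linear_scale del: scaleR_Pair)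
      finally show ?thesis using True by simp
    qed simp
    moreover have "(\<lambda>z. (indicator Q z *\<^sub>R D z (0, 1)) \<bullet> v z + (\<Sum>b\<in>Basis. (v z \<bullet> b) *\<^sub>R (indicator Q z *\<^sub>R D z (b, 0))) \<bullet> v z) \<in> borel_measurable borel"
      by (intro borel_measurable_add borel_measurable_inner borel_measurable_sum borel_measurable_scaleR D vm)
         (auto simp: Basis_prod_def)
    ultimately show ?thesis by simp
  qed
  have integ: "integrable lborel (\<lambda>z. indicator Q z *\<^sub>R (D z (0, 1) \<bullet> v z + D z (v z, 0) \<bullet> v z))"
    if D: "\<And>e. e \<in> Basis \<Longrightarrow> (\<lambda>z. indicator Q z *\<^sub>R D z e) \<in> borel_measurable borel"
      and lin: "\<And>z. z \<in> Q \<Longrightarrow> linear (D z)" and B: "\<And>z e. z \<in> Q \<Longrightarrow> norm (D z e) \<le> B * norm e" for D :: "'a \<times> real \<Rightarrow> 'a \<times> real \<Rightarrow> 'a" and B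
  proof (rule Bochner_Integration.integrable_bound)
    have "integrable lborel (\<lambda>z. indicator Q z :: real)"
      using emeasure_bounded_finite[OF Q_bounded] by (intro integrable_real_indicator) auto
    then show "integrable lborel (\<lambda>z. \<bar>B\<bar> * (indicator Q z + 2 * (indicator Q z * (norm (v z))\<^sup>2)))"
      using v2 by (intro integrable_mult_right Bochner_Integration.integrable_add)
    show "(\<lambda>z. indicator Q z *\<^sub>R (D z (0, 1) \<bullet> v z + D z (v z, 0) \<bullet> v z)) \<in> borel_measurable lborel"
      using meas[OF D lin] by simp
    show "AE z in lborel. norm (indicator Q z *\<^sub>R (D z (0, 1) \<bullet> v z + D z (v z, 0) \<bullet> v z)) \<le>
        norm (\<bar>B\<bar> * (indicator Q z + 2 * (indicator Q z * (norm (v z))\<^sup>2)))"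
    proof (intro always_eventually allI)
      fix z
      show "norm (indicator Q z *\<^sub>R (D z (0, 1) \<bullet> v z + D z (v z, 0) \<bullet> v z)) \<le>
        norm (\<bar>B\<bar> * (indicator Q z + 2 * (indicator Q z * (norm (v z))\<^sup>2)))"
      proof (cases "z \<in> Q")
        case True
        have B': "norm (D z e) \<le> \<bar>B\<bar> * norm e" for e
          using B[OF True, of e] mult_right_mono[OF abs_ge_self[of B], of "norm e"] by simp
        have "\<bar>D z (0, 1) \<bullet> v z\<bar> \<le> \<bar>B\<bar> * norm (v z)"
          using Cauchy_Schwarz_ineq2[of "D z (0, 1)" "v z"] mult_right_mono[OF B'[of "(0, 1)"], of "norm (v z)"] by (simp add: norm_Pair)
        moreover have "\<bar>D z (v z, 0) \<bullet> v z\<bar> \<le> \<bar>B\<bar> * (norm (v z))\<^sup>2"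
          using Cauchy_Schwarz_ineq2[of "D z (v z, 0)" "v z"] mult_right_mono[OF B'[of "(v z, 0)"], of "norm (v z)"]
          by (simp add: dir power2_eq_square mult.assoc)
        moreover have "\<bar>B\<bar> * norm (v z) \<le> \<bar>B\<bar> * (1 + (norm (v z))\<^sup>2)"
          by (rule mult_left_mono[OF norm_le_1_square]) simp
        ultimately have "\<bar>D z (0, 1) \<bullet> v z + D z (v z, 0) \<bullet> v z\<bar> \<le> \<bar>B\<bar> * (1 + (norm (v z))\<^sup>2) + \<bar>B\<bar> * (norm (v z))\<^sup>2"
          by linarith
        then have "\<bar>D z (0, 1) \<bullet> v z + D z (v z, 0) \<bullet> v z\<bar> \<le> \<bar>B\<bar> * (1 + 2 * (norm (v z))\<^sup>2)"
          by (simp add: algebra_simps)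
        then show ?thesis using True by (simp add: abs_mult)
      qed simp
    qed
  qed
  obtain K \<epsilon>0 where K: "K \<ge> 0" "\<epsilon>0 > 0" and est: "\<And>\<epsilon> \<omega>. 0 < \<epsilon> \<Longrightarrow> \<epsilon> < \<epsilon>0 \<Longrightarrow> 0 \<le> \<omega> \<Longrightarrow>
    (\<forall>z\<in>Q. \<forall>z'\<in>Q. dist z z' < A * \<epsilon> \<longrightarrow> norm (V z - V z') \<le> \<omega> \<and> (\<forall>e. norm e \<le> 1 \<longrightarrow> norm (V' z e - V' z' e) \<le> \<omega>)) \<Longrightarrow>
    (\<forall>y\<in>\<Omega>. (\<forall>t e. 0 < t \<longrightarrow> t < T \<longrightarrow>
        norm (\<phi>' \<epsilon> (y, t) e) \<le> K / \<epsilon> * norm e \<and>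
        (A * \<epsilon> \<le> d y \<longrightarrow> norm (\<phi>' \<epsilon> (y, t) e - V' (y, t) e) \<le> K * (\<omega> + \<epsilon>) * norm e) \<and>
        (\<forall>p\<in>frontier \<Omega>. dist y p < A * \<epsilon> \<longrightarrow> fst e \<bullet> \<nu> p = 0 \<longrightarrow> norm (\<phi>' \<epsilon> (y, t) e) \<le> K * (\<omega> / \<epsilon> + 1) * norm e)) \<and>
      norm (\<phi> \<epsilon> (y, 0)) \<le> K \<and>
      (\<forall>G0. A * \<epsilon> \<le> d y \<longrightarrow> norm G0 \<le> g \<longrightarrow> (\<forall>z\<in>Q. dist z (y, 0) < A * \<epsilon> \<longrightarrow> norm (V z - G0) \<le> \<omega>) \<longrightarrow>
         norm (\<phi> \<epsilon> (y, 0) - G0) \<le> K * (\<omega> + \<epsilon>)))"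
    using estimates by blast
  obtain \<epsilon>2 where e2: "\<epsilon>2 > 0" "\<And>\<epsilon>. 0 < \<epsilon> \<Longrightarrow> \<epsilon> < \<epsilon>2 \<Longrightarrow> \<exists>K. compact K \<and> K \<subseteq> \<Omega> \<times> {..<T} \<and> (\<forall>z. z \<notin> K \<longrightarrow> \<phi> \<epsilon> z = 0)"
    using \<phi>_support by blast
  obtain Cl \<delta>0 where Cl: "Cl \<ge> 0" "\<delta>0 > 0" "\<And>\<delta>. 0 < \<delta> \<Longrightarrow> \<delta> < \<delta>0 \<Longrightarrow> measure lborel {x \<in> \<Omega>. d x < \<delta>} \<le> Cl * \<delta>"
    using layer_measure by blast
  \<comment> \<open>Away from the boundary \<open>v\<close> is only square integrable. Since
    \<open>norm x \<le> 1 + (norm x)\<^sup>2\<close>, this integrand dominates the sum of the linear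
    and the quadratic term.\<close>
  define E where "E = (LINT z|lborel. indicator Q z + 2 * (indicator Q z * (norm (v z))\<^sup>2))"
  have E: "E \<ge> 0" unfolding E_def by (intro integral_nonneg_AE always_eventually) auto
  have Qi: "integrable lborel (\<lambda>z. indicator Q z :: real)"
    using emeasure_bounded_finite[OF Q_bounded] by (intro integrable_real_indicator) auto
  have T0: "T > 0" using T' by simp
  let ?F = "\<lambda>z. indicator Q z *\<^sub>R (V' z (0, 1) \<bullet> v z + V' z (v z, 0) \<bullet> v z)"
  let ?I = "(LINT z|lborel. ?F z) + (LINT x|lborel. indicator \<Omega> x *\<^sub>R (v0 x \<bullet> V0 x))"
  have V'lin: "linear (V' z)" if "z \<in> Q" for z using Vd[OF that] has_derivative_linear by blast
  have Fi: "integrable lborel ?F"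
    by (rule integ[OF _ V'lin V'g]) (rule borel_measurable_continuous_on_indicator[OF Q_borel V'c])
  define c1 where "c1 = 2 * K * E + (2 * K * (M1 + M1\<^sup>2) + K * M1 + g * (M1 + M1\<^sup>2)) * (Cl * A * T) + M0 * (2 * K) * measure lborel \<Omega> + M0 * (g + K) * (Cl * A)"
  have small: "norm ?I \<le> c1 * \<eta>" if \<eta>: "0 < \<eta>" for \<eta>
  proof -
    obtain \<delta>u where du: "\<delta>u > 0" "\<forall>z\<in>Q. \<forall>z'\<in>Q. dist z z' < \<delta>u \<longrightarrow> norm (V z - V z') \<le> \<eta> \<and> (\<forall>e. norm e \<le> 1 \<longrightarrow> norm (V' z e - V' z' e) \<le> \<eta>)"
      using unif[OF \<eta>] by blast
    obtain \<delta>i where di: "\<delta>i > 0" "\<forall>x\<in>\<Omega>. \<forall>z\<in>Q. dist z (x, 0) < \<delta>i \<longrightarrow> norm (V z - V0 x) \<le> \<eta>"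
      using init[OF \<eta>] by blast
    obtain \<delta>n where dn: "\<delta>n > 0" "AE z in lborel. z \<in> Q \<longrightarrow> d (fst z) < \<delta>n \<longrightarrow>
        (\<forall>p\<in>frontier \<Omega>. dist (fst z) p = d (fst z) \<longrightarrow> \<bar>\<nu> p \<bullet> v z\<bar> \<le> \<eta>)"
      using normal[OF \<eta>] by blast
    obtain \<epsilon> where eps: "\<epsilon> > 0" "\<epsilon> < \<eta>" "\<epsilon> < \<epsilon>0" "\<epsilon> < \<epsilon>2" "\<epsilon> < \<delta>u / A" "\<epsilon> < \<delta>i / A" "\<epsilon> < \<delta>n / A" "\<epsilon> < \<delta>0 / A" "\<epsilon> < \<delta>1 / A"
      using ex_pos_less_finite[of "{\<eta>, \<epsilon>0, \<epsilon>2, \<delta>u / A, \<delta>i / A, \<delta>n / A, \<delta>0 / A, \<delta>1 / A}"] \<eta> K(2) e2(1) du(1) di(1) dn(1) Cl(2) layer(1) A_pos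
      by auto
    have Ae: "A * \<epsilon> < \<delta>u" "A * \<epsilon> < \<delta>i" "A * \<epsilon> < \<delta>n" "A * \<epsilon> < \<delta>0" "A * \<epsilon> < \<delta>1" "A * \<epsilon> > 0"
      using eps A_pos by (auto simp: pos_less_divide_eq mult.commute)
    note es = est[OF eps(1,3) less_imp_le[OF \<eta>]]
    have oscQ: "\<forall>z\<in>Q. \<forall>z'\<in>Q. dist z z' < A * \<epsilon> \<longrightarrow> norm (V z - V z') \<le> \<eta> \<and> (\<forall>e. norm e \<le> 1 \<longrightarrow> norm (V' z e - V' z' e) \<le> \<eta>)"
      using du(2) Ae(1) by (meson order.strict_trans)
    have esz: "norm (\<phi>' \<epsilon> z e) \<le> K / \<epsilon> * norm e"
        "A * \<epsilon> \<le> d (fst z) \<Longrightarrow> norm (\<phi>' \<epsilon> z e - V' z e) \<le> K * (\<eta> + \<epsilon>) * norm e"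
        "p \<in> frontier \<Omega> \<Longrightarrow> dist (fst z) p < A * \<epsilon> \<Longrightarrow> fst e \<bullet> \<nu> p = 0 \<Longrightarrow> norm (\<phi>' \<epsilon> z e) \<le> K * (\<eta> / \<epsilon> + 1) * norm e"
      if z: "z \<in> Q" for z e p
    proof -
      obtain y t where yt: "z = (y, t)" "y \<in> \<Omega>" "0 < t" "t < T" using z by (metis greaterThanLessThan_iff mem_Sigma_iff prod.collapse)
      note h = bspec[OF es[OF oscQ] yt(2), THEN conjunct1, rule_format, OF yt(3,4), of e, folded yt(1)]
      show "norm (\<phi>' \<epsilon> z e) \<le> K / \<epsilon> * norm e" by (rule h[THEN conjunct1])
      show "norm (\<phi>' \<epsilon> z e - V' z e) \<le> K * (\<eta> + \<epsilon>) * norm e" if "A * \<epsilon> \<le> d (fst z)"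
        using h[THEN conjunct2, THEN conjunct1] that yt(1) by simp
      show "norm (\<phi>' \<epsilon> z e) \<le> K * (\<eta> / \<epsilon> + 1) * norm e" if "p \<in> frontier \<Omega>" "dist (fst z) p < A * \<epsilon>" "fst e \<bullet> \<nu> p = 0"
        using h[THEN conjunct2, THEN conjunct2] that yt(1) by simp
    qed
    have ea: "norm (\<phi>' \<epsilon> z e) \<le> K / \<epsilon> * norm e" if "z \<in> Q" for z e
      using esz(1) that by blast
    have eb: "norm (\<phi>' \<epsilon> z e - V' z e) \<le> K * (\<eta> + \<epsilon>) * norm e" if "z \<in> Q" "A * \<epsilon> \<le> d (fst z)" for z e
      using esz(2) that by blast
    have ec: "norm (\<phi>' \<epsilon> z e) \<le> K * (\<eta> / \<epsilon> + 1) * norm e" if "z \<in> Q" "p \<in> frontier \<Omega>" "dist (fst z) p < A * \<epsilon>" "fst e \<bullet> \<nu> p = 0" for z e p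
      using esz(3) that by blast
    have ed: "norm (\<phi> \<epsilon> (y, 0)) \<le> K" if "y \<in> \<Omega>" for y using es[OF oscQ] that by blast
    have ee: "norm (\<phi> \<epsilon> (y, 0) - V0 y) \<le> K * (\<eta> + \<epsilon>)" if y: "y \<in> \<Omega>" "A * \<epsilon> \<le> d y" for y
    proof -
      have "\<forall>z\<in>Q. dist z (y, 0) < A * \<epsilon> \<longrightarrow> norm (V z - V0 y) \<le> \<eta>" using di(2) Ae(2) y(1) by (meson order.strict_trans)
      then show ?thesis using es[OF oscQ] y V0g[OF y(1)] by blast
    qed
    let ?Fe = "\<lambda>z. indicator Q z *\<^sub>R (\<phi>' \<epsilon> z (0, 1) \<bullet> v z + \<phi>' \<epsilon> z (v z, 0) \<bullet> v z)"
    have lin: "linear (\<phi>' \<epsilon> z)" for z using \<phi>_has_derivative[OF eps(1)] has_derivative_linear by blast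
    have Fei: "integrable lborel ?Fe"
    proof (rule integ[OF _ lin ea])
      fix e :: "'a \<times> real" assume "e \<in> Basis"
      then have "continuous_on UNIV (\<lambda>z. \<phi>' \<epsilon> z e)"
        using smooth_onD(2)[OF smooth_onD(3)[OF \<phi>_smooth[OF eps(1)]]] by (simp add: frechet_derivative_at[OF \<phi>_has_derivative[OF eps(1)], symmetric])
      then have "(\<lambda>z. \<phi>' \<epsilon> z e) \<in> borel_measurable borel" by (rule borel_measurable_continuous_onI)
      then show "(\<lambda>z. indicator Q z *\<^sub>R \<phi>' \<epsilon> z e) \<in> borel_measurable borel" by measurable
    qed
    have zero: "(LINT z|lborel. ?Fe z) + (LINT x|lborel. indicator \<Omega> x *\<^sub>R (v0 x \<bullet> \<phi> \<epsilon> (x, 0))) = 0"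
      by (rule weak[OF \<phi>_smooth[OF eps(1)] \<phi>_has_derivative[OF eps(1)] e2(2)[OF eps(1,4)] \<phi>_divergence_free[OF eps(1)]])
    let ?L = "{x \<in> \<Omega>. d x < A * \<epsilon>}"
    \<comment> \<open>Bound for the integrand in the layer. The first two groups belong to
      \<open>\<phi> \<epsilon>\<close>: time and tangential derivatives of order
      \<open>\<eta> / \<epsilon> + 1\<close>, and the normal derivative of order
      \<open>1 / \<epsilon>\<close> multiplied by a normal component of at most
      \<open>\<eta>\<close>. The last group belongs to \<open>V\<close> itself. Multiplied by the
      volume of the layer, which is of order \<epsilon>, all of it is
      \<open>O(\<eta>)\<close>.\<close>
    define Bl where "Bl = (K * (\<eta> / \<epsilon> + 1) * (M1 + M1\<^sup>2) + K * \<eta> * M1 / \<epsilon>) + g * (M1 + M1\<^sup>2)"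
    have Bl: "Bl \<ge> 0" unfolding Bl_def using K(1) M1(1) g_nonneg \<eta> eps(1) by (intro add_nonneg_nonneg mult_nonneg_nonneg divide_nonneg_nonneg) auto
    have Lm: "?L \<in> sets borel" using layer_open by simp
    have mL: "measure lborel (?L \<times> {0<..<T}) \<le> Cl * (A * \<epsilon>) * T"
    proof -
      have "emeasure lborel (?L \<times> {0<..<T}) = emeasure lborel ?L * emeasure lborel {0<..<T}"
        unfolding lborel_prod[symmetric] using Lm by (intro lborel.emeasure_pair_measure_Times) auto
      then have "measure lborel (?L \<times> {0<..<T}) = measure lborel ?L * T"
        using T0 by (simp add: measure_def enn2real_mult)
      also have "\<dots> \<le> Cl * (A * \<epsilon>) * T" using Cl(3)[OF Ae(6,4)] T0 by (intro mult_right_mono) auto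
      finally show ?thesis .
    qed
    have pt: "AE z in lborel. norm (?F z - ?Fe z) \<le> K * (\<eta> + \<epsilon>) * (indicator Q z + 2 * (indicator Q z * (norm (v z))\<^sup>2)) + Bl * indicator (?L \<times> {0<..<T}) z"
      using M1(2) dn(2)
    proof eventually_elim
      fix z assume z1: "z \<in> Q \<longrightarrow> d (fst z) < \<delta>1 \<longrightarrow> norm (v z) \<le> M1"
        and z2: "z \<in> Q \<longrightarrow> d (fst z) < \<delta>n \<longrightarrow> (\<forall>p\<in>frontier \<Omega>. dist (fst z) p = d (fst z) \<longrightarrow> \<bar>\<nu> p \<bullet> v z\<bar> \<le> \<eta>)"
      have CS: "\<bar>a \<bullet> v z\<bar> \<le> c * norm (v z)" if "norm a \<le> c" for a :: 'a and c
        using Cauchy_Schwarz_ineq2[of a "v z"] mult_right_mono[OF that, of "norm (v z)"] by simp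
      show "norm (?F z - ?Fe z) \<le> K * (\<eta> + \<epsilon>) * (indicator Q z + 2 * (indicator Q z * (norm (v z))\<^sup>2)) + Bl * indicator (?L \<times> {0<..<T}) z"
      proof (cases "z \<in> Q")
        case zQ: True
        show ?thesis
        proof (cases "A * \<epsilon> \<le> d (fst z)")
          case True
          have "?F z - ?Fe z = - ((\<phi>' \<epsilon> z (0, 1) - V' z (0, 1)) \<bullet> v z + (\<phi>' \<epsilon> z (v z, 0) - V' z (v z, 0)) \<bullet> v z)"
            using zQ by (simp add: inner_diff_left)
          moreover have "\<bar>(\<phi>' \<epsilon> z (0, 1) - V' z (0, 1)) \<bullet> v z\<bar> \<le> K * (\<eta> + \<epsilon>) * norm (v z)"
            using CS[OF eb[OF zQ True, of "(0, 1)"]] by (simp add: norm_Pair)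
          moreover have "\<bar>(\<phi>' \<epsilon> z (v z, 0) - V' z (v z, 0)) \<bullet> v z\<bar> \<le> K * (\<eta> + \<epsilon>) * (norm (v z))\<^sup>2"
            using CS[OF eb[OF zQ True, of "(v z, 0)"]] by (simp add: dir power2_eq_square mult.assoc)
          moreover have "K * (\<eta> + \<epsilon>) * norm (v z) \<le> K * (\<eta> + \<epsilon>) * (1 + (norm (v z))\<^sup>2)"
          proof (rule mult_left_mono)
            have "0 \<le> (norm (v z) - 1)\<^sup>2 + norm (v z)" by simp
            then show "norm (v z) \<le> 1 + (norm (v z))\<^sup>2" by (simp add: power2_eq_square algebra_simps)
          qed (use K(1) \<eta> eps(1) in simp)
          ultimately have "norm (?F z - ?Fe z) \<le> K * (\<eta> + \<epsilon>) * (1 + (norm (v z))\<^sup>2) + K * (\<eta> + \<epsilon>) * (norm (v z))\<^sup>2"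
            unfolding real_norm_def by linarith
          also have "\<dots> = K * (\<eta> + \<epsilon>) * (indicator Q z + 2 * (indicator Q z * (norm (v z))\<^sup>2))"
            using zQ by (simp add: algebra_simps)
          finally show ?thesis using Bl by (simp add: indicator_def)
        next
          case False
          then have lay: "d (fst z) < A * \<epsilon>" by simp
          have fz: "fst z \<in> \<Omega>" using zQ by (auto simp: mem_Times_iff)
          have vz: "norm (v z) \<le> M1" using z1 zQ lay Ae(5) by simp
          obtain p where p: "p \<in> frontier \<Omega>" "dist (fst z) p = d (fst z)" using ex_foot[OF fz] by blast
          have a: "\<bar>\<nu> p \<bullet> v z\<bar> \<le> \<eta>" using z2 zQ lay Ae(3) p by simp
          \<comment> \<open>Only the direction of differentiation is split into a normal and a
            tangential part; the other factor \<open>v z\<close> is merely bounded by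
            \<open>M1\<close>.\<close>
          define \<tau> where "\<tau> = v z - (\<nu> p \<bullet> v z) *\<^sub>R \<nu> p"
          have \<tau>n: "\<tau> \<bullet> \<nu> p = 0" using nu_nu[OF p(1)] by (simp add: \<tau>_def inner_diff_left inner_commute[of "v z"])
          have "(norm \<tau>)\<^sup>2 = (norm (v z))\<^sup>2 - (\<nu> p \<bullet> v z)\<^sup>2"
            unfolding \<tau>_def using norm_add_scaleR_square[of "v z" "- (\<nu> p \<bullet> v z)" "\<nu> p"] norm_nu[OF p(1)]
            by (simp add: inner_commute power2_eq_square)
          then have "(norm \<tau>)\<^sup>2 \<le> (norm (v z))\<^sup>2" by simp
          then have "norm \<tau> \<le> norm (v z)" by (rule power2_le_imp_le) simp
          then have \<tau>M: "norm \<tau> \<le> M1" using vz by simp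
          have K0: "K * (\<eta> / \<epsilon> + 1) \<ge> 0" using K(1) \<eta> eps(1) by simp
          have pl: "dist (fst z) p < A * \<epsilon>" using p(2) lay by simp
          have t1: "\<bar>\<phi>' \<epsilon> z (0, 1) \<bullet> v z\<bar> \<le> K * (\<eta> / \<epsilon> + 1) * M1"
          proof -
            have "norm (\<phi>' \<epsilon> z (0, 1)) \<le> K * (\<eta> / \<epsilon> + 1)" using ec[OF zQ p(1) pl, of "(0, 1)"] by (simp add: norm_Pair)
            from CS[OF this] show ?thesis using mult_left_mono[OF vz K0] by linarith
          qed
          have t2: "\<bar>\<phi>' \<epsilon> z (\<tau>, 0) \<bullet> v z\<bar> \<le> K * (\<eta> / \<epsilon> + 1) * M1\<^sup>2"
          proof -
            have "norm (\<phi>' \<epsilon> z (\<tau>, 0)) \<le> K * (\<eta> / \<epsilon> + 1) * norm \<tau>" using ec[OF zQ p(1) pl, of "(\<tau>, 0)"] \<tau>n by (simp add: dir)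
            also have "\<dots> \<le> K * (\<eta> / \<epsilon> + 1) * M1" using \<tau>M K0 by (rule mult_left_mono)
            finally have "\<bar>\<phi>' \<epsilon> z (\<tau>, 0) \<bullet> v z\<bar> \<le> K * (\<eta> / \<epsilon> + 1) * M1 * norm (v z)" by (rule CS)
            also have "\<dots> \<le> K * (\<eta> / \<epsilon> + 1) * M1 * M1" using vz K0 M1(1) by (intro mult_left_mono) auto
            finally show ?thesis by (simp add: power2_eq_square mult.assoc)
          qed
          have t3: "\<bar>(\<nu> p \<bullet> v z) * (\<phi>' \<epsilon> z (\<nu> p, 0) \<bullet> v z)\<bar> \<le> K * \<eta> * M1 / \<epsilon>"
          proof -
            have "norm (\<phi>' \<epsilon> z (\<nu> p, 0)) \<le> K / \<epsilon>" using ea[OF zQ, of "(\<nu> p, 0)"] norm_nu[OF p(1)] by (simp add: dir)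
            then have "\<bar>\<phi>' \<epsilon> z (\<nu> p, 0) \<bullet> v z\<bar> \<le> K / \<epsilon> * norm (v z)" by (rule CS)
            also have "\<dots> \<le> K / \<epsilon> * M1" using vz K(1) eps(1) by (intro mult_left_mono) auto
            finally have "\<bar>\<nu> p \<bullet> v z\<bar> * \<bar>\<phi>' \<epsilon> z (\<nu> p, 0) \<bullet> v z\<bar> \<le> \<eta> * (K / \<epsilon> * M1)" using a \<eta> by (intro mult_mono) auto
            then show ?thesis by (simp add: abs_mult mult_ac)
          qed
          have dec: "\<phi>' \<epsilon> z (v z, 0) \<bullet> v z = (\<nu> p \<bullet> v z) * (\<phi>' \<epsilon> z (\<nu> p, 0) \<bullet> v z) + \<phi>' \<epsilon> z (\<tau>, 0) \<bullet> v z"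
          proof -
            have "(v z, 0) = (\<nu> p \<bullet> v z) *\<^sub>R (\<nu> p, 0::real) + (\<tau>, 0)" by (simp add: \<tau>_def)
            then have "\<phi>' \<epsilon> z (v z, 0) = (\<nu> p \<bullet> v z) *\<^sub>R \<phi>' \<epsilon> z (\<nu> p, 0) + \<phi>' \<epsilon> z (\<tau>, 0)"
              by (simp only: linear_add[OF lin] linear_scale[OF lin])
            then show ?thesis by (simp add: inner_add_left)
          qed
          have t4: "\<bar>V' z (0, 1) \<bullet> v z\<bar> \<le> g * M1"
          proof -
            have "\<bar>V' z (0, 1) \<bullet> v z\<bar> \<le> g * norm (v z)" using CS[OF V'g[OF zQ, of "(0, 1)"]] by (simp add: norm_Pair)
            also have "\<dots> \<le> g * M1" using vz g_nonneg by (rule mult_left_mono)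
            finally show ?thesis .
          qed
          have t5: "\<bar>V' z (v z, 0) \<bullet> v z\<bar> \<le> g * M1\<^sup>2"
          proof -
            have "\<bar>V' z (v z, 0) \<bullet> v z\<bar> \<le> g * norm (v z) * norm (v z)" using CS[OF V'g[OF zQ, of "(v z, 0)"]] by (simp add: dir)
            also have "\<dots> = g * (norm (v z))\<^sup>2" by (simp add: power2_eq_square)
            also have "\<dots> \<le> g * M1\<^sup>2" using vz g_nonneg by (intro mult_left_mono power_mono) auto
            finally show ?thesis .
          qed
          have "?F z - ?Fe z = (V' z (0, 1) \<bullet> v z + V' z (v z, 0) \<bullet> v z) - (\<phi>' \<epsilon> z (0, 1) \<bullet> v z + ((\<nu> p \<bullet> v z) * (\<phi>' \<epsilon> z (\<nu> p, 0) \<bullet> v z) + \<phi>' \<epsilon> z (\<tau>, 0) \<bullet> v z))"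
            using zQ dec by simp
          then have "norm (?F z - ?Fe z) \<le> g * M1 + g * M1\<^sup>2 + (K * (\<eta> / \<epsilon> + 1) * M1 + (K * \<eta> * M1 / \<epsilon> + K * (\<eta> / \<epsilon> + 1) * M1\<^sup>2))"
            unfolding real_norm_def using t1 t2 t3 t4 t5 by linarith
          also have "\<dots> = Bl" by (simp add: Bl_def algebra_simps)
          also have "\<dots> = Bl * indicator (?L \<times> {0<..<T}) z" using lay fz zQ by (auto simp: mem_Times_iff)
          finally show ?thesis using K(1) \<eta> eps(1) by (simp add: add_increasing)
        qed
      qed (auto simp: indicator_def)
    qed
    have LTi: "integrable lborel (\<lambda>z. indicator (?L \<times> {0<..<T}) z :: real)"
    proof (rule integrable_real_indicator)
      show "?L \<times> {0<..<T} \<in> sets lborel" using layer_open[of "A * \<epsilon>"] by (auto intro!: borel_open open_Times)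
      have "bounded (?L \<times> {0<..<T})" using Q_bounded by (rule bounded_subset) auto
      then show "emeasure lborel (?L \<times> {0<..<T}) < \<infinity>" using emeasure_bounded_finite by auto
    qed
    have EI: "integrable lborel (\<lambda>z. indicator Q z + 2 * (indicator Q z * (norm (v z))\<^sup>2))"
      using Qi v2 by (intro Bochner_Integration.integrable_add integrable_mult_right)
    have "norm (LINT z|lborel. ?F z - ?Fe z) \<le> (LINT z|lborel. K * (\<eta> + \<epsilon>) * (indicator Q z + 2 * (indicator Q z * (norm (v z))\<^sup>2)) + Bl * indicator (?L \<times> {0<..<T}) z)"
      by (rule integral_norm_bound_AE[OF pt]) (intro Bochner_Integration.integrable_add Bochner_Integration.integrable_diff integrable_mult_right EI LTi Fi Fei)+
    also have "\<dots> = K * (\<eta> + \<epsilon>) * E + Bl * measure lborel (?L \<times> {0<..<T})"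
      using EI LTi unfolding E_def by (subst Bochner_Integration.integral_add) (auto simp del: integral_indicator intro!: integrable_mult_right simp: integral_mult_right_zero)
    also have "\<dots> \<le> K * (\<eta> + \<epsilon>) * E + Bl * (Cl * (A * \<epsilon>) * T)" using mL Bl by (intro add_left_mono mult_left_mono)
    finally have I1: "norm (LINT z|lborel. ?F z - ?Fe z) \<le> K * (\<eta> + \<epsilon>) * E + Bl * (Cl * (A * \<epsilon>) * T)" .
    let ?h = "\<lambda>x. indicator \<Omega> x *\<^sub>R (v0 x \<bullet> V0 x) - indicator \<Omega> x *\<^sub>R (v0 x \<bullet> \<phi> \<epsilon> (x, 0))"
    \<comment> \<open>At time 0 no derivative of the test field occurs, so in the layer its
      boundedness suffices.\<close>
    have hbd: "norm (?h x) \<le> (M0 * (K * (\<eta> + \<epsilon>))) * indicator \<Omega> x + (M0 * (g + K)) * indicator ?L x" for x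
    proof (cases "x \<in> \<Omega>")
      case True
      have "?h x = v0 x \<bullet> (V0 x - \<phi> \<epsilon> (x, 0))" using True by (simp add: inner_diff_right)
      then have n: "norm (?h x) \<le> norm (v0 x) * norm (V0 x - \<phi> \<epsilon> (x, 0))" using Cauchy_Schwarz_ineq2[of "v0 x"] by simp
      show ?thesis
      proof (cases "A * \<epsilon> \<le> d x")
        case far: True
        have "norm (v0 x) * norm (V0 x - \<phi> \<epsilon> (x, 0)) \<le> M0 * (K * (\<eta> + \<epsilon>))"
          using ee[OF True far] v0b[OF True] M0 by (intro mult_mono) (auto simp: norm_minus_commute)
        then show ?thesis using n True M0 g_nonneg K(1) far by (simp add: indicator_def)
      next
        case False
        have "norm (V0 x - \<phi> \<epsilon> (x, 0)) \<le> g + K" using V0g[OF True] ed[OF True] norm_triangle_ineq4[of "V0 x" "\<phi> \<epsilon> (x, 0)"] by linarith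
        then have "norm (v0 x) * norm (V0 x - \<phi> \<epsilon> (x, 0)) \<le> M0 * (g + K)" using v0b[OF True] M0 by (intro mult_mono) auto
        moreover have "0 \<le> M0 * (K * (\<eta> + \<epsilon>))" using M0 K(1) \<eta> eps(1) by simp
        ultimately show ?thesis using n True False by (simp add: indicator_def)
      qed
    qed simp
    have I2: "norm (LINT x|lborel. ?h x) \<le> (M0 * (K * (\<eta> + \<epsilon>))) * measure lborel \<Omega> + (M0 * (g + K)) * measure lborel ?L"
      by (rule integral_split_bound[OF hbd dom_borel Lm bounded_dom bounded_subset[OF bounded_dom]])
         (use M0 K(1) g_nonneg \<eta> eps(1) in auto)
    have inner_m: "integrable lborel (\<lambda>x. indicator \<Omega> x *\<^sub>R (v0 x \<bullet> f x))"
      if fm: "(\<lambda>x. indicator \<Omega> x *\<^sub>R f x) \<in> borel_measurable borel" and fb: "\<And>x. x \<in> \<Omega> \<Longrightarrow> norm (f x) \<le> B" for f B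
    proof (rule borel_measurable_compact_support_integrable)
      have "(\<lambda>x. indicator \<Omega> x *\<^sub>R (v0 x \<bullet> f x)) = (\<lambda>x. (indicator \<Omega> x *\<^sub>R v0 x) \<bullet> (indicator \<Omega> x *\<^sub>R f x))"
        by (auto simp: indicator_def)
      then show "(\<lambda>x. indicator \<Omega> x *\<^sub>R (v0 x \<bullet> f x)) \<in> borel_measurable borel"
        using v0m fm by (simp only:) (rule borel_measurable_inner)
      show "norm (indicator \<Omega> x *\<^sub>R (v0 x \<bullet> f x)) \<le> M0 * \<bar>B\<bar>" for x
      proof (cases "x \<in> \<Omega>")
        case True
        have "\<bar>v0 x \<bullet> f x\<bar> \<le> norm (v0 x) * norm (f x)" by (rule Cauchy_Schwarz_ineq2)
        also have "\<dots> \<le> M0 * \<bar>B\<bar>" using v0b[OF True] fb[OF True] M0 by (intro mult_mono) auto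
        finally show ?thesis using True by simp
      qed (use M0 in simp)
    qed (use dom_borel bounded_dom in auto)
    have i1: "integrable lborel (\<lambda>x. indicator \<Omega> x *\<^sub>R (v0 x \<bullet> V0 x))" by (rule inner_m[OF V0m V0g])
    have i2: "integrable lborel (\<lambda>x. indicator \<Omega> x *\<^sub>R (v0 x \<bullet> \<phi> \<epsilon> (x, 0)))"
    proof (rule inner_m[OF _ ed])
      have "continuous_on UNIV (\<lambda>x. \<phi> \<epsilon> (x, 0))"
        by (rule continuous_on_compose2[OF smooth_onD(2)[OF \<phi>_smooth[OF eps(1)]]]) (auto intro!: continuous_intros)
      then have "(\<lambda>x. \<phi> \<epsilon> (x, 0)) \<in> borel_measurable borel" by (rule borel_measurable_continuous_onI)
      then show "(\<lambda>x. indicator \<Omega> x *\<^sub>R \<phi> \<epsilon> (x, 0)) \<in> borel_measurable borel" by measurable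
    qed
    have d1: "(LINT z|lborel. ?F z - ?Fe z) = (LINT z|lborel. ?F z) - (LINT z|lborel. ?Fe z)"
      using Fi Fei by (rule Bochner_Integration.integral_diff)
    have d2: "(LINT x|lborel. ?h x) = (LINT x|lborel. indicator \<Omega> x *\<^sub>R (v0 x \<bullet> V0 x)) - (LINT x|lborel. indicator \<Omega> x *\<^sub>R (v0 x \<bullet> \<phi> \<epsilon> (x, 0)))"
      using i1 i2 by (rule Bochner_Integration.integral_diff)
    have "?I = (LINT z|lborel. ?F z - ?Fe z) + (LINT x|lborel. ?h x)"
      unfolding d1 d2 using zero by linarith
    then have "norm ?I \<le> (K * (\<eta> + \<epsilon>) * E + Bl * (Cl * (A * \<epsilon>) * T)) + ((M0 * (K * (\<eta> + \<epsilon>))) * measure lborel \<Omega> + (M0 * (g + K)) * measure lborel ?L)"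
      using norm_triangle_mono[OF I1 I2] by simp
    also have "\<dots> \<le> 2 * K * E * \<eta> + (2 * K * (M1 + M1\<^sup>2) + K * M1 + g * (M1 + M1\<^sup>2)) * (Cl * A * T) * \<eta> + M0 * (2 * K) * measure lborel \<Omega> * \<eta> + M0 * (g + K) * (Cl * A) * \<eta>"
    proof -
      have "K * (\<eta> + \<epsilon>) * E \<le> K * (\<eta> + \<eta>) * E" using K(1) E eps(2) by (intro mult_right_mono mult_left_mono) auto
      moreover have "Bl * (Cl * (A * \<epsilon>) * T) \<le> (2 * K * (M1 + M1\<^sup>2) + K * M1 + g * (M1 + M1\<^sup>2)) * (Cl * A * T) * \<eta>"
      proof -
        have "Bl * \<epsilon> = K * (\<eta> + \<epsilon>) * (M1 + M1\<^sup>2) + K * \<eta> * M1 + g * (M1 + M1\<^sup>2) * \<epsilon>"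
          using eps(1) by (simp add: Bl_def field_simps)
        also have "\<dots> \<le> K * (\<eta> + \<eta>) * (M1 + M1\<^sup>2) + K * \<eta> * M1 + g * (M1 + M1\<^sup>2) * \<eta>"
          using K(1) M1(1) g_nonneg eps(2) by (intro add_mono mult_right_mono mult_left_mono order_refl) auto
        finally have "(Bl * \<epsilon>) * (Cl * A * T) \<le> (K * (\<eta> + \<eta>) * (M1 + M1\<^sup>2) + K * \<eta> * M1 + g * (M1 + M1\<^sup>2) * \<eta>) * (Cl * A * T)"
          using Cl(1) A_pos T0 by (intro mult_right_mono) auto
        then show ?thesis by (simp add: algebra_simps)
      qed
      moreover have "(M0 * (K * (\<eta> + \<epsilon>))) * measure lborel \<Omega> \<le> (M0 * (K * (\<eta> + \<eta>))) * measure lborel \<Omega>"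
        using M0 K(1) eps(2) by (intro mult_right_mono mult_left_mono) auto
      moreover have "(M0 * (g + K)) * measure lborel ?L \<le> (M0 * (g + K)) * (Cl * (A * \<eta>))"
      proof (rule mult_left_mono)
        have "Cl * (A * \<epsilon>) \<le> Cl * (A * \<eta>)" using Cl(1) A_pos eps(2) by (intro mult_left_mono) auto
        then show "measure lborel ?L \<le> Cl * (A * \<eta>)" using Cl(3)[OF Ae(6,4)] by linarith
      qed (use M0 K(1) g_nonneg in simp)
      ultimately show ?thesis by (simp add: algebra_simps)
    qed
    also have "\<dots> = c1 * \<eta>" by (simp add: c1_def algebra_simps)
    finally show ?thesis .
  qed
  show ?thesis by (rule eq_0_if_arbitrarily_small[OF small])
qed

end

section \<open>Uniform continuity and integration over slices\<close>

lemma uniformly_continuous_on_bilinear: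
  fixes pr :: "'b::real_normed_vector \<Rightarrow> 'c::real_normed_vector \<Rightarrow> 'd::real_normed_vector"
    and f :: "'a::metric_space \<Rightarrow> 'b" and g :: "'a \<Rightarrow> 'c"
  assumes "bounded_bilinear pr"
    and f: "uniformly_continuous_on S f" "bounded (f ` S)" and g: "uniformly_continuous_on S g" "bounded (g ` S)"
  shows "uniformly_continuous_on S (\<lambda>x. pr (f x) (g x))"
proof -
  interpret bounded_bilinear pr by fact
  obtain K where K: "K > 0" "\<And>a b. norm (pr a b) \<le> norm a * norm b * K" using pos_bounded by blast
  obtain F where F: "F > 0" "\<And>x. x \<in> S \<Longrightarrow> norm (f x) \<le> F" using f(2) by (auto simp: bounded_pos)
  obtain G where G: "G > 0" "\<And>x. x \<in> S \<Longrightarrow> norm (g x) \<le> G" using g(2) by (auto simp: bounded_pos)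
  show ?thesis
    unfolding uniformly_continuous_on_def
  proof (intro allI impI)
    fix e :: real assume e: "e > 0"
    define e' where "e' = e / (2 * K * (F + G))"
    have e': "e' > 0" unfolding e'_def using e K F G by simp
    obtain d1 where d1: "d1 > 0" "\<forall>x\<in>S. \<forall>x'\<in>S. dist x' x < d1 \<longrightarrow> dist (f x') (f x) < e'"
      using f(1) e' unfolding uniformly_continuous_on_def by blast
    obtain d2 where d2: "d2 > 0" "\<forall>x\<in>S. \<forall>x'\<in>S. dist x' x < d2 \<longrightarrow> dist (g x') (g x) < e'"
      using g(1) e' unfolding uniformly_continuous_on_def by blast
    show "\<exists>d>0. \<forall>x\<in>S. \<forall>x'\<in>S. dist x' x < d \<longrightarrow> dist (pr (f x') (g x')) (pr (f x) (g x)) < e"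
    proof (intro exI[of _ "min d1 d2"] conjI ballI impI)
      fix x x' assume x: "x \<in> S" "x' \<in> S" "dist x' x < min d1 d2"
      have 1: "norm (f x' - f x) \<le> e'" "norm (g x' - g x) \<le> e'" using d1 d2 x by (auto simp: dist_norm less_imp_le)
      have "pr (f x') (g x') - pr (f x) (g x) = pr (f x' - f x) (g x') + pr (f x) (g x' - g x)"
        by (simp add: diff_left diff_right)
      also have "norm \<dots> \<le> norm (f x' - f x) * norm (g x') * K + norm (f x) * norm (g x' - g x) * K"
        by (intro norm_triangle_le add_mono K)
      also have "\<dots> \<le> e' * G * K + F * e' * K"
        using 1 F(2)[OF x(1)] G(2)[OF x(2)] K(1) F(1) G(1) e' by (intro add_mono mult_right_mono mult_mono) auto
      also have "\<dots> = e / 2"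
      proof -
        have "e' * (2 * K * (F + G)) = e" unfolding e'_def using K(1) F(1) G(1) by simp
        then show ?thesis by (simp add: algebra_simps)
      qed
      also have "\<dots> < e" using e by simp
      finally show "dist (pr (f x') (g x')) (pr (f x) (g x)) < e" by (simp add: dist_norm)
    qed (use d1 d2 in auto)
  qed
qed

lemma uniformly_continuous_on_slice:
  fixes f :: "'a::metric_space \<times> real \<Rightarrow> 'b::metric_space"
  assumes "uniformly_continuous_on (S \<times> I) f" "s \<in> I"
  shows "uniformly_continuous_on S (\<lambda>x. f (x, s))"
  unfolding uniformly_continuous_on_def
proof (intro allI impI)
  fix e :: real assume "e > 0"
  then obtain d where d: "d > 0" "\<forall>z\<in>S \<times> I. \<forall>z'\<in>S \<times> I. dist z' z < d \<longrightarrow> dist (f z') (f z) < e"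
    using assms(1) unfolding uniformly_continuous_on_def by meson
  have "dist (f (x', s)) (f (x, s)) < e" if "x \<in> S" "x' \<in> S" "dist x' x < d" for x x'
    using d(2) that assms(2) by (auto simp: dist_Pair_Pair)
  then show "\<exists>d>0. \<forall>x\<in>S. \<forall>x'\<in>S. dist x' x < d \<longrightarrow> dist (f (x', s)) (f (x, s)) < e" using d(1) by blast
qed

lemma uniformly_continuous_derivative:
  fixes D :: "'a::metric_space \<Rightarrow> 'b::euclidean_space \<Rightarrow> 'c::real_normed_vector"
  assumes "\<And>e. e \<in> Basis \<Longrightarrow> uniformly_continuous_on S (\<lambda>z. D z e)" "\<And>z. z \<in> S \<Longrightarrow> linear (D z)" "\<eta> > 0"
  shows "\<exists>\<delta>>0. \<forall>z\<in>S. \<forall>z'\<in>S. dist z z' < \<delta> \<longrightarrow> (\<forall>e. norm e \<le> 1 \<longrightarrow> norm (D z e - D z' e) \<le> \<eta>)"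
proof -
  define \<eta>' where "\<eta>' = \<eta> / real DIM('b)"
  have \<eta>': "\<eta>' > 0" using assms(3) by (simp add: \<eta>'_def)
  have "\<exists>\<delta>>0. \<forall>z\<in>S. \<forall>z'\<in>S. dist z z' < \<delta> \<longrightarrow> norm (D z e - D z' e) < \<eta>'" if "e \<in> Basis" for e
    using assms(1)[OF that] \<eta>' unfolding uniformly_continuous_on_def dist_norm by (metis norm_minus_commute)
  then obtain \<delta> where \<delta>: "\<And>e. e \<in> Basis \<Longrightarrow> \<delta> e > 0"
    "\<And>e z z'. e \<in> Basis \<Longrightarrow> z \<in> S \<Longrightarrow> z' \<in> S \<Longrightarrow> dist z z' < \<delta> e \<Longrightarrow> norm (D z e - D z' e) < \<eta>'" by metis
  define m where "m = Min (\<delta> ` Basis)"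
  have m: "m > 0" "\<And>e. e \<in> Basis \<Longrightarrow> m \<le> \<delta> e" unfolding m_def using \<delta>(1) by auto
  have "norm (D z e - D z' e) \<le> \<eta>" if z: "z \<in> S" "z' \<in> S" "dist z z' < m" and e: "norm e \<le> 1" for z z' e
  proof -
    have "norm (D z e - D z' e) \<le> real DIM('b) * \<eta>' * norm e"
    proof (rule linear_bound_Basis[where f = "\<lambda>e. D z e - D z' e"])
      show "linear (\<lambda>e. D z e - D z' e)" using assms(2) z by (intro linear_compose_sub) auto
      show "norm (D z e - D z' e) \<le> \<eta>'" if "e \<in> Basis" for e using \<delta>(2)[OF that z(1,2)] m(2)[OF that] z(3) by simp
    qed
    also have "\<dots> \<le> \<eta>" using e assms(3) by (simp add: \<eta>'_def mult_left_le)
    finally show ?thesis .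
  qed
  then show ?thesis using m(1) by blast
qed

section \<open>Slices of space-time and Borel representatives\<close>

lemma partial_derivatives:
  fixes f :: "'a::euclidean_space \<times> real \<Rightarrow> 'b::euclidean_space"
  assumes "(f has_derivative f') (at (x, t))"
  shows "((\<lambda>y. f (y, t)) has_derivative (\<lambda>h. f' (h, 0))) (at x)"
    "((\<lambda>s. f (x, s)) has_vector_derivative f' (0, 1)) (at t)"
proof -
  have "((\<lambda>y. (y, t)) has_derivative (\<lambda>h. (h, 0))) (at x)" by (auto intro!: derivative_eq_intros)
  from has_derivative_compose[OF this assms] show "((\<lambda>y. f (y, t)) has_derivative (\<lambda>h. f' (h, 0))) (at x)" by simp
  have "((\<lambda>s. (x, s)) has_derivative (\<lambda>h. (0, h))) (at t)" by (auto intro!: derivative_eq_intros)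
  from has_derivative_compose[OF this assms] have "((\<lambda>s. f (x, s)) has_derivative (\<lambda>h. f' (0, h))) (at t)" by simp
  moreover have "(\<lambda>h. f' (0, h)) = (\<lambda>h. h *\<^sub>R f' (0, 1))"
  proof
    show "f' (0, h) = h *\<^sub>R f' (0, 1)" for h
      using linear_scale[OF has_derivative_linear[OF assms], of h "(0, 1)"] by simp
  qed
  ultimately show "((\<lambda>s. f (x, s)) has_vector_derivative f' (0, 1)) (at t)" by (simp only: has_vector_derivative_def)
qed

text \<open>The exceptional set is enlarged to a Borel null set, for which the two almost-everywhere
  quantifiers can be exchanged.\<close>

lemma AE_lborel_snd:
  fixes P :: "'a::euclidean_space \<times> real \<Rightarrow> bool"
  assumes "AE z in lborel. P z"
  shows "AE s in lborel. AE x in lborel. P (x, s)"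
proof -
  obtain N where N: "{z \<in> space lborel. \<not> P z} \<subseteq> N" "N \<in> sets lborel" "emeasure lborel N = 0"
    using assms by (rule AE_E)
  have "AE z in lborel \<Otimes>\<^sub>M lborel. z \<notin> N"
    unfolding lborel_prod using N by (intro AE_not_in) (auto simp: null_sets_def)
  then have "AE x in lborel. AE s in lborel. (x, s) \<notin> N" by (rule lborel_pair.AE_pair)
  moreover have "{z \<in> space (lborel \<Otimes>\<^sub>M lborel). (fst z, snd z) \<notin> N} \<in> sets (lborel \<Otimes>\<^sub>M lborel)"
    unfolding lborel_prod using N(2) by simp
  ultimately have "AE s in lborel. AE x in lborel. (x, s) \<notin> N"
    using lborel_pair.AE_commute[of "\<lambda>x s. (x, s) \<notin> N"] by simp
  then show ?thesis
  proof eventually_elim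
    case (elim s)
    then show ?case by eventually_elim (use N(1) in auto)
  qed
qed

lemma integral_lborel_snd:
  fixes F :: "'a::euclidean_space \<times> real \<Rightarrow> 'b::euclidean_space"
  assumes "integrable lborel F"
  shows "(LINT z|lborel. F z) = (LINT s|lborel. (LINT x|lborel. F (x, s)))"
    "integrable lborel (\<lambda>s. LINT x|lborel. F (x, s))"
  using lborel_pair.integral_snd[of "\<lambda>x s. F (x, s)"] lborel_pair.integrable_snd[of "\<lambda>x s. F (x, s)"] assms
  unfolding lborel_prod by (simp_all add: case_prod_beta')

lemma integral_lborel_fst:
  fixes F :: "'a::euclidean_space \<times> real \<Rightarrow> 'b::euclidean_space"
  assumes "integrable lborel F"
  shows "(LINT z|lborel. F z) = (LINT x|lborel. (LINT s|lborel. F (x, s)))"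
  using lborel_pair.integral_fst'[of F] assms unfolding lborel_prod by simp

lemma integral_lborel_eq_0_slices:
  fixes F :: "'a::euclidean_space \<times> real \<Rightarrow> 'b::euclidean_space"
  assumes "AE s in lborel. (LINT x|lborel. F (x, s)) = 0"
  shows "(LINT z|lborel. F z) = 0"
proof (cases "integrable lborel F")
  case True
  then show ?thesis using integral_lborel_snd(1) integral_eq_zero_AE[OF assms] by metis
qed (simp add: not_integrable_integral_eq)

text \<open>The fields of the theorem are measurable for the completed measure, while integration
  over slices is carried out for the Borel product measure. A Borel representative, built component
  by component, bridges the two.\<close>

lemma ex_borel_representative:
  fixes f :: "'a::euclidean_space \<Rightarrow> 'b::euclidean_space"
  assumes "f \<in> borel_measurable lebesgue"
  shows "\<exists>f'\<in>borel_measurable borel. AE x in lborel. f x = f' x"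
proof -
  have "\<exists>g\<in>borel_measurable lborel. AE x in lborel. f x \<bullet> b = g x" for b
    by (rule completion_ex_borel_measurable_real) (use assms in measurable)
  then obtain g where g: "\<And>b. g b \<in> borel_measurable lborel" "\<And>b. AE x in lborel. f x \<bullet> b = g b x" by metis
  show ?thesis
  proof (intro bexI[of _ "\<lambda>x. \<Sum>b\<in>Basis. g b x *\<^sub>R b"])
    have "AE x in lborel. \<forall>b\<in>Basis. f x \<bullet> b = g b x" using g(2) by (intro AE_finite_allI) auto
    then show "AE x in lborel. f x = (\<Sum>b\<in>Basis. g b x *\<^sub>R b)"
      by eventually_elim (metis (no_types, lifting) euclidean_representation sum.cong)
    show "(\<lambda>x. \<Sum>b\<in>Basis. g b x *\<^sub>R b) \<in> borel_measurable borel" using g(1) by simp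
  qed
qed

lemma integral_lebesgue_eq_lborel:
  fixes f f' :: "'a::euclidean_space \<Rightarrow> 'b::euclidean_space"
  assumes "AE x in lborel. f x = f' x" "f' \<in> borel_measurable borel"
  shows "(LINT x|lebesgue. f x) = (LINT x|lborel. f' x)"
proof -
  have f'm: "f' \<in> borel_measurable lebesgue" using assms(2) by (simp add: measurable_completion)
  have ae: "AE x in lebesgue. f x = f' x" using assms(1) by (simp add: AE_completion_iff)
  have "f \<in> borel_measurable lebesgue"
    by (rule borel_measurable_AE[OF f'm]) (use ae in auto)
  then have "(LINT x|lebesgue. f x) = (LINT x|lebesgue. f' x)" using f'm ae by (intro integral_cong_AE)
  also have "\<dots> = (LINT x|lborel. f' x)" using assms(2) by (intro integral_completion) simp
  finally show ?thesis .
qed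

lemma DERIV_max_square: "((\<lambda>x. (max x 0)\<^sup>2) has_real_derivative 2 * max x 0) (at x)" for x :: real
proof -
  consider "x > 0" | "x < 0" | "x = 0" by linarith
  then show ?thesis
  proof cases
    case 1
    have "((\<lambda>x. x\<^sup>2) has_real_derivative 2 * max x 0) (at x)" using 1 by (auto intro!: derivative_eq_intros)
    then show ?thesis
      by (rule has_field_derivative_transform_within_open[where S = "{0<..}"]) (use 1 in auto)
  next
    case 2
    have "((\<lambda>x. 0) has_real_derivative 2 * max x 0) (at x)" using 2 by (auto intro!: derivative_eq_intros)
    then show ?thesis
      by (rule has_field_derivative_transform_within_open[where S = "{..<0}"]) (use 2 in auto)
  next
    case 3
    have "((\<lambda>h. ((max h 0)\<^sup>2 - (max 0 0)\<^sup>2) / h) \<longlongrightarrow> 0) (at (0::real))"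
    proof (rule Lim_null_comparison)
      have "norm (((max h 0)\<^sup>2 - (max 0 0)\<^sup>2) / h) \<le> \<bar>h\<bar>" for h :: real
        by (cases "h > 0") (auto simp: power2_eq_square)
      then show "\<forall>\<^sub>F h in at 0. norm (((max h 0)\<^sup>2 - (max 0 0)\<^sup>2) / h) \<le> \<bar>h\<bar>" by simp
      show "((\<lambda>h::real. \<bar>h\<bar>) \<longlongrightarrow> 0) (at 0)" by (auto intro!: tendsto_eq_intros)
    qed
    then show ?thesis using 3 by (simp add: DERIV_def)
  qed
qed

lemma integral_interval_FTC:
  fixes h h' :: "real \<Rightarrow> real"
  assumes "T > 0" "continuous_on {0..T} h" "\<And>s. s \<in> {0<..<T} \<Longrightarrow> (h has_real_derivative h' s) (at s)"
    and "integrable lborel (\<lambda>s. indicator {0<..<T} s *\<^sub>R h' s)"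
  shows "(LINT s|lborel. indicator {0<..<T} s *\<^sub>R h' s) = h T - h 0"
proof -
  have "(h' has_integral (h T - h 0)) {0..T}"
    using assms(1-3) by (intro fundamental_theorem_of_calculus_interior) (auto simp: has_real_derivative_iff_has_vector_derivative)
  then have "(h' has_integral (h T - h 0)) {0<..<T}" by (simp add: has_integral_Icc_iff_Ioo)
  then have "((\<lambda>s. if s \<in> {0<..<T} then h' s else 0) has_integral (h T - h 0)) UNIV" by (simp only: has_integral_restrict_UNIV)
  moreover have "(\<lambda>s. if s \<in> {0<..<T} then h' s else 0) = (\<lambda>s. indicator {0<..<T} s *\<^sub>R h' s)" by (auto simp: indicator_def)
  ultimately show ?thesis using has_integral_integral_lborel[OF assms(4)] has_integral_unique by metis
qed

section \<open>Weak-strong uniqueness\<close>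

text \<open>The situation of the theorem with the fields on space-time: \<open>D\<close> is the full
  derivative of \<open>U\<close>, \<open>G\<close> the pressure gradient, \<open>v\<close> a Borel
  representative of the weak solution, and the initial datum is written as \<open>U (x, 0)\<close>.
  The normal condition speaks of the normals at foot points instead of the gradient of the
  distance.\<close>

locale weak_strong = shifted_domain \<Omega> r \<nu> w w' W L
  for \<Omega> :: "'a::euclidean_space set" and r \<nu> w w' W L +
  fixes T :: real and U :: "'a \<times> real \<Rightarrow> 'a" and D :: "'a \<times> real \<Rightarrow> 'a \<times> real \<Rightarrow> 'a"
    and P :: "'a \<Rightarrow> real \<Rightarrow> real" and G v :: "'a \<times> real \<Rightarrow> 'a"
  assumes Tpos: "T > 0"
    and Uc: "continuous_on (closure \<Omega> \<times> {0..T}) U"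
    and Ud: "z \<in> \<Omega> \<times> {0<..<T} \<Longrightarrow> (U has_derivative D z) (at z)"
    and Du: "e \<in> Basis \<Longrightarrow> uniformly_continuous_on (\<Omega> \<times> {0<..<T}) (\<lambda>z. D z e)"
    and divU: "z \<in> \<Omega> \<times> {0<..<T} \<Longrightarrow> (\<Sum>b\<in>Basis. D z (b, 0) \<bullet> b) = 0"
    and Un: "p \<in> frontier \<Omega> \<Longrightarrow> 0 \<le> s \<Longrightarrow> s \<le> T \<Longrightarrow> U (p, s) \<bullet> \<nu> p = 0"
    and Pd: "(x, s) \<in> \<Omega> \<times> {0<..<T} \<Longrightarrow> ((\<lambda>y. P y s) has_derivative (\<lambda>h. G (x, s) \<bullet> h)) (at x)"
    and euler: "z \<in> \<Omega> \<times> {0<..<T} \<Longrightarrow> D z (0, 1) + D z (U z, 0) + G z = 0"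
    and vm: "v \<in> borel_measurable borel"
    and v2: "integrable lborel (\<lambda>z. indicator (\<Omega> \<times> {0<..<T}) z * (norm (v z))\<^sup>2)"
    and weak: "smooth_on UNIV \<psi> \<Longrightarrow> (\<And>z. (\<psi> has_derivative \<psi>' z) (at z)) \<Longrightarrow>
       \<exists>K. compact K \<and> K \<subseteq> \<Omega> \<times> {..<T} \<and> (\<forall>z. z \<notin> K \<longrightarrow> \<psi> z = 0) \<Longrightarrow>
       (\<And>y t. (\<Sum>b\<in>Basis. \<psi>' (y, t) (b, 0) \<bullet> b) = 0) \<Longrightarrow>
       (LINT z|lborel. indicator (\<Omega> \<times> {0<..<T}) z *\<^sub>R (\<psi>' z (0, 1) \<bullet> v z + \<psi>' z (v z, 0) \<bullet> v z)) +
       (LINT x|lborel. indicator \<Omega> x *\<^sub>R (U (x, 0) \<bullet> \<psi> (x, 0))) = 0"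
    and layer: "\<exists>\<delta>>0. \<exists>M. AE z in lborel. z \<in> \<Omega> \<times> {0<..<T} \<longrightarrow> infdist (fst z) (frontier \<Omega>) < \<delta> \<longrightarrow> norm (v z) \<le> M"
    and normal: "\<eta> > 0 \<Longrightarrow> \<exists>\<delta>>0. AE z in lborel. z \<in> \<Omega> \<times> {0<..<T} \<longrightarrow> infdist (fst z) (frontier \<Omega>) < \<delta> \<longrightarrow>
        (\<forall>p\<in>frontier \<Omega>. dist (fst z) p = infdist (fst z) (frontier \<Omega>) \<longrightarrow> \<bar>\<nu> p \<bullet> v z\<bar> \<le> \<eta>)"
    and sol: "AE s in lborel. 0 < s \<longrightarrow> s < T \<longrightarrow> (\<forall>\<psi>::'a \<Rightarrow> real. smooth_on UNIV \<psi> \<longrightarrow>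
        (\<exists>K. compact K \<and> (\<forall>x. x \<notin> K \<longrightarrow> \<psi> x = 0)) \<longrightarrow>
        (LINT x|lborel. indicator \<Omega> x *\<^sub>R frechet_derivative \<psi> (at x) (v (x, s))) = 0)"
    and energy: "AE s in lborel. 0 < s \<longrightarrow> s < T \<longrightarrow>
        (LINT x|lborel. indicator \<Omega> x * (norm (v (x, s)))\<^sup>2) \<le> (LINT x|lborel. indicator \<Omega> x * (norm (U (x, 0)))\<^sup>2)"
begin

abbreviation Q :: "('a \<times> real) set" where "Q \<equiv> \<Omega> \<times> {0<..<T}"

lemma Q_open: "open Q" using open_dom by (intro open_Times) auto

lemma Q_bounded: "bounded Q" using bounded_dom by (intro bounded_Times) auto

lemma Q_borel [measurable]: "Q \<in> sets borel" using Q_open by simp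

lemma closed_cylinder: "compact (closure \<Omega> \<times> {0..T})" "Q \<subseteq> closure \<Omega> \<times> {0..T}"
  using bounded_dom closure_subset[of \<Omega>] by (auto intro!: compact_Times)

lemma cylinder_continuous:
  fixes f :: "'a \<times> real \<Rightarrow> 'b::euclidean_space"
  assumes "continuous_on (closure \<Omega> \<times> {0..T}) f"
  shows "uniformly_continuous_on Q f" "bounded (f ` Q)"
proof -
  show "uniformly_continuous_on Q f"
    using compact_uniformly_continuous[OF assms closed_cylinder(1)] closed_cylinder(2)
    unfolding uniformly_continuous_on_def by (meson subsetD)
  show "bounded (f ` Q)"
    using compact_imp_bounded[OF compact_continuous_image[OF assms closed_cylinder(1)]] image_mono[OF closed_cylinder(2)]
    by (rule bounded_subset)
qed

lemma D_linear: "z \<in> Q \<Longrightarrow> linear (D z)" using Ud has_derivative_linear by blast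

lemma D_bounded: "e \<in> Basis \<Longrightarrow> bounded ((\<lambda>z. D z e) ` Q)"
  using bounded_uniformly_continuous_image[OF Du Q_bounded] .

lemma D_space: "z \<in> Q \<Longrightarrow> D z (h, 0) = (\<Sum>b\<in>Basis. (h \<bullet> b) *\<^sub>R D z (b, 0))"
proof -
  assume z: "z \<in> Q"
  have "D z (h, 0) = D z (\<Sum>b\<in>Basis. (h \<bullet> b) *\<^sub>R (b, 0))" by (simp add: sum_prod euclidean_representation)
  also have "\<dots> = (\<Sum>b\<in>Basis. (h \<bullet> b) *\<^sub>R D z (b, 0))"
    using D_linear[OF z] by (simp add: linear_sum linear_scale del: scaleR_Pair)
  finally show ?thesis .
qed

lemma G_eq: "z \<in> Q \<Longrightarrow> G z = - (D z (0, 1) + (\<Sum>b\<in>Basis. (U z \<bullet> b) *\<^sub>R D z (b, 0)))"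
  using euler[of z] D_space[of z "U z"] by (metis add.inverse_unique minus_minus)

lemma U_inner_continuous: "uniformly_continuous_on Q (\<lambda>z. U z \<bullet> b)" "bounded ((\<lambda>z. U z \<bullet> b) ` Q)"
  using cylinder_continuous[OF continuous_on_inner[OF Uc continuous_on_const]] by auto

text \<open>About the pressure only differentiability in space is assumed. The Euler equation, in
  the form \<open>G_eq\<close>, expresses its gradient by sums and products of bounded uniformly
  continuous functions.\<close>

lemma G_continuous: "uniformly_continuous_on Q G"
proof -
  have "uniformly_continuous_on Q (\<lambda>z. - (D z (0, 1) + (\<Sum>b\<in>Basis. (U z \<bullet> b) *\<^sub>R D z (b, 0))))"
    by (intro uniformly_continuous_on_minus uniformly_continuous_on_add uniformly_continuous_on_sum Du
          uniformly_continuous_on_bilinear[OF bounded_bilinear_scaleR] U_inner_continuous D_bounded) (auto simp: Basis_prod_def)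
  then show ?thesis unfolding uniformly_continuous_on_def by (simp add: G_eq)
qed

lemma bounds:
  "\<exists>B\<ge>0. (\<forall>z\<in>closure \<Omega> \<times> {0..T}. norm (U z) \<le> B) \<and> (\<forall>z\<in>Q. \<forall>e. norm (D z e) \<le> B * norm e) \<and> (\<forall>z\<in>Q. norm (G z) \<le> B)"
proof -
  obtain B1 where B1: "B1 > 0" "\<And>z. z \<in> closure \<Omega> \<times> {0..T} \<Longrightarrow> norm (U z) \<le> B1"
    using compact_imp_bounded[OF compact_continuous_image[OF Uc closed_cylinder(1)]] by (auto simp: bounded_pos)
  have "\<exists>B. \<forall>z\<in>Q. norm (D z e) \<le> B" if "e \<in> Basis" for e using D_bounded[OF that] by (auto simp: bounded_iff)
  then obtain b where b: "\<And>e z. e \<in> Basis \<Longrightarrow> z \<in> Q \<Longrightarrow> norm (D z e) \<le> b e" by metis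
  define B2 where "B2 = Max (b ` Basis)"
  have B2: "norm (D z e) \<le> B2" if "z \<in> Q" "e \<in> Basis" for z e
  proof -
    have "b e \<le> B2" unfolding B2_def using that by (intro Max_ge) auto
    then show ?thesis using b[OF that(2,1)] by simp
  qed
  obtain B3 where B3: "B3 > 0" "\<And>z. z \<in> Q \<Longrightarrow> norm (G z) \<le> B3"
    using bounded_uniformly_continuous_image[OF G_continuous Q_bounded] by (auto simp: bounded_pos)
  define B where "B = max B1 (max (real DIM('a \<times> real) * B2) B3)"
  have "norm (D z e) \<le> B * norm e" if "z \<in> Q" for z e
  proof -
    have "norm (D z e) \<le> real DIM('a \<times> real) * B2 * norm e"
      by (rule linear_bound_Basis[OF D_linear[OF that]]) (use B2 that in auto)
    also have "\<dots> \<le> B * norm e" by (intro mult_right_mono) (auto simp: B_def)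
    finally show ?thesis .
  qed
  then show ?thesis using B1 B3 by (intro exI[of _ B]) (fastforce simp: B_def)
qed

lemma slice_has_derivative:
  "(x, s) \<in> Q \<Longrightarrow> ((\<lambda>y. U (y, s)) has_derivative (\<lambda>h. D (x, s) (h, 0))) (at x)"
  using partial_derivatives(1)[OF Ud] .

lemma time_has_vector_derivative:
  "(x, s) \<in> Q \<Longrightarrow> ((\<lambda>\<tau>. U (x, \<tau>)) has_vector_derivative D (x, s) (0, 1)) (at s)"
  using partial_derivatives(2)[OF Ud] .

lemma U_tangential:
  fixes f :: "'a \<Rightarrow> real"
  assumes s: "0 < s" "s < T" and f: "\<And>x. (f has_derivative f' x) (at x)"
    and f': "\<And>e. e \<in> Basis \<Longrightarrow> continuous_on UNIV (\<lambda>x. f' x e)"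
  shows "(LINT x|lborel. indicator \<Omega> x *\<^sub>R f' x (U (x, s))) = 0"
proof (rule tangential_weakly[OF _ _ _ _ _ f f'])
  show "continuous_on (closure \<Omega>) (\<lambda>x. U (x, s))"
    by (rule continuous_on_compose2[OF Uc]) (use s in \<open>auto intro!: continuous_intros\<close>)
  show "((\<lambda>y. U (y, s)) has_derivative (\<lambda>h. D (x, s) (h, 0))) (at x)" if "x \<in> \<Omega>" for x
    using slice_has_derivative that s by simp
  show "continuous_on \<Omega> (\<lambda>x. D (x, s) (e, 0))" if "e \<in> Basis" for e
  proof (rule uniformly_continuous_imp_continuous, rule uniformly_continuous_on_slice)
    show "uniformly_continuous_on Q (\<lambda>z. D z (e, 0))" using that by (intro Du) (simp add: Basis_prod_def)
  qed (use s in simp)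
  show "(\<Sum>b\<in>Basis. D (x, s) (b, 0) \<bullet> b) = 0" if "x \<in> \<Omega>" for x using divU that s by simp
  show "U (p, s) \<bullet> \<nu> p = 0" if "p \<in> frontier \<Omega>" for p using Un that s by simp
qed

lemma U_slice_integrable:
  assumes s: "0 \<le> s" "s \<le> T"
  shows "integrable lborel (\<lambda>x. indicator \<Omega> x *\<^sub>R U (x, s))"
proof -
  obtain B where B: "\<And>z. z \<in> closure \<Omega> \<times> {0..T} \<Longrightarrow> norm (U z) \<le> B" using bounds by blast
  have B': "norm (U (x, s)) \<le> B" if "x \<in> \<Omega>" for x using B[of "(x, s)"] that s closure_subset[of \<Omega>] by auto
  have c: "continuous_on \<Omega> (\<lambda>x. U (x, s))"
    by (rule continuous_on_compose2[OF Uc]) (use s closure_subset[of \<Omega>] in \<open>auto intro!: continuous_intros\<close>)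
  have B0: "B \<ge> 0" using nonempty B' norm_ge_zero order_trans by blast
  show "integrable lborel (\<lambda>x. indicator \<Omega> x *\<^sub>R U (x, s))"
    by (rule borel_measurable_compact_support_integrable[OF borel_measurable_continuous_on_indicator[OF dom_borel c], where B = B and S = \<Omega>])
       (use B' B0 bounded_dom dom_borel in \<open>auto simp: indicator_def\<close>)
qed

text \<open>Functions on the whole space are handled by \<open>U_tangential\<close>;
  \<open>solenoidal_gradient\<close> extends this to functions that, like the pressure, are
  controlled on the domain only.\<close>

lemma U_gradient:
  fixes f :: "'a \<Rightarrow> real"
  assumes s: "0 < s" "s < T" and f: "\<And>x. x \<in> \<Omega> \<Longrightarrow> (f has_derivative f' x) (at x)"
    and f': "\<And>e. e \<in> Basis \<Longrightarrow> uniformly_continuous_on \<Omega> (\<lambda>x. f' x e)"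
  shows "(LINT x|lborel. indicator \<Omega> x *\<^sub>R f' x (U (x, s))) = 0"
proof (rule solenoidal_gradient[OF _ _ f f'])
  show "integrable lborel (\<lambda>x. indicator \<Omega> x *\<^sub>R U (x, s))" using U_slice_integrable s by simp
  fix \<psi> :: "'a \<Rightarrow> real" assume \<psi>: "smooth_on UNIV \<psi>"
  show "(LINT x|lborel. indicator \<Omega> x *\<^sub>R frechet_derivative \<psi> (at x) (U (x, s))) = 0"
    using smooth_on_has_derivative[OF \<psi>] smooth_onD[OF \<psi>] by (intro U_tangential[OF s]) (auto intro: smooth_onD)
qed

lemma v_integrable:
  assumes "(\<lambda>z. indicator Q z *\<^sub>R f z) \<in> borel_measurable borel" "\<And>z. z \<in> Q \<Longrightarrow> norm (f z) \<le> c * (1 + (norm (v z))\<^sup>2)"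
  shows "integrable lborel (\<lambda>z. indicator Q z *\<^sub>R f z :: 'b::euclidean_space)"
proof (rule Bochner_Integration.integrable_bound)
  have "integrable lborel (\<lambda>z. indicator Q z :: real)"
    using emeasure_bounded_finite[OF Q_bounded] by (intro integrable_real_indicator) auto
  then show "integrable lborel (\<lambda>z. c * (indicator Q z + indicator Q z * (norm (v z))\<^sup>2))"
    using v2 by (intro integrable_mult_right Bochner_Integration.integrable_add)
  show "AE z in lborel. norm (indicator Q z *\<^sub>R f z) \<le> norm (c * (indicator Q z + indicator Q z * (norm (v z))\<^sup>2))"
    using assms(2) by (intro always_eventually allI) (fastforce simp: indicator_def)
qed (use assms(1) in simp)

lemma v_slice_integrable: "AE s in lborel. 0 < s \<longrightarrow> s < T \<longrightarrow> integrable lborel (\<lambda>x. indicator \<Omega> x *\<^sub>R v (x, s))"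
proof -
  have "integrable lborel (\<lambda>z. indicator Q z *\<^sub>R v z)"
    using vm norm_le_1_square by (intro v_integrable[where c = 1]) auto
  then have "AE s in lborel. integrable lborel (\<lambda>x. indicator Q (x, s) *\<^sub>R v (x, s))"
    using lborel_pair.AE_integrable_snd[of "\<lambda>x s. indicator Q (x, s) *\<^sub>R v (x, s)"] unfolding lborel_prod by (simp add: case_prod_beta')
  then show ?thesis
    by eventually_elim (auto simp: indicator_times)
qed

text \<open>The quantifier over \<open>f\<close> stands inside, so that one null set of times serves
  all functions. This matters because the function used later depends on \<open>s\<close>.\<close>

lemma v_gradient:
  "AE s in lborel. 0 < s \<longrightarrow> s < T \<longrightarrow> (\<forall>f f'. (\<forall>x\<in>\<Omega>. (f has_derivative f' x) (at x)) \<longrightarrow>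
    (\<forall>e\<in>Basis. uniformly_continuous_on \<Omega> (\<lambda>x. f' x e)) \<longrightarrow> (LINT x|lborel. indicator \<Omega> x *\<^sub>R (f' x (v (x, s)) :: real)) = 0)"
  using v_slice_integrable sol
proof eventually_elim
  case (elim s)
  show ?case
  proof (intro impI allI)
    fix f :: "'a \<Rightarrow> real" and f'
    assume s: "0 < s" "s < T" and f: "\<forall>x\<in>\<Omega>. (f has_derivative f' x) (at x)" "\<forall>e\<in>Basis. uniformly_continuous_on \<Omega> (\<lambda>x. f' x e)"
    show "(LINT x|lborel. indicator \<Omega> x *\<^sub>R f' x (v (x, s))) = 0"
    proof (rule solenoidal_gradient[where g = f])
      show "integrable lborel (\<lambda>x. indicator \<Omega> x *\<^sub>R v (x, s))" using elim(1) s by blast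
      show "(LINT x|lborel. indicator \<Omega> x *\<^sub>R frechet_derivative \<psi> (at x) (v (x, s))) = 0"
        if "smooth_on UNIV \<psi>" "\<exists>K. compact K \<and> (\<forall>x. x \<notin> K \<longrightarrow> \<psi> x = 0)" for \<psi> :: "'a \<Rightarrow> real"
        using elim(2) s that by blast
    qed (use f in blast)+
  qed
qed
end

section \<open>Weighted energy integrals\<close>

context weak_strong
begin

lemma measurable_coefficients:
  "(\<lambda>z. indicator Q z *\<^sub>R U z) \<in> borel_measurable borel"
  "e \<in> Basis \<Longrightarrow> (\<lambda>z. indicator Q z *\<^sub>R D z e) \<in> borel_measurable borel"
  "(\<lambda>z. indicator Q z *\<^sub>R G z) \<in> borel_measurable borel"
  using cylinder_continuous(1)[OF Uc] Du[of e] G_continuous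
  by (auto simp del: split_paired_All split_paired_Ex intro!: borel_measurable_continuous_on_indicator Q_borel uniformly_continuous_imp_continuous)

lemma measurable_space_derivative:
  assumes "h \<in> borel_measurable borel"
  shows "(\<lambda>z. indicator Q z *\<^sub>R D z (h z, 0)) \<in> borel_measurable borel"
proof -
  have "(\<lambda>z. indicator Q z *\<^sub>R D z (h z, 0)) = (\<lambda>z. \<Sum>b\<in>Basis. (h z \<bullet> b) *\<^sub>R (indicator Q z *\<^sub>R D z (b, 0)))"
    by (rule ext) (auto simp: indicator_def D_space)
  moreover have "\<dots> \<in> borel_measurable borel"
    using assms by (intro borel_measurable_sum borel_measurable_scaleR borel_measurable_inner measurable_coefficients) (auto simp: Basis_prod_def)
  ultimately show ?thesis by simp
qed

lemma weighted_measurable: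
  fixes g h :: "'a \<times> real \<Rightarrow> 'a"
  assumes "f \<in> borel_measurable borel" "(\<lambda>z. indicator Q z *\<^sub>R g z) \<in> borel_measurable borel" "(\<lambda>z. indicator Q z *\<^sub>R h z) \<in> borel_measurable borel"
  shows "(\<lambda>z. indicator Q z *\<^sub>R (f z * (g z \<bullet> h z)) :: real) \<in> borel_measurable borel"
proof -
  have "(\<lambda>z. indicator Q z *\<^sub>R (f z * (g z \<bullet> h z))) = (\<lambda>z. f z * ((indicator Q z *\<^sub>R g z) \<bullet> (indicator Q z *\<^sub>R h z)))"
    by (auto simp: indicator_def)
  also have "\<dots> \<in> borel_measurable borel" using assms by (intro borel_measurable_times borel_measurable_inner)
  finally show ?thesis .
qed

lemma weighted_integrable:
  fixes g h :: "'a \<times> real \<Rightarrow> 'a"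
  assumes "f \<in> borel_measurable borel" "(\<lambda>z. indicator Q z *\<^sub>R g z) \<in> borel_measurable borel" "(\<lambda>z. indicator Q z *\<^sub>R h z) \<in> borel_measurable borel"
    and f: "\<And>z. z \<in> Q \<Longrightarrow> \<bar>f z\<bar> \<le> F"
    and g: "\<And>z. z \<in> Q \<Longrightarrow> norm (g z) \<le> b1 * (1 + norm (v z))" and h: "\<And>z. z \<in> Q \<Longrightarrow> norm (h z) \<le> b2 * (1 + norm (v z))"
  shows "integrable lborel (\<lambda>z. indicator Q z *\<^sub>R (f z * (g z \<bullet> h z)) :: real)"
proof (rule v_integrable[OF weighted_measurable[OF assms(1-3)]])
  fix z assume z: "z \<in> Q"
  have "0 \<le> b1 * (1 + norm (v z))" "0 \<le> b2 * (1 + norm (v z))"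
    using g[OF z] h[OF z] norm_ge_zero order_trans by blast+
  moreover have "0 < 1 + norm (v z)" using norm_ge_zero[of "v z"] by linarith
  ultimately have b: "b1 \<ge> 0" "b2 \<ge> 0" by (auto simp: zero_le_mult_iff)
  have F: "F \<ge> 0" using f[OF z] by linarith
  have "\<bar>g z \<bullet> h z\<bar> \<le> norm (g z) * norm (h z)" by (rule Cauchy_Schwarz_ineq2)
  also have "\<dots> \<le> (b1 * (1 + norm (v z))) * (b2 * (1 + norm (v z)))" using g[OF z] h[OF z] b by (intro mult_mono) auto
  also have "\<dots> = b1 * b2 * (1 + norm (v z))\<^sup>2" by (simp add: power2_eq_square)
  also have "\<dots> \<le> b1 * b2 * (2 * (1 + (norm (v z))\<^sup>2))"
  proof (rule mult_left_mono)
    have "0 \<le> (1 - norm (v z))\<^sup>2" by simp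
    then show "(1 + norm (v z))\<^sup>2 \<le> 2 * (1 + (norm (v z))\<^sup>2)" by (simp add: power2_eq_square algebra_simps)
  qed (use b in simp)
  finally have "\<bar>f z\<bar> * \<bar>g z \<bullet> h z\<bar> \<le> F * (b1 * b2 * (2 * (1 + (norm (v z))\<^sup>2)))"
    using f[OF z] F by (intro mult_mono) auto
  then show "norm (f z * (g z \<bullet> h z)) \<le> (F * b1 * b2 * 2) * (1 + (norm (v z))\<^sup>2)" by (simp add: abs_mult mult_ac)
qed

text \<open>Admissibility holds for almost every time; integrating it against a nonnegative weight
  in time makes it compatible with the space-time identities.\<close>

lemma energy_weight:
  assumes f: "f \<in> borel_measurable borel" "\<And>s. 0 < s \<Longrightarrow> s < T \<Longrightarrow> 0 \<le> f s" "\<And>s. 0 < s \<Longrightarrow> s < T \<Longrightarrow> f s \<le> F"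
  shows "(LINT z|lborel. indicator Q z *\<^sub>R (f (snd z) * (v z \<bullet> v z))) \<le>
    (LINT s|lborel. indicator {0<..<T} s *\<^sub>R f s) * (LINT x|lborel. indicator \<Omega> x * (norm (U (x, 0)))\<^sup>2)" (is "?I \<le> _ * ?N")
proof -
  have i: "integrable lborel (\<lambda>z. indicator Q z *\<^sub>R (f (snd z) * (v z \<bullet> v z)))"
  proof (rule weighted_integrable[where F = F and ?b1.0 = 1 and ?b2.0 = 1])
    show "(\<lambda>z. f (snd z)) \<in> borel_measurable borel" using f(1) by - (rule measurable_compose[OF borel_measurable_continuous_onI[OF continuous_on_snd[OF continuous_on_id]]])
    show "(\<lambda>z. indicator Q z *\<^sub>R v z) \<in> borel_measurable borel" "(\<lambda>z. indicator Q z *\<^sub>R v z) \<in> borel_measurable borel" using vm by simp_all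
    show "\<bar>f (snd z)\<bar> \<le> F" if "z \<in> Q" for z using f(2,3)[of "snd z"] that by (auto simp: mem_Times_iff)
  qed auto
  have fi: "integrable lborel (\<lambda>s. indicator {0<..<T} s *\<^sub>R f s)"
    by (rule borel_measurable_compact_support_integrable[where B = "\<bar>F\<bar>" and S = "{0<..<T}"])
       (use f in \<open>auto simp: indicator_def intro!: order_trans[OF _ abs_ge_self]\<close>)
  have slice: "(LINT x|lborel. indicator Q (x, s) *\<^sub>R (f (snd (x, s)) * (v (x, s) \<bullet> v (x, s)))) =
    indicator {0<..<T} s * f s * (LINT x|lborel. indicator \<Omega> x * (norm (v (x, s)))\<^sup>2)" for s
  proof -
    have "(\<lambda>x. indicator Q (x, s) *\<^sub>R (f (snd (x, s)) * (v (x, s) \<bullet> v (x, s)))) =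
      (\<lambda>x. (indicator {0<..<T} s * f s) * (indicator \<Omega> x * (norm (v (x, s)))\<^sup>2))"
      by (auto simp: indicator_def dot_square_norm)
    then show ?thesis by simp
  qed
  have "?I = (LINT s|lborel. indicator {0<..<T} s * f s * (LINT x|lborel. indicator \<Omega> x * (norm (v (x, s)))\<^sup>2))"
    unfolding integral_lborel_snd(1)[OF i] slice ..
  also have "\<dots> \<le> (LINT s|lborel. (indicator {0<..<T} s *\<^sub>R f s) * ?N)"
  proof (rule integral_mono_AE)
    show "integrable lborel (\<lambda>s. indicator {0<..<T} s * f s * (LINT x|lborel. indicator \<Omega> x * (norm (v (x, s)))\<^sup>2))"
      using integral_lborel_snd(2)[OF i] unfolding slice .
    show "integrable lborel (\<lambda>s. (indicator {0<..<T} s *\<^sub>R f s) * ?N)" using fi by (rule integrable_mult_left)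
    show "AE s in lborel. indicator {0<..<T} s * f s * (LINT x|lborel. indicator \<Omega> x * (norm (v (x, s)))\<^sup>2) \<le> (indicator {0<..<T} s *\<^sub>R f s) * ?N"
      using energy by eventually_elim (auto simp: indicator_def intro!: mult_left_mono f(2))
  qed
  also have "\<dots> = (LINT s|lborel. indicator {0<..<T} s *\<^sub>R f s) * ?N" by simp
  finally show ?thesis .
qed

text \<open>For fixed \<open>x\<close> the two integrands add up to the time derivative of
  \<open>\<theta> * |U|^2 / 2\<close>, which vanishes at \<open>T\<close>; the fundamental theorem
  is applied on each line in time before integrating over space.\<close>

lemma U_energy_weight:
  assumes \<theta>: "\<And>s. (\<theta> has_real_derivative \<theta>' s) (at s)" and \<theta>'c: "continuous_on UNIV \<theta>'" and "\<theta> T = 0"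
  shows "integrable lborel (\<lambda>z. indicator Q z *\<^sub>R (\<theta>' (snd z) / 2 * (U z \<bullet> U z)))" (is "integrable lborel ?f1")
    "integrable lborel (\<lambda>z. indicator Q z *\<^sub>R (\<theta> (snd z) * (D z (0, 1) \<bullet> U z)))" (is "integrable lborel ?f2")
    "(LINT z|lborel. indicator Q z *\<^sub>R (\<theta>' (snd z) / 2 * (U z \<bullet> U z))) + (LINT z|lborel. indicator Q z *\<^sub>R (\<theta> (snd z) * (D z (0, 1) \<bullet> U z)))
      = - (\<theta> 0 / 2) * (LINT x|lborel. indicator \<Omega> x * (norm (U (x, 0)))\<^sup>2)"
proof -
  obtain B where B: "B \<ge> 0" "\<And>z. z \<in> closure \<Omega> \<times> {0..T} \<Longrightarrow> norm (U z) \<le> B" "\<And>z e. z \<in> Q \<Longrightarrow> norm (D z e) \<le> B * norm e"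
    using bounds by blast
  have \<theta>c: "continuous_on UNIV \<theta>" using \<theta> DERIV_isCont by (auto simp: continuous_on_eq_continuous_at)
  have cm: "(\<lambda>z::'a \<times> real. k (snd z)) \<in> borel_measurable borel" if "continuous_on UNIV k" for k :: "real \<Rightarrow> real"
    by (rule borel_measurable_continuous_onI) (rule continuous_on_compose2[OF that], auto intro!: continuous_intros)
  have cb: "\<exists>F. \<forall>z\<in>Q. \<bar>k (snd z)\<bar> \<le> F" if "continuous_on UNIV k" for k :: "real \<Rightarrow> real"
    using compact_imp_bounded[OF compact_continuous_image[OF continuous_on_subset[OF that] compact_Icc[of 0 T]]]
    by (fastforce simp: bounded_iff mem_Times_iff)
  have "\<exists>F. \<forall>z\<in>Q. \<bar>\<theta>' (snd z) / 2\<bar> \<le> F" by (rule cb) (intro continuous_on_divide \<theta>'c continuous_on_const, simp)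
  then obtain F where F: "\<And>z. z \<in> Q \<Longrightarrow> \<bar>\<theta>' (snd z) / 2\<bar> \<le> F" by blast
  obtain F' where F': "\<And>z. z \<in> Q \<Longrightarrow> \<bar>\<theta> (snd z)\<bar> \<le> F'" using cb[OF \<theta>c] by blast
  have 1: "1 \<le> 1 + norm (v z)" for z by simp
  have UB: "norm (U z) \<le> B * (1 + norm (v z))" if "z \<in> Q" for z
    using B(2)[of z] closed_cylinder(2) that mult_left_mono[OF 1, of B z] B(1) by auto
  have DB: "norm (D z (0, 1)) \<le> B * (1 + norm (v z))" if "z \<in> Q" for z
    using B(3)[OF that, of "(0, 1)"] mult_left_mono[OF 1, of B z] B(1) by (simp add: norm_Pair)
  have D1: "(0, 1::real) \<in> (Basis :: ('a \<times> real) set)" by (simp add: Basis_prod_def)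
  show i1: "integrable lborel ?f1"
    by (rule weighted_integrable[OF _ _ _ F UB UB])
       (use \<theta>'c in \<open>auto intro!: cm[of "\<lambda>s. \<theta>' s / 2", simplified] continuous_intros measurable_coefficients\<close>)
  show i2: "integrable lborel ?f2"
    by (rule weighted_integrable[OF cm[OF \<theta>c] _ _ F' DB UB]) (auto intro!: measurable_coefficients D1)
  have i: "integrable lborel (\<lambda>z. ?f1 z + ?f2 z)" using i1 i2 by (rule Bochner_Integration.integrable_add)
  have slice: "(LINT s|lborel. ?f1 (x, s) + ?f2 (x, s)) = - (\<theta> 0 / 2) * (indicator \<Omega> x * (norm (U (x, 0)))\<^sup>2)" for x
  proof (cases "x \<in> \<Omega>")
    case x: True
    define h where "h = (\<lambda>s. 1 / 2 * (\<theta> s * (U (x, s) \<bullet> U (x, s))))"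
    define h' where "h' = (\<lambda>s. \<theta>' s / 2 * (U (x, s) \<bullet> U (x, s)) + \<theta> s * (D (x, s) (0, 1) \<bullet> U (x, s)))"
    have Uxc: "continuous_on {0..T} (\<lambda>s. U (x, s))"
      by (rule continuous_on_compose2[OF Uc]) (use x closure_subset[of \<Omega>] in \<open>auto intro!: continuous_intros\<close>)
    have Dxc: "continuous_on {0<..<T} (\<lambda>s. D (x, s) (0, 1))"
      by (rule continuous_on_compose2[OF uniformly_continuous_imp_continuous[OF Du[OF D1]]]) (use x in \<open>auto intro!: continuous_intros\<close>)
    have Uxo: "continuous_on {0<..<T} (\<lambda>s. U (x, s))" by (rule continuous_on_subset[OF Uxc]) auto
    have hc: "continuous_on {0..T} h" unfolding h_def by (intro continuous_intros Uxc continuous_on_subset[OF \<theta>c]) auto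
    have hd: "(h has_real_derivative h' s) (at s)" if s: "s \<in> {0<..<T}" for s
    proof -
      have U: "((\<lambda>\<tau>. U (x, \<tau>)) has_derivative (\<lambda>h. h *\<^sub>R D (x, s) (0, 1))) (at s)"
        using time_has_vector_derivative[of x s] x s by (simp add: has_vector_derivative_def)
      have \<theta>d: "(\<theta> has_derivative (\<lambda>h. \<theta>' s * h)) (at s)" using \<theta>[of s] by (simp add: has_field_derivative_def)
      show ?thesis unfolding has_field_derivative_def h_def h'_def
        by (rule has_derivative_eq_rhs[OF has_derivative_mult_right[OF has_derivative_mult[OF \<theta>d has_derivative_inner[OF U U]]]])
           (simp add: fun_eq_iff inner_commute algebra_simps)
    qed
    have h'i: "integrable lborel (\<lambda>s. indicator {0<..<T} s *\<^sub>R h' s)"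
    proof (rule borel_measurable_compact_support_integrable[where S = "{0<..<T}"])
      show "(\<lambda>s. indicator {0<..<T} s *\<^sub>R h' s) \<in> borel_measurable borel"
        unfolding h'_def by (rule borel_measurable_continuous_on_indicator)
          (auto intro!: continuous_intros Uxo Dxc continuous_on_subset[OF \<theta>c] continuous_on_subset[OF \<theta>'c])
      show "norm (indicator {0<..<T} s *\<^sub>R h' s) \<le> \<bar>F\<bar> * (B * B) + \<bar>F'\<bar> * (B * B)" for s
      proof (cases "s \<in> {0<..<T}")
        case True
        have z: "(x, s) \<in> Q" using x True by simp
        have UB: "norm (U (x, s)) \<le> B" using B(2) z closed_cylinder(2) by blast
        have "\<bar>U (x, s) \<bullet> U (x, s)\<bar> \<le> B * B" using Cauchy_Schwarz_ineq2 mult_mono[OF UB UB] B(1) order_trans by fastforce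
        moreover have "\<bar>D (x, s) (0, 1) \<bullet> U (x, s)\<bar> \<le> B * B"
          using Cauchy_Schwarz_ineq2[of "D (x, s) (0, 1)" "U (x, s)"] mult_mono[OF B(3)[OF z, of "(0, 1)"] UB] B(1) by (simp add: norm_Pair)
        moreover have "\<bar>\<theta>' s / 2\<bar> \<le> \<bar>F\<bar>" "\<bar>\<theta> s\<bar> \<le> \<bar>F'\<bar>" using F[OF z] F'[OF z] by auto
        ultimately have "\<bar>\<theta>' s / 2\<bar> * \<bar>U (x, s) \<bullet> U (x, s)\<bar> + \<bar>\<theta> s\<bar> * \<bar>D (x, s) (0, 1) \<bullet> U (x, s)\<bar> \<le> \<bar>F\<bar> * (B * B) + \<bar>F'\<bar> * (B * B)"
          by (intro add_mono mult_mono) auto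
        then have "\<bar>h' s\<bar> \<le> \<bar>F\<bar> * (B * B) + \<bar>F'\<bar> * (B * B)"
          unfolding h'_def using abs_triangle_ineq[of "\<theta>' s / 2 * (U (x, s) \<bullet> U (x, s))" "\<theta> s * (D (x, s) (0, 1) \<bullet> U (x, s))"]
          unfolding abs_mult by linarith
        then show ?thesis using True by simp
      qed (use B(1) in simp)
    qed auto
    have "(\<lambda>s. ?f1 (x, s) + ?f2 (x, s)) = (\<lambda>s. indicator {0<..<T} s *\<^sub>R h' s)"
      using x by (auto simp: indicator_def h'_def)
    then have "(LINT s|lborel. ?f1 (x, s) + ?f2 (x, s)) = h T - h 0"
      using integral_interval_FTC[OF Tpos hc hd h'i] by simp
    then show ?thesis using x assms(3) by (simp add: h_def dot_square_norm)
  qed (simp add: indicator_times)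
  have "(LINT z|lborel. ?f1 z) + (LINT z|lborel. ?f2 z) = (LINT z|lborel. ?f1 z + ?f2 z)"
    using i1 i2 by (rule Bochner_Integration.integral_add[symmetric])
  also have "\<dots> = (LINT x|lborel. - (\<theta> 0 / 2) * (indicator \<Omega> x * (norm (U (x, 0)))\<^sup>2))"
    unfolding integral_lborel_fst[OF i] slice ..
  finally show "(LINT z|lborel. ?f1 z) + (LINT z|lborel. ?f2 z) = - (\<theta> 0 / 2) * (LINT x|lborel. indicator \<Omega> x * (norm (U (x, 0)))\<^sup>2)"
    by simp
qed

end

context weak_strong
begin

text \<open>The energy inequality of \<open>v\<close>, the energy balance of \<open>U\<close> and the weak formulation tested with \<open>\<theta> U\<close> add up to this;
  the terms \<open>Z1\<close>, \<open>Z2\<close>, \<open>Z3\<close> that are not quadratic in \<open>v - U\<close> are gradients tested with \<open>v\<close> or \<open>U\<close>.\<close>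

lemma weighted_inequality:
  assumes T': "0 < T'" "T' < T"
    and \<theta>: "\<And>s. (\<theta> has_real_derivative \<theta>' s) (at s)" and \<theta>'c: "continuous_on UNIV \<theta>'"
    and \<theta>0: "\<And>s. s \<ge> T' \<Longrightarrow> \<theta> s = 0" "\<And>s. s \<ge> T' \<Longrightarrow> \<theta>' s = 0"
    and \<theta>s: "\<And>s. 0 < s \<Longrightarrow> \<theta> s \<ge> 0" "\<And>s. 0 < s \<Longrightarrow> \<theta>' s \<le> 0"
    and g0: "\<And>z e. z \<in> Q \<Longrightarrow> norm (D z e) \<le> g0 * norm e"
  shows "integrable lborel (\<lambda>z. indicator Q z *\<^sub>R ((- \<theta>' (snd z) / 2 - g0 * \<theta> (snd z)) * ((v z - U z) \<bullet> (v z - U z))))"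
    "(LINT z|lborel. indicator Q z *\<^sub>R ((- \<theta>' (snd z) / 2 - g0 * \<theta> (snd z)) * ((v z - U z) \<bullet> (v z - U z)))) \<le> 0"
proof -
  obtain B where B: "B \<ge> 0" "\<And>z. z \<in> closure \<Omega> \<times> {0..T} \<Longrightarrow> norm (U z) \<le> B" "\<And>z e. z \<in> Q \<Longrightarrow> norm (D z e) \<le> B * norm e"
    "\<And>z. z \<in> Q \<Longrightarrow> norm (G z) \<le> B"
    using bounds by blast
  have UB: "norm (U z) \<le> B" if "z \<in> Q" for z using B(2) that closed_cylinder(2) by blast
  have \<theta>c: "continuous_on UNIV \<theta>" using \<theta> DERIV_isCont by (auto simp: continuous_on_eq_continuous_at)
  have cs: "continuous_on S (\<lambda>z::'a \<times> real. k (snd z))" if "continuous_on UNIV k" for k :: "real \<Rightarrow> real" and S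
    by (rule continuous_on_compose2[OF that]) (auto intro!: continuous_intros)
  have cm: "(\<lambda>z::'a \<times> real. k (snd z)) \<in> borel_measurable borel" if "continuous_on UNIV k" for k :: "real \<Rightarrow> real"
    by (rule borel_measurable_continuous_onI) (rule cs[OF that])
  have cb: "\<exists>F. \<forall>s\<in>{0..T}. \<bar>k s\<bar> \<le> F" if "continuous_on UNIV k" for k :: "real \<Rightarrow> real"
    using compact_imp_bounded[OF compact_continuous_image[OF continuous_on_subset[OF that] compact_Icc[of 0 T]]]
    by (fastforce simp: bounded_iff)
  obtain F1 F2 where "\<forall>s\<in>{0..T}. \<bar>\<theta> s\<bar> \<le> F1" "\<forall>s\<in>{0..T}. \<bar>\<theta>' s\<bar> \<le> F2" using cb[OF \<theta>c] cb[OF \<theta>'c] by blast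
  then obtain F where F: "F \<ge> 0" "\<And>s. s \<in> {0..T} \<Longrightarrow> \<bar>\<theta> s\<bar> \<le> F" "\<And>s. s \<in> {0..T} \<Longrightarrow> \<bar>\<theta>' s\<bar> \<le> F"
    using Tpos by (intro that[of "max 0 (max F1 F2)"]) fastforce+
  have FQ: "\<bar>\<theta> (snd z)\<bar> \<le> F" "\<bar>\<theta>' (snd z)\<bar> \<le> F" if "z \<in> Q" for z using F that by (auto simp: mem_Times_iff)
  define V where "V z = \<theta> (snd z) *\<^sub>R U z" for z
  define V' where "V' z e = \<theta> (snd z) *\<^sub>R D z e + (\<theta>' (snd z) * snd e) *\<^sub>R U z" for z e
  define gV where "gV = 2 * (F * B)"
  have FB: "0 \<le> F * B" using F(1) B(1) by simp
  have Vd: "(V has_derivative V' z) (at z)" if z: "z \<in> Q" for z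
  proof -
    have "((\<lambda>z. \<theta> (snd z)) has_derivative (\<lambda>e. \<theta>' (snd z) * snd e)) (at z)"
      using has_derivative_compose[OF has_derivative_snd[OF has_derivative_ident] \<theta>[unfolded has_field_derivative_def]] .
    from has_derivative_scaleR[OF this Ud[OF z]] show ?thesis unfolding V_def[abs_def] V'_def[abs_def] .
  qed
  have Vc: "continuous_on (closure \<Omega> \<times> {0..T}) V" unfolding V_def[abs_def] by (intro continuous_intros Uc cs \<theta>c)
  have V'u: "uniformly_continuous_on Q (\<lambda>z. V' z e)" if e: "e \<in> Basis" for e
    unfolding V'_def
    by (intro uniformly_continuous_on_add uniformly_continuous_on_bilinear[OF bounded_bilinear_scaleR]
          cylinder_continuous Du D_bounded e Uc cs \<theta>c continuous_on_mult \<theta>'c continuous_on_const)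
  have V'lin: "linear (V' z)" if "z \<in> Q" for z using Vd[OF that] has_derivative_linear by blast
  have Vg: "norm (V z) \<le> gV" if "z \<in> Q" for z
  proof -
    have "norm (V z) \<le> F * B" unfolding V_def norm_scaleR using FQ[OF that] UB[OF that] F(1) by (intro mult_mono) auto
    then show ?thesis using FB by (simp add: gV_def)
  qed
  have V'g: "norm (V' z e) \<le> gV * norm e" if "z \<in> Q" for z e
  proof -
    have "norm (\<theta> (snd z) *\<^sub>R D z e) \<le> F * (B * norm e)"
      unfolding norm_scaleR using FQ[OF that] B(3)[OF that] F(1) by (intro mult_mono) auto
    moreover have "norm ((\<theta>' (snd z) * snd e) *\<^sub>R U z) \<le> (F * norm e) * B"
      unfolding norm_scaleR abs_mult using FQ[OF that] UB[OF that] F(1) norm_snd_le[of "snd e" "fst e"] by (intro mult_mono) auto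
    ultimately show ?thesis unfolding V'_def gV_def by (intro norm_triangle_le) (simp add: algebra_simps)
  qed
  have V'c: "continuous_on Q (\<lambda>z. V' z e)" for e
  proof -
    have "continuous_on Q (\<lambda>z. \<Sum>b\<in>Basis. (e \<bullet> b) *\<^sub>R V' z b)"
      by (intro continuous_on_sum continuous_on_scaleR continuous_on_const uniformly_continuous_imp_continuous[OF V'u])
    moreover have "V' z e = (\<Sum>b\<in>Basis. (e \<bullet> b) *\<^sub>R V' z b)" if "z \<in> Q" for z
      using linear_sum[OF V'lin[OF that], of "\<lambda>b. (e \<bullet> b) *\<^sub>R b" Basis] linear_scale[OF V'lin[OF that]]
      by (simp add: euclidean_representation)
    ultimately show ?thesis by (simp cong: continuous_on_cong)
  qed
  interpret tf: test_field \<Omega> r \<nu> w w' W L T T' gV V V'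
  proof
    show "0 < T'" "T' < T" by fact+
    show "V z = 0" if "z \<in> \<Omega> \<times> {T'..<T}" for z using that \<theta>0 by (auto simp: V_def)
    show "V' z e = 0" if "z \<in> \<Omega> \<times> {T'..<T}" for z e using that \<theta>0 by (auto simp: V'_def)
    fix s and f :: "'a \<Rightarrow> real" and f'
    assume s: "0 < s" "s < T" and f: "\<And>x. (f has_derivative f' x) (at x)" "\<And>e. e \<in> Basis \<Longrightarrow> continuous_on UNIV (\<lambda>x. f' x e)"
    have "(\<lambda>x. indicator \<Omega> x *\<^sub>R f' x (V (x, s))) = (\<lambda>x. \<theta> s * (indicator \<Omega> x *\<^sub>R f' x (U (x, s))))"
      using linear_scale[OF has_derivative_linear[OF f(1)]] by (auto simp: V_def)
    then show "(LINT x|lborel. indicator \<Omega> x *\<^sub>R f' x (V (x, s))) = 0" using U_tangential[OF s f] by simp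
  qed (fact Vd V'c Vg V'g)+
  let ?N = "LINT x|lborel. indicator \<Omega> x * (norm (U (x, 0)))\<^sup>2"
  have Vu: "\<exists>\<delta>>0. \<forall>z\<in>closure \<Omega> \<times> {0..T}. \<forall>z'\<in>closure \<Omega> \<times> {0..T}. dist z z' < \<delta> \<longrightarrow> norm (V z - V z') \<le> \<eta>" if "\<eta> > 0" for \<eta>
    using compact_uniformly_continuous[OF Vc closed_cylinder(1)] that unfolding uniformly_continuous_on_def dist_norm
    by (metis less_imp_le norm_minus_commute)
  obtain \<delta>1 M where layer1: "\<delta>1 > 0" "AE z in lborel. z \<in> Q \<longrightarrow> d (fst z) < \<delta>1 \<longrightarrow> norm (v z) \<le> M"
    using layer by blast
  have E: "(LINT z|lborel. indicator Q z *\<^sub>R (V' z (0, 1) \<bullet> v z + V' z (v z, 0) \<bullet> v z)) +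
       (LINT x|lborel. indicator \<Omega> x *\<^sub>R (U (x, 0) \<bullet> (\<theta> 0 *\<^sub>R U (x, 0)))) = 0"
  proof (rule tf.weak_limit[OF vm v2 weak layer1 normal, where ?M0.0 = B])
    fix \<eta> :: real assume \<eta>: "\<eta> > 0"
    obtain \<delta> where \<delta>: "\<delta> > 0" "\<forall>z\<in>closure \<Omega> \<times> {0..T}. \<forall>z'\<in>closure \<Omega> \<times> {0..T}. dist z z' < \<delta> \<longrightarrow> norm (V z - V z') \<le> \<eta>"
      using Vu[OF \<eta>] by blast
    obtain \<delta>' where \<delta>': "\<delta>' > 0" "\<forall>z\<in>Q. \<forall>z'\<in>Q. dist z z' < \<delta>' \<longrightarrow> (\<forall>e. norm e \<le> 1 \<longrightarrow> norm (V' z e - V' z' e) \<le> \<eta>)"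
      using uniformly_continuous_derivative[OF V'u V'lin \<eta>] by blast
    show "\<exists>\<delta>>0. \<forall>z\<in>Q. \<forall>z'\<in>Q. dist z z' < \<delta> \<longrightarrow> norm (V z - V z') \<le> \<eta> \<and> (\<forall>e. norm e \<le> 1 \<longrightarrow> norm (V' z e - V' z' e) \<le> \<eta>)"
      using \<delta> \<delta>' closed_cylinder(2) by (intro exI[of _ "min \<delta> \<delta>'"]) (meson min_less_iff_conj subsetD)
    show "\<exists>\<delta>>0. \<forall>x\<in>\<Omega>. \<forall>z\<in>Q. dist z (x, 0) < \<delta> \<longrightarrow> norm (V z - \<theta> 0 *\<^sub>R U (x, 0)) \<le> \<eta>"
    proof (intro exI[of _ \<delta>] conjI ballI impI \<delta>(1))
      fix x z assume a: "x \<in> \<Omega>" "z \<in> Q" "dist z (x, 0) < \<delta>"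
      have "(x, 0) \<in> closure \<Omega> \<times> {0..T}" using a(1) closure_subset[of \<Omega>] Tpos by auto
      then have "norm (V z - V (x, 0)) \<le> \<eta>" using \<delta>(2) a closed_cylinder(2) by blast
      then show "norm (V z - \<theta> 0 *\<^sub>R U (x, 0)) \<le> \<eta>" by (simp add: V_def)
    qed
  next
    show U0: "norm (U (x, 0)) \<le> B" if "x \<in> \<Omega>" for x using B(2)[of "(x, 0)"] that closure_subset[of \<Omega>] Tpos by auto
    show "norm (\<theta> 0 *\<^sub>R U (x, 0)) \<le> gV" if "x \<in> \<Omega>" for x
    proof -
      have "norm (\<theta> 0 *\<^sub>R U (x, 0)) \<le> F * B" unfolding norm_scaleR using F(1) F(2)[of 0] U0[OF that] Tpos by (intro mult_mono) auto
      then show ?thesis using FB by (simp add: gV_def)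
    qed
    have "(\<lambda>x. indicator \<Omega> x *\<^sub>R U (x, 0)) \<in> borel_measurable borel"
      using U_slice_integrable[of 0] Tpos by (simp add: integrable_iff_bounded)
    then show m: "(\<lambda>x. indicator \<Omega> x *\<^sub>R U (x, 0)) \<in> borel_measurable borel" .
    show "(\<lambda>x. indicator \<Omega> x *\<^sub>R (\<theta> 0 *\<^sub>R U (x, 0))) \<in> borel_measurable borel"
      using borel_measurable_scaleR[OF borel_measurable_const[of "\<theta> 0"] m] by (simp only: scaleR_left_commute)
  qed
  have N0: "(LINT x|lborel. indicator \<Omega> x *\<^sub>R (U (x, 0) \<bullet> (\<theta> 0 *\<^sub>R U (x, 0)))) = \<theta> 0 * ?N"
  proof -
    have "(\<lambda>x. indicator \<Omega> x *\<^sub>R (U (x, 0) \<bullet> (\<theta> 0 *\<^sub>R U (x, 0)))) = (\<lambda>x. \<theta> 0 * (indicator \<Omega> x * (norm (U (x, 0)))\<^sup>2))"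
      by (auto simp: dot_square_norm mult_ac)
    then show ?thesis by simp
  qed
  note mU = measurable_coefficients(1) and mG = measurable_coefficients(3)
  have mv: "(\<lambda>z. indicator Q z *\<^sub>R v z) \<in> borel_measurable borel" using vm by simp
  have mD1: "(\<lambda>z. indicator Q z *\<^sub>R D z (0, 1)) \<in> borel_measurable borel" by (rule measurable_coefficients(2)) (simp add: Basis_prod_def)
  note mDv = measurable_space_derivative[OF vm]
  have mvU: "(\<lambda>z. indicator Q z *\<^sub>R (v z - U z)) \<in> borel_measurable borel"
    using borel_measurable_diff[OF mv mU] by (simp add: scaleR_diff_right)
  have grow: "b \<le> b * (1 + norm (v z))" if "b \<ge> 0" for b z using mult_left_mono[OF _ that, of 1 "1 + norm (v z)"] by simp
  have vb: "norm (v z) \<le> 1 * (1 + norm (v z))" for z by simp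
  have Ub: "norm (U z) \<le> B * (1 + norm (v z))" if "z \<in> Q" for z using UB[OF that] grow[OF B(1), of z] by linarith
  have Gb: "norm (G z) \<le> B * (1 + norm (v z))" if "z \<in> Q" for z using B(4)[OF that] grow[OF B(1), of z] by linarith
  have D1b: "norm (D z (0, 1)) \<le> B * (1 + norm (v z))" if "z \<in> Q" for z
    using B(3)[OF that, of "(0, 1)"] grow[OF B(1), of z] by (simp add: norm_Pair)
  have Dvb: "norm (D z (v z, 0)) \<le> B * (1 + norm (v z))" if "z \<in> Q" for z
    using B(3)[OF that, of "(v z, 0)"] B(1) by (simp add: norm_Pair algebra_simps)
  have vUb: "norm (v z - U z) \<le> (1 + B) * (1 + norm (v z))" if "z \<in> Q" for z
    using norm_triangle_ineq4[of "v z" "U z"] Ub[OF that] by (simp add: algebra_simps)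
  have \<theta>2c: "continuous_on UNIV (\<lambda>s. - \<theta>' s / 2)" by (intro continuous_on_divide continuous_on_minus \<theta>'c continuous_on_const) simp
  have \<theta>2b: "\<bar>- \<theta>' (snd z) / 2\<bar> \<le> F" if "z \<in> Q" for z using FQ(2)[OF that] F(1) by simp
  have \<theta>3c: "continuous_on UNIV (\<lambda>s. - \<theta>' s / 2 - g0 * \<theta> s)" by (intro continuous_on_diff \<theta>2c continuous_on_mult continuous_on_const \<theta>c)
  obtain F3 where F3: "\<forall>s\<in>{0..T}. \<bar>- \<theta>' s / 2 - g0 * \<theta> s\<bar> \<le> F3" using cb[OF \<theta>3c] by blast
  have F3Q: "\<bar>- \<theta>' (snd z) / 2 - g0 * \<theta> (snd z)\<bar> \<le> F3" if "z \<in> Q" for z using F3 that by (auto simp: mem_Times_iff)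
  \<comment> \<open>\<open>A1\<close> comes from the energy inequality of \<open>v\<close>,
    \<open>A2\<close> and \<open>A3\<close> from the time derivative of
    \<open>\<theta> * |U|^2 / 2\<close>, and \<open>H1\<close>, \<open>H2\<close>, \<open>H3\<close>
    from the weak formulation tested with \<open>\<theta> U\<close>. With the signs of
    \<open>?R\<close> below, their bounds in terms of the initial energy cancel:
    \<open>\<theta> 0 / 2 + \<theta> 0 / 2 - \<theta> 0 = 0\<close>.\<close>
  define A1 A2 A3 H1 H2 H3 Z1 Z2 Z3 where
    "A1 = (\<lambda>z. indicator Q z *\<^sub>R (- \<theta>' (snd z) / 2 * (v z \<bullet> v z)))"
    and "A2 = (\<lambda>z. indicator Q z *\<^sub>R (\<theta>' (snd z) / 2 * (U z \<bullet> U z)))"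
    and "A3 = (\<lambda>z. indicator Q z *\<^sub>R (\<theta> (snd z) * (D z (0, 1) \<bullet> U z)))"
    and "H1 = (\<lambda>z. indicator Q z *\<^sub>R (\<theta>' (snd z) * (U z \<bullet> v z)))"
    and "H2 = (\<lambda>z. indicator Q z *\<^sub>R (\<theta> (snd z) * (D z (0, 1) \<bullet> v z)))"
    and "H3 = (\<lambda>z. indicator Q z *\<^sub>R (\<theta> (snd z) * (D z (v z, 0) \<bullet> v z)))"
    and "Z1 = (\<lambda>z. indicator Q z *\<^sub>R (\<theta> (snd z) * (D z (v z, 0) \<bullet> U z)))"
    and "Z2 = (\<lambda>z. indicator Q z *\<^sub>R (\<theta> (snd z) * (G z \<bullet> v z)))"
    and "Z3 = (\<lambda>z. indicator Q z *\<^sub>R (\<theta> (snd z) * (G z \<bullet> U z)))"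
  note defs = A1_def A2_def A3_def H1_def H2_def H3_def Z1_def Z2_def Z3_def
  have i: "integrable lborel A1" "integrable lborel H1" "integrable lborel H2" "integrable lborel H3"
    "integrable lborel Z1" "integrable lborel Z2" "integrable lborel Z3"
    unfolding defs
    by (rule weighted_integrable[OF cm[OF \<theta>2c] mv mv \<theta>2b vb vb] weighted_integrable[OF cm[OF \<theta>'c] mU mv FQ(2) Ub vb]
        weighted_integrable[OF cm[OF \<theta>c] mD1 mv FQ(1) D1b vb] weighted_integrable[OF cm[OF \<theta>c] mDv mv FQ(1) Dvb vb]
        weighted_integrable[OF cm[OF \<theta>c] mDv mU FQ(1) Dvb Ub] weighted_integrable[OF cm[OF \<theta>c] mG mv FQ(1) Gb vb]
        weighted_integrable[OF cm[OF \<theta>c] mG mU FQ(1) Gb Ub]; assumption)+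
  have i': "integrable lborel A2" "integrable lborel A3" and IA: "(LINT z|lborel. A2 z) + (LINT z|lborel. A3 z) = - (\<theta> 0 / 2) * ?N"
    using U_energy_weight[OF \<theta> \<theta>'c] \<theta>0 T' unfolding defs by auto
  have IH: "(LINT z|lborel. H1 z) + (LINT z|lborel. H2 z) + (LINT z|lborel. H3 z) = - \<theta> 0 * ?N"
  proof -
    have "(\<lambda>z. indicator Q z *\<^sub>R (V' z (0, 1) \<bullet> v z + V' z (v z, 0) \<bullet> v z)) = (\<lambda>z. H1 z + H2 z + H3 z)"
      unfolding defs by (rule ext) (simp add: V'_def indicator_def inner_add_left)
    then have "(LINT z|lborel. indicator Q z *\<^sub>R (V' z (0, 1) \<bullet> v z + V' z (v z, 0) \<bullet> v z)) =
        (LINT z|lborel. H1 z) + (LINT z|lborel. H2 z) + (LINT z|lborel. H3 z)"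
      using i by (simp add: Bochner_Integration.integral_add)
    then show ?thesis using E N0 by simp
  qed
  have IA1: "(LINT z|lborel. A1 z) \<le> \<theta> 0 / 2 * ?N"
  proof -
    have "(LINT z|lborel. A1 z) \<le> (LINT s|lborel. indicator {0<..<T} s *\<^sub>R (- \<theta>' s / 2)) * ?N"
      unfolding A1_def
    proof (rule energy_weight)
      show "(\<lambda>s. - \<theta>' s / 2) \<in> borel_measurable borel" using \<theta>2c by (rule borel_measurable_continuous_onI)
      show "0 \<le> - \<theta>' s / 2" if "0 < s" for s using \<theta>s(2)[OF that] by simp
      show "- \<theta>' s / 2 \<le> F" if "0 < s" "s < T" for s using F(1) F(3)[of s] that by auto
    qed
    also have "(LINT s|lborel. indicator {0<..<T} s *\<^sub>R (- \<theta>' s / 2)) = - \<theta> T / 2 - (- \<theta> 0 / 2)"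
    proof (rule integral_interval_FTC[OF Tpos])
      show "continuous_on {0..T} (\<lambda>s. - \<theta> s / 2)"
        by (intro continuous_on_divide continuous_on_minus continuous_on_const continuous_on_subset[OF \<theta>c]) auto
      show "((\<lambda>s. - \<theta> s / 2) has_real_derivative - \<theta>' s / 2) (at s)" for s by (intro DERIV_cdivide DERIV_minus \<theta>)
      show "integrable lborel (\<lambda>s. indicator {0<..<T} s *\<^sub>R (- \<theta>' s / 2))"
      proof (rule borel_measurable_compact_support_integrable[where B = F and S = "{0<..<T}"])
        show "(\<lambda>s. indicator {0<..<T} s *\<^sub>R (- \<theta>' s / 2)) \<in> borel_measurable borel"
          by (intro borel_measurable_continuous_on_indicator continuous_on_subset[OF \<theta>2c]) auto
        show "norm (indicator {0<..<T} s *\<^sub>R (- \<theta>' s / 2)) \<le> F" for s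
          using F(1) F(3)[of s] by (auto simp: indicator_def)
      qed auto
    qed
    finally show ?thesis using \<theta>0 T' by simp
  qed
  have Gu: "uniformly_continuous_on Q (\<lambda>z. G z \<bullet> e)" for e
    by (rule uniformly_continuous_on_bilinear[OF bounded_bilinear_inner G_continuous
          bounded_uniformly_continuous_image[OF G_continuous Q_bounded] cylinder_continuous[OF continuous_on_const]])
  have IZ: "(LINT z|lborel. Z1 z - Z2 z) = 0"
  proof (rule integral_lborel_eq_0_slices)
    show "AE s in lborel. (LINT x|lborel. Z1 (x, s) - Z2 (x, s)) = 0"
      using v_gradient
    proof eventually_elim
      case (elim s)
      show ?case
      proof (cases "s \<in> {0<..<T}")
        case s: True
        \<comment> \<open>The transpose of the spatial derivative of \<open>U\<close>, applied to
          \<open>U\<close>, is the gradient of \<open>|U|^2 / 2\<close>. Hence at each time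
          \<open>Z1 - Z2\<close> is \<open>v\<close> tested with the gradient of this function minus
          the pressure, times \<open>\<theta> s\<close>.\<close>
        define f where "f = (\<lambda>x. (U (x, s) \<bullet> U (x, s)) / 2 - P x s)"
        define f' where "f' = (\<lambda>x h. D (x, s) (h, 0) \<bullet> U (x, s) - G (x, s) \<bullet> h)"
        have fd: "(f has_derivative f' x) (at x)" if x: "x \<in> \<Omega>" for x
        proof -
          have xs: "(x, s) \<in> Q" using x s by simp
          note U' = slice_has_derivative[OF xs]
          have "((\<lambda>x. U (x, s) \<bullet> U (x, s)) has_derivative (\<lambda>h. U (x, s) \<bullet> D (x, s) (h, 0) + D (x, s) (h, 0) \<bullet> U (x, s))) (at x)"
            by (rule has_derivative_inner[OF U' U'])
          then have "((\<lambda>x. (1 / 2) * (U (x, s) \<bullet> U (x, s))) has_derivative (\<lambda>h. (1 / 2) * (U (x, s) \<bullet> D (x, s) (h, 0) + D (x, s) (h, 0) \<bullet> U (x, s)))) (at x)"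
            by (rule has_derivative_mult_right)
          from has_derivative_diff[OF this Pd[OF xs]] show ?thesis
            unfolding f_def f'_def by (simp add: inner_commute)
        qed
        have fu: "uniformly_continuous_on \<Omega> (\<lambda>x. f' x e)" if e: "e \<in> Basis" for e
        proof -
          have eB: "(e, 0::real) \<in> Basis" using e by (simp add: Basis_prod_def)
          have "uniformly_continuous_on Q (\<lambda>z. D z (e, 0) \<bullet> U z - G z \<bullet> e)"
            by (rule uniformly_continuous_on_diff[OF uniformly_continuous_on_bilinear[OF bounded_bilinear_inner
                  Du[OF eB] D_bounded[OF eB] cylinder_continuous[OF Uc]] Gu])
          then show ?thesis unfolding f'_def by (rule uniformly_continuous_on_slice) (rule s)
        qed
        have "(LINT x|lborel. indicator \<Omega> x *\<^sub>R f' x (v (x, s))) = 0"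
          by (rule elim[rule_format, OF _ _ fd fu]) (use s in auto)
        moreover have "(\<lambda>x. Z1 (x, s) - Z2 (x, s)) = (\<lambda>x. \<theta> s * (indicator \<Omega> x *\<^sub>R f' x (v (x, s))))"
          using s by (auto simp: defs f'_def indicator_def algebra_simps)
        ultimately show ?thesis by simp
      qed (simp add: defs indicator_times)
    qed
  qed
  have IZ3: "(LINT z|lborel. Z3 z) = 0"
  proof (rule integral_lborel_eq_0_slices, rule always_eventually, rule allI)
    fix s
    show "(LINT x|lborel. Z3 (x, s)) = 0"
    proof (cases "s \<in> {0<..<T}")
      case s: True
      have "(LINT x|lborel. indicator \<Omega> x *\<^sub>R (G (x, s) \<bullet> U (x, s))) = 0"
      proof (rule U_gradient)
        show "((\<lambda>y. P y s) has_derivative (\<lambda>h. G (x, s) \<bullet> h)) (at x)" if "x \<in> \<Omega>" for x using Pd that s by simp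
        show "uniformly_continuous_on \<Omega> (\<lambda>x. G (x, s) \<bullet> e)" for e
        proof (rule uniformly_continuous_on_slice[OF _ s])
          show "uniformly_continuous_on Q (\<lambda>z. G z \<bullet> e)" by (rule Gu)
        qed
      qed (use s in auto)
      moreover have "(\<lambda>x. Z3 (x, s)) = (\<lambda>x. \<theta> s * (indicator \<Omega> x *\<^sub>R (G (x, s) \<bullet> U (x, s))))"
        using s by (auto simp: defs indicator_def)
      ultimately show ?thesis by simp
    qed (simp add: defs indicator_times)
  qed
  \<comment> \<open>Inserting the Euler equation for \<open>D z (0, 1)\<close> turns this into
    \<open>- \<theta>' / 2 * |v - U|^2\<close> plus \<open>\<theta>\<close> times the inner product
    of \<open>D z (v z - U z, 0)\<close> with \<open>v z - U z\<close>. So it is quadratic in the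
    difference, and the second term is at least \<open>- g0 * \<theta> * |v - U|^2\<close>.\<close>
  let ?R = "\<lambda>z. A1 z - A2 z - A3 z + H1 z + H2 z + H3 z - (Z1 z - Z2 z) - Z3 z"
  show LI: "integrable lborel (\<lambda>z. indicator Q z *\<^sub>R ((- \<theta>' (snd z) / 2 - g0 * \<theta> (snd z)) * ((v z - U z) \<bullet> (v z - U z))))"
    by (rule weighted_integrable[OF cm[OF \<theta>3c] mvU mvU F3Q vUb vUb])
  have RI: "integrable lborel ?R"
    using i i' by (intro Bochner_Integration.integrable_add Bochner_Integration.integrable_diff)
  have "(LINT z|lborel. indicator Q z *\<^sub>R ((- \<theta>' (snd z) / 2 - g0 * \<theta> (snd z)) * ((v z - U z) \<bullet> (v z - U z)))) \<le> (LINT z|lborel. ?R z)"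
  proof (rule integral_mono[OF LI RI])
    fix z
    show "indicator Q z *\<^sub>R ((- \<theta>' (snd z) / 2 - g0 * \<theta> (snd z)) * ((v z - U z) \<bullet> (v z - U z))) \<le> ?R z"
    proof (cases "z \<in> Q")
      case z: True
      have D2: "D z (v z - U z, 0) = D z (v z, 0) - D z (U z, 0)"
        using linear_diff[OF D_linear[OF z], of "(v z, 0)" "(U z, 0)"] by simp
      have D1: "D z (0, 1) = - D z (U z, 0) - G z" using euler[OF z] by (simp add: algebra_simps eq_neg_iff_add_eq_0)
      have "?R z = - \<theta>' (snd z) / 2 * ((v z - U z) \<bullet> (v z - U z)) + \<theta> (snd z) * (D z (v z - U z, 0) \<bullet> (v z - U z))"
        using z unfolding defs D2 D1 by (simp add: inner_diff_left inner_diff_right inner_commute algebra_simps)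
      moreover have "\<theta> (snd z) * (D z (v z - U z, 0) \<bullet> (v z - U z)) \<ge> \<theta> (snd z) * (- (g0 * ((v z - U z) \<bullet> (v z - U z))))"
      proof (rule mult_left_mono)
        have "\<bar>D z (v z - U z, 0) \<bullet> (v z - U z)\<bar> \<le> norm (D z (v z - U z, 0)) * norm (v z - U z)" by (rule Cauchy_Schwarz_ineq2)
        also have "\<dots> \<le> (g0 * norm (v z - U z)) * norm (v z - U z)"
          using g0[OF z, of "(v z - U z, 0)"] by (intro mult_right_mono) (auto simp: norm_Pair)
        also have "\<dots> = g0 * ((v z - U z) \<bullet> (v z - U z))" by (simp add: dot_square_norm power2_eq_square)
        finally show "- (g0 * ((v z - U z) \<bullet> (v z - U z))) \<le> D z (v z - U z, 0) \<bullet> (v z - U z)" by linarith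
        show "0 \<le> \<theta> (snd z)" using \<theta>s(1)[of "snd z"] z by (auto simp: mem_Times_iff)
      qed
      ultimately have "?R z \<ge> - \<theta>' (snd z) / 2 * ((v z - U z) \<bullet> (v z - U z)) + \<theta> (snd z) * (- (g0 * ((v z - U z) \<bullet> (v z - U z))))" by linarith
      moreover have "(- a / 2 - g0 * b) * n = - a / 2 * n + b * (- (g0 * n))" for a b n :: real by (simp add: algebra_simps)
      ultimately show ?thesis using z by simp
    qed (simp add: defs)
  qed
  also have "(LINT z|lborel. ?R z) = (LINT z|lborel. A1 z) - (LINT z|lborel. A2 z) - (LINT z|lborel. A3 z) +
     (LINT z|lborel. H1 z) + (LINT z|lborel. H2 z) + (LINT z|lborel. H3 z) - (LINT z|lborel. Z1 z - Z2 z) - (LINT z|lborel. Z3 z)"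
    using i i' by simp
  also have "\<dots> \<le> 0" using IA IH IA1 IZ IZ3 by (simp add: field_simps)
  finally show "(LINT z|lborel. indicator Q z *\<^sub>R ((- \<theta>' (snd z) / 2 - g0 * \<theta> (snd z)) * ((v z - U z) \<bullet> (v z - U z)))) \<le> 0" .
qed

end

section \<open>Uniqueness from the weighted inequality\<close>

context weak_strong
begin

text \<open>Gronwall's lemma is built into the choice of the weight. For
  \<open>\<theta> s = exp (- 2 * g0 * s) * (max (T' - s) 0)\<^sup>2\<close> the factor
  \<open>- \<theta>' s / 2 - g0 * \<theta> s\<close> equals
  \<open>exp (- 2 * g0 * s) * max (T' - s) 0\<close>, which is nonnegative, and positive before
  \<open>T'\<close>; an integral that is at most 0 then forces \<open>v = U\<close>. The square
  makes \<open>\<theta>\<close> continuously differentiable at \<open>T'\<close>.\<close>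

lemma uniqueness_before:
  assumes T': "0 < T'" "T' < T"
  shows "AE z in lborel. z \<in> \<Omega> \<times> {0<..<T'} \<longrightarrow> v z = U z"
proof -
  obtain g0 where g0: "g0 \<ge> 0" "\<And>z e. z \<in> Q \<Longrightarrow> norm (D z e) \<le> g0 * norm e" using bounds by blast
  define \<theta> where "\<theta> = (\<lambda>s. exp (- 2 * g0 * s) * (max (T' - s) 0)\<^sup>2)"
  define \<theta>' where "\<theta>' = (\<lambda>s. - 2 * exp (- 2 * g0 * s) * (g0 * (max (T' - s) 0)\<^sup>2 + max (T' - s) 0))"
  have d1: "((\<lambda>s. (max (T' - s) 0)\<^sup>2) has_real_derivative - 2 * max (T' - s) 0) (at s)" for s
    by (rule DERIV_chain2[OF DERIV_max_square DERIV_diff[OF DERIV_const DERIV_ident], THEN DERIV_cong]) simp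
  have d2: "((\<lambda>s. exp (- 2 * g0 * s)) has_real_derivative - 2 * g0 * exp (- 2 * g0 * s)) (at s)" for s
    by (rule DERIV_chain2[OF DERIV_exp DERIV_cmult[OF DERIV_ident], THEN DERIV_cong]) simp
  have \<theta>: "(\<theta> has_real_derivative \<theta>' s) (at s)" for s
    unfolding \<theta>_def \<theta>'_def by (rule DERIV_mult[OF d2 d1, THEN DERIV_cong]) (simp add: algebra_simps)
  have \<theta>'c: "continuous_on UNIV \<theta>'" unfolding \<theta>'_def by (intro continuous_intros)
  have w: "- \<theta>' s / 2 - g0 * \<theta> s = exp (- 2 * g0 * s) * max (T' - s) 0" for s
    by (simp add: \<theta>_def \<theta>'_def algebra_simps)
  let ?F = "\<lambda>z. indicator Q z *\<^sub>R ((- \<theta>' (snd z) / 2 - g0 * \<theta> (snd z)) * ((v z - U z) \<bullet> (v z - U z)))"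
  have F: "integrable lborel ?F" "(LINT z|lborel. ?F z) \<le> 0"
    by (rule weighted_inequality[OF T' \<theta> \<theta>'c _ _ _ _ g0(2)];
        use g0(1) in \<open>simp add: \<theta>_def \<theta>'_def mult_nonpos_nonneg add_nonneg_nonneg\<close>)+
  have pos: "AE z in lborel. 0 \<le> ?F z" unfolding w by (intro always_eventually allI) (auto simp: indicator_def)
  have "(LINT z|lborel. ?F z) = 0" using F(2) integral_nonneg_AE[OF pos] by linarith
  then have "AE z in lborel. ?F z = 0" using integral_nonneg_eq_0_iff_AE[OF F(1) pos] by blast
  then show ?thesis
  proof eventually_elim
    case (elim z)
    show ?case
    proof
      assume z: "z \<in> \<Omega> \<times> {0<..<T'}"
      then have "z \<in> Q" "snd z < T'" using T' by (auto simp: mem_Times_iff)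
      then have "exp (- 2 * g0 * snd z) * (T' - snd z) * ((v z - U z) \<bullet> (v z - U z)) = 0" using elim unfolding w by simp
      then show "v z = U z" using \<open>snd z < T'\<close> by simp
    qed
  qed
qed

lemma uniqueness: "AE z in lborel. z \<in> Q \<longrightarrow> v z = U z"
proof -
  \<comment> \<open>The weight must vanish before time \<open>T\<close>, so \<open>T\<close> is
    approached by countably many times, which preserves statements that hold almost
    everywhere.\<close>
  define \<tau> where "\<tau> = (\<lambda>n. T - T / real (n + 2))"
  have \<tau>: "0 < \<tau> n" "\<tau> n < T" for n using Tpos by (auto simp: \<tau>_def field_simps add_pos_nonneg)
  have "AE z in lborel. \<forall>n. z \<in> \<Omega> \<times> {0<..<\<tau> n} \<longrightarrow> v z = U z"
    using uniqueness_before[OF \<tau>] by (simp only: AE_all_countable) blast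
  then show ?thesis
  proof eventually_elim
    case (elim z)
    show ?case
    proof
      assume z: "z \<in> Q"
      have "\<tau> \<longlonglongrightarrow> T - 0"
        unfolding \<tau>_def by (intro tendsto_diff tendsto_const LIMSEQ_ignore_initial_segment[OF lim_const_over_n])
      then have "eventually (\<lambda>n. snd z < \<tau> n) sequentially" using z by (intro order_tendstoD) (auto simp: mem_Times_iff)
      then obtain n where "snd z < \<tau> n" by (auto simp: eventually_sequentially)
      then show "v z = U z" using elim z by (auto simp: mem_Times_iff)
    qed
  qed
qed

end

section \<open>Reduction of the theorem to the abstract setting\<close>

lemma AE_lebesgue_iff: "(AE x in lebesgue. P x) \<longleftrightarrow> (AE x in lborel. P x)"
  by (simp add: AE_completion_iff)

lemma divg_eq:
  fixes v :: "real^'n \<Rightarrow> real^'n"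
  assumes "(v has_derivative v') (at x)"
  shows "divg v x = (\<Sum>b\<in>Basis. v' b \<bullet> b)"
proof -
  have "(\<Sum>b\<in>Basis. v' b \<bullet> b) = (\<Sum>i\<in>UNIV. v' (axis i 1) \<bullet> axis i 1)"
    unfolding Basis_vec_def by (subst sum.UNION_disjoint) (auto simp: axis_eq_axis)
  then show ?thesis by (simp add: divg_def frechet_derivative_at[OF assms, symmetric] inner_axis)
qed

lemma borel_measurable_slice:
  fixes v :: "'a::euclidean_space \<times> real \<Rightarrow> 'b::euclidean_space"
  assumes "v \<in> borel_measurable borel"
  shows "(\<lambda>x. v (x, s)) \<in> borel_measurable borel"
  by (rule measurable_compose[OF borel_measurable_continuous_onI assms]) (auto intro!: continuous_intros)

lemma borel_measurable_frechet_derivative: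
  fixes \<psi> :: "'a::euclidean_space \<Rightarrow> 'b::euclidean_space"
  assumes "smooth_on UNIV \<psi>" "h \<in> borel_measurable borel"
  shows "(\<lambda>x. frechet_derivative \<psi> (at x) (h x)) \<in> borel_measurable borel"
proof -
  have "(\<lambda>x. frechet_derivative \<psi> (at x) (h x)) = (\<lambda>x. \<Sum>b\<in>Basis. (h x \<bullet> b) *\<^sub>R frechet_derivative \<psi> (at x) b)"
    by (rule ext, rule frechet_euclidean_sum, rule smooth_on_has_derivative[OF assms(1)]) simp
  also have "\<dots> \<in> borel_measurable borel"
    by (intro borel_measurable_sum borel_measurable_scaleR[OF borel_measurable_inner[OF assms(2) borel_measurable_const]]
        borel_measurable_continuous_onI smooth_onD(2)[OF smooth_onD(3)[OF assms(1)]])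
  finally show ?thesis .
qed

lemma square_integrable_spacetime:
  fixes v :: "'a::euclidean_space \<times> real \<Rightarrow> 'b::euclidean_space"
  assumes v: "v \<in> borel_measurable borel" and \<Omega>: "open \<Omega>" and T: "T > 0"
    and M: "AE s in lborel. 0 < s \<longrightarrow> s < T \<longrightarrow> (\<integral>\<^sup>+x. indicator \<Omega> x * ennreal ((norm (v (x, s)))\<^sup>2) \<partial>lborel) \<le> ennreal M"
  shows "integrable lborel (\<lambda>z. indicator (\<Omega> \<times> {0<..<T}) z * (norm (v z))\<^sup>2)"
proof (rule integrableI_bounded)
  have Q: "\<Omega> \<times> {0<..<T} \<in> sets borel" using \<Omega> by (intro borel_open open_Times) auto
  show "(\<lambda>z. indicator (\<Omega> \<times> {0<..<T}) z * (norm (v z))\<^sup>2) \<in> borel_measurable lborel"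
    using v Q by simp
  define f where "f z = indicator (\<Omega> \<times> {0<..<T}) z * ennreal ((norm (v z))\<^sup>2)" for z
  have fm: "f \<in> borel_measurable borel" unfolding f_def[abs_def] using v Q by simp
  have "(\<integral>\<^sup>+z. ennreal (norm (indicator (\<Omega> \<times> {0<..<T}) z * (norm (v z))\<^sup>2)) \<partial>lborel) = (\<integral>\<^sup>+z. f z \<partial>lborel)"
    by (intro nn_integral_cong) (auto simp: f_def indicator_def)
  also have "\<dots> = (\<integral>\<^sup>+s. (\<integral>\<^sup>+x. f (x, s) \<partial>lborel) \<partial>lborel)"
    using lborel_pair.nn_integral_snd[of f] fm unfolding lborel_prod by simp
  also have "\<dots> \<le> (\<integral>\<^sup>+s. ennreal M * indicator {0<..<T} s \<partial>lborel)"
  proof (rule nn_integral_mono_AE)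
    show "AE s in lborel. (\<integral>\<^sup>+x. f (x, s) \<partial>lborel) \<le> ennreal M * indicator {0<..<T} s"
      using M
    proof eventually_elim
      case (elim s)
      have "(\<lambda>x. f (x, s)) = (\<lambda>x. indicator {0<..<T} s * (indicator \<Omega> x * ennreal ((norm (v (x, s)))\<^sup>2)))"
        by (auto simp: f_def indicator_def)
      then show ?case using elim by (cases "s \<in> {0<..<T}") auto
    qed
  qed
  also have "\<dots> = ennreal M * ennreal T" using T by (simp add: nn_integral_cmult_indicator)
  also have "\<dots> < \<infinity>" by (simp add: ennreal_mult_less_top)
  finally show "(\<integral>\<^sup>+z. ennreal (norm (indicator (\<Omega> \<times> {0<..<T}) z * (norm (v z))\<^sup>2)) \<partial>lborel) < \<infinity>" .
qed

theorem theorem3: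
  fixes \<Omega> :: "(real^'n) set" and T :: real
    and U u :: "real^'n \<Rightarrow> real \<Rightarrow> real^'n" and u0 :: "real^'n \<Rightarrow> real^'n"
  assumes dim: "CARD('n) = 2 \<or> CARD('n) = 3"
    and dom: "open \<Omega>" "connected \<Omega>" "bounded \<Omega>" "simply_connected \<Omega>" "smooth_boundary \<Omega>"
    and T: "T > 0"
    and u0: "H_space \<Omega> u0"
    and strong: "strong_euler \<Omega> T U u0"
    and weak: "admissible_weak_euler \<Omega> T u u0"
    and eps: "\<exists>\<epsilon>>0. \<exists>M. AE z in lebesgue.
                 z \<in> layer \<Omega> \<epsilon> \<times> {0<..<T} \<longrightarrow> norm (u (fst z) (snd z)) \<le> M"
    and normal_lim: "\<forall>\<eta>>0. \<exists>\<delta>0>0. \<forall>\<delta>. 0 < \<delta> \<and> \<delta> < \<delta>0 \<longrightarrow>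
                 (AE z in lebesgue. z \<in> layer \<Omega> \<delta> \<times> {0<..<T} \<longrightarrow>
                    \<bar>nfield \<Omega> (fst z) \<bullet> u (fst z) (snd z)\<bar> \<le> \<eta>)"
  shows "AE z in lebesgue. z \<in> \<Omega> \<times> {0<..<T} \<longrightarrow> u (fst z) (snd z) = U (fst z) (snd z)"
proof (cases "\<Omega> = {}")
  \<comment> \<open>Tangent balls and foot points need a nonempty domain; for the empty one the
    conclusion is vacuous.\<close>
  case False
  define Q where "Q = \<Omega> \<times> {0<..<T}"
  have Q: "open Q" "Q \<in> sets borel" using dom(1) unfolding Q_def by (auto intro!: open_Times borel_open)
  have \<Omega>b: "\<Omega> \<in> sets borel" using dom(1) by simp
  obtain r where tb: "two_ball_domain \<Omega> r (inward_normal \<Omega>)"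
    using smooth_boundary_two_ball[OF dom(1,3) False dom(5)] by blast
  interpret tb: two_ball_domain \<Omega> r "inward_normal \<Omega>" by (rule tb)
  obtain w w' W L where sf: "shift_field w w' W L" "\<forall>p\<in>frontier \<Omega>. w p \<bullet> inward_normal \<Omega> p \<ge> 8"
    using tb.ex_shift_field by blast
  interpret sd: shifted_domain \<Omega> r "inward_normal \<Omega>" w w' W L
    using tb sf by (simp add: shifted_domain_def shifted_domain_axioms_def)
  define U' where "U' = (\<lambda>z. U (fst z) (snd z))"
  define D where "D = (\<lambda>z. frechet_derivative U' (at z))"
  have C1: "continuous_on (closure \<Omega> \<times> {0..T}) U'" "\<And>z. z \<in> Q \<Longrightarrow> U' differentiable (at z)"
    "\<And>e. e \<in> Basis \<Longrightarrow> uniformly_continuous_on Q (\<lambda>z. D z e)"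
    using strong unfolding strong_euler_def C1_closed_cyl_def U'_def D_def Q_def by blast+
  obtain P where P: "\<And>x t. x \<in> \<Omega> \<Longrightarrow> t \<in> {0<..<T} \<Longrightarrow> (\<lambda>y. P y t) differentiable (at x)"
    "\<And>x t. x \<in> \<Omega> \<Longrightarrow> t \<in> {0<..<T} \<Longrightarrow> vector_derivative (\<lambda>s. U x s) (at t)
            + frechet_derivative (\<lambda>y. U y t) (at x) (U x t) + grad (\<lambda>y. P y t) x = 0"
    using strong unfolding strong_euler_def by blast
  have div: "\<And>x t. x \<in> \<Omega> \<Longrightarrow> t \<in> {0<..<T} \<Longrightarrow> divg (\<lambda>y. U y t) x = 0"
    and tang: "\<And>p t. p \<in> frontier \<Omega> \<Longrightarrow> t \<in> {0..T} \<Longrightarrow> U p t \<bullet> inward_normal \<Omega> p = 0"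
    and U0: "AE x in lebesgue. x \<in> \<Omega> \<longrightarrow> U x 0 = u0 x"
    using strong unfolding strong_euler_def by blast+
  define G where "G = (\<lambda>z. grad (\<lambda>y. P y (snd z)) (fst z))"
  have U'd: "(U' has_derivative D z) (at z)" if "z \<in> Q" for z
    using C1(2)[OF that] unfolding D_def by (simp add: frechet_derivative_works)
  have Ux: "((\<lambda>y. U y t) has_derivative (\<lambda>h. D (x, t) (h, 0))) (at x)" "vector_derivative (\<lambda>s. U x s) (at t) = D (x, t) (0, 1)"
    if "x \<in> \<Omega>" "t \<in> {0<..<T}" for x t
    using partial_derivatives[OF U'd[of "(x, t)"]] that by (auto simp: U'_def Q_def intro: vector_derivative_at)
  have Linf: "set_borel_measurable lebesgue Q (\<lambda>z. u (fst z) (snd z))"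
    "AE t in lebesgue. t \<in> {0<..<T} \<longrightarrow> H_space \<Omega> (\<lambda>x. u x t)"
    and weq: "\<And>\<phi>::real^'n \<Rightarrow> real \<Rightarrow> real^'n. smooth_on UNIV (\<lambda>z. \<phi> (fst z) (snd z)) \<Longrightarrow>
        \<exists>K. compact K \<and> K \<subseteq> \<Omega> \<times> {..<T} \<and> (\<forall>z. z \<notin> K \<longrightarrow> \<phi> (fst z) (snd z) = 0) \<Longrightarrow>
        (\<And>x t. divg (\<lambda>y. \<phi> y t) x = 0) \<Longrightarrow>
        (LINT z:Q|lebesgue. vector_derivative (\<lambda>s. \<phi> (fst z) s) (at (snd z)) \<bullet> u (fst z) (snd z)
          + frechet_derivative (\<lambda>y. \<phi> y (snd z)) (at (fst z)) (u (fst z) (snd z)) \<bullet> u (fst z) (snd z))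
        + (LINT x:\<Omega>|lebesgue. u0 x \<bullet> \<phi> x 0) = 0"
    and adm: "AE t in lebesgue. t \<in> {0<..<T} \<longrightarrow>
        (LINT x:\<Omega>|lebesgue. (norm (u x t))\<^sup>2) \<le> (LINT x:\<Omega>|lebesgue. (norm (u0 x))\<^sup>2)"
    using weak unfolding admissible_weak_euler_def weak_euler_def Linf_H_def Q_def by auto
  obtain M where M: "AE t in lebesgue. t \<in> {0<..<T} \<longrightarrow>
          (\<integral>\<^sup>+x. indicator \<Omega> x * ennreal ((norm (u x t))\<^sup>2) \<partial>lebesgue) \<le> ennreal M"
    using weak unfolding admissible_weak_euler_def weak_euler_def Linf_H_def by blast
  \<comment> \<open>\<open>u\<close> is only Lebesgue measurable and matters only on the cylinder.
    Each hypothesis about it is transferred to the Borel function \<open>v\<close>, which equals it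
    there almost everywhere.\<close>
  obtain v where v: "v \<in> borel_measurable borel" "AE z in lborel. indicator Q z *\<^sub>R u (fst z) (snd z) = v z"
    using ex_borel_representative[of "\<lambda>z. indicator Q z *\<^sub>R u (fst z) (snd z)"] Linf(1) unfolding set_borel_measurable_def by blast
  have uv: "AE z in lborel. z \<in> Q \<longrightarrow> u (fst z) (snd z) = v z" using v(2) by eventually_elim auto
  have uvs: "AE s in lborel. AE x in lborel. s \<in> {0<..<T} \<longrightarrow> x \<in> \<Omega> \<longrightarrow> u x s = v (x, s)"
    using AE_lborel_snd[OF uv]
  proof eventually_elim
    case (elim s)
    then show ?case by eventually_elim (simp add: Q_def)
  qed
  note vs = borel_measurable_slice[OF v(1)]
  have U0c: "continuous_on \<Omega> (\<lambda>x. U' (x, 0))"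
    by (rule continuous_on_compose2[OF C1(1)]) (use closure_subset[of \<Omega>] T in \<open>auto intro!: continuous_intros\<close>)
  have slice_norm: "(LINT x:\<Omega>|lebesgue. (norm (f x))\<^sup>2) = (LINT x|lborel. indicator \<Omega> x * (norm (g x))\<^sup>2)"
    if ae: "AE x in lborel. x \<in> \<Omega> \<longrightarrow> f x = g x" and m: "(\<lambda>x. indicator \<Omega> x *\<^sub>R g x) \<in> borel_measurable borel" for f g :: "real^'n \<Rightarrow> real^'n"
    unfolding set_lebesgue_integral_def
  proof (rule integral_lebesgue_eq_lborel)
    show "AE x in lborel. indicator \<Omega> x *\<^sub>R (norm (f x))\<^sup>2 = indicator \<Omega> x * (norm (g x))\<^sup>2"
      using ae by eventually_elim (auto simp: indicator_def)
    have "(\<lambda>x. indicator \<Omega> x * (norm (g x))\<^sup>2) = (\<lambda>x. (norm (indicator \<Omega> x *\<^sub>R g x))\<^sup>2)"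
      by (auto simp: indicator_def)
    also have "\<dots> \<in> borel_measurable borel" by (rule borel_measurable_power[OF measurable_compose[OF m borel_measurable_continuous_onI[OF continuous_on_norm[OF continuous_on_id]]]])
    finally show "(\<lambda>x. indicator \<Omega> x * (norm (g x))\<^sup>2) \<in> borel_measurable borel" .
  qed
  interpret ws: weak_strong \<Omega> r "inward_normal \<Omega>" w w' W L T U' D P G v
  proof
    show "T > 0" by (rule T)
    show "continuous_on (closure \<Omega> \<times> {0..T}) U'" by (rule C1)
    show "(U' has_derivative D z) (at z)" if "z \<in> \<Omega> \<times> {0<..<T}" for z using U'd that by (simp add: Q_def)
    show "uniformly_continuous_on (\<Omega> \<times> {0<..<T}) (\<lambda>z. D z e)" if "e \<in> Basis" for e using C1(3)[OF that] by (simp add: Q_def)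
    show "(\<Sum>b\<in>Basis. D z (b, 0) \<bullet> b) = 0" if "z \<in> \<Omega> \<times> {0<..<T}" for z
      using divg_eq[OF Ux(1)] div that by (cases z) auto
    show "U' (p, s) \<bullet> inward_normal \<Omega> p = 0" if "p \<in> frontier \<Omega>" "0 \<le> s" "s \<le> T" for p s
      using tang that by (simp add: U'_def)
    show "((\<lambda>y. P y s) has_derivative (\<lambda>h. G (x, s) \<bullet> h)) (at x)" if "(x, s) \<in> \<Omega> \<times> {0<..<T}" for x s
    proof -
      have "((\<lambda>y. P y s) has_derivative frechet_derivative (\<lambda>y. P y s) (at x)) (at x)"
        using P(1)[of x s] that by (simp add: frechet_derivative_works)
      then show ?thesis by (rule has_derivative_eq_rhs) (simp add: G_def grad_inner[OF \<open>((\<lambda>y. P y s) has_derivative _) _\<close>] fun_eq_iff)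
    qed
    show "D z (0, 1) + D z (U' z, 0) + G z = 0" if zQ: "z \<in> \<Omega> \<times> {0<..<T}" for z
    proof -
      obtain x t where z: "z = (x, t)" "x \<in> \<Omega>" "t \<in> {0<..<T}" using zQ by auto
      show ?thesis using P(2)[OF z(2,3)] unfolding Ux(2)[OF z(2,3)] frechet_derivative_at[OF Ux(1)[OF z(2,3)], symmetric]
        by (simp add: z(1) U'_def G_def)
    qed
    show "v \<in> borel_measurable borel" by (rule v)
    show "integrable lborel (\<lambda>z. indicator (\<Omega> \<times> {0<..<T}) z * (norm (v z))\<^sup>2)"
    proof (rule square_integrable_spacetime[OF v(1) dom(1) T])
      show "AE s in lborel. 0 < s \<longrightarrow> s < T \<longrightarrow> (\<integral>\<^sup>+x. indicator \<Omega> x * ennreal ((norm (v (x, s)))\<^sup>2) \<partial>lborel) \<le> ennreal M"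
        using M[unfolded AE_lebesgue_iff] uvs
      proof eventually_elim
        case (elim s)
        show ?case
        proof (intro impI)
          assume s: "0 < s" "s < T"
          have "(\<integral>\<^sup>+x. indicator \<Omega> x * ennreal ((norm (u x s))\<^sup>2) \<partial>lebesgue) = (\<integral>\<^sup>+x. indicator \<Omega> x * ennreal ((norm (v (x, s)))\<^sup>2) \<partial>lebesgue)"
          proof (rule nn_integral_cong_AE)
            have "AE x in lebesgue. s \<in> {0<..<T} \<longrightarrow> x \<in> \<Omega> \<longrightarrow> u x s = v (x, s)" using elim(2) by (simp add: AE_lebesgue_iff)
            then show "AE x in lebesgue. indicator \<Omega> x * ennreal ((norm (u x s))\<^sup>2) = indicator \<Omega> x * ennreal ((norm (v (x, s)))\<^sup>2)"
              by eventually_elim (use s in \<open>auto simp: indicator_def\<close>)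
          qed
          then show "(\<integral>\<^sup>+x. indicator \<Omega> x * ennreal ((norm (v (x, s)))\<^sup>2) \<partial>lborel) \<le> ennreal M"
            using elim(1) s by (simp add: nn_integral_completion)
        qed
      qed
    qed
    show "(LINT z|lborel. indicator (\<Omega> \<times> {0<..<T}) z *\<^sub>R (\<psi>' z (0, 1) \<bullet> v z + \<psi>' z (v z, 0) \<bullet> v z)) +
       (LINT x|lborel. indicator \<Omega> x *\<^sub>R (U' (x, 0) \<bullet> \<psi> (x, 0))) = 0"
      if \<psi>: "smooth_on UNIV \<psi>" "\<And>z. (\<psi> has_derivative \<psi>' z) (at z)"
        "\<exists>K. compact K \<and> K \<subseteq> \<Omega> \<times> {..<T} \<and> (\<forall>z. z \<notin> K \<longrightarrow> \<psi> z = 0)"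
        "\<And>y t. (\<Sum>b\<in>Basis. \<psi>' (y, t) (b, 0) \<bullet> b) = 0" for \<psi> \<psi>'
    proof -
      define \<phi> where "\<phi> = (\<lambda>x t. \<psi> (x, t))"
      note pd = partial_derivatives[OF \<psi>(2)]
      have e: "(LINT z:Q|lebesgue. vector_derivative (\<lambda>s. \<phi> (fst z) s) (at (snd z)) \<bullet> u (fst z) (snd z)
          + frechet_derivative (\<lambda>y. \<phi> y (snd z)) (at (fst z)) (u (fst z) (snd z)) \<bullet> u (fst z) (snd z))
        + (LINT x:\<Omega>|lebesgue. u0 x \<bullet> \<phi> x 0) = 0"
      proof (rule weq)
        show "smooth_on UNIV (\<lambda>z. \<phi> (fst z) (snd z))" using \<psi>(1) by (simp add: \<phi>_def)
        show "\<exists>K. compact K \<and> K \<subseteq> \<Omega> \<times> {..<T} \<and> (\<forall>z. z \<notin> K \<longrightarrow> \<phi> (fst z) (snd z) = 0)" using \<psi>(3) by (simp add: \<phi>_def)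
        show "divg (\<lambda>y. \<phi> y t) x = 0" for x t using divg_eq[OF pd(1)] \<psi>(4) by (simp add: \<phi>_def)
      qed
      have \<psi>': "\<psi>' z = frechet_derivative \<psi> (at z)" for z using frechet_derivative_at[OF \<psi>(2)] .
      have "(LINT z:Q|lebesgue. vector_derivative (\<lambda>s. \<phi> (fst z) s) (at (snd z)) \<bullet> u (fst z) (snd z)
          + frechet_derivative (\<lambda>y. \<phi> y (snd z)) (at (fst z)) (u (fst z) (snd z)) \<bullet> u (fst z) (snd z)) =
        (LINT z|lborel. indicator Q z *\<^sub>R (\<psi>' z (0, 1) \<bullet> v z + \<psi>' z (v z, 0) \<bullet> v z))"
        unfolding set_lebesgue_integral_def
      proof (rule integral_lebesgue_eq_lborel)
        have pd': "vector_derivative (\<lambda>s. \<phi> (fst z) s) (at (snd z)) = \<psi>' z (0, 1)"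
          "frechet_derivative (\<lambda>y. \<phi> y (snd z)) (at (fst z)) h = \<psi>' z (h, 0)" for z h
          using vector_derivative_at[OF pd(2)[of "fst z" "snd z"]] frechet_derivative_at[OF pd(1)[of "snd z" "fst z"], symmetric] by (simp_all add: \<phi>_def)
        show "AE z in lborel. indicator Q z *\<^sub>R (vector_derivative (\<lambda>s. \<phi> (fst z) s) (at (snd z)) \<bullet> u (fst z) (snd z)
          + frechet_derivative (\<lambda>y. \<phi> y (snd z)) (at (fst z)) (u (fst z) (snd z)) \<bullet> u (fst z) (snd z)) =
          indicator Q z *\<^sub>R (\<psi>' z (0, 1) \<bullet> v z + \<psi>' z (v z, 0) \<bullet> v z)"
          using uv unfolding pd' by eventually_elim (simp add: indicator_def)
        show "(\<lambda>z. indicator Q z *\<^sub>R (\<psi>' z (0, 1) \<bullet> v z + \<psi>' z (v z, 0) \<bullet> v z)) \<in> borel_measurable borel"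
          unfolding \<psi>' using Q(2) v(1)
          by (intro borel_measurable_scaleR borel_measurable_indicator borel_measurable_add borel_measurable_inner
              borel_measurable_frechet_derivative[OF \<psi>(1)] borel_measurable_Pair) auto
      qed
      moreover have "(LINT x:\<Omega>|lebesgue. u0 x \<bullet> \<phi> x 0) = (LINT x|lborel. indicator \<Omega> x *\<^sub>R (U' (x, 0) \<bullet> \<psi> (x, 0)))"
        unfolding set_lebesgue_integral_def
      proof (rule integral_lebesgue_eq_lborel)
        show "AE x in lborel. indicator \<Omega> x *\<^sub>R (u0 x \<bullet> \<phi> x 0) = indicator \<Omega> x *\<^sub>R (U' (x, 0) \<bullet> \<psi> (x, 0))"
          using U0[unfolded AE_lebesgue_iff] by eventually_elim (auto simp: indicator_def \<phi>_def U'_def)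
        have "continuous_on \<Omega> (\<lambda>x. \<psi> (x, 0))"
          by (rule continuous_on_compose2[OF smooth_onD(2)[OF \<psi>(1)]]) (auto intro!: continuous_intros)
        then show "(\<lambda>x. indicator \<Omega> x *\<^sub>R (U' (x, 0) \<bullet> \<psi> (x, 0))) \<in> borel_measurable borel"
          using U0c by (intro borel_measurable_continuous_on_indicator \<Omega>b continuous_on_inner)
      qed
      ultimately show ?thesis using e by (simp add: Q_def)
    qed
    show "\<exists>\<delta>>0. \<exists>M. AE z in lborel. z \<in> \<Omega> \<times> {0<..<T} \<longrightarrow> infdist (fst z) (frontier \<Omega>) < \<delta> \<longrightarrow> norm (v z) \<le> M"
    proof -
      obtain \<delta> M where \<delta>: "\<delta> > 0" "AE z in lborel. z \<in> layer \<Omega> \<delta> \<times> {0<..<T} \<longrightarrow> norm (u (fst z) (snd z)) \<le> M"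
        using eps by (auto simp: AE_lebesgue_iff)
      from \<delta>(2) uv have "AE z in lborel. z \<in> \<Omega> \<times> {0<..<T} \<longrightarrow> infdist (fst z) (frontier \<Omega>) < \<delta> \<longrightarrow> norm (v z) \<le> M"
        by eventually_elim (auto simp: layer_def bdist_def Q_def)
      then show ?thesis using \<delta>(1) by blast
    qed
    show "\<exists>\<delta>>0. AE z in lborel. z \<in> \<Omega> \<times> {0<..<T} \<longrightarrow> infdist (fst z) (frontier \<Omega>) < \<delta> \<longrightarrow>
        (\<forall>p\<in>frontier \<Omega>. dist (fst z) p = infdist (fst z) (frontier \<Omega>) \<longrightarrow> \<bar>inward_normal \<Omega> p \<bullet> v z\<bar> \<le> \<eta>)" if \<eta>: "\<eta> > 0" for \<eta>
    proof -
      from normal_lim[THEN spec, THEN mp, OF \<eta>]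
      obtain \<delta>0 where \<delta>0: "\<delta>0 > 0" "\<And>\<delta>. 0 < \<delta> \<and> \<delta> < \<delta>0 \<Longrightarrow> AE z in lborel. z \<in> layer \<Omega> \<delta> \<times> {0<..<T} \<longrightarrow>
                    \<bar>nfield \<Omega> (fst z) \<bullet> u (fst z) (snd z)\<bar> \<le> \<eta>"
        unfolding AE_lebesgue_iff by blast
      \<comment> \<open>Within distance \<open>r\<close> of the boundary \<open>nfield_eq\<close>
        identifies the gradient of the distance with the normal at a foot point; half of
        \<open>\<delta>0\<close> satisfies the strict inequality in the hypothesis.\<close>
      define \<delta> where "\<delta> = min r (\<delta>0 / 2)"
      have \<delta>: "0 < \<delta>" "\<delta> < \<delta>0" "\<delta> \<le> r" using \<delta>0(1) tb.r_pos by (auto simp: \<delta>_def)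
      show ?thesis
      proof (intro exI[of _ \<delta>] conjI \<delta>(1))
        show "AE z in lborel. z \<in> \<Omega> \<times> {0<..<T} \<longrightarrow> infdist (fst z) (frontier \<Omega>) < \<delta> \<longrightarrow>
          (\<forall>p\<in>frontier \<Omega>. dist (fst z) p = infdist (fst z) (frontier \<Omega>) \<longrightarrow> \<bar>inward_normal \<Omega> p \<bullet> v z\<bar> \<le> \<eta>)"
          using \<delta>0(2)[OF conjI[OF \<delta>(1,2)]] uv
        proof eventually_elim
          case (elim z)
          show ?case
          proof (intro impI ballI)
            fix p assume z: "z \<in> \<Omega> \<times> {0<..<T}" "infdist (fst z) (frontier \<Omega>) < \<delta>"
              and p: "p \<in> frontier \<Omega>" "dist (fst z) p = infdist (fst z) (frontier \<Omega>)"
            have x: "fst z \<in> \<Omega>" "snd z \<in> {0<..<T}" using z(1) by auto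
            have "nfield \<Omega> (fst z) = inward_normal \<Omega> p"
              using nfield_eq[OF tb x(1) _ p(1) tb.foot[OF x(1) p]] z(2) \<delta>(3) by simp
            moreover have "z \<in> layer \<Omega> \<delta> \<times> {0<..<T}" using x z(2) by (simp add: layer_def bdist_def mem_Times_iff)
            moreover have "u (fst z) (snd z) = v z" using elim(2) z(1) by (simp add: Q_def)
            ultimately show "\<bar>inward_normal \<Omega> p \<bullet> v z\<bar> \<le> \<eta>" using elim(1) by simp
          qed
        qed
      qed
    qed
    show "AE s in lborel. 0 < s \<longrightarrow> s < T \<longrightarrow> (\<forall>\<psi>::real^'n \<Rightarrow> real. smooth_on UNIV \<psi> \<longrightarrow>
        (\<exists>K. compact K \<and> (\<forall>x. x \<notin> K \<longrightarrow> \<psi> x = 0)) \<longrightarrow>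
        (LINT x|lborel. indicator \<Omega> x *\<^sub>R frechet_derivative \<psi> (at x) (v (x, s))) = 0)"
      using Linf(2)[unfolded AE_lebesgue_iff] uvs
    proof eventually_elim
      case (elim s)
      show ?case
      proof (intro impI allI)
        fix \<psi> :: "real^'n \<Rightarrow> real"
        assume s: "0 < s" "s < T" and \<psi>: "smooth_on UNIV \<psi>" "\<exists>K. compact K \<and> (\<forall>x. x \<notin> K \<longrightarrow> \<psi> x = 0)"
        have "(LINT x:\<Omega>|lebesgue. u x s \<bullet> grad \<psi> x) = 0" using elim(1) s \<psi> unfolding H_space_def by auto
        moreover have "(LINT x:\<Omega>|lebesgue. u x s \<bullet> grad \<psi> x) = (LINT x|lborel. indicator \<Omega> x *\<^sub>R frechet_derivative \<psi> (at x) (v (x, s)))"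
          unfolding set_lebesgue_integral_def
        proof (rule integral_lebesgue_eq_lborel)
          show "AE x in lborel. indicator \<Omega> x *\<^sub>R (u x s \<bullet> grad \<psi> x) = indicator \<Omega> x *\<^sub>R frechet_derivative \<psi> (at x) (v (x, s))"
            using elim(2)
          proof eventually_elim
            case (elim x)
            have "frechet_derivative \<psi> (at x) (v (x, s)) = grad \<psi> x \<bullet> v (x, s)"
              by (rule grad_inner[OF smooth_on_has_derivative[OF \<psi>(1)]]) simp
            then show ?case using elim s by (auto simp: indicator_def inner_commute)
          qed
          show "(\<lambda>x. indicator \<Omega> x *\<^sub>R frechet_derivative \<psi> (at x) (v (x, s))) \<in> borel_measurable borel"
            using \<Omega>b by (intro borel_measurable_scaleR borel_measurable_indicator borel_measurable_frechet_derivative[OF \<psi>(1)] vs) auto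
        qed
        ultimately show "(LINT x|lborel. indicator \<Omega> x *\<^sub>R frechet_derivative \<psi> (at x) (v (x, s))) = 0" by simp
      qed
    qed
    show "AE s in lborel. 0 < s \<longrightarrow> s < T \<longrightarrow>
        (LINT x|lborel. indicator \<Omega> x * (norm (v (x, s)))\<^sup>2) \<le> (LINT x|lborel. indicator \<Omega> x * (norm (U' (x, 0)))\<^sup>2)"
      using adm[unfolded AE_lebesgue_iff] uvs
    proof eventually_elim
      case (elim s)
      show ?case
      proof (intro impI)
        assume s: "0 < s" "s < T"
        have "(LINT x:\<Omega>|lebesgue. (norm (u x s))\<^sup>2) = (LINT x|lborel. indicator \<Omega> x * (norm (v (x, s)))\<^sup>2)"
        proof (rule slice_norm)
          show "AE x in lborel. x \<in> \<Omega> \<longrightarrow> u x s = v (x, s)" using elim(2) by eventually_elim (use s in auto)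
          show "(\<lambda>x. indicator \<Omega> x *\<^sub>R v (x, s)) \<in> borel_measurable borel"
            using \<Omega>b by (intro borel_measurable_scaleR borel_measurable_indicator vs) auto
        qed
        moreover have "(LINT x:\<Omega>|lebesgue. (norm (u0 x))\<^sup>2) = (LINT x|lborel. indicator \<Omega> x * (norm (U' (x, 0)))\<^sup>2)"
        proof (rule slice_norm)
          show "AE x in lborel. x \<in> \<Omega> \<longrightarrow> u0 x = U' (x, 0)"
            using U0[unfolded AE_lebesgue_iff] by eventually_elim (auto simp: U'_def)
        qed (rule borel_measurable_continuous_on_indicator[OF \<Omega>b U0c])
        ultimately show "(LINT x|lborel. indicator \<Omega> x * (norm (v (x, s)))\<^sup>2) \<le> (LINT x|lborel. indicator \<Omega> x * (norm (U' (x, 0)))\<^sup>2)"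
          using elim(1) s by simp
      qed
    qed
  qed
  from ws.uniqueness uv show ?thesis
    unfolding AE_lebesgue_iff by eventually_elim (auto simp: U'_def Q_def)
qed simp

end
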